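(* Let $X=(V,E)$ be a $\Gamma$-crystal lattice with $\Gamma\cong\mathbb Z^d$ and finite quotient graph $X_0=(V_0,E_0)$. Let $p:E\to(0,1]$ be a $\Gamma$-invariant positive transition probability with asymptotic direction $\rho_{\mathbb R}(\gamma_p)\neq \mathbf 0$. Let $\Phi_0:X\to\Gamma\otimes\mathbb R$ be a $p$-modified harmonic realization of $X$, and let $x_*\in V$ be such that $\Phi_0(x_* )=\mathbf 0$. Let $\mathfrak p$ be the changed transition probability built from $p$ and $\Phi_0$, let $g_0^{(\mathfrak p)}$ be the $\mathfrak p$-Albanese metric on $\Gamma\otimes\mathbb R$, and let $(w_n^{(\mathfrak p)})_{n\ge 0}$ be the random walk on $X$ with transition probability $\mathfrak p$ started at $x_*$. Put $\xi_n^{(\mathfrak p)}:=\Phi_0(w_n^{(\mathfrak p)})$ and, for $n\ge1$, $$\mathfrak X^{(n)}_t:=\frac1{\sqrt n}\Big\{\xi^{(\mathfrak p)}_{[nt]}+(nt-[nt])\big(\xi^{(\mathfrak p)}_{[nt]+1}-\xi^{(\mathfrak p)}_{[nt]}\big)\Big\}\qquad(t\ge0).$$ Let $\mathfrak P^{(n)}$ be the law of $\mathfrak X^{(n)}$ on the space $C_{\mathbf 0}\big([0,\infty),(\Gamma\otimes\mathbb R,g_0^{(\mathfrak p)})\big)$ of continuous paths starting at the origin, equipped with the topology of uniform convergence on compact sets. Then $\mathfrak P^{(n)}$ converges weakly, as $n\to\infty$, to the Wiener measure $\mu$ on this space. That is, $\mathfrak X^{(n)}$ converges in law to a standard Brownian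 motion $(B_t^{(\mathfrak p)})_{t\ge0}$ with values in the Euclidean space $(\Gamma\otimes\mathbb R,g_0^{(\mathfrak p)})$, started at the origin.
   Context: **Graphs.** A graph $X=(V,E)$ has vertex set $V$ and set $E$ of oriented edges. Each $e\in E$ has an origin $o(e)$, a terminus $t(e)$ and an inverse edge $\overline e\in E$. Loops and multiple edges are allowed. $E_x$ is the set of edges with origin $x$. **Crystal lattice.** $X$ is a locally finite connected graph on which an abelian group $\Gamma\cong\mathbb Z^d$ acts freely by graph automorphisms with finite quotient graph $X_0=(V_0,E_0)=\Gamma\backslash X$. The map $\pi:X\to X_0$ is the covering map, and $\widetilde e\in E$ denotes any lift of $e\in E_0$. **Transition probability and invariant measure.** A transition probability is a function $p:E\to(0,1]$ with $\sum_{e\in E_x}p(e)=1$ for all $x\in V$. It is $\Gamma$-invariant if $p(\sigma e)=p(e)$ for all $\sigma\in\Gamma$, $e\in E$, and then it descends to $X_0$. The invariant probability measure $m:V_0\to(0,1]$ is the unique one with $\sum_{x\in V_0} m(x)=1$ and $m(x)=\sum_{e\in(E_0)_x}p(\overline e)m(t(e))$ for all $x\in V_0$. Put $\widetilde m(e):=p(e)m(o(e))$ for $e\in E_0$. **Directions.** $C_1(X_0,\mathbb R)$ is the space of real combinations of edges of $X_0$ modulo $\overline e=-e$. $H_1(X_0,\mathbb R)\subset C_1(X_0,\mathbb R)$ is the kernel of $\partial e=t(e)-o(e)$. The homological direction is $\gamma_p:=\sum_{e\in E_0}\widetilde m(e)e\in H_1(X_0,\mathbb R)$. The surjective linear map $\rho_{\mathbb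 R}:H_1(X_0,\mathbb R)\to\Gamma\otimes\mathbb R$ is induced by the covering: if a closed path $c$ in $X_0$ lifts to a path in $X$ from $x$ to $\sigma x$ with $\sigma\in\Gamma$, then $\rho_{\mathbb R}([c])=\sigma\otimes1$. The vector $\rho_{\mathbb R}(\gamma_p)\in\Gamma\otimes\mathbb R$ is the asymptotic direction. **Realizations.** A periodic realization is a map $\Phi:V\to\Gamma\otimes\mathbb R$ (extended piecewise linearly to edges) with $\Phi(\sigma x)=\Phi(x)+\sigma\otimes1$ for $\sigma\in\Gamma$, $x\in V$. A periodic realization $\Phi_0$ is $p$-modified harmonic if $\sum_{e\in E_x}p(e)\big(\Phi_0(t(e))-\Phi_0(o(e))\big)=\rho_{\mathbb R}(\gamma_p)$ for all $x\in V$. It exists and is unique up to translation. Write $d\Phi_0(e):=\Phi_0(t(e))-\Phi_0(o(e))$. **Changed transition probability.** For $\lambda\in\mathrm{Hom}(\Gamma,\mathbb R)$, extended linearly to $\Gamma\otimes\mathbb R$, and $x\in V_0$, put $F_x(\lambda):=\sum_{e\in(E_0)_x}p(e)\exp\big(\lambda(d\Phi_0(\widetilde e))\big)$. Let $\lambda_*(x)\in\mathrm{Hom}(\Gamma,\mathbb R)$ be the unique minimizer of $F_x(\cdot)$ (its existence and uniqueness for every $x\in V_0$ is asserted in a separate lemma of the paper). Define $$\mathfrak p(e):=\frac{p(e)\exp\big(\lambda_*(o(e))(d\Phi_0(\widetilde e))\big)}{F_{o(e)}(\lambda_*(o(e)))}\qquad(e\in E_0).$$ This is a positive transition probability on $X_0$.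 Its $\Gamma$-invariant lift to $E$ is also denoted $\mathfrak p$. Let $\mathfrak m$ be the invariant probability measure of $\mathfrak p$ on $V_0$ (defined as $m$ was for $p$), let $\widetilde{\mathfrak m}(e):=\mathfrak p(e)\mathfrak m(o(e))$ and $\gamma_{\mathfrak p}:=\sum_{e\in E_0}\widetilde{\mathfrak m}(e)e$. **Albanese metric.** For $\omega:E_0\to\mathbb R$ with $\omega(\overline e)=-\omega(e)$, put $\langle\gamma_{\mathfrak p},\omega\rangle:=\sum_{e\in E_0}\widetilde{\mathfrak m}(e)\omega(e)$. Call $\omega$ $\mathfrak p$-modified harmonic if $-\sum_{e\in(E_0)_x}\mathfrak p(e)\omega(e)+\langle\gamma_{\mathfrak p},\omega\rangle=0$ for all $x\in V_0$. Every class in $H^1(X_0,\mathbb R)=\{\omega:\omega(\overline e)=-\omega(e)\}/\{df\}$, where $df(e)=f(t(e))-f(o(e))$ for $f:V_0\to\mathbb R$, has a unique $\mathfrak p$-modified harmonic representative. So $H^1(X_0,\mathbb R)$ carries the inner product $\langle\!\langle\omega,\eta\rangle\!\rangle_{\mathfrak p}:=\sum_{e\in E_0}\widetilde{\mathfrak m}(e)\omega(e)\eta(e)-\langle\gamma_{\mathfrak p},\omega\rangle\langle\gamma_{\mathfrak p},\eta\rangle$ computed on these representatives. The transpose ${}^t\rho_{\mathbb R}:\mathrm{Hom}(\Gamma,\mathbb R)\hookrightarrow H^1(X_0,\mathbb R)$ is injective. The $\mathfrak p$-Albanese metric $g_0^{(\mathfrak p)}$ is the Euclidean inner product on $\Gamma\otimes\mathbb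 R=\mathrm{Hom}(\Gamma,\mathbb R)^*$ dual to the restriction of $\langle\!\langle\cdot,\cdot\rangle\!\rangle_{\mathfrak p}$ to $\mathrm{Hom}(\Gamma,\mathbb R)$. $[a]$ denotes the integer part of $a$.
   Formalization: The formal theorem assumes explicitly that F_x has exactly one minimizer for every x in V_0; this can fail (at a vertex of degree 1, F_x has no minimizer), and the changed transition probability is then undefined. *)

theory Defs
  imports
    "HOL-Probability.Probability"
    "HOL-Algebra.Group_Action"
    "HOL-Algebra.Elementary_Groups"
    "HOL-Algebra.Product_Groups"
    "Graph_Theory.Arc_Walk"
    "Graph_Theory.Digraph_Component"
begin

section \<open>Graphs with inverse edges\<close>

text \<open>
  Origin and terminus are \<open>tail\<close> and \<open>head\<close>; \<open>E\<^sub>x\<close> is \<open>out_arcs G x\<close>. An inverse edge is not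
  required to differ from the edge, so a loop may be its own inverse.
\<close>

definition edge_inversion :: "('v, 'e) pre_digraph \<Rightarrow> ('e \<Rightarrow> 'e) \<Rightarrow> bool" where
  "edge_inversion G bar \<longleftrightarrow>
     (\<forall>e\<in>arcs G. bar e \<in> arcs G \<and> bar (bar e) = e
        \<and> tail G (bar e) = head G e \<and> head G (bar e) = tail G e)"

definition transition_probability :: "('v, 'e) pre_digraph \<Rightarrow> ('e \<Rightarrow> real) \<Rightarrow> bool" where
  "transition_probability G p \<longleftrightarrow>
     (\<forall>e\<in>arcs G. 0 < p e \<and> p e \<le> 1) \<and> (\<forall>x\<in>verts G. (\<Sum>e\<in>out_arcs G x. p e) = 1)"

definition invariant_measure ::
  "('v, 'e) pre_digraph \<Rightarrow> ('e \<Rightarrow> 'e) \<Rightarrow> ('e \<Rightarrow> real) \<Rightarrow> 'v \<Rightarrow> real" where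
  "invariant_measure G bar p =
     (THE m. m \<in> extensional (verts G)
        \<and> (\<forall>x\<in>verts G. 0 < m x \<and> m x \<le> 1)
        \<and> (\<Sum>x\<in>verts G. m x) = 1
        \<and> (\<forall>x\<in>verts G. m x = (\<Sum>e\<in>out_arcs G x. p (bar e) * m (head G e))))"

definition edge_measure ::
  "('v, 'e) pre_digraph \<Rightarrow> ('e \<Rightarrow> 'e) \<Rightarrow> ('e \<Rightarrow> real) \<Rightarrow> 'e \<Rightarrow> real" where
  "edge_measure G bar p e = p e * invariant_measure G bar p (tail G e)"

subsection \<open>Homology\<close>

text \<open>
  The space of real combinations of edges modulo \<open>bar e = - e\<close> is identified with the space of
  antisymmetric functions on the edges: the class of \<open>\<Sum>e. a e \<cdot> e\<close> corresponds to
  \<open>e \<mapsto> a e - a (bar e)\<close>. Conversely, an antisymmetric \<open>c\<close> is the class of \<open>\<Sum>e. (c e / 2) \<cdot> e\<close>,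
  which explains the factors \<open>1/2\<close> below.
\<close>

definition chains :: "('v, 'e) pre_digraph \<Rightarrow> ('e \<Rightarrow> 'e) \<Rightarrow> ('e \<Rightarrow> real) set" where
  "chains G bar = {c \<in> extensional (arcs G). \<forall>e\<in>arcs G. c (bar e) = - c e}"

definition chain_class :: "('v, 'e) pre_digraph \<Rightarrow> ('e \<Rightarrow> 'e) \<Rightarrow> ('e \<Rightarrow> real) \<Rightarrow> 'e \<Rightarrow> real" where
  "chain_class G bar a = (\<lambda>e\<in>arcs G. a e - a (bar e))"

definition walk_chain :: "('v, 'e) pre_digraph \<Rightarrow> ('e \<Rightarrow> 'e) \<Rightarrow> 'e list \<Rightarrow> 'e \<Rightarrow> real" where
  "walk_chain G bar c = chain_class G bar (\<lambda>e. real (count_list c e))"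

definition boundary :: "('v, 'e) pre_digraph \<Rightarrow> ('e \<Rightarrow> real) \<Rightarrow> 'v \<Rightarrow> real" where
  "boundary G c x = (\<Sum>e\<in>in_arcs G x. c e / 2) - (\<Sum>e\<in>out_arcs G x. c e / 2)"

definition first_homology :: "('v, 'e) pre_digraph \<Rightarrow> ('e \<Rightarrow> 'e) \<Rightarrow> ('e \<Rightarrow> real) set" where
  "first_homology G bar = {c \<in> chains G bar. \<forall>x\<in>verts G. boundary G c x = 0}"

definition homological_direction ::
  "('v, 'e) pre_digraph \<Rightarrow> ('e \<Rightarrow> 'e) \<Rightarrow> ('e \<Rightarrow> real) \<Rightarrow> 'e \<Rightarrow> real" where
  "homological_direction G bar p = chain_class G bar (edge_measure G bar p)"

subsection \<open>Cohomology and modified harmonic forms\<close>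

definition one_forms :: "('v, 'e) pre_digraph \<Rightarrow> ('e \<Rightarrow> 'e) \<Rightarrow> ('e \<Rightarrow> real) set" where
  "one_forms G bar = {\<omega> \<in> extensional (arcs G). \<forall>e\<in>arcs G. \<omega> (bar e) = - \<omega> e}"

definition cohomology_class ::
  "('v, 'e) pre_digraph \<Rightarrow> ('e \<Rightarrow> 'e) \<Rightarrow> ('e \<Rightarrow> real) \<Rightarrow> ('e \<Rightarrow> real) set" where
  "cohomology_class G bar \<omega> =
     {\<eta> \<in> one_forms G bar. \<exists>f. \<forall>e\<in>arcs G. \<eta> e - \<omega> e = f (head G e) - f (tail G e)}"

definition first_cohomology ::
  "('v, 'e) pre_digraph \<Rightarrow> ('e \<Rightarrow> 'e) \<Rightarrow> ('e \<Rightarrow> real) set set" where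
  "first_cohomology G bar = cohomology_class G bar ` one_forms G bar"

definition chain_pairing :: "('v, 'e) pre_digraph \<Rightarrow> ('e \<Rightarrow> real) \<Rightarrow> ('e \<Rightarrow> real) \<Rightarrow> real" where
  "chain_pairing G c \<omega> = (\<Sum>e\<in>arcs G. c e / 2 * \<omega> e)"

definition direction_pairing ::
  "('v, 'e) pre_digraph \<Rightarrow> ('e \<Rightarrow> 'e) \<Rightarrow> ('e \<Rightarrow> real) \<Rightarrow> ('e \<Rightarrow> real) \<Rightarrow> real" where
  "direction_pairing G bar p \<omega> = (\<Sum>e\<in>arcs G. edge_measure G bar p e * \<omega> e)"

definition modified_harmonic_form ::
  "('v, 'e) pre_digraph \<Rightarrow> ('e \<Rightarrow> 'e) \<Rightarrow> ('e \<Rightarrow> real) \<Rightarrow> ('e \<Rightarrow> real) \<Rightarrow> bool" where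
  "modified_harmonic_form G bar p \<omega> \<longleftrightarrow>
     (\<forall>x\<in>verts G. - (\<Sum>e\<in>out_arcs G x. p e * \<omega> e) + direction_pairing G bar p \<omega> = 0)"

definition harmonic_representative ::
  "('v, 'e) pre_digraph \<Rightarrow> ('e \<Rightarrow> 'e) \<Rightarrow> ('e \<Rightarrow> real) \<Rightarrow> ('e \<Rightarrow> real) set \<Rightarrow> 'e \<Rightarrow> real" where
  "harmonic_representative G bar p C = (THE \<omega>. \<omega> \<in> C \<and> modified_harmonic_form G bar p \<omega>)"

definition cohomology_inner ::
  "('v, 'e) pre_digraph \<Rightarrow> ('e \<Rightarrow> 'e) \<Rightarrow> ('e \<Rightarrow> real)
     \<Rightarrow> ('e \<Rightarrow> real) set \<Rightarrow> ('e \<Rightarrow> real) set \<Rightarrow> real" where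
  "cohomology_inner G bar p C D =
     (let \<omega> = harmonic_representative G bar p C; \<eta> = harmonic_representative G bar p D
      in (\<Sum>e\<in>arcs G. edge_measure G bar p e * \<omega> e * \<eta> e)
           - direction_pairing G bar p \<omega> * direction_pairing G bar p \<eta>)"

subsection \<open>Random walks\<close>

definition step_probability :: "('v, 'e) pre_digraph \<Rightarrow> ('e \<Rightarrow> real) \<Rightarrow> 'v \<Rightarrow> 'v \<Rightarrow> real" where
  "step_probability G p x y = (\<Sum>e\<in>{e \<in> out_arcs G x. head G e = y}. p e)"

text \<open>
  The walk lives on an arbitrary probability space. It starts at \<open>x\<^sub>0\<close> at every sample point, not
  just almost surely, so that all rescaled paths belong to the path space.
\<close>

definition random_walk ::
  "('v, 'e) pre_digraph \<Rightarrow> ('e \<Rightarrow> real) \<Rightarrow> 'v \<Rightarrow> 'a measure \<Rightarrow> (nat \<Rightarrow> 'a \<Rightarrow> 'v) \<Rightarrow> bool" where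
  "random_walk G p x\<^sub>0 M w \<longleftrightarrow>
     prob_space M
     \<and> (\<forall>n. w n \<in> measurable M (count_space (verts G)))
     \<and> (\<forall>z\<in>space M. w 0 z = x\<^sub>0)
     \<and> (\<forall>n y. y 0 = x\<^sub>0 \<and> (\<forall>i\<le>n. y i \<in> verts G) \<longrightarrow>
          measure M {z \<in> space M. \<forall>i\<le>n. w i z = y i}
            = (\<Prod>i<n. step_probability G p (y i) (y (Suc i))))"

section \<open>Crystal lattices\<close>

text \<open>
  \<open>coords\<close> is an isomorphism from the acting group \<open>\<Gamma>\<close> onto \<open>\<int>\<^sup>d\<close>, with \<open>d = CARD('d)\<close>. It is used
  to take \<open>\<real>\<^sup>d\<close> as the carrier of \<open>\<Gamma> \<otimes> \<real>\<close>, with \<open>\<sigma> \<otimes> 1\<close> the coordinate vector of \<open>\<sigma>\<close>.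
\<close>

record ('v, 'e, 'g, 'd) crystal =
  graph :: "('v, 'e) pre_digraph"
  inv_edge :: "'e \<Rightarrow> 'e"
  transl :: "'g monoid"
  act_vert :: "'g \<Rightarrow> 'v \<Rightarrow> 'v"
  act_edge :: "'g \<Rightarrow> 'e \<Rightarrow> 'e"
  coords :: "'g \<Rightarrow> 'd \<Rightarrow> int"

definition crystal_lattice :: "('v, 'e, 'g, 'd::finite) crystal \<Rightarrow> bool" where
  "crystal_lattice X \<longleftrightarrow>
     wf_digraph (graph X)
     \<and> edge_inversion (graph X) (inv_edge X)
     \<and> (\<forall>x\<in>verts (graph X). finite (out_arcs (graph X) x))
     \<and> Digraph_Component.connected (graph X)
     \<and> coords X \<in> iso (transl X) (product_group UNIV (\<lambda>_. integer_group))
     \<and> group_action (transl X) (verts (graph X)) (act_vert X)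
     \<and> group_action (transl X) (arcs (graph X)) (act_edge X)
     \<and> (\<forall>\<sigma>\<in>carrier (transl X). \<forall>e\<in>arcs (graph X).
          tail (graph X) (act_edge X \<sigma> e) = act_vert X \<sigma> (tail (graph X) e)
          \<and> head (graph X) (act_edge X \<sigma> e) = act_vert X \<sigma> (head (graph X) e)
          \<and> inv_edge X (act_edge X \<sigma> e) = act_edge X \<sigma> (inv_edge X e))
     \<and> (\<forall>\<sigma>\<in>carrier (transl X). \<forall>x\<in>verts (graph X).
          act_vert X \<sigma> x = x \<longrightarrow> \<sigma> = \<one>\<^bsub>transl X\<^esub>)
     \<and> finite (orbits (transl X) (verts (graph X)) (act_vert X))
     \<and> finite (orbits (transl X) (arcs (graph X)) (act_edge X))"

text \<open>
  Vertices and edges of the quotient graph are orbits. As \<open>\<Gamma>\<close> acts by automorphisms, the origins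
  of the edges in an edge orbit form a vertex orbit, and similarly for termini and inverses.
\<close>

definition quotient_graph :: "('v, 'e, 'g, 'd) crystal \<Rightarrow> ('v set, 'e set) pre_digraph" where
  "quotient_graph X =
     \<lparr> verts = orbits (transl X) (verts (graph X)) (act_vert X),
       arcs = orbits (transl X) (arcs (graph X)) (act_edge X),
       tail = (\<lambda>A. tail (graph X) ` A),
       head = (\<lambda>A. head (graph X) ` A) \<rparr>"

definition quotient_inv :: "('v, 'e, 'g, 'd) crystal \<Rightarrow> 'e set \<Rightarrow> 'e set" where
  "quotient_inv X A = inv_edge X ` A"

definition edge_proj :: "('v, 'e, 'g, 'd) crystal \<Rightarrow> 'e \<Rightarrow> 'e set" where
  "edge_proj X e = orbit (transl X) (act_edge X) e"

definition edge_lift :: "'e set \<Rightarrow> 'e" where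
  "edge_lift A = (SOME e. e \<in> A)"

definition descend :: "('e \<Rightarrow> real) \<Rightarrow> 'e set \<Rightarrow> real" where
  "descend p A = p (edge_lift A)"

definition invariant_function :: "('v, 'e, 'g, 'd) crystal \<Rightarrow> ('e \<Rightarrow> real) \<Rightarrow> bool" where
  "invariant_function X p \<longleftrightarrow>
     (\<forall>\<sigma>\<in>carrier (transl X). \<forall>e\<in>arcs (graph X). p (act_edge X \<sigma> e) = p e)"

definition tensor_one :: "('v, 'e, 'g, 'd::finite) crystal \<Rightarrow> 'g \<Rightarrow> real ^ 'd" where
  "tensor_one X \<sigma> = (\<chi> i. real_of_int (coords X \<sigma> i))"

text \<open>
  This is the universal property of \<open>\<sigma> \<mapsto> \<sigma> \<otimes> 1\<close>. In particular, linear extension identifies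
  \<open>Hom(\<Gamma>, \<real>)\<close> with the space of linear functionals on \<open>\<real>\<^sup>d\<close>; the latter is used for it from here on.
\<close>

lemma tensor_one_universal:
  fixes X :: "('v, 'e, 'g, 'd::finite) crystal" and h :: "'g \<Rightarrow> 'b::real_vector"
  assumes grp: "group (transl X)"
    and X: "coords X \<in> iso (transl X) (product_group UNIV (\<lambda>_. integer_group))"
    and h: "\<And>\<sigma> \<tau>. \<sigma> \<in> carrier (transl X) \<Longrightarrow> \<tau> \<in> carrier (transl X) \<Longrightarrow>
              h (\<sigma> \<otimes>\<^bsub>transl X\<^esub> \<tau>) = h \<sigma> + h \<tau>"
  shows "\<exists>!l. linear l \<and> (\<forall>\<sigma>\<in>carrier (transl X). l (tensor_one X \<sigma>) = h \<sigma>)"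
proof -
  interpret G: group "transl X" by (rule grp)
  have bij: "bij_betw (coords X) (carrier (transl X)) UNIV"
    using X by (simp add: iso_def)
  have hom: "coords X (\<sigma> \<otimes>\<^bsub>transl X\<^esub> \<tau>) = (\<lambda>i. coords X \<sigma> i + coords X \<tau> i)"
    if "\<sigma> \<in> carrier (transl X)" "\<tau> \<in> carrier (transl X)" for \<sigma> \<tau>
    using X that by (auto simp: iso_def hom_def product_group_def fun_eq_iff)
  define s where "s = inv_into (carrier (transl X)) (coords X)"
  have s: "s k \<in> carrier (transl X)" and coords_s: "coords X (s k) = k" for k
    using bij by (simp_all add: s_def bij_betw_def inv_into_into f_inv_into_f)
  have s_coords: "s (coords X \<sigma>) = \<sigma>" if "\<sigma> \<in> carrier (transl X)" for \<sigma>
    using bij that by (auto simp: s_def bij_betw_def)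
  define H where "H k = h (s k)" for k
  have H_add: "H (\<lambda>i. k i + k' i) = H k + H k'" for k k'
  proof -
    have "s (\<lambda>i. k i + k' i) = s k \<otimes>\<^bsub>transl X\<^esub> s k'"
      using s_coords[of "s k \<otimes>\<^bsub>transl X\<^esub> s k'"] hom[OF s s, of k k'] s
      by (simp add: coords_s)
    then show ?thesis using h[OF s s] by (simp add: H_def)
  qed
  have H_0: "H (\<lambda>_. 0) = 0"
    using H_add[of "\<lambda>_. 0" "\<lambda>_. 0"] by simp
  define e where "e i = (\<lambda>j. if j = i then 1 else 0 :: int)" for i :: 'd
  have H_nat: "H (\<lambda>j. int n * e i j) = real n *\<^sub>R H (e i)" for n i
  proof (induction n)
    case (Suc n)
    have "H (\<lambda>j. int (Suc n) * e i j) = H (\<lambda>j. int n * e i j + e i j)"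
      by (rule arg_cong[where f = H]) (auto simp: algebra_simps)
    with Suc show ?case using H_add[of "\<lambda>j. int n * e i j" "e i"] by (simp add: algebra_simps)
  qed (simp add: H_0)
  have H_int: "H (\<lambda>j. z * e i j) = real_of_int z *\<^sub>R H (e i)" for z i
  proof (cases "z \<ge> 0")
    case True
    then show ?thesis using H_nat[of "nat z" i] by simp
  next
    case False
    have "H (\<lambda>j. z * e i j + int (nat (- z)) * e i j) = 0"
      using False H_0 by simp
    then have "H (\<lambda>j. z * e i j) = - H (\<lambda>j. int (nat (- z)) * e i j)"
      using H_add[of "\<lambda>j. z * e i j" "\<lambda>j. int (nat (- z)) * e i j"]
      by (simp add: eq_neg_iff_add_eq_0)
    also have "\<dots> = real_of_int z *\<^sub>R H (e i)"
      using False by (simp only: H_nat) simp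
    finally show ?thesis .
  qed
  have H_set: "H (\<lambda>j. if j \<in> S then k j else 0) = (\<Sum>i\<in>S. real_of_int (k i) *\<^sub>R H (e i))"
    if "finite S" for S k
    using that
  proof (induction S)
    case (insert i S)
    have "H (\<lambda>j. if j \<in> insert i S then k j else 0)
        = H (\<lambda>j. k i * e i j + (if j \<in> S then k j else 0))"
      using insert.hyps by (intro arg_cong[where f = H]) (auto simp: e_def)
    with insert show ?case
      using H_add[of "\<lambda>j. k i * e i j" "\<lambda>j. if j \<in> S then k j else 0"] by (simp add: H_int)
  qed (simp add: H_0)
  have H_eq: "H k = (\<Sum>i\<in>UNIV. real_of_int (k i) *\<^sub>R H (e i))" for k
    using H_set[of UNIV k] by simp
  define l where "l v = (\<Sum>i\<in>UNIV. (v $ i) *\<^sub>R H (e i))" for v :: "real ^ 'd"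
  have "linear l"
    by (rule linearI) (simp_all add: l_def scaleR_add_left sum.distrib scaleR_sum_right)
  moreover have "l (tensor_one X \<sigma>) = h \<sigma>" if "\<sigma> \<in> carrier (transl X)" for \<sigma>
    using H_eq[of "coords X \<sigma>"] s_coords[OF that] by (simp add: l_def tensor_one_def H_def)
  moreover have "l' = l''"
    if l': "linear l'" "\<forall>\<sigma>\<in>carrier (transl X). l' (tensor_one X \<sigma>) = h \<sigma>"
      and l'': "linear l''" "\<forall>\<sigma>\<in>carrier (transl X). l'' (tensor_one X \<sigma>) = h \<sigma>" for l' l''
  proof (rule linear_eq_stdbasis[OF l'(1) l''(1)])
    fix b :: "real ^ 'd" assume "b \<in> Basis"
    then obtain i where "b = axis i 1" by (auto simp: Basis_vec_def)
    then have "b = tensor_one X (s (e i))"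
      by (simp add: tensor_one_def coords_s e_def axis_def vec_eq_iff)
    then show "l' b = l'' b" using l'(2) l''(2) s by simp
  qed
  ultimately show ?thesis by blast
qed

text \<open>The linear map from homology to \<open>\<Gamma> \<otimes> \<real>\<close> induced by the covering.\<close>

definition rho ::
  "('v, 'e, 'g, 'd::finite) crystal \<Rightarrow> ('e set \<Rightarrow> real) \<Rightarrow> real ^ 'd" where
  "rho X =
     (let X\<^sub>0 = quotient_graph X; bar\<^sub>0 = quotient_inv X; H = first_homology X\<^sub>0 bar\<^sub>0 in
      THE r. r \<in> extensional H
        \<and> (\<forall>c\<in>H. \<forall>c'\<in>H. \<forall>a b.
              r (\<lambda>e\<in>arcs X\<^sub>0. a * c e + b * c' e) = a *\<^sub>R r c + b *\<^sub>R r c')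
        \<and> (\<forall>x\<in>verts (graph X). \<forall>\<sigma>\<in>carrier (transl X). \<forall>P.
              pre_digraph.awalk (graph X) x P (act_vert X \<sigma> x) \<longrightarrow>
              r (walk_chain X\<^sub>0 bar\<^sub>0 (map (edge_proj X) P)) = tensor_one X \<sigma>))"

definition asymptotic_direction ::
  "('v, 'e, 'g, 'd::finite) crystal \<Rightarrow> ('e \<Rightarrow> real) \<Rightarrow> real ^ 'd" where
  "asymptotic_direction X p =
     rho X (homological_direction (quotient_graph X) (quotient_inv X) (descend p))"

definition periodic_realization ::
  "('v, 'e, 'g, 'd::finite) crystal \<Rightarrow> ('v \<Rightarrow> real ^ 'd) \<Rightarrow> bool" where
  "periodic_realization X \<Phi> \<longleftrightarrow>
     (\<forall>\<sigma>\<in>carrier (transl X). \<forall>x\<in>verts (graph X).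
        \<Phi> (act_vert X \<sigma> x) = \<Phi> x + tensor_one X \<sigma>)"

definition edge_diff ::
  "('v, 'e, 'g, 'd::finite) crystal \<Rightarrow> ('v \<Rightarrow> real ^ 'd) \<Rightarrow> 'e \<Rightarrow> real ^ 'd" where
  "edge_diff X \<Phi> e = \<Phi> (head (graph X) e) - \<Phi> (tail (graph X) e)"

definition modified_harmonic_realization ::
  "('v, 'e, 'g, 'd::finite) crystal \<Rightarrow> ('e \<Rightarrow> real) \<Rightarrow> ('v \<Rightarrow> real ^ 'd) \<Rightarrow> bool" where
  "modified_harmonic_realization X p \<Phi> \<longleftrightarrow>
     periodic_realization X \<Phi>
     \<and> (\<forall>x\<in>verts (graph X).
          (\<Sum>e\<in>out_arcs (graph X) x. p e *\<^sub>R edge_diff X \<Phi> e) = asymptotic_direction X p)"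

subsection \<open>The changed transition probability\<close>

definition exp_moment ::
  "('v, 'e, 'g, 'd::finite) crystal \<Rightarrow> ('e \<Rightarrow> real) \<Rightarrow> ('v \<Rightarrow> real ^ 'd) \<Rightarrow> 'v set
     \<Rightarrow> ((real ^ 'd) \<Rightarrow>\<^sub>L real) \<Rightarrow> real" where
  "exp_moment X p \<Phi> x l =
     (\<Sum>e\<in>out_arcs (quotient_graph X) x.
        descend p e * exp (blinfun_apply l (edge_diff X \<Phi> (edge_lift e))))"

text \<open>This is meaningful only if \<open>exp_moment X p \<Phi> x\<close> has exactly one minimizer.\<close>

definition minimizer ::
  "('v, 'e, 'g, 'd::finite) crystal \<Rightarrow> ('e \<Rightarrow> real) \<Rightarrow> ('v \<Rightarrow> real ^ 'd) \<Rightarrow> 'v set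
     \<Rightarrow> ((real ^ 'd) \<Rightarrow>\<^sub>L real)" where
  "minimizer X p \<Phi> x = (THE l. is_arg_min (exp_moment X p \<Phi> x) (\<lambda>_. True) l)"

definition changed_probability ::
  "('v, 'e, 'g, 'd::finite) crystal \<Rightarrow> ('e \<Rightarrow> real) \<Rightarrow> ('v \<Rightarrow> real ^ 'd) \<Rightarrow> 'e set \<Rightarrow> real" where
  "changed_probability X p \<Phi> e =
     (let x = tail (quotient_graph X) e; l = minimizer X p \<Phi> x
      in descend p e * exp (blinfun_apply l (edge_diff X \<Phi> (edge_lift e))) / exp_moment X p \<Phi> x l)"

subsection \<open>The Albanese metric\<close>

text \<open>
  Classes in \<open>H\<^sup>1\<close> are determined by their pairing with \<open>H\<^sub>1\<close>, so \<open>transpose_rho\<close> is well defined.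
  Below, \<open>q\<close> is a transition probability on the quotient graph. The dual inner product of \<open>u\<close>
  and \<open>v\<close> is the inner product of the functionals that represent evaluation at \<open>u\<close> and at \<open>v\<close>.
\<close>

definition transpose_rho ::
  "('v, 'e, 'g, 'd::finite) crystal \<Rightarrow> ((real ^ 'd) \<Rightarrow>\<^sub>L real) \<Rightarrow> ('e set \<Rightarrow> real) set" where
  "transpose_rho X l =
     (THE C. C \<in> first_cohomology (quotient_graph X) (quotient_inv X)
        \<and> (\<forall>\<omega>\<in>C. \<forall>c\<in>first_homology (quotient_graph X) (quotient_inv X).
              chain_pairing (quotient_graph X) c \<omega> = blinfun_apply l (rho X c)))"

definition hom_inner ::
  "('v, 'e, 'g, 'd::finite) crystal \<Rightarrow> ('e set \<Rightarrow> real)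
     \<Rightarrow> ((real ^ 'd) \<Rightarrow>\<^sub>L real) \<Rightarrow> ((real ^ 'd) \<Rightarrow>\<^sub>L real) \<Rightarrow> real" where
  "hom_inner X q l l' =
     cohomology_inner (quotient_graph X) (quotient_inv X) q (transpose_rho X l) (transpose_rho X l')"

definition riesz_functional ::
  "('v, 'e, 'g, 'd::finite) crystal \<Rightarrow> ('e set \<Rightarrow> real) \<Rightarrow> real ^ 'd \<Rightarrow> ((real ^ 'd) \<Rightarrow>\<^sub>L real)" where
  "riesz_functional X q u = (THE l. \<forall>l'. hom_inner X q l l' = blinfun_apply l' u)"

definition albanese_metric ::
  "('v, 'e, 'g, 'd::finite) crystal \<Rightarrow> ('e set \<Rightarrow> real) \<Rightarrow> real ^ 'd \<Rightarrow> real ^ 'd \<Rightarrow> real" where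
  "albanese_metric X q u v = hom_inner X q (riesz_functional X q u) (riesz_functional X q v)"

section \<open>Path space, weak convergence and Wiener measure\<close>

text \<open>
  In this section \<open>g\<close> is an inner product on a finite-dimensional space \<open>'w\<close>. It need not be the one
  of the type class; since all norms on \<open>'w\<close> are equivalent, \<open>continuous_on\<close> also means continuity
  with respect to \<open>g\<close>. Paths on \<open>[0, \<infinity>)\<close> are \<open>undefined\<close> at negative times.
\<close>

definition path_space :: "(real \<Rightarrow> 'w::euclidean_space) set" where
  "path_space = {f \<in> extensional {0..}. continuous_on {0..} f \<and> f 0 = 0}"

text \<open>Since \<open>K\<close> is compact, the condition below says that the supremum over \<open>K\<close> is less than \<open>\<epsilon>\<close>.\<close>

definition path_nbhd ::
  "('w::euclidean_space \<Rightarrow> 'w \<Rightarrow> real) \<Rightarrow> (real \<Rightarrow> 'w) \<Rightarrow> real set \<Rightarrow> real \<Rightarrow> (real \<Rightarrow> 'w) set" where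
  "path_nbhd g f K \<epsilon> = {h \<in> path_space. \<forall>t\<in>K. sqrt (g (h t - f t) (h t - f t)) < \<epsilon>}"

definition path_topology :: "('w::euclidean_space \<Rightarrow> 'w \<Rightarrow> real) \<Rightarrow> (real \<Rightarrow> 'w) topology" where
  "path_topology g =
     topology (\<lambda>U. U \<subseteq> path_space
       \<and> (\<forall>f\<in>U. \<exists>K \<epsilon>. compact K \<and> K \<subseteq> {0..} \<and> 0 < \<epsilon> \<and> path_nbhd g f K \<epsilon> \<subseteq> U))"

lemma openin_path_topology:
  "openin (path_topology g) U \<longleftrightarrow> U \<subseteq> path_space
     \<and> (\<forall>f\<in>U. \<exists>K \<epsilon>. compact K \<and> K \<subseteq> {0..} \<and> 0 < \<epsilon> \<and> path_nbhd g f K \<epsilon> \<subseteq> U)"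
proof -
  let ?P = "\<lambda>U. U \<subseteq> path_space
     \<and> (\<forall>f\<in>U. \<exists>K \<epsilon>. compact K \<and> K \<subseteq> {0..} \<and> 0 < \<epsilon> \<and> path_nbhd g f K \<epsilon> \<subseteq> U)"
  have "istopology ?P"
    unfolding istopology_def
  proof (intro conjI allI impI)
    fix S T assume S: "?P S" and T: "?P T"
    show "S \<inter> T \<subseteq> path_space" using S by blast
    show "\<forall>f\<in>S \<inter> T. \<exists>K \<epsilon>. compact K \<and> K \<subseteq> {0..} \<and> 0 < \<epsilon> \<and> path_nbhd g f K \<epsilon> \<subseteq> S \<inter> T"
    proof
      fix f assume "f \<in> S \<inter> T"
      with S T obtain K \<epsilon> K' \<epsilon>'
        where "compact K" "K \<subseteq> {0..}" "0 < \<epsilon>" "path_nbhd g f K \<epsilon> \<subseteq> S"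
          and "compact K'" "K' \<subseteq> {0..}" "0 < \<epsilon>'" "path_nbhd g f K' \<epsilon>' \<subseteq> T"
        by (metis IntE)
      then show "\<exists>K \<epsilon>. compact K \<and> K \<subseteq> {0..} \<and> 0 < \<epsilon> \<and> path_nbhd g f K \<epsilon> \<subseteq> S \<inter> T"
        by (intro exI[of _ "K \<union> K'"] exI[of _ "min \<epsilon> \<epsilon>'"])
           (auto simp: path_nbhd_def subset_eq intro: compact_Un)
    qed
  next
    fix \<U> assume U: "\<forall>U\<in>\<U>. ?P U"
    then show "\<Union>\<U> \<subseteq> path_space" by blast
    show "\<forall>f\<in>\<Union>\<U>. \<exists>K \<epsilon>. compact K \<and> K \<subseteq> {0..} \<and> 0 < \<epsilon> \<and> path_nbhd g f K \<epsilon> \<subseteq> \<Union>\<U>"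
    proof
      fix f assume "f \<in> \<Union>\<U>"
      then obtain U where "U \<in> \<U>" "f \<in> U" by blast
      with U obtain K \<epsilon> where "compact K" "K \<subseteq> {0..}" "0 < \<epsilon>" "path_nbhd g f K \<epsilon> \<subseteq> U"
        by meson
      with \<open>U \<in> \<U>\<close> show "\<exists>K \<epsilon>. compact K \<and> K \<subseteq> {0..} \<and> 0 < \<epsilon> \<and> path_nbhd g f K \<epsilon> \<subseteq> \<Union>\<U>"
        by (meson Union_upper order_trans)
    qed
  qed
  then show ?thesis by (simp add: path_topology_def topology_inverse')
qed

lemma topspace_path_topology: "topspace (path_topology g) = path_space"
proof -
  have "openin (path_topology g) path_space"
    unfolding openin_path_topology
    by (auto simp: path_nbhd_def intro!: exI[of _ "{}"] exI[of _ 1])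
  then show ?thesis
    using openin_path_topology[of g "topspace (path_topology g)"]
    by (auto dest: openin_subset)
qed

definition path_borel :: "('w::euclidean_space \<Rightarrow> 'w \<Rightarrow> real) \<Rightarrow> (real \<Rightarrow> 'w) measure" where
  "path_borel g = sigma path_space {U. openin (path_topology g) U}"

definition weakly_converges :: "'x topology \<Rightarrow> (nat \<Rightarrow> 'x measure) \<Rightarrow> 'x measure \<Rightarrow> bool" where
  "weakly_converges T P \<mu> \<longleftrightarrow>
     (\<forall>F. continuous_map T euclideanreal F \<and> bounded (F ` topspace T) \<longrightarrow>
        (\<lambda>n. integral\<^sup>L (P n) F) \<longlonglongrightarrow> integral\<^sup>L \<mu> F)"

text \<open>
  The Wiener measure is the law of standard Brownian motion in the Euclidean space \<open>('w, g)\<close>: the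
  increments are independent, and the increment over \<open>[s, t]\<close> is centred Gaussian with
  covariance \<open>(t - s) g\<close>, i.e. its \<open>g\<close>-product with any nonzero \<open>u\<close> is normal with
  variance \<open>(t - s) g(u, u)\<close>.
\<close>

definition wiener_measure ::
  "('w::euclidean_space \<Rightarrow> 'w \<Rightarrow> real) \<Rightarrow> (real \<Rightarrow> 'w) measure \<Rightarrow> bool" where
  "wiener_measure g \<mu> \<longleftrightarrow>
     sets \<mu> = sets (path_borel g) \<and> prob_space \<mu>
     \<and> (\<forall>(\<tau> :: nat \<Rightarrow> real) n. 0 \<le> \<tau> 0 \<and> mono \<tau> \<longrightarrow>
          prob_space.indep_vars \<mu> (\<lambda>_. borel) (\<lambda>i b. b (\<tau> (Suc i)) - b (\<tau> i)) {..<n})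
     \<and> (\<forall>s t u. 0 \<le> s \<and> s < t \<and> u \<noteq> 0 \<longrightarrow>
          distributed \<mu> lborel (\<lambda>b. g (b t - b s) u)
            (normal_density 0 (sqrt ((t - s) * g u u))))"

definition interpolated_path :: "(nat \<Rightarrow> 'w::euclidean_space) \<Rightarrow> nat \<Rightarrow> real \<Rightarrow> 'w" where
  "interpolated_path \<xi> n =
     (\<lambda>t\<in>{0..}. let k = nat \<lfloor>real n * t\<rfloor> in
        (1 / sqrt (real n)) *\<^sub>R (\<xi> k + (real n * t - real k) *\<^sub>R (\<xi> (k + 1) - \<xi> k)))"

end

theory Submission
  imports Defs "HOL-Real_Asymp.Real_Asymp"
begin

text \<open>
  Minimality of \<open>\<lambda>\<^sub>*(x)\<close> means that the increments of \<open>\<Phi>\<^sub>0\<close> are centred under the changed transition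
  probability at every vertex, so \<open>\<Phi>\<^sub>0(w\<^sub>n)\<close> is a martingale with bounded increments and the Albanese
  metric is dual to its asymptotic covariance form \<open>Q(a) = \<Sum>\<^sub>e m(e) (a \<bullet> d\<Phi>\<^sub>0(e))\<^sup>2\<close>.

  For the marginals, let \<open>g\<close> solve the Poisson equation on the quotient graph for the conditional
  variance of \<open>a \<bullet> \<Phi>\<^sub>0(w\<^sub>n)\<close>. Weighting with \<open>1 - \<epsilon>\<^sup>2 g / 2\<close> turns \<open>exp (i \<epsilon> a \<bullet> \<Phi>\<^sub>0)\<close> into an approximate
  eigenfunction of the walk with eigenvalue \<open>1 - \<epsilon>\<^sup>2 Q(a) / 2\<close>. With \<open>\<epsilon> = 1 / \<surd>n\<close>, the characteristic
  functions of the increments converge to those of a Brownian motion (Levy's construction).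

  Fourth moments of increments are at most a constant times \<open>(t - s)\<^sup>2\<close> for all \<open>n\<close>. A chaining argument
  therefore bounds, uniformly in \<open>n\<close>, the distance of the paths to their dyadic interpolations, which
  reduces Lipschitz functionals to functions of finitely many increments. A bounded continuous
  functional is a limit of Lipschitz ones from below and from above, so its expectations converge too.
\<close>

section \<open>Finite irreducible Markov chains\<close>

text \<open>Brownian motion is built explicitly, with covariance form \<open>Q\<close>. It is
  standard for the Albanese metric g because g(u, v) = R u \<bullet> v, where \<open>R\<close>
  inverts the Gram operator of \<open>Q\<close>: testing an increment b with u gives R u \<bullet>
  b, whose variance is proportional to Q (R u) = g(u, u).

  The obstacle is that the conditional variance of a step depends on the vertex. A martingale
  central limit theorem would call for an ergodic theorem for the averaged variances; the corrector
  replaces it by an algebraic identity with an error of third order in \<epsilon> per step, so that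
  n steps with \<epsilon> = 1 / \<surd>n cost O(1 / \<surd>n).

  No compactness of laws is used. The fourth moments give order 4^(-m) per dyadic interval of level
  m, hence 2^(-m) for all intervals in a unit of time; the threshold c = 2^(-m/4) makes both terms c
  and 2^(-m) / c^3 of the chaining bound equal, and the result is summable in m. The same
  interpolation estimate makes the midpoint construction of Brownian motion converge.\<close>

lemma underdetermined_system:
  fixes A :: "'a \<Rightarrow> 'b \<Rightarrow> real"
  assumes "finite T" "finite S" "card T < card S"
  shows "\<exists>v. (\<exists>x\<in>S. v x \<noteq> 0) \<and> (\<forall>t\<in>T. (\<Sum>x\<in>S. A t x * v x) = 0)"
  using assms
proof (induction T arbitrary: A S rule: finite_induct)
  case empty
  then obtain x where "x \<in> S" by fastforce
  then show ?case by (intro exI[of _ "\<lambda>_. 1"]) auto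
next
  case (insert t T)
  show ?case
  proof (cases "\<forall>x\<in>S. A t x = 0")
    case True
    have "card T < card S" using insert by simp
    from insert.IH[OF insert.prems(1) this, of A] True show ?thesis by force
  next
    case False
    \<comment> \<open>Gaussian elimination: equation t is solved for the unknown at the pivot x0,
      and the induction hypothesis applies to the remaining equations after substitution.\<close>
    then obtain x0 where x0: "x0 \<in> S" "A t x0 \<noteq> 0" by blast
    define S' where "S' = S - {x0}"
    have S: "S = insert x0 S'" "x0 \<notin> S'" "finite S'"
      using x0 insert.prems by (auto simp: S'_def)
    have "card T < card S'" using insert.prems insert.hyps S by simp
    from insert.IH[OF \<open>finite S'\<close> this, of "\<lambda>s x. A s x - A s x0 * A t x / A t x0"]
    obtain v where v: "\<exists>x\<in>S'. v x \<noteq> 0"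
      "\<And>s. s \<in> T \<Longrightarrow> (\<Sum>x\<in>S'. (A s x - A s x0 * A t x / A t x0) * v x) = 0" by blast
    define c where "c = - (\<Sum>x\<in>S'. A t x * v x) / A t x0"
    define v' where "v' = v(x0 := c)"
    have sum: "(\<Sum>x\<in>S. A s x * v' x) = A s x0 * c + (\<Sum>x\<in>S'. A s x * v x)" for s
    proof -
      have "(\<Sum>x\<in>S'. A s x * v' x) = (\<Sum>x\<in>S'. A s x * v x)"
        using S(2) by (intro sum.cong) (auto simp: v'_def)
      then show ?thesis using S(2,3) by (simp add: S(1) v'_def)
    qed
    have "(\<Sum>x\<in>S. A s x * v' x) = 0" if "s \<in> T" for s
    proof -
      have "A s x0 * c = - (\<Sum>x\<in>S'. A s x0 * A t x / A t x0 * v x)"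
        by (simp add: c_def sum_distrib_left sum_divide_distrib sum_negf algebra_simps)
      then show ?thesis using v(2)[OF that]
        by (simp add: sum left_diff_distrib sum_subtractf)
    qed
    moreover have "(\<Sum>x\<in>S. A t x * v' x) = 0"
      using x0 by (simp add: sum c_def)
    moreover have "\<exists>x\<in>S. v' x \<noteq> 0"
      using v(1) S by (auto simp: v'_def)
    ultimately show ?thesis by blast
  qed
qed

section \<open>Maximum principle, invariant measures and Poisson equation\<close>

locale finite_markov_chain =
  fixes V :: "'a set" and P :: "'a \<Rightarrow> 'a \<Rightarrow> real"
  assumes finite_V: "finite V" and V_nonempty: "V \<noteq> {}"
    and P_nonneg: "\<And>x y. x \<in> V \<Longrightarrow> y \<in> V \<Longrightarrow> 0 \<le> P x y"
    and P_sum: "\<And>x. x \<in> V \<Longrightarrow> (\<Sum>y\<in>V. P x y) = 1"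
    and irreducible: "\<And>S. S \<subseteq> V \<Longrightarrow> S \<noteq> {} \<Longrightarrow>
      (\<And>x y. x \<in> S \<Longrightarrow> y \<in> V \<Longrightarrow> 0 < P x y \<Longrightarrow> y \<in> S) \<Longrightarrow> S = V"
begin

text \<open>Maximum principle: where \<open>f\<close> attains its maximum c, the average of c - f
  over the next step vanishes and has nonnegative terms, so the set of maximum points is closed
  under transitions and \<open>irreducible\<close> applies.\<close>

lemma harmonic_imp_constant:
  assumes harm: "\<And>x. x \<in> V \<Longrightarrow> f x = (\<Sum>y\<in>V. P x y * f y)"
  shows "\<exists>c. \<forall>x\<in>V. f x = c"
proof -
  define c where "c = Max (f ` V)"
  have le: "f y \<le> c" if "y \<in> V" for y
    using that finite_V by (simp add: c_def)
  have "c \<in> f ` V" unfolding c_def using finite_V V_nonempty by (intro Max_in) auto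
  have "{x \<in> V. f x = c} = V"
  proof (rule irreducible)
    show "{x \<in> V. f x = c} \<noteq> {}" using \<open>c \<in> f ` V\<close> by auto
    fix x y assume x: "x \<in> {x \<in> V. f x = c}" and y: "y \<in> V" "0 < P x y"
    have "(\<Sum>y\<in>V. P x y * (c - f y)) = (\<Sum>y\<in>V. P x y) * c - (\<Sum>y\<in>V. P x y * f y)"
      by (simp add: right_diff_distrib sum_subtractf sum_distrib_right)
    then have "(\<Sum>y\<in>V. P x y * (c - f y)) = 0"
      using x harm[of x] P_sum[of x] by simp
    moreover have "0 \<le> P x y * (c - f y)" if "y \<in> V" for y
      using P_nonneg[of x y] le[OF that] x that by simp
    ultimately have "P x y * (c - f y) = 0"
      using finite_V y(1) by (simp add: sum_nonneg_eq_0_iff)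
    then show "y \<in> {x \<in> V. f x = c}" using y by simp
  qed auto
  then show ?thesis by blast
qed

text \<open>The support of a nonnegative invariant vector is closed under transitions.\<close>

lemma stationary_pos:
  assumes inv: "\<And>y. y \<in> V \<Longrightarrow> m y = (\<Sum>x\<in>V. m x * P x y)"
    and nonneg: "\<And>x. x \<in> V \<Longrightarrow> 0 \<le> m x" and nz: "\<exists>x\<in>V. m x \<noteq> 0"
    and x: "x \<in> V"
  shows "0 < m x"
proof -
  have "{x \<in> V. 0 < m x} = V"
  proof (rule irreducible)
    show "{x \<in> V. 0 < m x} \<noteq> {}" using nz nonneg by (force simp: less_le)
    fix x y assume x: "x \<in> {x \<in> V. 0 < m x}" and y: "y \<in> V" "0 < P x y"
    have "0 < m x * P x y" using x y by simp
    also have "\<dots> \<le> (\<Sum>x\<in>V. m x * P x y)"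
      using x y by (intro member_le_sum[where f = "\<lambda>x. m x * P x y"])
        (auto simp: nonneg P_nonneg finite_V)
    finally show "y \<in> {x \<in> V. 0 < m x}" using inv[OF y(1)] y(1) by simp
  qed auto
  then show ?thesis using x by blast
qed

lemma exists_stationary:
  "\<exists>m. (\<forall>x\<in>V. 0 < m x) \<and> (\<Sum>x\<in>V. m x) = 1 \<and> (\<forall>y\<in>V. m y = (\<Sum>x\<in>V. m x * P x y))"
proof -
  obtain y0 where y0: "y0 \<in> V" using V_nonempty by blast
  have "card (V - {y0}) < card V" using finite_V y0 by (simp add: card_gt_0_iff V_nonempty)
  then obtain m where m: "\<exists>x\<in>V. m x \<noteq> 0"
    "\<And>y. y \<in> V - {y0} \<Longrightarrow> (\<Sum>x\<in>V. ((if x = y then 1 else 0) - P x y) * m x) = 0"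
    using underdetermined_system[of "V - {y0}" V "\<lambda>y x. (if x = y then 1 else 0) - P x y"] finite_V
    by auto
  have row: "(\<Sum>x\<in>V. ((if x = y then 1 else 0) - P x y) * m x) = m y - (\<Sum>x\<in>V. m x * P x y)"
    if "y \<in> V" for y
  proof -
    have "(\<Sum>x\<in>V. ((if x = y then 1 else 0) - P x y) * m x)
        = (\<Sum>x\<in>V. (if x = y then m x else 0) - m x * P x y)"
      by (intro sum.cong) (auto simp: algebra_simps)
    then show ?thesis using that finite_V by (simp add: sum_subtractf)
  qed
  have tot: "(\<Sum>y\<in>V. \<Sum>x\<in>V. g x * P x y) = (\<Sum>x\<in>V. g x)" for g :: "'a \<Rightarrow> real"
    by (subst sum.swap) (simp add: P_sum flip: sum_distrib_left)
  have inv: "m y = (\<Sum>x\<in>V. m x * P x y)" if "y \<in> V" for y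
  proof (cases "y = y0")
    case False
    then show ?thesis using m(2)[of y] row[OF that] that by simp
  next
    case True
    \<comment> \<open>The equation dropped at y0 is minus the sum of the others, since the rows of P
      sum to one.\<close>
    have "(\<Sum>y\<in>V. m y - (\<Sum>x\<in>V. m x * P x y)) = 0" by (simp add: sum_subtractf tot)
    moreover have "(\<Sum>y\<in>V. m y - (\<Sum>x\<in>V. m x * P x y))
        = (m y0 - (\<Sum>x\<in>V. m x * P x y0)) + (\<Sum>y\<in>V - {y0}. m y - (\<Sum>x\<in>V. m x * P x y))"
      using y0 finite_V by (subst sum.remove[of V y0]) auto
    moreover have "(\<Sum>y\<in>V - {y0}. m y - (\<Sum>x\<in>V. m x * P x y)) = 0"
      using m(2) row by (intro sum.neutral) auto
    ultimately show ?thesis using True by simp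
  qed
  define n where "n x = \<bar>m x\<bar>" for x
  have le: "n y \<le> (\<Sum>x\<in>V. n x * P x y)" if "y \<in> V" for y
  proof -
    have "n y \<le> (\<Sum>x\<in>V. \<bar>m x * P x y\<bar>)"
      using inv[OF that] sum_abs[of "\<lambda>x. m x * P x y" V] by (simp add: n_def)
    also have "\<dots> = (\<Sum>x\<in>V. n x * P x y)"
      using that by (intro sum.cong) (auto simp: n_def abs_mult P_nonneg)
    finally show ?thesis .
  qed
  have n_inv: "n y = (\<Sum>x\<in>V. n x * P x y)" if "y \<in> V" for y
  proof -
    have "(\<Sum>y\<in>V. (\<Sum>x\<in>V. n x * P x y) - n y) = 0" by (simp add: sum_subtractf tot)
    then have "\<forall>y\<in>V. (\<Sum>x\<in>V. n x * P x y) - n y = 0"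
      using le by (subst (asm) sum_nonneg_eq_0_iff) (auto simp: finite_V)
    then show ?thesis using that by auto
  qed
  have n_pos: "0 < n x" if "x \<in> V" for x
    using stationary_pos[of n, OF n_inv _ _ that] m(1) by (auto simp: n_def)
  define Z where "Z = (\<Sum>x\<in>V. n x)"
  have Z: "0 < Z" unfolding Z_def using n_pos finite_V V_nonempty by (intro sum_pos) auto
  show ?thesis
  proof (intro exI[of _ "\<lambda>x. n x / Z"] conjI ballI)
    show "(\<Sum>x\<in>V. n x / Z) = 1" using Z by (simp add: Z_def flip: sum_divide_distrib)
    show "n y / Z = (\<Sum>x\<in>V. n x / Z * P x y)" if "y \<in> V" for y
      using n_inv[OF that] by (simp add: sum_divide_distrib)
  qed (use n_pos Z in auto)
qed

text \<open>Fredholm alternative by counting: the coefficient of the right-hand side is made an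
  extra unknown \<open>None\<close>, which gives one more unknown than equations. Adding
  \<open>m y\<close> to the matrix forces the solution to have m-mean zero, which excludes constants
  from the kernel.\<close>

lemma poisson_equation:
  assumes m: "\<And>x. x \<in> V \<Longrightarrow> 0 < m x" "(\<Sum>x\<in>V. m x) = 1"
    and inv: "\<And>y. y \<in> V \<Longrightarrow> m y = (\<Sum>x\<in>V. m x * P x y)"
  shows "\<exists>g. \<forall>x\<in>V. g x - (\<Sum>y\<in>V. P x y * g y) = f x - (\<Sum>y\<in>V. m y * f y)"
proof -
  define c where "c = (\<Sum>y\<in>V. m y * f y)"
  define A :: "'a \<Rightarrow> 'a option \<Rightarrow> real" where
    "A x o' = (case o' of None \<Rightarrow> f x - c | Some y \<Rightarrow> (if x = y then 1 else 0) - P x y + m y)" for x o'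
  have fin: "finite (insert None (Some ` V))" using finite_V by simp
  have card: "card V < card (insert None (Some ` V))"
    using finite_V by (simp add: card_image)
  obtain v where v: "\<exists>o'\<in>insert None (Some ` V). v o' \<noteq> 0"
    and sys: "\<And>x. x \<in> V \<Longrightarrow> (\<Sum>o'\<in>insert None (Some ` V). A x o' * v o') = 0"
    using underdetermined_system[OF finite_V fin card, of A] by blast
  define u where "u y = v (Some y)" for y
  have eq: "(f x - c) * v None + (u x - (\<Sum>y\<in>V. P x y * u y) + (\<Sum>y\<in>V. m y * u y)) = 0"
    if "x \<in> V" for x
  proof -
    have "(\<Sum>o'\<in>Some ` V. A x o' * v o') = (\<Sum>y\<in>V. (if x = y then u y else 0) - P x y * u y + m y * u y)"
      by (subst sum.reindex) (auto simp: A_def u_def algebra_simps intro!: sum.cong)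
    then show ?thesis using sys[OF that] finite_V that
      by (simp add: A_def sum_subtractf sum.distrib)
  qed
  have Pm: "(\<Sum>x\<in>V. m x * (\<Sum>y\<in>V. P x y * u y)) = (\<Sum>y\<in>V. m y * u y)"
  proof -
    have "(\<Sum>x\<in>V. m x * (\<Sum>y\<in>V. P x y * u y)) = (\<Sum>y\<in>V. \<Sum>x\<in>V. m x * P x y * u y)"
      by (subst sum.swap) (simp add: sum_distrib_left mult.assoc)
    also have "\<dots> = (\<Sum>y\<in>V. m y * u y)"
      by (intro sum.cong refl) (simp add: inv flip: sum_distrib_right)
    finally show ?thesis .
  qed
  have mu: "(\<Sum>y\<in>V. m y * u y) = 0"
  proof -
    define U where "U = (\<Sum>y\<in>V. m y * u y)"
    have "0 = (\<Sum>x\<in>V. m x * ((f x - c) * v None + (u x - (\<Sum>y\<in>V. P x y * u y) + U)))"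
      using eq by (simp add: U_def)
    also have "\<dots> = (\<Sum>x\<in>V. v None * (m x * f x) - v None * c * m x + m x * u x
        - m x * (\<Sum>y\<in>V. P x y * u y) + U * m x)"
      by (intro sum.cong) (auto simp: algebra_simps)
    also have "\<dots> = v None * c - v None * c * 1 + U - U + U * 1"
      by (simp add: sum.distrib sum_subtractf Pm m(2) flip: sum_distrib_left)
        (simp add: c_def U_def)
    finally show ?thesis by (simp add: U_def)
  qed
  \<comment> \<open>With \<open>v None = 0\<close> the solution would be harmonic, hence constant,
    and of mean zero, hence trivial. So it can be normalised by dividing by
    \<open>v None\<close>.\<close>
  have "v None \<noteq> 0"
  proof
    assume 0: "v None = 0"
    have "u x = (\<Sum>y\<in>V. P x y * u y)" if "x \<in> V" for x
      using eq[OF that] by (simp add: 0 mu)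
    then obtain d where d: "\<forall>x\<in>V. u x = d" using harmonic_imp_constant by blast
    then have "(\<Sum>y\<in>V. m y * u y) = (\<Sum>y\<in>V. m y) * d" by (simp add: sum_distrib_right)
    then have "d = 0" using mu m by simp
    then show False using v d 0 by (auto simp: u_def)
  qed
  show ?thesis
  proof (intro exI[of _ "\<lambda>x. - u x / v None"] ballI)
    fix x assume x: "x \<in> V"
    have "(\<Sum>y\<in>V. P x y * (- u y / v None)) = - (\<Sum>y\<in>V. P x y * u y) / v None"
      by (simp add: sum_negf sum_divide_distrib)
    moreover have "(\<Sum>y\<in>V. P x y * u y) = u x + (f x - c) * v None" using eq[OF x] mu by simp
    ultimately show "- u x / v None - (\<Sum>y\<in>V. P x y * (- u y / v None)) = f x - (\<Sum>y\<in>V. m y * f y)"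
      using \<open>v None \<noteq> 0\<close> by (simp add: c_def field_simps)
  qed
qed

text \<open>Duality: an invariant m' annihilates g - P g, so pairing m' with the Poisson equation
  for the indicator of z leaves m' z - m z.\<close>

lemma stationary_unique:
  assumes m: "\<And>x. x \<in> V \<Longrightarrow> 0 < m x" "(\<Sum>x\<in>V. m x) = 1"
      "\<And>y. y \<in> V \<Longrightarrow> m y = (\<Sum>x\<in>V. m x * P x y)"
    and m': "(\<Sum>x\<in>V. m' x) = 1" "\<And>y. y \<in> V \<Longrightarrow> m' y = (\<Sum>x\<in>V. m' x * P x y)"
    and z: "z \<in> V"
  shows "m' z = m z"
proof -
  define f where "f x = (if x = z then 1 else 0 :: real)" for x
  obtain g where g: "\<And>x. x \<in> V \<Longrightarrow> g x - (\<Sum>y\<in>V. P x y * g y) = f x - (\<Sum>y\<in>V. m y * f y)"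
    using poisson_equation[OF m, of f] by blast
  have mf: "(\<Sum>y\<in>V. n y * f y) = n z" for n :: "'a \<Rightarrow> real"
    using z finite_V by (simp add: f_def if_distrib cong: if_cong)
  have "(\<Sum>x\<in>V. m' x * (\<Sum>y\<in>V. P x y * g y)) = (\<Sum>y\<in>V. \<Sum>x\<in>V. m' x * P x y * g y)"
    by (subst sum.swap) (simp add: sum_distrib_left mult.assoc)
  also have "\<dots> = (\<Sum>y\<in>V. m' y * g y)"
    by (intro sum.cong refl) (simp add: m'(2) flip: sum_distrib_right)
  finally have "0 = (\<Sum>x\<in>V. m' x * (g x - (\<Sum>y\<in>V. P x y * g y)))"
    by (simp add: algebra_simps sum_subtractf)
  also have "\<dots> = (\<Sum>x\<in>V. m' x * f x - m' x * m z)"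
    by (intro sum.cong refl) (simp only: g mf right_diff_distrib)
  also have "\<dots> = m' z - m z"
    by (simp add: sum_subtractf mf m'(1) flip: sum_distrib_right)
  finally show ?thesis by simp
qed

end

section \<open>Random walks on finite graphs with inverse edges\<close>

lemma sum_step_probability:
  assumes "finite (arcs G)" "finite (verts G)" "wf_digraph G"
  shows "(\<Sum>y\<in>verts G. step_probability G q x y * f y) = (\<Sum>e\<in>out_arcs G x. q e * f (head G e))"
proof -
  have fin: "finite (out_arcs G x)" using assms(1) by (rule rev_finite_subset) auto
  have "head G ` out_arcs G x \<subseteq> verts G" using assms(3) by (auto simp: wf_digraph_def)
  then have "(\<Sum>e\<in>out_arcs G x. q e * f (head G e))
      = (\<Sum>y\<in>verts G. \<Sum>e\<in>{e \<in> out_arcs G x. head G e = y}. q e * f (head G e))"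
    using fin assms(2) by (intro sum.group[symmetric]) auto
  then show ?thesis by (simp add: step_probability_def sum_distrib_right)
qed

locale finite_graph_walk =
  fixes G :: "('v, 'e) pre_digraph" and bar :: "'e \<Rightarrow> 'e" and q :: "'e \<Rightarrow> real"
  assumes wf: "wf_digraph G" and finite_arcs: "finite (arcs G)" and finite_verts: "finite (verts G)"
    and verts_nonempty: "verts G \<noteq> {}"
    and inversion: "edge_inversion G bar"
    and q_pos: "\<And>e. e \<in> arcs G \<Longrightarrow> 0 < q e"
    and q_sum: "\<And>x. x \<in> verts G \<Longrightarrow> (\<Sum>e\<in>out_arcs G x. q e) = 1"
    and connected_verts: "\<And>S. S \<subseteq> verts G \<Longrightarrow> S \<noteq> {} \<Longrightarrow>
      (\<And>e. e \<in> arcs G \<Longrightarrow> tail G e \<in> S \<Longrightarrow> head G e \<in> S) \<Longrightarrow> S = verts G"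
begin

lemma finite_out_arcs: "finite (out_arcs G x)"
  using finite_arcs by (rule rev_finite_subset) auto

lemmas sum_step = sum_step_probability[OF finite_arcs finite_verts wf]

lemma step_nonneg: "0 \<le> step_probability G q x y"
  unfolding step_probability_def by (intro sum_nonneg) (auto intro: less_imp_le q_pos)

sublocale finite_markov_chain "verts G" "step_probability G q"
proof
  show "(\<Sum>y\<in>verts G. step_probability G q x y) = 1" if "x \<in> verts G" for x
    using sum_step[of q x "\<lambda>_. 1"] q_sum[OF that] by simp
  fix S assume S: "S \<subseteq> verts G" "S \<noteq> {}"
    and closed: "\<And>x y. x \<in> S \<Longrightarrow> y \<in> verts G \<Longrightarrow> 0 < step_probability G q x y \<Longrightarrow> y \<in> S"
  show "S = verts G"
  proof (rule connected_verts[OF S])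
    fix e assume e: "e \<in> arcs G" "tail G e \<in> S"
    have "0 < step_probability G q (tail G e) (head G e)"
      unfolding step_probability_def
    proof (rule sum_pos2[of _ e])
      show "finite {ea \<in> out_arcs G (tail G e). head G ea = head G e}"
        using finite_out_arcs by (rule rev_finite_subset) auto
    qed (use e in \<open>auto intro: q_pos less_imp_le\<close>)
    with e(1) wf show "head G e \<in> S" by (intro closed[OF e(2)]) (simp_all add: wf_digraph_def)
  qed
qed (auto simp: finite_verts verts_nonempty step_nonneg)

lemma sum_arcs: "(\<Sum>e\<in>arcs G. F e) = (\<Sum>x\<in>verts G. \<Sum>e\<in>out_arcs G x. F e)" for F :: "'e \<Rightarrow> 'z::comm_monoid_add"
proof -
  have "(\<Sum>e\<in>arcs G. F e) = (\<Sum>x\<in>verts G. \<Sum>e\<in>{e \<in> arcs G. tail G e = x}. F e)"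
    using wf finite_arcs finite_verts by (intro sum.group[symmetric]) (auto simp: wf_digraph_def)
  then show ?thesis by (simp add: out_arcs_def)
qed

text \<open>Reversal turns the edges into y, over which stationarity sums, into the edges out of y,
  over which \<open>invariant_measure\<close> sums with the weights of the inverse edges.\<close>

lemma stationary_eq:
  assumes y: "y \<in> verts G"
  shows "(\<Sum>x\<in>verts G. m x * step_probability G q x y) = (\<Sum>e\<in>out_arcs G y. q (bar e) * m (head G e))"
proof -
  have "(\<Sum>x\<in>verts G. m x * step_probability G q x y)
      = (\<Sum>x\<in>verts G. \<Sum>e\<in>{e \<in> in_arcs G y. tail G e = x}. q e * m (tail G e))"
    unfolding step_probability_def by (auto simp: sum_distrib_left intro!: sum.cong)
  also have "\<dots> = (\<Sum>e\<in>in_arcs G y. q e * m (tail G e))"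
  proof (rule sum.group)
    show "finite (in_arcs G y)" using finite_arcs by (rule rev_finite_subset) auto
  qed (use wf finite_verts in \<open>auto simp: wf_digraph_def\<close>)
  also have "\<dots> = (\<Sum>e\<in>out_arcs G y. q (bar e) * m (head G e))"
    by (rule sum.reindex_bij_witness[of _ bar bar]) (use inversion in \<open>auto simp: edge_inversion_def\<close>)
  finally show ?thesis .
qed

definition stat :: "'v \<Rightarrow> real" where "stat = invariant_measure G bar q"

text \<open>The definite description in \<open>invariant_measure\<close> is resolved here: a
  positive stationary vector exists, and it is unique among stationary vectors of total mass one.
  Restriction to \<open>verts G\<close> makes it extensional.\<close>

lemma
  shows stat_pos: "x \<in> verts G \<Longrightarrow> 0 < stat x"
    and stat_sum: "(\<Sum>x\<in>verts G. stat x) = 1"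
    and stat_inv: "y \<in> verts G \<Longrightarrow> stat y = (\<Sum>x\<in>verts G. stat x * step_probability G q x y)"
proof -
  obtain m where m: "\<And>x. x \<in> verts G \<Longrightarrow> 0 < m x" "(\<Sum>x\<in>verts G. m x) = 1"
    "\<And>y. y \<in> verts G \<Longrightarrow> m y = (\<Sum>x\<in>verts G. m x * step_probability G q x y)"
    using exists_stationary by blast
  define m' where "m' = restrict m (verts G)"
  have le: "m x \<le> 1" if "x \<in> verts G" for x
    using member_le_sum[of x "verts G" m] that m finite_verts by (auto intro: less_imp_le)
  have m'_eq: "(\<Sum>e\<in>out_arcs G y. q (bar e) * m' (head G e)) = (\<Sum>e\<in>out_arcs G y. q (bar e) * m (head G e))" for y
    using wf by (intro sum.cong) (auto simp: m'_def wf_digraph_def)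
  have "stat = m'"
    unfolding stat_def invariant_measure_def
  proof (rule the_equality)
    show "m' \<in> extensional (verts G) \<and> (\<forall>x\<in>verts G. 0 < m' x \<and> m' x \<le> 1) \<and> (\<Sum>x\<in>verts G. m' x) = 1
        \<and> (\<forall>x\<in>verts G. m' x = (\<Sum>e\<in>out_arcs G x. q (bar e) * m' (head G e)))"
      unfolding m'_eq by (auto simp: m'_def m(1,2) le stationary_eq[symmetric] m(3)[symmetric])
    fix n assume n: "n \<in> extensional (verts G) \<and> (\<forall>x\<in>verts G. 0 < n x \<and> n x \<le> 1) \<and> (\<Sum>x\<in>verts G. n x) = 1
        \<and> (\<forall>x\<in>verts G. n x = (\<Sum>e\<in>out_arcs G x. q (bar e) * n (head G e)))"
    show "n = m'"
    proof (rule extensionalityI[of _ "verts G"])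
      fix x assume "x \<in> verts G"
      then show "n x = m' x"
        using stationary_unique[OF m(1,2) m(3), of n x] n
        by (metis (no_types, lifting) m'_def restrict_apply' stationary_eq)
    qed (use n in \<open>auto simp: m'_def\<close>)
  qed
  then have eq: "\<And>x. x \<in> verts G \<Longrightarrow> stat x = m x" by (simp add: m'_def)
  show "x \<in> verts G \<Longrightarrow> 0 < stat x" by (simp add: eq m(1))
  show "(\<Sum>x\<in>verts G. stat x) = 1" using m(2) by (simp add: eq cong: sum.cong)
  show "y \<in> verts G \<Longrightarrow> stat y = (\<Sum>x\<in>verts G. stat x * step_probability G q x y)"
    using m(3)[of y] by (simp add: eq cong: sum.cong)
qed

lemma edge_measure_eq: "edge_measure G bar q e = q e * stat (tail G e)"
  by (simp add: edge_measure_def stat_def)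

lemma edge_measure_pos: "e \<in> arcs G \<Longrightarrow> 0 < edge_measure G bar q e"
  using wf by (simp add: edge_measure_eq q_pos stat_pos wf_digraph_def)

lemma sum_edge_measure:
  "(\<Sum>e\<in>arcs G. edge_measure G bar q e * F e) = (\<Sum>x\<in>verts G. stat x * (\<Sum>e\<in>out_arcs G x. q e * F e))"
  unfolding sum_arcs by (auto simp: edge_measure_eq sum_distrib_left intro!: sum.cong)

text \<open>Under \<open>stat\<close> one step does not change the mean of f. Dually, the
  homological direction is a cycle, so its pairing with a form sees only the cohomology
  class.\<close>

lemma direction_pairing_exact:
  "(\<Sum>e\<in>arcs G. edge_measure G bar q e * (f (head G e) - f (tail G e))) = 0"
proof -
  have "(\<Sum>e\<in>out_arcs G x. q e * (f (head G e) - f (tail G e)))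
      = (\<Sum>y\<in>verts G. step_probability G q x y * f y) - f x" if "x \<in> verts G" for x
  proof -
    have "(\<Sum>e\<in>out_arcs G x. q e * (f (head G e) - f (tail G e)))
        = (\<Sum>e\<in>out_arcs G x. q e * f (head G e) - q e * f x)" by (intro sum.cong) (auto simp: algebra_simps)
    then show ?thesis by (simp add: sum_step sum_subtractf q_sum[OF that] flip: sum_distrib_right)
  qed
  then have "(\<Sum>e\<in>arcs G. edge_measure G bar q e * (f (head G e) - f (tail G e)))
      = (\<Sum>x\<in>verts G. stat x * (\<Sum>y\<in>verts G. step_probability G q x y * f y)) - (\<Sum>x\<in>verts G. stat x * f x)"
    unfolding sum_edge_measure by (simp add: right_diff_distrib sum_subtractf)
  also have "(\<Sum>x\<in>verts G. stat x * (\<Sum>y\<in>verts G. step_probability G q x y * f y))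
      = (\<Sum>y\<in>verts G. (\<Sum>x\<in>verts G. stat x * step_probability G q x y) * f y)"
    unfolding sum_distrib_left sum_distrib_right by (subst sum.swap) (simp add: mult.assoc)
  also have "\<dots> = (\<Sum>y\<in>verts G. stat y * f y)" by (intro sum.cong) (simp_all only: stat_inv[symmetric])
  finally show ?thesis by simp
qed

lemma graph_poisson:
  "\<exists>g. \<forall>x\<in>verts G. g x - (\<Sum>e\<in>out_arcs G x. q e * g (head G e)) = f x - (\<Sum>y\<in>verts G. stat y * f y)"
  using poisson_equation[OF stat_pos stat_sum stat_inv, of f] unfolding sum_step .

lemma graph_harmonic_constant:
  assumes "\<And>x. x \<in> verts G \<Longrightarrow> (\<Sum>e\<in>out_arcs G x. q e * (f (head G e) - f (tail G e))) = 0"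
  shows "\<exists>c. \<forall>x\<in>verts G. f x = c"
proof (rule harmonic_imp_constant)
  fix x assume x: "x \<in> verts G"
  have "(\<Sum>e\<in>out_arcs G x. q e * (f (head G e) - f (tail G e))) = (\<Sum>e\<in>out_arcs G x. q e * f (head G e) - q e * f x)"
    by (intro sum.cong) (auto simp: algebra_simps)
  then show "f x = (\<Sum>y\<in>verts G. step_probability G q x y * f y)"
    using assms[OF x] by (simp add: sum_step sum_subtractf q_sum[OF x] flip: sum_distrib_right)
qed

text \<open>Zero drift at every vertex already makes the pairing with the homological direction
  vanish, so such a form is modified harmonic. A second representative differs from it by some df;
  the pairing does not see df, so df has zero drift too, and f is constant by the maximum
  principle.\<close>

lemma harmonic_representative_eq:
  assumes \<omega>: "\<omega> \<in> one_forms G bar" and harm: "\<And>x. x \<in> verts G \<Longrightarrow> (\<Sum>e\<in>out_arcs G x. q e * \<omega> e) = 0"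
  shows "harmonic_representative G bar q (cohomology_class G bar \<omega>) = \<omega>" and "direction_pairing G bar q \<omega> = 0"
proof -
  show dir: "direction_pairing G bar q \<omega> = 0"
    unfolding direction_pairing_def sum_edge_measure by (intro sum.neutral) (simp add: harm)
  show "harmonic_representative G bar q (cohomology_class G bar \<omega>) = \<omega>"
    unfolding harmonic_representative_def
  proof (rule the_equality)
    show "\<omega> \<in> cohomology_class G bar \<omega> \<and> modified_harmonic_form G bar q \<omega>"
      using \<omega> by (auto simp: cohomology_class_def modified_harmonic_form_def harm dir intro!: exI[of _ "\<lambda>_. 0"])
    fix \<eta> assume "\<eta> \<in> cohomology_class G bar \<omega> \<and> modified_harmonic_form G bar q \<eta>"
    then obtain f where \<eta>: "\<eta> \<in> one_forms G bar" and f: "\<And>e. e \<in> arcs G \<Longrightarrow> \<eta> e = \<omega> e + (f (head G e) - f (tail G e))"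
      and mh: "modified_harmonic_form G bar q \<eta>" by (auto simp: cohomology_class_def algebra_simps)
    have "direction_pairing G bar q \<eta>
        = direction_pairing G bar q \<omega> + (\<Sum>e\<in>arcs G. edge_measure G bar q e * (f (head G e) - f (tail G e)))"
      unfolding direction_pairing_def sum.distrib[symmetric] by (intro sum.cong) (auto simp: f algebra_simps)
    then have "direction_pairing G bar q \<eta> = 0" by (simp add: dir direction_pairing_exact)
    then have h\<eta>: "(\<Sum>e\<in>out_arcs G x. q e * \<eta> e) = 0" if "x \<in> verts G" for x
      using mh that by (simp add: modified_harmonic_form_def)
    have "(\<Sum>e\<in>out_arcs G x. q e * (f (head G e) - f (tail G e))) = 0" if x: "x \<in> verts G" for x
    proof -
      have "(\<Sum>e\<in>out_arcs G x. q e * (f (head G e) - f (tail G e))) = (\<Sum>e\<in>out_arcs G x. q e * \<eta> e - q e * \<omega> e)"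
        by (intro sum.cong) (auto simp: f algebra_simps)
      then show ?thesis by (simp add: sum_subtractf h\<eta>[OF x] harm[OF x])
    qed
    then obtain c where c: "\<And>x. x \<in> verts G \<Longrightarrow> f x = c" using graph_harmonic_constant by blast
    show "\<eta> = \<omega>"
    proof (rule extensionalityI[of _ "arcs G"])
      show "\<eta> e = \<omega> e" if "e \<in> arcs G" for e
        using f[OF that] c wf that by (simp add: wf_digraph_def)
    qed (use \<eta> \<omega> in \<open>auto simp: one_forms_def\<close>)
  qed
qed

end

section \<open>Pairing of chains with forms\<close>

locale finite_inverse_graph =
  fixes G :: "('v, 'e) pre_digraph" and bar :: "'e \<Rightarrow> 'e"
  assumes wf: "wf_digraph G" and finite_arcs: "finite (arcs G)" and finite_verts: "finite (verts G)"
    and inversion: "edge_inversion G bar"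
begin

lemma bar_arcs: "e \<in> arcs G \<Longrightarrow> bar e \<in> arcs G" and bar_bar: "e \<in> arcs G \<Longrightarrow> bar (bar e) = e"
  using inversion by (auto simp: edge_inversion_def)

lemma chain_class_chains: "chain_class G bar a \<in> chains G bar"
  by (auto simp: chains_def chain_class_def bar_arcs bar_bar)

text \<open>Reversal of the edges maps the second half of the chain class to the first, the two
  signs cancelling; this doubling uses up the factor 1/2 in \<open>chain_pairing\<close>.\<close>

lemma pairing_chain_class:
  assumes \<omega>: "\<And>e. e \<in> arcs G \<Longrightarrow> \<omega> (bar e) = - \<omega> e"
  shows "chain_pairing G (chain_class G bar a) \<omega> = (\<Sum>e\<in>arcs G. a e * \<omega> e)"
proof -
  have swap: "(\<Sum>e\<in>arcs G. a (bar e) * \<omega> e) = (\<Sum>e\<in>arcs G. - (a e * \<omega> e))"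
    by (rule sum.reindex_bij_witness[of _ bar bar]) (auto simp: bar_arcs bar_bar \<omega>)
  have "chain_pairing G (chain_class G bar a) \<omega> = (\<Sum>e\<in>arcs G. (a e * \<omega> e) / 2 - (a (bar e) * \<omega> e) / 2)"
    unfolding chain_pairing_def chain_class_def by (intro sum.cong) (auto simp: field_simps)
  also have "\<dots> = (\<Sum>e\<in>arcs G. a e * \<omega> e) / 2 - (\<Sum>e\<in>arcs G. a (bar e) * \<omega> e) / 2"
    by (simp add: sum_subtractf sum_divide_distrib)
  finally show ?thesis unfolding swap by (simp add: sum_negf)
qed

lemma pairing_walk_chain:
  assumes \<omega>: "\<And>e. e \<in> arcs G \<Longrightarrow> \<omega> (bar e) = - \<omega> e" and c: "set c \<subseteq> arcs G"
  shows "chain_pairing G (walk_chain G bar c) \<omega> = (\<Sum>e\<leftarrow>c. \<omega> e)"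
proof -
  have "(\<Sum>e\<in>arcs G. real (count_list c e) * \<omega> e) = (\<Sum>e\<leftarrow>c. \<omega> e)"
    using c
  proof (induction c)
    case (Cons a c)
    have "(\<Sum>e\<in>arcs G. real (count_list (a # c) e) * \<omega> e)
        = (\<Sum>e\<in>arcs G. (if e = a then \<omega> e else 0) + real (count_list c e) * \<omega> e)"
      by (intro sum.cong) (auto simp: algebra_simps)
    also have "\<dots> = \<omega> a + (\<Sum>e\<leftarrow>c. \<omega> e)"
      using Cons finite_arcs by (simp add: sum.distrib)
    finally show ?case by simp
  qed simp
  then show ?thesis unfolding walk_chain_def using pairing_chain_class[of \<omega>] \<omega> by simp
qed

text \<open>Summation by parts: \<open>boundary\<close> is the adjoint of the differential.\<close>

lemma pairing_exact:
  "chain_pairing G c (\<lambda>e. f (head G e) - f (tail G e)) = (\<Sum>x\<in>verts G. f x * boundary G c x)"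
proof -
  have "(\<Sum>e\<in>arcs G. c e / 2 * f (head G e)) = (\<Sum>x\<in>verts G. \<Sum>e\<in>{e \<in> arcs G. head G e = x}. c e / 2 * f (head G e))"
    using wf finite_arcs finite_verts by (intro sum.group[symmetric]) (auto simp: wf_digraph_def)
  also have "\<dots> = (\<Sum>x\<in>verts G. f x * (\<Sum>e\<in>in_arcs G x. c e / 2))"
    by (auto simp: sum_distrib_left in_arcs_def intro!: sum.cong)
  finally have h: "(\<Sum>e\<in>arcs G. c e / 2 * f (head G e)) = (\<Sum>x\<in>verts G. f x * (\<Sum>e\<in>in_arcs G x. c e / 2))" .
  have "(\<Sum>e\<in>arcs G. c e / 2 * f (tail G e)) = (\<Sum>x\<in>verts G. \<Sum>e\<in>{e \<in> arcs G. tail G e = x}. c e / 2 * f (tail G e))"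
    using wf finite_arcs finite_verts by (intro sum.group[symmetric]) (auto simp: wf_digraph_def)
  also have "\<dots> = (\<Sum>x\<in>verts G. f x * (\<Sum>e\<in>out_arcs G x. c e / 2))"
    by (auto simp: sum_distrib_left out_arcs_def intro!: sum.cong)
  finally have t: "(\<Sum>e\<in>arcs G. c e / 2 * f (tail G e)) = (\<Sum>x\<in>verts G. f x * (\<Sum>e\<in>out_arcs G x. c e / 2))" .
  show ?thesis
    unfolding chain_pairing_def boundary_def right_diff_distrib sum_subtractf h t ..
qed

lemma pairing_exact_homology:
  assumes "c \<in> first_homology G bar"
  shows "chain_pairing G c (\<lambda>e. f (head G e) - f (tail G e)) = 0"
  unfolding pairing_exact using assms by (auto simp: first_homology_def intro!: sum.neutral)

text \<open>Forms separate chains, because pairing with the unit mass at e minus the unit mass at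
  \<open>bar e\<close> evaluates a chain at e. If e is its own inverse, this test form is zero, and
  so is the chain at e by antisymmetry.\<close>

lemma chains_eqI:
  assumes c: "c \<in> chains G bar" "c' \<in> chains G bar"
    and eq: "\<And>\<omega>. (\<And>e. e \<in> arcs G \<Longrightarrow> \<omega> (bar e) = - \<omega> e) \<Longrightarrow> chain_pairing G c \<omega> = chain_pairing G c' \<omega>"
  shows "c = c'"
proof (rule extensionalityI[of _ "arcs G"])
  fix e assume e: "e \<in> arcs G"
  define \<omega> where "\<omega> e' = (if e' = e then 1 else 0) - (if e' = bar e then 1 else 0 :: real)" for e'
  have anti: "\<omega> (bar e') = - \<omega> e'" if "e' \<in> arcs G" for e'
  proof -
    have "bar e' = e \<longleftrightarrow> e' = bar e" "bar e' = bar e \<longleftrightarrow> e' = e" using that e bar_bar by metis+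
    then show ?thesis by (simp add: \<omega>_def)
  qed
  have val: "chain_pairing G b \<omega> = b e" if "b \<in> chains G bar" for b
  proof -
    have "chain_pairing G b \<omega> = (\<Sum>e'\<in>arcs G. (if e' = e then b e' / 2 else 0) - (if e' = bar e then b e' / 2 else 0))"
      unfolding chain_pairing_def \<omega>_def by (intro sum.cong) auto
    also have "\<dots> = b e / 2 - b (bar e) / 2"
      using finite_arcs e bar_arcs[OF e] by (simp add: sum_subtractf)
    finally show ?thesis using that e by (simp add: chains_def)
  qed
  show "c e = c' e" using eq[of \<omega>] anti val c by simp
qed (use c in \<open>auto simp: chains_def\<close>)

lemma boundary_eq_pairing:
  assumes x: "x \<in> verts G"
  shows "boundary G c x = chain_pairing G c (\<lambda>e. of_bool (head G e = x) - of_bool (tail G e = x))"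
proof -
  have "(\<Sum>y\<in>verts G. of_bool (y = x) * boundary G c y) = (\<Sum>y\<in>verts G. if y = x then boundary G c y else 0)"
    by (intro sum.cong) auto
  then show ?thesis using pairing_exact[of c "\<lambda>y. of_bool (y = x)"] x finite_verts by simp
qed

end

section \<open>Realizations of crystal lattices\<close>

lemma (in wf_digraph) sum_awalk_exact:
  fixes f :: "'a \<Rightarrow> 'c::ab_group_add"
  shows "awalk u P v \<Longrightarrow> (\<Sum>e\<leftarrow>P. f (head G e) - f (tail G e)) = f v - f u"
proof (induction P arbitrary: u)
  case (Cons e P)
  then have "tail G e = u" "awalk (head G e) P v"
    by (auto simp: awalk_Cons_iff)
  with Cons.IH show ?case by simp
qed (simp add: awalk_def)

locale realized_crystal =
  fixes X :: "('v, 'e, 'g, 'd::finite) crystal" and \<Phi> :: "'v \<Rightarrow> real ^ 'd"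
  assumes crystal: "crystal_lattice X" and periodic: "periodic_realization X \<Phi>"
begin

abbreviation "G \<equiv> graph X"
abbreviation "bar \<equiv> inv_edge X"
abbreviation "\<Gamma> \<equiv> transl X"
abbreviation "G0 \<equiv> quotient_graph X"
abbreviation "bar0 \<equiv> quotient_inv X"
abbreviation "proj \<equiv> edge_proj X"
abbreviation "H1 \<equiv> first_homology G0 bar0"

definition pv :: "'v \<Rightarrow> 'v set" where "pv x = orbit \<Gamma> (act_vert X) x"

sublocale wf_digraph "graph X" using crystal by (simp add: crystal_lattice_def)
sublocale V: group_action "transl X" "verts (graph X)" "act_vert X" using crystal by (simp add: crystal_lattice_def)
sublocale E: group_action "transl X" "arcs (graph X)" "act_edge X" using crystal by (simp add: crystal_lattice_def)
sublocale group "transl X" using V.group_hom by (simp add: group_hom_def)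

lemma verts_nonempty: "verts G \<noteq> {}"
  using crystal by (auto simp: crystal_lattice_def Digraph_Component.connected_def strongly_connected_def)

lemma bar_arc: "e \<in> arcs G \<Longrightarrow> bar e \<in> arcs G"
  and bar_invol: "e \<in> arcs G \<Longrightarrow> bar (bar e) = e"
  and tail_bar: "e \<in> arcs G \<Longrightarrow> tail G (bar e) = head G e"
  and head_bar: "e \<in> arcs G \<Longrightarrow> head G (bar e) = tail G e"
  using crystal by (auto simp: crystal_lattice_def edge_inversion_def)

lemma act_tail: "\<sigma> \<in> carrier \<Gamma> \<Longrightarrow> e \<in> arcs G \<Longrightarrow> tail G (act_edge X \<sigma> e) = act_vert X \<sigma> (tail G e)"
  and act_head: "\<sigma> \<in> carrier \<Gamma> \<Longrightarrow> e \<in> arcs G \<Longrightarrow> head G (act_edge X \<sigma> e) = act_vert X \<sigma> (head G e)"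
  and act_bar: "\<sigma> \<in> carrier \<Gamma> \<Longrightarrow> e \<in> arcs G \<Longrightarrow> bar (act_edge X \<sigma> e) = act_edge X \<sigma> (bar e)"
  and free: "\<sigma> \<in> carrier \<Gamma> \<Longrightarrow> x \<in> verts G \<Longrightarrow> act_vert X \<sigma> x = x \<Longrightarrow> \<sigma> = \<one>\<^bsub>\<Gamma>\<^esub>"
  using crystal by (auto simp: crystal_lattice_def)

lemma act_vert_in: "\<sigma> \<in> carrier \<Gamma> \<Longrightarrow> x \<in> verts G \<Longrightarrow> act_vert X \<sigma> x \<in> verts G"
  using V.element_image by blast

lemma act_edge_in: "\<sigma> \<in> carrier \<Gamma> \<Longrightarrow> e \<in> arcs G \<Longrightarrow> act_edge X \<sigma> e \<in> arcs G"
  using E.element_image by blast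

lemma pv_act: "\<sigma> \<in> carrier \<Gamma> \<Longrightarrow> x \<in> verts G \<Longrightarrow> pv (act_vert X \<sigma> x) = pv x"
  using V.disjoint_union[of "pv (act_vert X \<sigma> x)" "pv x"] V.orbit_refl[of "act_vert X \<sigma> x"] act_vert_in[of \<sigma> x]
  by (auto simp: pv_def orbits_def orbit_def)

lemma proj_act: "\<sigma> \<in> carrier \<Gamma> \<Longrightarrow> e \<in> arcs G \<Longrightarrow> proj (act_edge X \<sigma> e) = proj e"
  using E.disjoint_union[of "proj (act_edge X \<sigma> e)" "proj e"] E.orbit_refl[of "act_edge X \<sigma> e"] act_edge_in[of \<sigma> e]
  by (auto simp: edge_proj_def orbits_def orbit_def)

lemma pv_eqD: "pv x = pv y \<Longrightarrow> x \<in> verts G \<Longrightarrow> y \<in> verts G \<Longrightarrow> \<exists>\<sigma>\<in>carrier \<Gamma>. y = act_vert X \<sigma> x"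
  using V.orbit_refl[of y] by (auto simp: pv_def orbit_def)

lemma proj_eqD: "proj e = proj e' \<Longrightarrow> e' \<in> arcs G \<Longrightarrow> \<exists>\<sigma>\<in>carrier \<Gamma>. e' = act_edge X \<sigma> e"
  using E.orbit_refl[of e'] by (auto simp: edge_proj_def orbit_def)

lemma verts0: "verts G0 = pv ` verts G"
  by (auto simp: quotient_graph_def orbits_def pv_def)

lemma arcs0: "arcs G0 = proj ` arcs G"
  by (auto simp: quotient_graph_def orbits_def edge_proj_def)

lemma tail0: "e \<in> arcs G \<Longrightarrow> tail G0 (proj e) = pv (tail G e)"
  by (auto simp: quotient_graph_def edge_proj_def pv_def orbit_def image_def act_tail intro!: Collect_cong)

lemma head0: "e \<in> arcs G \<Longrightarrow> head G0 (proj e) = pv (head G e)"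
  by (auto simp: quotient_graph_def edge_proj_def pv_def orbit_def image_def act_head intro!: Collect_cong)

lemma bar0: "e \<in> arcs G \<Longrightarrow> bar0 (proj e) = proj (bar e)"
  by (auto simp: quotient_inv_def edge_proj_def pv_def orbit_def image_def act_bar intro!: Collect_cong)

lemma lift_arc: "A \<in> arcs G0 \<Longrightarrow> edge_lift A \<in> arcs G" and proj_lift: "A \<in> arcs G0 \<Longrightarrow> proj (edge_lift A) = A"
proof -
  assume "A \<in> arcs G0"
  then obtain e where e: "e \<in> arcs G" "A = proj e" by (auto simp: arcs0)
  have "edge_lift A \<in> A" unfolding edge_lift_def e(2) edge_proj_def using E.orbit_refl[OF e(1)] by (rule someI)
  then obtain \<sigma> where \<sigma>: "\<sigma> \<in> carrier \<Gamma>" "edge_lift A = act_edge X \<sigma> e" by (auto simp: e edge_proj_def orbit_def)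
  then show "edge_lift A \<in> arcs G" "proj (edge_lift A) = A" using e by (simp_all add: act_edge_in proj_act)
qed

text \<open>The covering property. A group element that maps one edge at x to another fixes x and is
  the identity by freeness, whence injectivity; translating any lift so that it starts at x gives
  surjectivity.\<close>

lemma bij_betw_proj:
  assumes x: "x \<in> verts G"
  shows "bij_betw proj (out_arcs G x) (out_arcs G0 (pv x))"
proof (rule bij_betw_imageI)
  show "inj_on proj (out_arcs G x)"
  proof (rule inj_onI)
    fix e e' assume e: "e \<in> out_arcs G x" "e' \<in> out_arcs G x" "proj e = proj e'"
    then obtain \<sigma> where \<sigma>: "\<sigma> \<in> carrier \<Gamma>" "e' = act_edge X \<sigma> e" using proj_eqD[of e e'] by auto
    then have "act_vert X \<sigma> x = x" using e act_tail[of \<sigma> e] by auto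
    then have "\<sigma> = \<one>\<^bsub>\<Gamma>\<^esub>" using free \<sigma> x by blast
    then show "e = e'" using \<sigma> e(1) E.id_eq_one by (metis in_out_arcs_conv restrict_apply')
  qed
  show "proj ` out_arcs G x = out_arcs G0 (pv x)"
  proof (intro equalityI subsetI)
    fix A assume "A \<in> out_arcs G0 (pv x)"
    then obtain e where e: "e \<in> arcs G" "A = proj e" "pv (tail G e) = pv x" by (auto simp: arcs0 tail0)
    then obtain \<sigma> where \<sigma>: "\<sigma> \<in> carrier \<Gamma>" "x = act_vert X \<sigma> (tail G e)" using pv_eqD[OF e(3)] x by auto
    have "act_edge X \<sigma> e \<in> out_arcs G x" using \<sigma> e by (simp add: act_edge_in act_tail)
    moreover have "A = proj (act_edge X \<sigma> e)" using \<sigma> e by (simp add: proj_act)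
    ultimately show "A \<in> proj ` out_arcs G x" by blast
  qed (auto simp: arcs0 tail0)
qed

lemma sum_out_arcs_proj:
  "x \<in> verts G \<Longrightarrow> (\<Sum>e\<in>out_arcs G x. F (proj e)) = (\<Sum>A\<in>out_arcs G0 (pv x). F A)"
  by (rule sum.reindex_bij_betw[OF bij_betw_proj])

text \<open>Connectedness is defined through the symmetrised graph; inverse edges make the graph
  itself symmetric, so undirected connections are walks.\<close>

lemma walk_exists:
  assumes "x \<in> verts G" "y \<in> verts G"
  shows "\<exists>P. awalk x P y"
proof -
  have "arcs_ends G = (arcs_ends G)\<inverse>"
  proof -
    have "(head G e, tail G e) \<in> arcs_ends G" if "e \<in> arcs G" for e
      using bar_arc[OF that] tail_bar[OF that] head_bar[OF that] unfolding arcs_ends_def arc_to_ends_def by force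
    then show ?thesis by (auto simp: arcs_ends_def arc_to_ends_def)
  qed
  then have "symmetric G" by (simp add: symmetric_def sym_conv_converse_eq)
  moreover have "x \<rightarrow>\<^sup>*\<^bsub>mk_symmetric G\<^esub> y"
    using crystal assms by (auto simp: crystal_lattice_def Digraph_Component.connected_def strongly_connected_def)
  ultimately show ?thesis using reachable_mk_symmetric_eq reachable_awalk by blast
qed

lemma awalk_act:
  assumes \<sigma>: "\<sigma> \<in> carrier \<Gamma>"
  shows "awalk u P v \<Longrightarrow> awalk (act_vert X \<sigma> u) (map (act_edge X \<sigma>) P) (act_vert X \<sigma> v)"
proof (induction P arbitrary: u)
  case (Cons e P)
  then show ?case using \<sigma> by (auto simp: awalk_Cons_iff act_tail act_head act_edge_in)
qed (simp add: awalk_Nil_iff act_vert_in \<sigma>)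

lemma awalk_rev: "awalk u P v \<Longrightarrow> awalk v (rev (map bar P)) u"
proof (induction P arbitrary: u)
  case (Cons e P)
  then have e: "e \<in> arcs G" "tail G e = u" and "awalk v (rev (map bar P)) (head G e)"
    by (auto simp: awalk_Cons_iff)
  moreover have "awalk (head G e) [bar e] u"
    using e by (auto simp: awalk_Cons_iff awalk_Nil_iff bar_arc tail_bar head_bar)
  ultimately show ?case by simp
qed (simp add: awalk_Nil_iff)

lemma quotient_inverse_graph: "finite_inverse_graph G0 bar0"
proof (rule finite_inverse_graph.intro)
  show "wf_digraph G0" by (auto simp: wf_digraph_def arcs0 verts0 tail0 head0)
  show "finite (arcs G0)" "finite (verts G0)"
    using crystal by (auto simp: crystal_lattice_def quotient_graph_def)
  show "edge_inversion G0 bar0"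
    by (auto simp: edge_inversion_def arcs0 bar0 bar_arc bar_invol tail0 head0 tail_bar head_bar)
qed

sublocale G0: finite_inverse_graph "quotient_graph X" "quotient_inv X" by (rule quotient_inverse_graph)

section \<open>The vector-valued form of a realization and lifted loops\<close>

definition D :: "'e set \<Rightarrow> real ^ 'd" where "D A = edge_diff X \<Phi> (edge_lift A)"

lemma \<Phi>_act: "\<sigma> \<in> carrier \<Gamma> \<Longrightarrow> x \<in> verts G \<Longrightarrow> \<Phi> (act_vert X \<sigma> x) = \<Phi> x + tensor_one X \<sigma>"
  using periodic by (auto simp: periodic_realization_def)

lemma edge_diff_act: "\<sigma> \<in> carrier \<Gamma> \<Longrightarrow> e \<in> arcs G \<Longrightarrow> edge_diff X \<Phi> (act_edge X \<sigma> e) = edge_diff X \<Phi> e"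
  by (simp add: edge_diff_def act_tail act_head \<Phi>_act)

text \<open>Two lifts of an edge differ by a translation, which shifts both end points by the same
  vector.\<close>

lemma D_proj: "e \<in> arcs G \<Longrightarrow> D (proj e) = \<Phi> (head G e) - \<Phi> (tail G e)"
proof -
  assume e: "e \<in> arcs G"
  then have "proj e \<in> arcs G0" by (auto simp: arcs0)
  then obtain \<sigma> where "\<sigma> \<in> carrier \<Gamma>" "edge_lift (proj e) = act_edge X \<sigma> e"
    using proj_eqD[of e "edge_lift (proj e)"] lift_arc proj_lift by metis
  then show ?thesis using e by (simp add: D_def edge_diff_act) (simp add: edge_diff_def)
qed

lemma D_bar: "A \<in> arcs G0 \<Longrightarrow> D (bar0 A) = - D A"
  by (auto simp: arcs0 bar0 D_proj bar_arc tail_bar head_bar)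

lemma sum_D_walk:
  assumes "awalk u P v"
  shows "(\<Sum>e\<leftarrow>P. D (proj e)) = \<Phi> v - \<Phi> u"
proof -
  have "set P \<subseteq> arcs G" using assms by (simp add: awalk_def)
  then have "map (\<lambda>e. D (proj e)) P = map (\<lambda>e. \<Phi> (head G e) - \<Phi> (tail G e)) P" by (auto simp: D_proj)
  then show ?thesis using sum_awalk_exact[OF assms, of \<Phi>] by (simp only:)
qed

text \<open>\<open>L\<close> closes up the edge \<open>A\<close> by the paths \<open>P x\<close> from the base point \<open>x0\<close> to a
  representative of each vertex \<open>x\<close> of the quotient.\<close>

definition closes_up :: "'v \<Rightarrow> ('v set \<Rightarrow> 'e list) \<Rightarrow> 'e set \<Rightarrow> 'g \<Rightarrow> 'e list \<Rightarrow> bool" where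
  "closes_up x0 P A \<sigma> L \<longleftrightarrow> \<sigma> \<in> carrier \<Gamma> \<and> awalk x0 L (act_vert X \<sigma> x0)
    \<and> (\<forall>\<omega> :: 'e set \<Rightarrow> real. (\<forall>B\<in>arcs G0. \<omega> (bar0 B) = - \<omega> B) \<longrightarrow>
        (\<Sum>e\<leftarrow>L. \<omega> (proj e)) = \<omega> A - ((\<Sum>e\<leftarrow>P (head G0 A). \<omega> (proj e)) - (\<Sum>e\<leftarrow>P (tail G0 A). \<omega> (proj e))))"

text \<open>The loop goes from x0 to a representative y of the tail, crosses the lift of A at y, and
  returns. The head of that lift is a translate of the chosen representative z of the head of A by
  some \<sigma>, so the way back is the path to z, translated by \<sigma> and reversed, and it ends
  at the translate of x0. Reversal changes the sign of an antisymmetric form, and translation is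
  invisible in the quotient.\<close>

lemma loops_exist:
  assumes x0: "x0 \<in> verts G"
  shows "\<exists>P. \<forall>A\<in>arcs G0. \<exists>\<sigma> L. closes_up x0 P A \<sigma> L"
proof -
  have "\<forall>x\<in>verts G0. \<exists>P. \<exists>y\<in>verts G. pv y = x \<and> awalk x0 P y"
    using walk_exists[OF x0] by (auto simp: verts0) blast
  then obtain P where P: "\<forall>x\<in>verts G0. \<exists>y\<in>verts G. pv y = x \<and> awalk x0 (P x) y" by metis
  have "\<exists>\<sigma> L. closes_up x0 P A \<sigma> L" if A: "A \<in> arcs G0" for A
  proof -
    have "tail G0 A \<in> verts G0" "head G0 A \<in> verts G0"
      using A G0.wf by (auto simp: wf_digraph_def)
    then obtain y z where y: "y \<in> verts G" "pv y = tail G0 A" "awalk x0 (P (tail G0 A)) y"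
      and z: "z \<in> verts G" "pv z = head G0 A" "awalk x0 (P (head G0 A)) z" using P by meson
    have "A \<in> proj ` out_arcs G y" using A y bij_betw_imp_surj_on[OF bij_betw_proj[OF y(1)]] by simp
    then obtain e where e: "e \<in> out_arcs G y" "A = proj e" by blast
    have "pv (head G e) = pv z" using e z by (auto simp: head0)
    then obtain \<sigma> where \<sigma>: "\<sigma> \<in> carrier \<Gamma>" "head G e = act_vert X \<sigma> z"
      using pv_eqD[of z "head G e"] z e by auto
    define R where "R = rev (map (\<lambda>e. bar (act_edge X \<sigma> e)) (P (head G0 A)))"
    have R: "awalk (head G e) R (act_vert X \<sigma> x0)"
      using awalk_rev[OF awalk_act[OF \<sigma>(1) z(3)]] by (simp add: R_def \<sigma> o_def)
    have "awalk y ([e] @ R) (act_vert X \<sigma> x0)" using e R by (auto simp: awalk_Cons_iff)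
    with y(3) have L: "awalk x0 (P (tail G0 A) @ [e] @ R) (act_vert X \<sigma> x0)"
      by (rule awalk_appendI)
    have "(\<Sum>e\<leftarrow>P (tail G0 A) @ [e] @ R. \<omega> (proj e))
        = \<omega> A - ((\<Sum>e\<leftarrow>P (head G0 A). \<omega> (proj e)) - (\<Sum>e\<leftarrow>P (tail G0 A). \<omega> (proj e)))"
      if \<omega>: "\<forall>B\<in>arcs G0. \<omega> (bar0 B) = - \<omega> B" for \<omega> :: "'e set \<Rightarrow> real"
    proof -
      have "\<omega> (proj (bar (act_edge X \<sigma> e'))) = - \<omega> (proj e')" if "e' \<in> arcs G" for e'
        using \<omega> that bar0[of "act_edge X \<sigma> e'", symmetric] \<sigma>(1) by (simp add: act_edge_in proj_act arcs0)
      moreover have "set (P (head G0 A)) \<subseteq> arcs G" using z(3) by (simp add: awalk_def)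
      ultimately have "map (\<lambda>e. \<omega> (proj (bar (act_edge X \<sigma> e)))) (P (head G0 A)) = map (\<lambda>e. - \<omega> (proj e)) (P (head G0 A))"
        by auto
      moreover have "(\<Sum>e\<leftarrow>R. \<omega> (proj e)) = (\<Sum>e\<leftarrow>P (head G0 A). \<omega> (proj (bar (act_edge X \<sigma> e))))"
        unfolding R_def rev_map[symmetric] by (simp add: sum_list_rev o_def rev_map[symmetric])
      ultimately have "(\<Sum>e\<leftarrow>R. \<omega> (proj e)) = - (\<Sum>e\<leftarrow>P (head G0 A). \<omega> (proj e))"
        by (simp only: uminus_sum_list_map o_def)
      then show ?thesis by (simp add: e(2))
    qed
    with L \<sigma>(1) show ?thesis unfolding closes_up_def by blast
  qed
  then show ?thesis by blast
qed

section \<open>Computation of the map induced by the covering\<close>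

text \<open>The period of the vector-valued form \<open>D\<close> along a chain;
  \<open>rho_eq\<close> shows that on cycles it is the map induced by the covering.\<close>

definition pairing_vec :: "('e set \<Rightarrow> real) \<Rightarrow> real ^ 'd" where
  "pairing_vec c = (\<Sum>A\<in>arcs G0. (c A / 2) *\<^sub>R D A)"

lemma pairing_vec_inner: "u \<bullet> pairing_vec c = chain_pairing G0 c (\<lambda>A. u \<bullet> D A)"
  by (simp add: pairing_vec_def chain_pairing_def inner_sum_right)

lemma set_walk: "awalk u P v \<Longrightarrow> set (map proj P) \<subseteq> arcs G0"
  by (auto simp: awalk_def arcs0)

lemma pairing_walk:
  assumes "awalk u P v" "\<And>B. B \<in> arcs G0 \<Longrightarrow> \<omega> (bar0 B) = - \<omega> B"
  shows "chain_pairing G0 (walk_chain G0 bar0 (map proj P)) \<omega> = (\<Sum>e\<leftarrow>P. \<omega> (proj e))"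
  using G0.pairing_walk_chain[of \<omega> "map proj P"] assms(2) set_walk[OF assms(1)] by (simp add: o_def)

text \<open>The boundary at z is the pairing with the differential of the indicator of z, so along a
  walk it telescopes to the two end points, which here lie in one orbit.\<close>

lemma walk_chain_homology:
  assumes L: "awalk x L (act_vert X \<sigma> x)" and \<sigma>: "\<sigma> \<in> carrier \<Gamma>" and x: "x \<in> verts G"
  shows "walk_chain G0 bar0 (map proj L) \<in> H1"
proof -
  have "boundary G0 (walk_chain G0 bar0 (map proj L)) z = 0" if z: "z \<in> verts G0" for z
  proof -
    let ?\<omega> = "\<lambda>A. of_bool (head G0 A = z) - of_bool (tail G0 A = z) :: real"
    have "boundary G0 (walk_chain G0 bar0 (map proj L)) z = (\<Sum>e\<leftarrow>L. ?\<omega> (proj e))"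
      unfolding G0.boundary_eq_pairing[OF z]
      by (rule pairing_walk[OF L]) (use G0.inversion in \<open>simp add: edge_inversion_def\<close>)
    also have "map (\<lambda>e. ?\<omega> (proj e)) L = map (\<lambda>e. of_bool (pv (head G e) = z) - of_bool (pv (tail G e) = z)) L"
    proof (rule map_cong[OF refl])
      fix e assume "e \<in> set L"
      then have "e \<in> arcs G" using L by (auto simp: awalk_def)
      then show "?\<omega> (proj e) = of_bool (pv (head G e) = z) - of_bool (pv (tail G e) = z)"
        by (simp only: head0 tail0)
    qed
    also have "sum_list \<dots> = of_bool (pv (act_vert X \<sigma> x) = z) - of_bool (pv x = z)"
      by (rule sum_awalk_exact[OF L])
    finally show ?thesis by (simp add: pv_act[OF \<sigma> x])
  qed
  then show ?thesis by (simp add: first_homology_def walk_chain_def G0.chain_class_chains)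
qed

lemma homology_combination:
  assumes "c \<in> H1" "c' \<in> H1"
  shows "(\<lambda>A\<in>arcs G0. a * c A + b * c' A) \<in> H1"
proof -
  have "boundary G0 (\<lambda>A\<in>arcs G0. a * c A + b * c' A) z = a * boundary G0 c z + b * boundary G0 c' z" for z
    by (simp add: boundary_def sum.distrib sum_distrib_left right_diff_distrib distrib_left add_divide_distrib in_arcs_def out_arcs_def)
  then show ?thesis
    using assms by (auto simp: first_homology_def chains_def G0.bar_arcs algebra_simps)
qed

text \<open>\<open>pairing_vec\<close> satisfies both clauses of the description of
  \<open>rho\<close>, because \<open>D\<close> sums along a lifted loop to the translation vector of
  its end points. Uniqueness rests on expanding each cycle in classes of lifted loops, where the
  value is prescribed: replacing every edge by its loop from \<open>loops_exist\<close> changes the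
  pairing with a form only by the pairing with an exact form, which vanishes on cycles.\<close>

lemma rho_eq:
  assumes "c \<in> H1"
  shows "rho X c = pairing_vec c"
proof -
  obtain x0 where x0: "x0 \<in> verts G" using verts_nonempty by blast
  obtain P where "\<forall>A\<in>arcs G0. \<exists>\<sigma> L. closes_up x0 P A \<sigma> L" using loops_exist[OF x0] by blast
  then obtain \<sigma> L where PL: "\<And>A. A \<in> arcs G0 \<Longrightarrow> closes_up x0 P A (\<sigma> A) (L A)" by metis
  note \<sigma> = PL[unfolded closes_up_def, THEN conjunct1]
    and L = PL[unfolded closes_up_def, THEN conjunct2, THEN conjunct1]
    and loop = PL[unfolded closes_up_def, THEN conjunct2, THEN conjunct2, rule_format]
  define l where "l A = walk_chain G0 bar0 (map proj (L A))" for A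
  have lH: "l A \<in> H1" if "A \<in> arcs G0" for A
    unfolding l_def by (rule walk_chain_homology[OF L[OF that] \<sigma>[OF that] x0])
  let ?Q = "\<lambda>r. r \<in> extensional H1
        \<and> (\<forall>c\<in>H1. \<forall>c'\<in>H1. \<forall>a b. r (\<lambda>e\<in>arcs G0. a * c e + b * c' e) = a *\<^sub>R r c + b *\<^sub>R r c')
        \<and> (\<forall>x\<in>verts G. \<forall>\<sigma>\<in>carrier \<Gamma>. \<forall>P. awalk x P (act_vert X \<sigma> x) \<longrightarrow>
              r (walk_chain G0 bar0 (map proj P)) = tensor_one X \<sigma>)"
  have exp: "c = (\<lambda>e\<in>arcs G0. \<Sum>A\<in>arcs G0. c A / 2 * l A e)" if c: "c \<in> H1" for c
  proof (rule G0.chains_eqI)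
    show "c \<in> chains G0 bar0" using c by (simp add: first_homology_def)
    show "(\<lambda>e\<in>arcs G0. \<Sum>A\<in>arcs G0. c A / 2 * l A e) \<in> chains G0 bar0"
      using lH by (auto simp: chains_def first_homology_def G0.bar_arcs simp flip: sum_negf intro!: sum.cong)
    fix \<omega> :: "'e set \<Rightarrow> real" assume \<omega>: "\<And>e. e \<in> arcs G0 \<Longrightarrow> \<omega> (bar0 e) = - \<omega> e"
    define h where "h x = (\<Sum>e\<leftarrow>P x. \<omega> (proj e))" for x
    have "chain_pairing G0 (\<lambda>e\<in>arcs G0. \<Sum>A\<in>arcs G0. c A / 2 * l A e) \<omega>
        = (\<Sum>e\<in>arcs G0. \<Sum>A\<in>arcs G0. c A / 2 * (l A e / 2 * \<omega> e))"
    proof -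
      have "(\<Sum>A\<in>arcs G0. c A / 2 * l A e) / 2 * \<omega> e = (\<Sum>A\<in>arcs G0. c A / 2 * (l A e / 2 * \<omega> e))" for e
        unfolding sum_divide_distrib sum_distrib_right by (intro sum.cong) auto
      then show ?thesis unfolding chain_pairing_def by (intro sum.cong) (simp_all only: restrict_apply')
    qed
    also have "\<dots> = (\<Sum>A\<in>arcs G0. c A / 2 * chain_pairing G0 (l A) \<omega>)"
      by (subst sum.swap) (simp add: chain_pairing_def sum_distrib_left)
    also have "\<dots> = (\<Sum>A\<in>arcs G0. c A / 2 * (\<omega> A - (h (head G0 A) - h (tail G0 A))))"
    proof (intro sum.cong refl)
      fix A assume A: "A \<in> arcs G0"
      have "chain_pairing G0 (l A) \<omega> = (\<Sum>e\<leftarrow>L A. \<omega> (proj e))"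
        unfolding l_def by (rule pairing_walk[OF L[OF A]]) (rule \<omega>)
      also have "\<dots> = \<omega> A - (h (head G0 A) - h (tail G0 A))" unfolding h_def by (rule loop[OF A]) (rule \<omega>)
      finally show "c A / 2 * chain_pairing G0 (l A) \<omega> = c A / 2 * (\<omega> A - (h (head G0 A) - h (tail G0 A)))" by simp
    qed
    also have "\<dots> = chain_pairing G0 c \<omega> - chain_pairing G0 c (\<lambda>e. h (head G0 e) - h (tail G0 e))"
      unfolding chain_pairing_def sum_subtractf[symmetric] by (intro sum.cong) (auto simp: algebra_simps)
    finally show "chain_pairing G0 c \<omega> = chain_pairing G0 (\<lambda>e\<in>arcs G0. \<Sum>A\<in>arcs G0. c A / 2 * l A e) \<omega>"
      using G0.pairing_exact_homology[OF c] by simp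
  qed
  have walk: "pairing_vec (walk_chain G0 bar0 (map proj Q)) = tensor_one X \<tau>"
    if "awalk x Q (act_vert X \<tau> x)" "\<tau> \<in> carrier \<Gamma>" "x \<in> verts G" for x Q \<tau>
  proof (rule vector_eq_ldot[THEN iffD1], intro allI)
    fix u :: "real ^ 'd"
    have "u \<bullet> pairing_vec (walk_chain G0 bar0 (map proj Q)) = (\<Sum>e\<leftarrow>Q. u \<bullet> D (proj e))"
      unfolding pairing_vec_inner by (rule pairing_walk[OF that(1)]) (simp add: D_bar)
    also have "\<dots> = u \<bullet> (\<Sum>e\<leftarrow>Q. D (proj e))" by (induction Q) (auto simp: inner_right_distrib)
    finally show "u \<bullet> pairing_vec (walk_chain G0 bar0 (map proj Q)) = u \<bullet> tensor_one X \<tau>"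
      using \<Phi>_act that by (simp add: sum_D_walk[OF that(1)])
  qed
  have uniq: "r c = pairing_vec c" if r: "?Q r" and c: "c \<in> H1" for r c
  proof -
    \<comment> \<open>Linearity of r is available only for combinations of two cycles; its value at
      zero starts the induction that sums over all edges.\<close>
    have "r (\<lambda>e\<in>arcs G0. 0 * c e + 0 * c e) = 0 *\<^sub>R r c + 0 *\<^sub>R r c" using r c by blast
    then have r0: "r (\<lambda>e\<in>arcs G0. 0) = 0" by simp
    have z0: "(\<lambda>e\<in>arcs G0. 0) \<in> H1" using homology_combination[OF c c, of 0 0] by simp
    define F where "F S = (\<lambda>e\<in>arcs G0. \<Sum>A\<in>S. c A / 2 * l A e)" for S
    have "F S \<in> H1 \<and> r (F S) = (\<Sum>A\<in>S. (c A / 2) *\<^sub>R r (l A))" if "finite S" "S \<subseteq> arcs G0" for S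
      using that
    proof (induction S)
      case (insert A S)
      then have IH: "F S \<in> H1" "r (F S) = (\<Sum>A\<in>S. (c A / 2) *\<^sub>R r (l A))" and A: "l A \<in> H1" by (auto intro: lH)
      have eq: "F (insert A S) = (\<lambda>e\<in>arcs G0. c A / 2 * l A e + 1 * F S e)"
        using insert.hyps unfolding F_def by (intro restrict_ext) simp
      have "r (\<lambda>e\<in>arcs G0. c A / 2 * l A e + 1 * F S e) = (c A / 2) *\<^sub>R r (l A) + 1 *\<^sub>R r (F S)"
        using r A IH(1) by blast
      then have "r (F (insert A S)) = (\<Sum>A\<in>insert A S. (c A / 2) *\<^sub>R r (l A))"
        unfolding eq IH(2) using insert.hyps by simp
      moreover have "F (insert A S) \<in> H1" unfolding eq by (rule homology_combination[OF A IH(1)])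
      ultimately show ?case by blast
    qed (simp add: F_def r0 z0)
    from this[OF G0.finite_arcs] have "r c = (\<Sum>A\<in>arcs G0. (c A / 2) *\<^sub>R r (l A))"
      using exp[OF c] by (simp add: F_def)
    also have "\<dots> = (\<Sum>A\<in>arcs G0. (c A / 2) *\<^sub>R tensor_one X (\<sigma> A))"
      using r x0 \<sigma> L by (intro sum.cong refl arg_cong2[of _ _ _ _ scaleR]) (simp add: l_def)
    also have "\<dots> = (\<Sum>A\<in>arcs G0. (c A / 2) *\<^sub>R pairing_vec (l A))"
      using walk[OF L \<sigma> x0] by (simp add: l_def)
    also have "\<dots> = pairing_vec (\<lambda>e\<in>arcs G0. \<Sum>A\<in>arcs G0. c A / 2 * l A e)"
    proof -
      have "pairing_vec (\<lambda>e\<in>arcs G0. \<Sum>A\<in>arcs G0. c A / 2 * l A e)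
          = (\<Sum>e\<in>arcs G0. \<Sum>A\<in>arcs G0. (c A / 2) *\<^sub>R ((l A e / 2) *\<^sub>R D e))"
        unfolding pairing_vec_def
        by (intro sum.cong) (auto simp: scaleR_sum_left[symmetric] sum_divide_distrib)
      then show ?thesis by (subst (asm) sum.swap) (simp add: pairing_vec_def scaleR_sum_right)
    qed
    finally show ?thesis using exp[OF c] by simp
  qed
  have ex: "?Q (restrict pairing_vec H1)"
  proof (intro conjI ballI allI impI)
    fix c c' :: "'e set \<Rightarrow> real" and a b :: real assume "c \<in> H1" "c' \<in> H1"
    then show "restrict pairing_vec H1 (\<lambda>e\<in>arcs G0. a * c e + b * c' e)
        = a *\<^sub>R restrict pairing_vec H1 c + b *\<^sub>R restrict pairing_vec H1 c'"
      by (simp add: homology_combination)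
        (simp add: pairing_vec_def scaleR_sum_right add_divide_distrib scaleR_left_distrib flip: sum.distrib)
  next
    fix x \<tau> Q assume "x \<in> verts G" "\<tau> \<in> carrier \<Gamma>" "awalk x Q (act_vert X \<tau> x)"
    then show "restrict pairing_vec H1 (walk_chain G0 bar0 (map proj Q)) = tensor_one X \<tau>"
      by (simp add: walk_chain_homology walk)
  qed auto
  have "rho X = restrict pairing_vec H1"
    unfolding rho_def Let_def
  proof (rule the_equality)
    show "?Q (restrict pairing_vec H1)" by (rule ex)
    fix r assume r: "?Q r"
    show "r = restrict pairing_vec H1"
      using r uniq[OF r] by (intro extensionalityI[of _ H1]) auto
  qed
  then show ?thesis using assms by simp
qed

end

section \<open>The transpose map into cohomology and its injectivity\<close>

context realized_crystal
begin

definition form :: "((real ^ 'd) \<Rightarrow>\<^sub>L real) \<Rightarrow> 'e set \<Rightarrow> real" where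
  "form l = (\<lambda>A\<in>arcs G0. blinfun_apply l (D A))"

lemma form_one_forms: "form l \<in> one_forms G0 bar0"
  by (auto simp: one_forms_def form_def G0.bar_arcs D_bar blinfun.minus_right)

lemma pairing_form: "chain_pairing G0 c (form l) = blinfun_apply l (pairing_vec c)"
  by (simp add: chain_pairing_def form_def pairing_vec_def blinfun.sum_right blinfun.scaleR_right cong: sum.cong)

text \<open>The composition of l with \<open>D\<close> has the right periods by
  \<open>rho_eq\<close>. For uniqueness, a form \<theta> whose pairing with all cycles is zero must
  be exact: its primitive h at x is the sum of \<theta> along the chosen path to x, and the loops of
  \<open>loops_exist\<close> then express \<theta> as dh.\<close>

lemma transpose_rho_eq: "transpose_rho X l = cohomology_class G0 bar0 (form l)"
  unfolding transpose_rho_def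
proof (rule the_equality, intro conjI ballI)
  show "cohomology_class G0 bar0 (form l) \<in> first_cohomology G0 bar0"
    using form_one_forms by (auto simp: first_cohomology_def)
  fix \<omega> c assume "\<omega> \<in> cohomology_class G0 bar0 (form l)" and c: "c \<in> H1"
  then obtain f where f: "\<And>e. e \<in> arcs G0 \<Longrightarrow> \<omega> e = form l e + (f (head G0 e) - f (tail G0 e))"
    by (auto simp: cohomology_class_def algebra_simps)
  have "chain_pairing G0 c \<omega> = chain_pairing G0 c (form l) + chain_pairing G0 c (\<lambda>e. f (head G0 e) - f (tail G0 e))"
    unfolding chain_pairing_def sum.distrib[symmetric] by (intro sum.cong) (auto simp: f algebra_simps)
  then show "chain_pairing G0 c \<omega> = blinfun_apply l (rho X c)"
    by (simp add: G0.pairing_exact_homology[OF c] pairing_form rho_eq[OF c])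
next
  fix C assume C: "C \<in> first_cohomology G0 bar0 \<and>
    (\<forall>\<omega>\<in>C. \<forall>c\<in>H1. chain_pairing G0 c \<omega> = blinfun_apply l (rho X c))"
  then obtain \<eta> where \<eta>: "\<eta> \<in> one_forms G0 bar0" "C = cohomology_class G0 bar0 \<eta>"
    by (auto simp: first_cohomology_def)
  then have "\<eta> \<in> C" by (auto simp: cohomology_class_def intro!: exI[of _ "\<lambda>_. 0"])
  define \<theta> where "\<theta> A = \<eta> A - form l A" for A
  have \<theta>: "\<theta> (bar0 B) = - \<theta> B" if "B \<in> arcs G0" for B
    using \<eta>(1) form_one_forms[of l] that by (simp add: \<theta>_def one_forms_def)
  have zero: "chain_pairing G0 c \<theta> = 0" if "c \<in> H1" for c
  proof -
    have "chain_pairing G0 c \<theta> = chain_pairing G0 c \<eta> - chain_pairing G0 c (form l)"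
      by (simp add: chain_pairing_def \<theta>_def right_diff_distrib sum_subtractf)
    then show ?thesis using C \<open>\<eta> \<in> C\<close> that by (simp add: pairing_form rho_eq[OF that])
  qed
  obtain x0 where x0: "x0 \<in> verts G" using verts_nonempty by blast
  obtain P where P: "\<forall>A\<in>arcs G0. \<exists>\<sigma> L. closes_up x0 P A \<sigma> L" using loops_exist[OF x0] by blast
  define h where "h x = (\<Sum>e\<leftarrow>P x. \<theta> (proj e))" for x
  have h: "\<theta> A = h (head G0 A) - h (tail G0 A)" if A: "A \<in> arcs G0" for A
  proof -
    obtain \<sigma> L where \<sigma>: "\<sigma> \<in> carrier \<Gamma>" and L: "awalk x0 L (act_vert X \<sigma> x0)"
      and sum: "(\<Sum>e\<leftarrow>L. \<theta> (proj e)) = \<theta> A - (h (head G0 A) - h (tail G0 A))"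
      using P A \<theta> unfolding closes_up_def h_def by meson
    have "(\<Sum>e\<leftarrow>L. \<theta> (proj e)) = chain_pairing G0 (walk_chain G0 bar0 (map proj L)) \<theta>"
      using pairing_walk[OF L, of \<theta>] \<theta> by simp
    also have "\<dots> = 0" by (rule zero[OF walk_chain_homology[OF L \<sigma> x0]])
    finally show ?thesis using sum by simp
  qed
  show "C = cohomology_class G0 bar0 (form l)"
  proof (intro equalityI subsetI)
    fix \<omega> assume "\<omega> \<in> C"
    then obtain f where \<omega>: "\<omega> \<in> one_forms G0 bar0"
      and f: "\<And>e. e \<in> arcs G0 \<Longrightarrow> \<omega> e - \<eta> e = f (head G0 e) - f (tail G0 e)"
      by (auto simp: \<eta>(2) cohomology_class_def)
    have "\<omega> e - form l e = (f (head G0 e) + h (head G0 e)) - (f (tail G0 e) + h (tail G0 e))" if "e \<in> arcs G0" for e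
      using f[OF that] h[OF that] unfolding \<theta>_def by linarith
    with \<omega> show "\<omega> \<in> cohomology_class G0 bar0 (form l)"
      unfolding cohomology_class_def by (intro CollectI conjI exI[of _ "\<lambda>x. f x + h x"] ballI)
  next
    fix \<omega> assume "\<omega> \<in> cohomology_class G0 bar0 (form l)"
    then obtain f where \<omega>: "\<omega> \<in> one_forms G0 bar0"
      and f: "\<And>e. e \<in> arcs G0 \<Longrightarrow> \<omega> e - form l e = f (head G0 e) - f (tail G0 e)"
      by (auto simp: cohomology_class_def)
    have "\<omega> e - \<eta> e = (f (head G0 e) - h (head G0 e)) - (f (tail G0 e) - h (tail G0 e))" if "e \<in> arcs G0" for e
      using f[OF that] h[OF that] unfolding \<theta>_def by linarith
    with \<omega> show "\<omega> \<in> C"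
      unfolding \<eta>(2) cohomology_class_def by (intro CollectI conjI exI[of _ "\<lambda>x. f x - h x"] ballI)
  qed
qed

text \<open>A functional that vanishes on all edges vanishes on the displacement along any walk, in
  particular on all translation vectors and so on the standard basis. The definiteness of
  \<open>Q\<close> comes from here.\<close>

lemma annihilator_trivial:
  assumes "\<And>A. A \<in> arcs G0 \<Longrightarrow> a \<bullet> D A = 0"
  shows "a = 0"
proof -
  obtain x where x: "x \<in> verts G" using verts_nonempty by blast
  have tens: "a \<bullet> tensor_one X \<sigma> = 0" if \<sigma>: "\<sigma> \<in> carrier \<Gamma>" for \<sigma>
  proof -
    obtain L where L: "awalk x L (act_vert X \<sigma> x)" using walk_exists[OF x act_vert_in[OF \<sigma> x]] by blast
    have "a \<bullet> (\<Sum>e\<leftarrow>L. D (proj e)) = (\<Sum>e\<leftarrow>L. a \<bullet> D (proj e))" by (induction L) (auto simp: inner_right_distrib)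
    also have "map (\<lambda>e. a \<bullet> D (proj e)) L = map (\<lambda>_. 0) L"
      using L assms by (auto simp: awalk_def arcs0)
    finally show ?thesis by (simp add: sum_D_walk[OF L] \<Phi>_act[OF \<sigma> x])
  qed
  have "a $ i = 0" for i
  proof -
    have "coords X ` carrier \<Gamma> = UNIV"
      using crystal by (simp add: crystal_lattice_def iso_def bij_betw_def product_group_def)
    then have "(\<lambda>j. if j = i then 1 else 0) \<in> coords X ` carrier \<Gamma>" by simp
    then obtain \<sigma> where \<sigma>: "\<sigma> \<in> carrier \<Gamma>" "(\<lambda>j. if j = i then 1 else 0) = coords X \<sigma>" by (rule imageE)
    have "tensor_one X \<sigma> = axis i 1" unfolding tensor_one_def \<sigma>(2)[symmetric] axis_def
      by (rule arg_cong[where f = vec_lambda]) auto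
    with tens[OF \<sigma>(1)] have "a \<bullet> axis i 1 = 0" by simp
    then show ?thesis unfolding inner_axis by simp
  qed
  then show ?thesis by (simp add: vec_eq_iff)
qed

end

section \<open>Centred transition probabilities and the Albanese metric\<close>

locale centred_crystal = realized_crystal X \<Phi> for X :: "('v, 'e, 'g, 'd::finite) crystal" and \<Phi> +
  fixes q :: "'e set \<Rightarrow> real"
  assumes q_pos: "\<And>A. A \<in> arcs G0 \<Longrightarrow> 0 < q A"
    and q_sum: "\<And>x. x \<in> verts G0 \<Longrightarrow> (\<Sum>A\<in>out_arcs G0 x. q A) = 1"
    and centred: "\<And>x. x \<in> verts G0 \<Longrightarrow> (\<Sum>A\<in>out_arcs G0 x. q A *\<^sub>R D A) = 0"
begin

text \<open>Connectedness passes to the quotient: a set of vertex orbits closed under edges contains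
  the projection of every walk that starts in it.\<close>

lemma quotient_graph_walk: "finite_graph_walk G0 bar0 q"
proof (rule finite_graph_walk.intro)
  show "verts G0 \<noteq> {}"
    using verts_nonempty by (simp add: verts0)
  fix S assume S: "S \<subseteq> verts G0" "S \<noteq> {}" and closed: "\<And>e. e \<in> arcs G0 \<Longrightarrow> tail G0 e \<in> S \<Longrightarrow> head G0 e \<in> S"
  have reach: "pv v \<in> S" if "awalk u P v" "pv u \<in> S" for u P v
    using that
  proof (induction P arbitrary: u)
    case (Cons e P)
    then have "e \<in> arcs G" "tail G e = u" "awalk (head G e) P v" by (auto simp: awalk_Cons_iff)
    then show ?case using Cons.IH[of "head G e"] closed[of "proj e"] Cons.prems by (auto simp: arcs0 tail0 head0)
  qed (simp add: awalk_Nil_iff)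
  obtain x where x: "x \<in> verts G" "pv x \<in> S" using S by (auto simp: verts0)
  have "pv y \<in> S" if "y \<in> verts G" for y
    using walk_exists[OF x(1) that] reach x(2) by blast
  then show "S = verts G0" using S by (auto simp: verts0)
qed (use G0.wf G0.finite_arcs G0.finite_verts G0.inversion q_pos q_sum in auto)

sublocale W: finite_graph_walk "quotient_graph X" "quotient_inv X" q by (rule quotient_graph_walk)

definition em :: "'e set \<Rightarrow> real" where "em = edge_measure G0 bar0 q"

lemma em_pos: "A \<in> arcs G0 \<Longrightarrow> 0 < em A" unfolding em_def by (rule W.edge_measure_pos)

text \<open>Centring makes \<open>form l\<close> harmonic at each vertex, so it is its own modified
  harmonic representative, and the correction by the homological direction drops out of the inner
  product.\<close>

lemma hom_inner_eq:
  "hom_inner X q l l' = (\<Sum>A\<in>arcs G0. em A * blinfun_apply l (D A) * blinfun_apply l' (D A))"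
proof -
  have harm: "(\<Sum>e\<in>out_arcs G0 x. q e * form l e) = 0" if x: "x \<in> verts G0" for x l
  proof -
    have "(\<Sum>e\<in>out_arcs G0 x. q e * form l e) = blinfun_apply l (\<Sum>e\<in>out_arcs G0 x. q e *\<^sub>R D e)"
      unfolding blinfun.sum_right blinfun.scaleR_right form_def by (intro sum.cong) auto
    then show ?thesis by (simp add: centred[OF x] blinfun.zero_right)
  qed
  note h = W.harmonic_representative_eq[OF form_one_forms harm]
  have "hom_inner X q l l' = (\<Sum>A\<in>arcs G0. em A * form l A * form l' A)"
    unfolding hom_inner_def transpose_rho_eq cohomology_inner_def Let_def using h by (simp add: em_def)
  then show ?thesis by (simp add: form_def cong: sum.cong)
qed

text \<open>\<open>S\<close> is the Gram operator of the inner product on \<open>Hom(\<Gamma>, \<real>)\<close>, so that its inverse \<open>R\<close> is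
  that of the dual inner product.\<close>

definition S :: "real ^ 'd \<Rightarrow> real ^ 'd" where "S a = (\<Sum>A\<in>arcs G0. (em A * (a \<bullet> D A)) *\<^sub>R D A)"

definition Q :: "real ^ 'd \<Rightarrow> real" where "Q a = (\<Sum>A\<in>arcs G0. em A * (a \<bullet> D A)\<^sup>2)"

lemma S_inner: "S a \<bullet> b = (\<Sum>A\<in>arcs G0. em A * (a \<bullet> D A) * (b \<bullet> D A))"
  unfolding S_def inner_sum_left by (intro sum.cong) (simp_all add: inner_commute)

lemma Q_eq: "Q a = S a \<bullet> a" by (simp add: S_inner Q_def power2_eq_square mult.assoc)

lemma linear_S: "linear S"
  by (rule linearI) (simp_all add: S_def inner_add_left distrib_left scaleR_left_distrib sum.distrib scaleR_sum_right mult.left_commute)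

lemma Q_nonneg: "0 \<le> Q a" unfolding Q_def by (intro sum_nonneg mult_nonneg_nonneg) (auto intro: less_imp_le em_pos)

lemma Q_pos: "a \<noteq> 0 \<Longrightarrow> 0 < Q a"
proof (rule ccontr)
  assume a: "a \<noteq> 0" and "\<not> 0 < Q a"
  then have "Q a = 0" using Q_nonneg[of a] by simp
  then have "\<forall>A\<in>arcs G0. em A * (a \<bullet> D A)\<^sup>2 = 0"
    unfolding Q_def using G0.finite_arcs em_pos
    by (subst (asm) sum_nonneg_eq_0_iff) (auto intro!: mult_nonneg_nonneg intro: less_imp_le)
  then have "a \<bullet> D A = 0" if "A \<in> arcs G0" for A using em_pos[OF that] that by auto
  then show False using annihilator_trivial a by blast
qed

definition R :: "real ^ 'd \<Rightarrow> real ^ 'd" where "R = inv_into UNIV S"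

lemma inj_S: "inj S"
  unfolding linear_injective_0[OF linear_S] using Q_pos Q_eq by (metis inner_zero_left less_irrefl)

lemma S_R [simp]: "S (R u) = u"
  unfolding R_def by (rule surj_f_inv_f[OF linear_injective_imp_surjective[OF linear_S inj_S]]) simp

lemma linear_R: "linear R"
proof (rule linearI)
  show "R (u + v) = R u + R v" for u v by (rule injD[OF inj_S]) (simp add: linear_add[OF linear_S])
  show "R (c *\<^sub>R u) = c *\<^sub>R R u" for c u by (rule injD[OF inj_S]) (simp add: linear_scale[OF linear_S])
qed

lemma R_nonzero: "u \<noteq> 0 \<Longrightarrow> R u \<noteq> 0"
  using S_R[of u] linear_0[OF linear_S] by metis

text \<open>The inner product of the functional of a vector a with l is l (S a), so the vector
  \<open>R u\<close> represents evaluation at u. A second representing functional differs by some k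
  of norm zero; k vanishes on all \<open>D A\<close>, hence on the range of \<open>S\<close>, which
  is the whole space.\<close>

lemma riesz_eq: "riesz_functional X q u = blinfun_inner_left (R u)"
  unfolding riesz_functional_def
proof (rule the_equality)
  have repr: "(\<Sum>A\<in>arcs G0. em A * (a \<bullet> D A) * blinfun_apply l (D A)) = blinfun_apply l (S a)" for a l
    by (simp add: S_def blinfun.sum_right blinfun.scaleR_right)
  show ex: "\<forall>l'. hom_inner X q (blinfun_inner_left (R u)) l' = blinfun_apply l' u"
    using repr[of "R u"] by (simp add: hom_inner_eq inner_commute)
  fix l assume l: "\<forall>l'. hom_inner X q l l' = blinfun_apply l' u"
  define k where "k = l - blinfun_inner_left (R u)"
  have "(\<Sum>A\<in>arcs G0. em A * (blinfun_apply k (D A))\<^sup>2) = hom_inner X q l k - hom_inner X q (blinfun_inner_left (R u)) k"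
    unfolding hom_inner_eq sum_subtractf[symmetric]
    by (intro sum.cong) (auto simp: k_def blinfun.diff_left power2_eq_square algebra_simps)
  also have "\<dots> = 0" using l ex by simp
  finally have "\<forall>A\<in>arcs G0. em A * (blinfun_apply k (D A))\<^sup>2 = 0"
    using G0.finite_arcs em_pos by (subst (asm) sum_nonneg_eq_0_iff) (auto intro!: mult_nonneg_nonneg intro: less_imp_le)
  then have k: "blinfun_apply k (D A) = 0" if "A \<in> arcs G0" for A using em_pos[OF that] that by auto
  have "blinfun_apply k v = 0" for v
    using repr[of "R v" k] k by simp
  then have "k = 0" by (intro blinfun_eqI) simp
  then show "l = blinfun_inner_left (R u)" by (simp add: k_def)
qed

lemma albanese_eq: "albanese_metric X q u v = R v \<bullet> u"
proof -
  have "albanese_metric X q u v = S (R u) \<bullet> R v"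
    unfolding albanese_metric_def riesz_eq hom_inner_eq S_inner by (intro sum.cong) (simp_all add: inner_commute)
  then show ?thesis by (simp add: inner_commute)
qed

lemma albanese_eq_Q: "albanese_metric X q u u = Q (R u)"
  by (simp add: albanese_eq Q_eq inner_commute)

text \<open>The topology on paths is defined by the metric; this comparison reduces it to the
  Euclidean one. The lower bound writes u as S (R u) and bounds each coefficient of this sum by
  means of sqrt (Q (R u)).\<close>

lemma albanese_equivalent_norm:
  "\<exists>c C. 0 < c \<and> 0 < C \<and> (\<forall>u. c * norm u \<le> sqrt (albanese_metric X q u u) \<and> sqrt (albanese_metric X q u u) \<le> C * norm u)"
proof -
  obtain B where B: "0 < B" "\<And>u. norm (R u) \<le> B * norm u"
    using linear_bounded_pos[OF linear_R] by blast
  define N where "N = 1 + (\<Sum>A\<in>arcs G0. sqrt (em A) * norm (D A))"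
  have N: "0 < N" unfolding N_def by (intro add_pos_nonneg sum_nonneg) (auto intro!: mult_nonneg_nonneg simp: less_imp_le em_pos)
  have up: "sqrt (albanese_metric X q u u) \<le> sqrt B * norm u" for u
  proof -
    have "R u \<bullet> u \<le> norm (R u) * norm u" by (rule norm_cauchy_schwarz)
    also have "\<dots> \<le> B * norm u * norm u" using B(2) by (intro mult_right_mono) auto
    finally have "sqrt (R u \<bullet> u) \<le> sqrt (B * (norm u * norm u))" by (simp add: mult.assoc)
    then show ?thesis by (simp add: albanese_eq real_sqrt_mult)
  qed
  have low: "1 / N * norm u \<le> sqrt (albanese_metric X q u u)" for u
  proof -
    have "norm u = norm (S (R u))" by simp
    also have "\<dots> \<le> (\<Sum>A\<in>arcs G0. norm ((em A * (R u \<bullet> D A)) *\<^sub>R D A))"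
      unfolding S_def by (rule norm_sum)
    also have "\<dots> \<le> (\<Sum>A\<in>arcs G0. sqrt (em A) * norm (D A) * sqrt (Q (R u)))"
    proof (rule sum_mono)
      fix A assume A: "A \<in> arcs G0"
      have "em A * (R u \<bullet> D A)\<^sup>2 \<le> Q (R u)"
        unfolding Q_def using A G0.finite_arcs em_pos by (intro member_le_sum) (auto intro!: mult_nonneg_nonneg intro: less_imp_le)
      then have "sqrt (em A * (R u \<bullet> D A)\<^sup>2) \<le> sqrt (Q (R u))" by (rule real_sqrt_le_mono)
      then have "sqrt (em A) * \<bar>R u \<bullet> D A\<bar> \<le> sqrt (Q (R u))" by (simp add: real_sqrt_mult)
      then have "sqrt (em A) * norm (D A) * (sqrt (em A) * \<bar>R u \<bullet> D A\<bar>) \<le> sqrt (em A) * norm (D A) * sqrt (Q (R u))"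
        using em_pos[OF A] by (intro mult_left_mono) auto
      moreover have "sqrt (em A) * norm (D A) * (sqrt (em A) * \<bar>R u \<bullet> D A\<bar>) = sqrt (em A) * sqrt (em A) * \<bar>R u \<bullet> D A\<bar> * norm (D A)"
        by simp
      ultimately show "norm ((em A * (R u \<bullet> D A)) *\<^sub>R D A) \<le> sqrt (em A) * norm (D A) * sqrt (Q (R u))"
        using em_pos[OF A] by (simp add: abs_mult)
    qed
    also have "\<dots> = (N - 1) * sqrt (Q (R u))" by (simp add: N_def sum_distrib_right)
    also have "\<dots> \<le> N * sqrt (Q (R u))" using Q_nonneg by (intro mult_right_mono) auto
    finally show ?thesis using N by (simp add: albanese_eq_Q field_simps)
  qed
  show ?thesis using up low B(1) N by (intro exI[of _ "1 / N"] exI[of _ "sqrt B"]) simp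
qed

end

text \<open>The mean of \<open>D\<close> under the changed probability is the gradient of
  \<open>exp_moment\<close> at its minimizer divided by the minimal value, so it vanishes by the
  first-order condition.\<close>

lemma (in realized_crystal) centred_crystal_changed:
  assumes p: "transition_probability G p"
    and min: "\<forall>x\<in>verts G0. \<exists>!l. is_arg_min (exp_moment X p \<Phi> x) (\<lambda>_. True) l"
  shows "centred_crystal X \<Phi> (changed_probability X p \<Phi>)"
proof
  define F where "F x = exp_moment X p \<Phi> x" for x
  have F: "F x l = (\<Sum>A\<in>out_arcs G0 x. descend p A * exp (blinfun_apply l (D A)))" for x l
    by (simp add: F_def exp_moment_def D_def)
  define m where "m x = minimizer X p \<Phi> x" for x
  have dp: "0 < descend p A" if "A \<in> arcs G0" for A
    using p lift_arc[OF that] by (simp add: transition_probability_def descend_def)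
  have fin: "finite (out_arcs G0 x)" for x using G0.finite_arcs by (rule rev_finite_subset) auto
  have Fpos: "0 < F x l" if "out_arcs G0 x \<noteq> {}" for x l
    unfolding F
  proof (rule sum_pos[OF fin that])
    fix A assume "A \<in> out_arcs G0 x"
    then show "0 < descend p A * exp (blinfun_apply l (D A))" using dp by (intro mult_pos_pos) auto
  qed
  have ne: "out_arcs G0 x \<noteq> {}" if x: "x \<in> verts G0" for x
  proof -
    obtain y where y: "y \<in> verts G" "x = pv y" using x by (auto simp: verts0)
    have "(\<Sum>e\<in>out_arcs G y. p e) = 1" using p y(1) by (simp add: transition_probability_def)
    then have "out_arcs G y \<noteq> {}" by (metis sum.empty zero_neq_one)
    then show ?thesis unfolding y(2) bij_betw_imp_surj_on[OF bij_betw_proj[OF y(1)], symmetric] by simp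
  qed
  have q: "changed_probability X p \<Phi> A = descend p A * exp (blinfun_apply (m (tail G0 A)) (D A)) / F (tail G0 A) (m (tail G0 A))" for A
    unfolding changed_probability_def Let_def m_def F_def D_def ..
  show "0 < changed_probability X p \<Phi> A" if A: "A \<in> arcs G0" for A
  proof -
    have "out_arcs G0 (tail G0 A) \<noteq> {}" using A by auto
    then show ?thesis unfolding q using dp[OF A] by (intro divide_pos_pos mult_pos_pos Fpos) simp_all
  qed
  show "(\<Sum>A\<in>out_arcs G0 x. changed_probability X p \<Phi> A) = 1" if x: "x \<in> verts G0" for x
  proof -
    have "(\<Sum>A\<in>out_arcs G0 x. changed_probability X p \<Phi> A)
        = (\<Sum>A\<in>out_arcs G0 x. descend p A * exp (blinfun_apply (m x) (D A)) / F x (m x))"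
      unfolding q by (intro sum.cong) auto
    also have "\<dots> = F x (m x) / F x (m x)" unfolding sum_divide_distrib[symmetric] F[symmetric] ..
    finally show ?thesis using Fpos[OF ne[OF x], of "m x"] by simp
  qed
  show "(\<Sum>A\<in>out_arcs G0 x. changed_probability X p \<Phi> A *\<^sub>R D A) = 0" if x: "x \<in> verts G0" for x
  proof -
    define grad where "grad = (\<Sum>A\<in>out_arcs G0 x. (descend p A * exp (blinfun_apply (m x) (D A))) *\<^sub>R D A)"
    have "is_arg_min (F x) (\<lambda>_. True) (m x)"
      using theI'[OF min[rule_format, OF x]] by (simp add: m_def minimizer_def F_def)
    then have le: "F x (m x) \<le> F x l" for l by (auto simp: is_arg_min_linorder)
    \<comment> \<open>Differentiating in the direction of the gradient itself turns the scalar
      first-order condition into grad \<bullet> grad = 0.\<close>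
    define f where "f s = F x (m x + s *\<^sub>R blinfun_inner_left grad)" for s
    have feq: "f = (\<lambda>s. \<Sum>A\<in>out_arcs G0 x. descend p A * exp (blinfun_apply (m x) (D A) + s * (D A \<bullet> grad)))"
      by (simp add: f_def F blinfun.add_left blinfun.scaleR_left fun_eq_iff)
    have "(f has_field_derivative (\<Sum>A\<in>out_arcs G0 x. descend p A * (exp (blinfun_apply (m x) (D A) + 0 * (D A \<bullet> grad)) * (D A \<bullet> grad)))) (at 0)"
      unfolding feq by (auto intro!: derivative_eq_intros sum.cong)
    moreover have "\<forall>y. \<bar>0 - y\<bar> < 1 \<longrightarrow> f 0 \<le> f y" using le by (simp add: f_def)
    ultimately have "(\<Sum>A\<in>out_arcs G0 x. descend p A * (exp (blinfun_apply (m x) (D A) + 0 * (D A \<bullet> grad)) * (D A \<bullet> grad))) = 0"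
      by (intro DERIV_local_min[of f _ 0 1]) auto
    then have "grad \<bullet> grad = 0" by (subst (1) grad_def) (simp add: inner_sum_left mult.assoc)
    then have "grad = 0" by simp
    moreover have "(\<Sum>A\<in>out_arcs G0 x. changed_probability X p \<Phi> A *\<^sub>R D A) = (1 / F x (m x)) *\<^sub>R grad"
      unfolding q grad_def scaleR_sum_right by (intro sum.cong) auto
    ultimately show ?thesis by simp
  qed
qed

section \<open>Convergence of characteristic functions in several variables\<close>

text \<open>The approximating sequence and its limit may depend on e, so smoothing, truncation and
  discretisation can each be chosen after the tolerance.\<close>

lemma tendsto_approx:
  fixes x :: "nat \<Rightarrow> 'z::real_normed_vector"
  assumes "\<And>e. 0 < e \<Longrightarrow> \<exists>y l'. y \<longlonglongrightarrow> l' \<and> (\<forall>\<^sub>F n in sequentially. norm (x n - y n) \<le> e) \<and> norm (l - l') \<le> e"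
  shows "x \<longlonglongrightarrow> l"
proof (rule tendstoI)
  fix e :: real assume "0 < e"
  then obtain y l' where y: "y \<longlonglongrightarrow> l'" "\<forall>\<^sub>F n in sequentially. norm (x n - y n) \<le> e / 4" "norm (l - l') \<le> e / 4"
    using assms[of "e / 4"] by auto
  from tendstoD[OF y(1), of "e / 4"] \<open>0 < e\<close> have "\<forall>\<^sub>F n in sequentially. dist (y n) l' < e / 4" by simp
  then show "\<forall>\<^sub>F n in sequentially. dist (x n) l < e"
    using y(2)
  proof eventually_elim
    case (elim n)
    have "x n - l = (x n - y n) + (y n - l') - (l - l')" by simp
    then have "norm (x n - l) \<le> norm (x n - y n) + norm (y n - l') + norm (l - l')"
      by (metis norm_triangle_ineq norm_triangle_ineq4 add_right_mono order_trans)
    then show ?case using elim y(3) \<open>0 < e\<close> by (simp add: dist_norm)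
  qed
qed

section \<open>Test functions and their Fourier approximation\<close>

text \<open>Lipschitz functions of compact support bounded by one: a class that is closed under
  products, integrable as the Fourier representation requires, and whose products over any finite
  index set are again bounded by one.\<close>

definition bump :: "(real \<Rightarrow> real) \<Rightarrow> bool" where
  "bump f \<longleftrightarrow> (\<exists>L R. \<forall>x y. \<bar>f x - f y\<bar> \<le> L * \<bar>x - y\<bar> \<and> (R < \<bar>x\<bar> \<longrightarrow> f x = 0) \<and> \<bar>f x\<bar> \<le> 1)"

lemma bump_continuous: "bump f \<Longrightarrow> continuous_on A f"
proof -
  assume "bump f"
  then obtain L where L: "\<And>x y. \<bar>f x - f y\<bar> \<le> L * \<bar>x - y\<bar>" by (auto simp: bump_def)
  have "L-lipschitz_on UNIV f"
    using L[of 0 1] L by (auto intro!: lipschitz_onI simp: dist_real_def)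
  then show ?thesis by (metis lipschitz_on_continuous_on continuous_on_subset top_greatest)
qed

lemma bump_measurable: "bump f \<Longrightarrow> f \<in> borel_measurable borel"
  by (intro borel_measurable_continuous_onI bump_continuous)

lemma bump_integrable: "bump f \<Longrightarrow> integrable lborel f"
proof -
  assume f: "bump f"
  then obtain R where R: "\<And>x. R < \<bar>x\<bar> \<Longrightarrow> f x = 0" by (auto simp: bump_def)
  have "set_integrable lborel {-R..R} f"
    by (rule borel_integrable_atLeastAtMost') (rule bump_continuous[OF f])
  moreover have "(\<lambda>x. indicator {-R..R} x *\<^sub>R f x) = f"
  proof
    show "indicator {-R..R} x *\<^sub>R f x = f x" for x
      using R[of x] by (cases "R < \<bar>x\<bar>") (auto simp: indicator_def abs_if split: if_splits)
  qed
  ultimately show ?thesis unfolding set_integrable_def by metis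
qed

lemma prob_space_std_normal: "prob_space std_normal_distribution"
  using real_dist_normal_dist by (simp add: real_distribution_def)

text \<open>
  The approximation of \<open>f\<close> is its convolution with a centred Gaussian density of standard deviation
  \<open>\<sigma>\<close>, which is itself the Fourier transform of a Gaussian.
\<close>

lemma bump_fourier_approx:
  assumes f: "bump f" and Lip: "\<And>x y. \<bar>f x - f y\<bar> \<le> L * \<bar>x - y\<bar>" and \<sigma>: "0 < \<sigma>"
  shows "\<exists>c B. c \<in> borel_measurable borel \<and> (\<forall>a. norm (c a :: complex) \<le> B) \<and>
    (\<forall>y. norm (of_real (f y) - (LINT a|std_normal_distribution. c a * iexp (a / \<sigma> * y))) \<le> L * \<sigma>)"
proof -
  let ?N = std_normal_distribution
  interpret N: prob_space ?N by (rule prob_space_std_normal)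
  interpret pair_sigma_finite lborel ?N ..
  note [measurable] = bump_measurable[OF f]
  note int = bump_integrable[OF f]
  define K where "K = 1 / sqrt (2 * pi * \<sigma>\<^sup>2)"
  \<comment> \<open>\<open>K\<close> normalises the Gaussian density of deviation \<sigma>, and c is
    \<open>K\<close> times the Fourier transform of f at a / \<sigma>. Integrating c against the
    standard normal law reproduces the convolution, because the characteristic function of that law
    at (y - z) / \<sigma> is the exponential factor of the density.\<close>
  define c where "c a = complex_of_real K * (LINT z|lborel. of_real (f z) * iexp (- (a / \<sigma> * z)))" for a
  have c_meas[measurable]: "c \<in> borel_measurable borel" unfolding c_def by measurable
  have K0: "0 \<le> K" by (simp add: K_def)
  have "norm (c a) \<le> K * (LINT z|lborel. \<bar>f z\<bar>)" for a
  proof -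
    have "norm (LINT z|lborel. of_real (f z) * iexp (- (a / \<sigma> * z)))
        \<le> (LINT z|lborel. norm (of_real (f z) * iexp (- (a / \<sigma> * z))))"
      by (rule integral_norm_bound)
    also have "\<dots> = (LINT z|lborel. \<bar>f z\<bar>)" by (simp add: norm_mult)
    finally show ?thesis using K0 by (simp add: c_def norm_mult mult_left_mono)
  qed
  moreover have "norm (of_real (f y) - (LINT a|?N. c a * iexp (a / \<sigma> * y))) \<le> L * \<sigma>" for y
  proof -
    have pint: "integrable (lborel \<Otimes>\<^sub>M ?N) (\<lambda>(z, a). of_real (f z) * iexp (a / \<sigma> * (y - z)))"
    proof (rule Fubini_integrable)
      show "integrable lborel (\<lambda>z. LINT a|?N. norm (case (z, a) of (z, a) \<Rightarrow> of_real (f z) * iexp (a / \<sigma> * (y - z))))"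
        using int by (simp add: norm_mult N.prob_space)
      show "AE z in lborel. integrable ?N (\<lambda>a. case (z, a) of (z, a) \<Rightarrow> of_real (f z) * iexp (a / \<sigma> * (y - z)))"
        by (intro AE_I2) (auto intro!: N.integrable_const_bound[where B = "\<bar>f _\<bar>"] simp: norm_mult)
    qed measurable
    have "(LINT a|?N. c a * iexp (a / \<sigma> * y))
        = of_real K * (LINT a|?N. LINT z|lborel. of_real (f z) * iexp (a / \<sigma> * (y - z)))"
    proof -
      have "c a * iexp (a / \<sigma> * y)
          = of_real K * (LINT z|lborel. of_real (f z) * iexp (a / \<sigma> * (y - z)))" for a
      proof -
        have "(LINT z|lborel. of_real (f z) * iexp (- (a / \<sigma> * z))) * iexp (a / \<sigma> * y)
          = (LINT z|lborel. of_real (f z) * iexp (- (a / \<sigma> * z)) * iexp (a / \<sigma> * y))"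
          by (subst integral_mult_left_zero) simp
        also have "\<dots> = (LINT z|lborel. of_real (f z) * iexp (a / \<sigma> * (y - z)))"
          by (intro Bochner_Integration.integral_cong refl)
            (simp add: mult.assoc exp_add[symmetric] algebra_simps diff_divide_distrib)
        finally show ?thesis by (simp add: c_def)
      qed
      then show ?thesis by simp
    qed
    also have "(LINT a|?N. LINT z|lborel. of_real (f z) * iexp (a / \<sigma> * (y - z)))
        = (LINT z|lborel. LINT a|?N. of_real (f z) * iexp (a / \<sigma> * (y - z)))"
      using Fubini_integral[OF pint] by simp
    also have "\<dots> = (LINT z|lborel. of_real (f z * exp (- ((y - z) / \<sigma>)\<^sup>2 / 2)))"
    proof (intro Bochner_Integration.integral_cong refl)
      fix z
      have "(LINT a|?N. iexp (a / \<sigma> * (y - z))) = char ?N ((y - z) / \<sigma>)"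
        by (simp add: char_def mult.commute)
      then show "(LINT a|?N. of_real (f z) * iexp (a / \<sigma> * (y - z)))
          = of_real (f z * exp (- ((y - z) / \<sigma>)\<^sup>2 / 2))"
        by (simp add: char_std_normal_distribution)
    qed
    also have "of_real K * \<dots> = of_real (LINT z|lborel. normal_density y \<sigma> z * f z)"
    proof -
      have "normal_density y \<sigma> z * f z = K * (f z * exp (- ((y - z) / \<sigma>)\<^sup>2 / 2))" for z
        by (simp add: normal_density_def K_def power_divide power2_commute[of y z])
      then have "(LINT z|lborel. normal_density y \<sigma> z * f z) = K * (LINT z|lborel. f z * exp (- ((y - z) / \<sigma>)\<^sup>2 / 2))"
        by (simp only: integral_mult_right_zero)
      then show ?thesis unfolding integral_complex_of_real by simp
    qed
    finally have eq: "(LINT a|?N. c a * iexp (a / \<sigma> * y)) = of_real (LINT z|lborel. normal_density y \<sigma> z * f z)" .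
    have i1: "integrable lborel (\<lambda>z. normal_density y \<sigma> z * f z)"
    proof (rule Bochner_Integration.integrable_bound)
      show "integrable lborel (\<lambda>z. normal_density y \<sigma> z)" using \<sigma> by simp
      show "AE z in lborel. norm (normal_density y \<sigma> z * f z) \<le> norm (normal_density y \<sigma> z)"
        using f by (intro AE_I2) (auto simp: bump_def abs_mult mult_left_le)
    qed measurable
    have i2: "integrable lborel (\<lambda>z. normal_density y \<sigma> z * f y)" using \<sigma> by simp
    have i3: "integrable lborel (\<lambda>z. normal_density y \<sigma> z * \<bar>z - y\<bar>)"
      using integrable_normal_moment_abs[OF \<sigma>, of y 1] by simp
    have "f y - (LINT z|lborel. normal_density y \<sigma> z * f z)
        = (LINT z|lborel. normal_density y \<sigma> z * f y - normal_density y \<sigma> z * f z)"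
      using i1 i2 \<sigma> by simp
    also have "\<bar>\<dots>\<bar> \<le> (LINT z|lborel. L * (normal_density y \<sigma> z * \<bar>z - y\<bar>))"
    proof (rule order_trans[OF integral_abs_bound], rule integral_mono)
      show "integrable lborel (\<lambda>z. \<bar>normal_density y \<sigma> z * f y - normal_density y \<sigma> z * f z\<bar>)"
        using i1 i2 by (intro integrable_abs Bochner_Integration.integrable_diff)
      show "integrable lborel (\<lambda>z. L * (normal_density y \<sigma> z * \<bar>z - y\<bar>))" using i3 by simp
      fix z
      have "\<bar>normal_density y \<sigma> z * f y - normal_density y \<sigma> z * f z\<bar> = normal_density y \<sigma> z * \<bar>f z - f y\<bar>"
        by (simp add: abs_mult abs_minus_commute flip: right_diff_distrib)
      also have "\<dots> \<le> normal_density y \<sigma> z * (L * \<bar>z - y\<bar>)"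
        by (intro mult_left_mono Lip) simp
      finally show "\<bar>normal_density y \<sigma> z * f y - normal_density y \<sigma> z * f z\<bar> \<le> L * (normal_density y \<sigma> z * \<bar>z - y\<bar>)"
        by (simp add: algebra_simps)
    qed
    \<comment> \<open>The mean absolute deviation of the normal law is \<sigma> sqrt (2 / pi), which
      is at most \<sigma>.\<close>
    also have "\<dots> = L * (\<sigma> * sqrt (2 / pi))"
      using integral_normal_moment_abs_odd[OF \<sigma>, of y 0] by simp
    also have "\<dots> \<le> L * (\<sigma> * 1)"
      using Lip[of 0 1] \<sigma> pi_gt3 by (intro mult_left_mono) (auto simp: real_sqrt_le_1_iff)
    finally show ?thesis
      unfolding eq by (metis norm_of_real of_real_diff mult_1_right)
  qed
  ultimately show ?thesis using c_meas by blast
qed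

text \<open>The bounded factor U stands for the remaining coordinates, so that several coordinates
  can be converted one at a time. The approximation of f is an average of characters with bounded
  weights, so convergence at each frequency passes to it by dominated convergence.\<close>

lemma char_conv_imp_bump_conv:
  fixes U :: "nat \<Rightarrow> 'a \<Rightarrow> complex" and U' :: "'b \<Rightarrow> complex"
  assumes "prob_space M" "prob_space N"
    and [measurable]: "\<And>n. U n \<in> borel_measurable M" "\<And>n. Y n \<in> borel_measurable M"
      "U' \<in> borel_measurable N" "Y' \<in> borel_measurable N"
    and U: "\<And>n z. norm (U n z) \<le> 1" and U': "\<And>z. norm (U' z) \<le> 1"
    and conv: "\<And>a. (\<lambda>n. LINT z|M. U n z * iexp (a * Y n z)) \<longlonglongrightarrow> (LINT z|N. U' z * iexp (a * Y' z))"
    and f: "bump f"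
  shows "(\<lambda>n. LINT z|M. U n z * of_real (f (Y n z))) \<longlonglongrightarrow> (LINT z|N. U' z * of_real (f (Y' z)))"
proof (rule tendsto_approx)
  fix e :: real assume e: "0 < e"
  let ?N = std_normal_distribution
  interpret G: prob_space ?N by (rule prob_space_std_normal)
  interpret M: prob_space M by fact
  interpret N: prob_space N by fact
  obtain L where Lip: "\<And>x y. \<bar>f x - f y\<bar> \<le> L * \<bar>x - y\<bar>" using f by (auto simp: bump_def)
  have L0: "0 \<le> L" using Lip[of 0 1] by auto
  \<comment> \<open>The denominator L + 1 also covers L = 0.\<close>
  define \<sigma> where "\<sigma> = e / (L + 1)"
  have \<sigma>: "0 < \<sigma>" "L * \<sigma> \<le> e" using L0 e by (auto simp: \<sigma>_def field_simps)
  obtain c B where cB: "c \<in> borel_measurable borel \<and> (\<forall>a. norm (c a :: complex) \<le> B) \<and>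
      (\<forall>y. norm (of_real (f y) - (LINT a|?N. c a * iexp (a / \<sigma> * y))) \<le> L * \<sigma>)"
    using bump_fourier_approx[OF f Lip \<sigma>(1)] by (elim exE)
  then have [measurable]: "c \<in> borel_measurable borel" and B: "norm (c a) \<le> B"
    and app: "norm (of_real (f y) - (LINT a|?N. c a * iexp (a / \<sigma> * y))) \<le> L * \<sigma>" for a y
    by blast+
  define h where "h y = (LINT a|?N. c a * iexp (a / \<sigma> * y))" for y
  have [measurable]: "h \<in> borel_measurable borel" "f \<in> borel_measurable borel"
    unfolding h_def using bump_measurable[OF f] by measurable
  have B0: "0 \<le> B" using order_trans[OF norm_ge_zero B] .
  have h_bound: "norm (h y) \<le> B" for y
  proof -
    have "norm (h y) \<le> (LINT a|?N. norm (c a * iexp (a / \<sigma> * y)))"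
      unfolding h_def by (rule integral_norm_bound)
    also have "\<dots> \<le> (LINT a|?N. B)"
      by (intro integral_mono G.integrable_const_bound[where B = B]) (auto simp: norm_mult B B0)
    finally show ?thesis using G.prob_space by simp
  qed
  have close: "norm ((LINT z|K. V z * of_real (f (W z))) - (LINT z|K. V z * h (W z))) \<le> e"
    if "prob_space K" and [measurable]: "V \<in> borel_measurable K" "W \<in> borel_measurable K"
      and V: "\<And>z. norm (V z) \<le> 1" for K :: "'c measure" and V W
  proof -
    interpret K: prob_space K by fact
    have i: "integrable K (\<lambda>z. V z * of_real (f (W z)))" "integrable K (\<lambda>z. V z * h (W z))"
    proof -
      have "\<bar>f x\<bar> \<le> 1" for x using f by (auto simp: bump_def)
      then show "integrable K (\<lambda>z. V z * of_real (f (W z)))"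
        using V by (intro K.integrable_const_bound[where B = 1] AE_I2) (auto simp: norm_mult intro!: mult_le_one)
      have "norm (V z) * norm (h (W z)) \<le> 1 * B" for z
        using V h_bound by (intro mult_mono) auto
      then show "integrable K (\<lambda>z. V z * h (W z))"
        by (intro K.integrable_const_bound[where B = B] AE_I2) (auto simp: norm_mult)
    qed
    have "(LINT z|K. V z * of_real (f (W z))) - (LINT z|K. V z * h (W z))
        = (LINT z|K. V z * (of_real (f (W z)) - h (W z)))"
      using i by (simp add: right_diff_distrib)
    also have "norm \<dots> \<le> (LINT z|K. norm (V z * (of_real (f (W z)) - h (W z))))"
      by (rule integral_norm_bound)
    also have "\<dots> \<le> (LINT z|K. e)"
    proof (rule integral_mono)
      show "integrable K (\<lambda>z. norm (V z * (of_real (f (W z)) - h (W z))))"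
        using i by (simp add: right_diff_distrib)
      fix z
      have "norm (V z * (of_real (f (W z)) - h (W z))) \<le> 1 * e"
        unfolding norm_mult using V app[of "W z"] \<sigma>(2)
        by (intro mult_mono) (auto simp: h_def)
      then show "norm (V z * (of_real (f (W z)) - h (W z))) \<le> e" by simp
    qed simp
    finally show ?thesis by (simp add: K.prob_space)
  qed
  have swap: "(LINT z|K. V z * h (W z)) = (LINT a|?N. c a * (LINT z|K. V z * iexp (a / \<sigma> * W z)))"
    if "prob_space K" and [measurable]: "V \<in> borel_measurable K" "W \<in> borel_measurable K"
      and V: "\<And>z. norm (V z) \<le> 1" for K :: "'c measure" and V W
  proof -
    interpret K: prob_space K by fact
    interpret KN: pair_prob_space ?N K ..
    have "integrable (?N \<Otimes>\<^sub>M K) (\<lambda>(a, z). c a * (V z * iexp (a / \<sigma> * W z)))"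
    proof (rule KN.integrable_const_bound[where B = B])
      show "AE x in ?N \<Otimes>\<^sub>M K. norm (case x of (a, z) \<Rightarrow> c a * (V z * iexp (a / \<sigma> * W z))) \<le> B"
        using mult_mono[OF B V] order_trans[OF norm_ge_zero B] by (auto intro!: AE_I2 simp: norm_mult)
    qed measurable
    from KN.Fubini_integral[OF this]
    have "(LINT z|K. LINT a|?N. c a * (V z * iexp (a / \<sigma> * W z)))
        = (LINT a|?N. LINT z|K. c a * (V z * iexp (a / \<sigma> * W z)))" .
    moreover have "(LINT a|?N. c a * (V z * iexp (a / \<sigma> * W z))) = V z * h (W z)" for z
    proof -
      have "(LINT a|?N. c a * (V z * iexp (a / \<sigma> * W z))) = (LINT a|?N. V z * (c a * iexp (a / \<sigma> * W z)))"
        by (intro Bochner_Integration.integral_cong) (auto simp: ac_simps)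
      then show ?thesis by (simp add: h_def)
    qed
    ultimately show ?thesis by simp
  qed
  have "(\<lambda>n. LINT a|?N. c a * (LINT z|M. U n z * iexp (a / \<sigma> * Y n z)))
      \<longlonglongrightarrow> (LINT a|?N. c a * (LINT z|N. U' z * iexp (a / \<sigma> * Y' z)))"
  proof (rule integral_dominated_convergence[where w = "\<lambda>_. B"])
    show "AE a in ?N. (\<lambda>n. c a * (LINT z|M. U n z * iexp (a / \<sigma> * Y n z)))
        \<longlonglongrightarrow> c a * (LINT z|N. U' z * iexp (a / \<sigma> * Y' z))"
      by (intro AE_I2 tendsto_intros conv)
    fix n
    have "norm (LINT z|M. U n z * iexp (a / \<sigma> * Y n z)) \<le> 1" for a
    proof -
      have "norm (LINT z|M. U n z * iexp (a / \<sigma> * Y n z)) \<le> (LINT z|M. norm (U n z * iexp (a / \<sigma> * Y n z)))"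
        by (rule integral_norm_bound)
      also have "\<dots> \<le> (LINT z|M. 1)"
        by (intro integral_mono M.integrable_const_bound[where B = 1]) (auto simp: norm_mult U)
      finally show ?thesis by (simp add: M.prob_space)
    qed
    then show "AE a in ?N. norm (c a * (LINT z|M. U n z * iexp (a / \<sigma> * Y n z))) \<le> B"
      using mult_mono[OF B, of _ 1] order_trans[OF norm_ge_zero B] by (auto intro!: AE_I2 simp: norm_mult)
  next
    show "(\<lambda>a. c a * (LINT z|N. U' z * iexp (a / \<sigma> * Y' z))) \<in> borel_measurable ?N"
      by (intro borel_measurable_times N.borel_measurable_lebesgue_integral) measurable
    show "(\<lambda>a. c a * (LINT z|M. U n z * iexp (a / \<sigma> * Y n z))) \<in> borel_measurable ?N" for n
      by (intro borel_measurable_times M.borel_measurable_lebesgue_integral) measurable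
  qed simp
  then have "(\<lambda>n. LINT z|M. U n z * h (Y n z)) \<longlonglongrightarrow> (LINT z|N. U' z * h (Y' z))"
    by (simp only: swap[OF \<open>prob_space M\<close> assms(3,4) U] swap[OF \<open>prob_space N\<close> assms(5,6) U'])
  then show "\<exists>y l'. y \<longlonglongrightarrow> l' \<and>
      (\<forall>\<^sub>F n in sequentially. norm ((LINT z|M. U n z * of_real (f (Y n z))) - y n) \<le> e) \<and>
      norm ((LINT z|N. U' z * of_real (f (Y' z))) - l') \<le> e"
    using close[OF \<open>prob_space M\<close> assms(3,4) U] close[OF \<open>prob_space N\<close> assms(5,6) U']
    by (intro exI[of _ "\<lambda>n. LINT z|M. U n z * h (Y n z)"] exI[of _ "LINT z|N. U' z * h (Y' z)"]) simp
qed

text \<open>Induction on the set J of coordinates that already carry bumps while the others still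
  carry characters. The step converts coordinate j, for which every frequency is needed; hence the
  induction generalises over a.\<close>

lemma char_conv_imp_prod_conv:
  fixes Y :: "nat \<Rightarrow> 'k \<Rightarrow> 'a \<Rightarrow> real" and Y' :: "'k \<Rightarrow> 'b \<Rightarrow> real"
  assumes M: "prob_space M" and N: "prob_space N" and K: "finite K"
    and meas[measurable]: "\<And>n k. k \<in> K \<Longrightarrow> Y n k \<in> borel_measurable M" "\<And>k. k \<in> K \<Longrightarrow> Y' k \<in> borel_measurable N"
    and conv: "\<And>a. (\<lambda>n. LINT z|M. iexp (\<Sum>k\<in>K. a k * Y n k z)) \<longlonglongrightarrow> (LINT z|N. iexp (\<Sum>k\<in>K. a k * Y' k z))"
    and f: "\<And>k. k \<in> K \<Longrightarrow> bump (f k)"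
  shows "(\<lambda>n. LINT z|M. (\<Prod>k\<in>K. f k (Y n k z))) \<longlonglongrightarrow> (LINT z|N. (\<Prod>k\<in>K. f k (Y' k z)))"
proof -
  have f1: "\<bar>f k x\<bar> \<le> 1" if "k \<in> K" for k x using f[OF that] by (auto simp: bump_def)
  note fm = bump_measurable[OF f]
  have main: "(\<lambda>n. LINT z|M. (\<Prod>k\<in>J. of_real (f k (Y n k z))) * iexp (\<Sum>k\<in>K - J. a k * Y n k z))
      \<longlonglongrightarrow> (LINT z|N. (\<Prod>k\<in>J. of_real (f k (Y' k z))) * iexp (\<Sum>k\<in>K - J. a k * Y' k z))"
    if "J \<subseteq> K" for J a
    using finite_subset[OF that K] that
  proof (induction J arbitrary: a rule: finite_induct)
    case empty
    then show ?case using conv by simp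
  next
    case (insert j J)
    have sub: "J \<subseteq> K" "j \<in> K" "j \<notin> J" using insert by auto
    have split: "(\<Sum>k\<in>K - J. g k) = g j + (\<Sum>k\<in>K - insert j J. g k)" for g :: "'k \<Rightarrow> real"
    proof -
      have "K - J = insert j (K - insert j J)" using sub by auto
      then show ?thesis using K by (metis Diff_iff finite_Diff insertI1 sum.insert)
    qed
    have "(\<lambda>n. LINT z|M. ((\<Prod>k\<in>J. of_real (f k (Y n k z))) * iexp (\<Sum>k\<in>K - insert j J. a k * Y n k z))
            * of_real (f j (Y n j z)))
        \<longlonglongrightarrow> (LINT z|N. ((\<Prod>k\<in>J. of_real (f k (Y' k z))) * iexp (\<Sum>k\<in>K - insert j J. a k * Y' k z))
            * of_real (f j (Y' j z)))"
    proof (rule char_conv_imp_bump_conv[OF M N, where Y = "\<lambda>n. Y n j" and Y' = "Y' j" and f = "f j"])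
      have [measurable]: "k \<in> J \<Longrightarrow> Y n k \<in> borel_measurable M" "k \<in> J \<Longrightarrow> Y' k \<in> borel_measurable N"
        "k \<in> J \<Longrightarrow> f k \<in> borel_measurable borel"
        "k \<in> K - insert j J \<Longrightarrow> Y n k \<in> borel_measurable M" "k \<in> K - insert j J \<Longrightarrow> Y' k \<in> borel_measurable N"
        for k n using sub fm by auto
      show "(\<lambda>z. (\<Prod>k\<in>J. complex_of_real (f k (Y n k z))) * iexp (\<Sum>k\<in>K - insert j J. a k * Y n k z)) \<in> borel_measurable M" for n
        by measurable
      show "(\<lambda>z. (\<Prod>k\<in>J. complex_of_real (f k (Y' k z))) * iexp (\<Sum>k\<in>K - insert j J. a k * Y' k z)) \<in> borel_measurable N"
        by measurable
      have le: "norm ((\<Prod>k\<in>J. complex_of_real (f k (x k)))) \<le> 1" for x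
        using sub f1 unfolding prod_norm[symmetric] by (intro prod_le_1) auto
      show "norm ((\<Prod>k\<in>J. complex_of_real (f k (Y n k z))) * iexp (\<Sum>k\<in>K - insert j J. a k * Y n k z)) \<le> 1" for n z
        using le[of "\<lambda>k. Y n k z"] by (simp add: norm_mult)
      show "norm ((\<Prod>k\<in>J. complex_of_real (f k (Y' k z))) * iexp (\<Sum>k\<in>K - insert j J. a k * Y' k z)) \<le> 1" for z
        using le[of "\<lambda>k. Y' k z"] by (simp add: norm_mult)
      fix b
      define a' where "a' = a(j := b)"
      have eq: "iexp (\<Sum>k\<in>K - J. a' k * x k) = iexp (\<Sum>k\<in>K - insert j J. a k * x k) * iexp (b * x j)" for x
      proof -
        have "(\<Sum>k\<in>K - insert j J. a' k * x k) = (\<Sum>k\<in>K - insert j J. a k * x k)"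
          by (intro sum.cong) (auto simp: a'_def)
        then have "(\<Sum>k\<in>K - J. a' k * x k) = b * x j + (\<Sum>k\<in>K - insert j J. a k * x k)"
          by (simp only: split) (simp add: a'_def)
        then show ?thesis by (simp only:) (simp add: exp_add[symmetric] algebra_simps)
      qed
      show "(\<lambda>n. LINT z|M. (\<Prod>k\<in>J. of_real (f k (Y n k z))) * iexp (\<Sum>k\<in>K - insert j J. a k * Y n k z) * iexp (b * Y n j z))
        \<longlonglongrightarrow> (LINT z|N. (\<Prod>k\<in>J. of_real (f k (Y' k z))) * iexp (\<Sum>k\<in>K - insert j J. a k * Y' k z) * iexp (b * Y' j z))"
        using insert.IH[OF sub(1), of a'] unfolding eq mult.assoc .
    qed (use sub meas f in auto)
    moreover have "(\<Prod>k\<in>insert j J. complex_of_real (f k (x k))) * E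
        = (\<Prod>k\<in>J. of_real (f k (x k))) * E * of_real (f j (x j))" for x E
      using insert.hyps by simp
    ultimately show ?case by (simp only:)
  qed
  from main[OF subset_refl, of "\<lambda>_. 0"] have "(\<lambda>n. LINT z|M. complex_of_real (\<Prod>k\<in>K. f k (Y n k z)))
      \<longlonglongrightarrow> (LINT z|N. complex_of_real (\<Prod>k\<in>K. f k (Y' k z)))"
    by (simp only: subset_refl Diff_cancel sum.empty of_real_0 mult_zero_right exp_zero mult_1_right of_real_prod)
  then show ?thesis by (simp only: integral_complex_of_real tendsto_of_real_iff)
qed

section \<open>Partitions of unity and Lipschitz test functions\<close>

lemma bump_clamp:
  assumes "\<And>x y. \<bar>g x - g y\<bar> \<le> L * \<bar>x - y\<bar>" "\<And>x. R < \<bar>x\<bar> \<Longrightarrow> g x \<le> 0"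
  shows "bump (\<lambda>x. max 0 (min 1 (g x)))"
  unfolding bump_def
proof (rule exI[of _ L], rule exI[of _ R], intro allI conjI impI)
  show "\<bar>max 0 (min 1 (g x)) - max 0 (min 1 (g y))\<bar> \<le> L * \<bar>x - y\<bar>" for x y
    using assms(1)[of x y] by (auto simp: max_def min_def abs_if split: if_splits)
  show "max 0 (min 1 (g x)) = 0" if "R < \<bar>x\<bar>" for x
    using assms(2)[OF that] by simp
qed simp

lemma bump_mult:
  assumes f: "bump f" and g: "bump g"
  shows "bump (\<lambda>x. f x * g x)"
proof -
  obtain L R where f': "\<And>x y. \<bar>f x - f y\<bar> \<le> L * \<bar>x - y\<bar>" "\<And>x. R < \<bar>x\<bar> \<Longrightarrow> f x = 0" "\<And>x. \<bar>f x\<bar> \<le> 1"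
    using f by (auto simp: bump_def)
  obtain L' where g': "\<And>x y. \<bar>g x - g y\<bar> \<le> L' * \<bar>x - y\<bar>" "\<And>x. \<bar>g x\<bar> \<le> 1"
    using g by (auto simp: bump_def)
  show ?thesis
    unfolding bump_def
  proof (rule exI[of _ "L + L'"], rule exI[of _ R], intro allI conjI impI)
    fix x y
    have "f x * g x - f y * g y = f x * (g x - g y) + (f x - f y) * g y" by (simp add: algebra_simps)
    also have "\<bar>\<dots>\<bar> \<le> \<bar>f x\<bar> * \<bar>g x - g y\<bar> + \<bar>f x - f y\<bar> * \<bar>g y\<bar>"
      by (metis abs_mult abs_triangle_ineq)
    also have "\<dots> \<le> 1 * (L' * \<bar>x - y\<bar>) + (L * \<bar>x - y\<bar>) * 1"
      using f'(1)[of x y] g'(1)[of x y] f'(3)[of x] g'(2)[of y] by (intro add_mono mult_mono) auto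
    finally show "\<bar>f x * g x - f y * g y\<bar> \<le> (L + L') * \<bar>x - y\<bar>" by (simp add: algebra_simps)
    show "\<bar>f x * g x\<bar> \<le> 1" using f'(3)[of x] g'(2)[of x] by (simp add: abs_mult mult_le_one)
  qed (simp add: f'(2))
qed

lemma sum_tents:
  assumes "\<bar>s\<bar> \<le> real Z - 1"
  shows "(\<Sum>j\<in>{- int Z..int Z}. max 0 (min 1 (1 - \<bar>s - of_int j\<bar>))) = 1"
proof -
  define k where "k = \<lfloor>s\<rfloor>"
  have k: "of_int k \<le> s" "s < of_int k + 1" by (auto simp: k_def)
  have "(\<Sum>j\<in>{k, k + 1}. max 0 (min 1 (1 - \<bar>s - of_int j\<bar>)))
      = (\<Sum>j\<in>{- int Z..int Z}. max 0 (min 1 (1 - \<bar>s - of_int j\<bar>)))"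
  proof (rule sum.mono_neutral_left)
    \<comment> \<open>The margin of one in the hypothesis keeps the right neighbour k + 1 of s
      inside the grid.\<close>
    have "- int Z \<le> k" "k + 1 \<le> int Z"
      using assms k by linarith+
    then show "{k, k + 1} \<subseteq> {- int Z..int Z}" by auto
    show "\<forall>j\<in>{- int Z..int Z} - {k, k + 1}. max 0 (min 1 (1 - \<bar>s - of_int j\<bar>)) = 0"
    proof
      fix j assume "j \<in> {- int Z..int Z} - {k, k + 1}"
      then have "j \<le> k - 1 \<or> k + 2 \<le> j" by auto
      then have "of_int j \<le> of_int k - (1::real) \<or> of_int k + 2 \<le> (of_int j :: real)" by linarith
      then show "max 0 (min 1 (1 - \<bar>s - of_int j\<bar>)) = 0" using k by (auto simp: max_def min_def abs_if)
    qed
  qed simp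
  moreover have "(\<Sum>j\<in>{k, k + 1}. max 0 (min 1 (1 - \<bar>s - of_int j\<bar>))) = 1"
    using k by (simp add: max_def min_def abs_if)
  ultimately show ?thesis by simp
qed

text \<open>
  The test function is approximated by combinations of products of bumps, using a cut-off and a
  partition of unity into products of tents on a fine grid; the convergence of the cut-off itself
  replaces a tightness assumption.
\<close>

lemma char_conv_imp_lipschitz_conv:
  fixes Y :: "nat \<Rightarrow> 'k \<Rightarrow> 'a \<Rightarrow> real" and Y' :: "'k \<Rightarrow> 'b \<Rightarrow> real"
  assumes M: "prob_space M" and N: "prob_space N" and K: "finite K"
    and meas[measurable]: "\<And>n k. k \<in> K \<Longrightarrow> Y n k \<in> borel_measurable M" "\<And>k. k \<in> K \<Longrightarrow> Y' k \<in> borel_measurable N"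
    and conv: "\<And>a. (\<lambda>n. LINT z|M. iexp (\<Sum>k\<in>K. a k * Y n k z)) \<longlonglongrightarrow> (LINT z|N. iexp (\<Sum>k\<in>K. a k * Y' k z))"
    and Lip: "\<And>x y. \<bar>h x - h y\<bar> \<le> L * (\<Sum>k\<in>K. \<bar>x k - y k\<bar>)" and B: "\<And>x. \<bar>h x\<bar> \<le> B"
    and hm[measurable]: "\<And>n. (\<lambda>z. h (\<lambda>k. Y n k z)) \<in> borel_measurable M" "(\<lambda>z. h (\<lambda>k. Y' k z)) \<in> borel_measurable N"
  shows "(\<lambda>n. LINT z|M. h (\<lambda>k. Y n k z)) \<longlonglongrightarrow> (LINT z|N. h (\<lambda>k. Y' k z) :: real)"
proof (rule tendsto_approx)
  fix e :: real assume e: "0 < e"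
  interpret N: prob_space N by (rule N)
  have B0: "0 \<le> B" using B[of undefined] by linarith
  define L1 where "L1 = \<bar>L\<bar>"
  have Lip1: "\<bar>h x - h y\<bar> \<le> L1 * (\<Sum>k\<in>K. \<bar>x k - y k\<bar>)" for x y
    using Lip[of x y] by (rule order_trans) (auto simp: L1_def intro!: mult_right_mono sum_nonneg)
  define \<kappa> where "\<kappa> R u = max 0 (min 1 (real R + 1 - \<bar>u\<bar>))" for R and u :: real
  have \<kappa>_bump: "bump (\<kappa> R)" for R
    unfolding \<kappa>_def by (rule bump_clamp[where L = 1 and R = "real R + 1"]) auto
  have [measurable]: "\<kappa> R \<in> borel_measurable borel" for R by (rule bump_measurable[OF \<kappa>_bump])
  have \<kappa>_range: "0 \<le> \<kappa> R u" "\<kappa> R u \<le> 1" for R u by (auto simp: \<kappa>_def)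
  define \<psi> where "\<psi> R x = (\<Prod>k\<in>K. \<kappa> R (x k))" for R x
  have \<psi>_range: "0 \<le> \<psi> R x" "\<psi> R x \<le> 1" for R x
    unfolding \<psi>_def by (auto intro!: prod_nonneg prod_le_1 simp: \<kappa>_range)
  have "(\<lambda>R. LINT z|N. \<psi> R (\<lambda>k. Y' k z)) \<longlonglongrightarrow> (LINT z|N. 1)"
  proof (rule integral_dominated_convergence[where w = "\<lambda>_. 1"])
    show "AE z in N. (\<lambda>R. \<psi> R (\<lambda>k. Y' k z)) \<longlonglongrightarrow> 1"
    proof (rule AE_I2)
      fix z
      define R0 where "R0 = nat \<lceil>\<Sum>k\<in>K. \<bar>Y' k z\<bar>\<rceil>"
      have "\<psi> R (\<lambda>k. Y' k z) = 1" if "R0 \<le> R" for R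
        unfolding \<psi>_def
      proof (rule prod.neutral, rule ballI)
        fix k assume "k \<in> K"
        then have "\<bar>Y' k z\<bar> \<le> (\<Sum>k\<in>K. \<bar>Y' k z\<bar>)" using K by (intro member_le_sum) auto
        also have "\<dots> \<le> real R0" by (simp add: R0_def real_nat_ceiling_ge)
        also have "\<dots> \<le> real R" using that by simp
        finally show "\<kappa> R (Y' k z) = 1" by (simp add: \<kappa>_def)
      qed
      then show "(\<lambda>R. \<psi> R (\<lambda>k. Y' k z)) \<longlonglongrightarrow> 1"
        by (intro tendsto_eventually) (auto simp: eventually_sequentially)
    qed
    show "(\<lambda>z. \<psi> R (\<lambda>k. Y' k z)) \<in> borel_measurable N" for R
      unfolding \<psi>_def by measurable
    show "AE z in N. norm (\<psi> R (\<lambda>k. Y' k z)) \<le> 1" for R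
      using \<psi>_range[of R] by (intro AE_I2) (simp add: abs_of_nonneg)
  qed simp_all
  then have "(\<lambda>R. B * (1 - (LINT z|N. \<psi> R (\<lambda>k. Y' k z)))) \<longlonglongrightarrow> B * (1 - 1)"
    by (intro tendsto_intros) (simp add: N.prob_space)
  then have "\<forall>\<^sub>F R in sequentially. B * (1 - (LINT z|N. \<psi> R (\<lambda>k. Y' k z))) < e / 2"
    by (rule order_tendstoD) (use e in simp)
  \<comment> \<open>The cut-off radius depends on the limit law only; convergence of the integrals
    of the cut-off then bounds the mass of \<open>Y n\<close> outside for all large n.\<close>
  then obtain R where R: "B * (1 - (LINT z|N. \<psi> R (\<lambda>k. Y' k z))) < e / 2"
    by (auto dest: eventually_happens)
  have "(\<lambda>n. LINT z|M. \<psi> R (\<lambda>k. Y n k z)) \<longlonglongrightarrow> (LINT z|N. \<psi> R (\<lambda>k. Y' k z))"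
    unfolding \<psi>_def by (rule char_conv_imp_prod_conv[OF M N K meas conv]) (auto intro: \<kappa>_bump)
  then have "(\<lambda>n. B * (1 - (LINT z|M. \<psi> R (\<lambda>k. Y n k z)))) \<longlonglongrightarrow> B * (1 - (LINT z|N. \<psi> R (\<lambda>k. Y' k z)))"
    by (intro tendsto_intros)
  then have Rn: "\<forall>\<^sub>F n in sequentially. B * (1 - (LINT z|M. \<psi> R (\<lambda>k. Y n k z))) < e / 2"
    by (rule order_tendstoD) (rule R)
  \<comment> \<open>The grid has mesh 1 / m, fine enough that moving each of the
    \<open>card K\<close> coordinates by one mesh changes h by at most e / 2.\<close>
  define m where "m = nat \<lceil>2 * (L1 * card K) / e\<rceil> + 1"
  have m: "0 < real m" "L1 * card K / m \<le> e / 2"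
  proof -
    have "2 * (L1 * card K) / e \<le> real m" unfolding m_def by linarith
    then show "L1 * card K / m \<le> e / 2" using e by (simp add: m_def field_simps)
  qed (simp add: m_def)
  \<comment> \<open>The cut-off lives on \<bar>u\<bar> \<le> R + 1, and m (R + 1) \<le> Z - 1
    because m \<ge> 1, as \<open>sum_tents\<close> demands.\<close>
  define Z where "Z = m * (R + 2)"
  define \<tau> where "\<tau> j u = max 0 (min 1 (1 - \<bar>real m * u - of_int j\<bar>))" for j :: int and u
  have \<tau>_bump: "bump (\<tau> j)" for j
    unfolding \<tau>_def
  proof (rule bump_clamp[where L = "real m" and R = "\<bar>real_of_int j\<bar> + 1"])
    fix x y
    have "\<bar>(1 - \<bar>real m * x - of_int j\<bar>) - (1 - \<bar>real m * y - of_int j\<bar>)\<bar> \<le> \<bar>real m * x - real m * y\<bar>" by linarith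
    then show "\<bar>(1 - \<bar>real m * x - of_int j\<bar>) - (1 - \<bar>real m * y - of_int j\<bar>)\<bar> \<le> real m * \<bar>x - y\<bar>"
      by (simp add: abs_mult flip: right_diff_distrib)
  next
    fix x :: real assume "\<bar>real_of_int j\<bar> + 1 < \<bar>x\<bar>"
    moreover have "1 * \<bar>x\<bar> \<le> real m * \<bar>x\<bar>" using m(1) by (intro mult_right_mono) auto
    then have "\<bar>x\<bar> \<le> \<bar>real m * x\<bar>" by (simp add: abs_mult)
    ultimately show "1 - \<bar>real m * x - of_int j\<bar> \<le> 0" by linarith
  qed
  define f where "f j u = \<kappa> R u * \<tau> j u" for j u
  have f_bump: "bump (f j)" for j unfolding f_def by (intro bump_mult \<kappa>_bump \<tau>_bump)
  have [measurable]: "f j \<in> borel_measurable borel" for j by (rule bump_measurable[OF f_bump])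
  have f0: "0 \<le> f j u" for j u by (simp add: f_def \<tau>_def \<kappa>_range)
  have f_sum: "(\<Sum>j\<in>{- int Z..int Z}. f j u) = \<kappa> R u" for u
  proof (cases "\<kappa> R u = 0")
    case False
    then have "\<bar>u\<bar> \<le> real R + 1" by (auto simp: \<kappa>_def max_def min_def split: if_splits)
    then have "real m * \<bar>u\<bar> \<le> real m * (real R + 1)" using m(1) by (intro mult_left_mono) auto
    then have "\<bar>real m * u\<bar> \<le> real Z - 1" using m(1) by (simp add: Z_def abs_mult algebra_simps)
    from sum_tents[OF this] show ?thesis by (simp add: f_def \<tau>_def flip: sum_distrib_left)
  qed (simp add: f_def)
  define G where "G = PiE K (\<lambda>_. {- int Z..int Z})"
  have G: "finite G" unfolding G_def using K by (intro finite_PiE) auto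
  define S where "S x = (\<Sum>g\<in>G. h (\<lambda>k. of_int (g k) / real m) * (\<Prod>k\<in>K. f (g k) (x k)))" for x
  have \<psi>_eq: "\<psi> R x = (\<Sum>g\<in>G. \<Prod>k\<in>K. f (g k) (x k))" for x
    unfolding \<psi>_def G_def by (subst prod_sum_PiE[symmetric]) (auto simp: K f_sum)
  \<comment> \<open>Where the cut-off is below one, h contributes at most B times the missing
    weight; on the support of each product of tents, h is within e / 2 of its value at the grid
    point.\<close>
  have bound: "\<bar>h x - S x\<bar> \<le> B * (1 - \<psi> R x) + e / 2" for x
  proof -
    have "h x - S x = h x * (1 - \<psi> R x) + (\<Sum>g\<in>G. (h x - h (\<lambda>k. of_int (g k) / real m)) * (\<Prod>k\<in>K. f (g k) (x k)))"
      by (simp add: S_def \<psi>_eq sum_distrib_left left_diff_distrib right_diff_distrib sum_subtractf)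
    also have "\<bar>\<dots>\<bar> \<le> \<bar>h x * (1 - \<psi> R x)\<bar> + \<bar>\<Sum>g\<in>G. (h x - h (\<lambda>k. of_int (g k) / real m)) * (\<Prod>k\<in>K. f (g k) (x k))\<bar>"
      by (rule abs_triangle_ineq)
    also have "\<bar>h x * (1 - \<psi> R x)\<bar> \<le> B * (1 - \<psi> R x)"
      using B[of x] \<psi>_range[of R x] by (simp add: abs_mult mult_right_mono)
    also have "\<bar>\<Sum>g\<in>G. (h x - h (\<lambda>k. of_int (g k) / real m)) * (\<Prod>k\<in>K. f (g k) (x k))\<bar>
        \<le> (\<Sum>g\<in>G. e / 2 * (\<Prod>k\<in>K. f (g k) (x k)))"
    proof (rule order_trans[OF sum_abs], rule sum_mono)
      fix g assume "g \<in> G"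
      show "\<bar>(h x - h (\<lambda>k. of_int (g k) / real m)) * (\<Prod>k\<in>K. f (g k) (x k))\<bar> \<le> e / 2 * (\<Prod>k\<in>K. f (g k) (x k))"
      proof (cases "(\<Prod>k\<in>K. f (g k) (x k)) = 0")
        case False
        have near: "\<bar>x k - of_int (g k) / real m\<bar> \<le> 1 / real m" if "k \<in> K" for k
        proof -
          have "f (g k) (x k) \<noteq> 0" using False K that by (auto simp: prod_zero_iff)
          then have "\<bar>real m * x k - of_int (g k)\<bar> \<le> 1"
            by (auto simp: f_def \<tau>_def max_def min_def split: if_splits)
          moreover have "x k - of_int (g k) / real m = (real m * x k - of_int (g k)) / real m"
            using m(1) by (simp add: field_simps)
          ultimately show ?thesis using m(1) by (simp add: divide_right_mono)
        qed
        have "\<bar>h x - h (\<lambda>k. of_int (g k) / real m)\<bar> \<le> L1 * (\<Sum>k\<in>K. \<bar>x k - of_int (g k) / real m\<bar>)"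
          by (rule Lip1)
        also have "\<dots> \<le> L1 * (\<Sum>k\<in>K. 1 / real m)"
          by (intro mult_left_mono sum_mono near) (auto simp: L1_def)
        also have "\<dots> \<le> e / 2" using m(2) by simp
        finally show ?thesis unfolding abs_mult
          by (intro mult_mono) (use e in \<open>auto intro!: prod_nonneg f0 simp: abs_of_nonneg\<close>)
      qed simp
    qed
    also have "\<dots> = e / 2 * \<psi> R x" by (simp add: \<psi>_eq sum_distrib_left)
    also have "\<dots> \<le> e / 2 * 1" using e \<psi>_range by (intro mult_left_mono) auto
    finally show ?thesis by simp
  qed
  have close: "norm ((LINT z|P. h (\<lambda>k. W k z)) - (LINT z|P. S (\<lambda>k. W k z)))
      \<le> B * (1 - (LINT z|P. \<psi> R (\<lambda>k. W k z))) + e / 2"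
    if "prob_space P" and [measurable]: "\<And>k. k \<in> K \<Longrightarrow> W k \<in> borel_measurable P"
      "(\<lambda>z. h (\<lambda>k. W k z)) \<in> borel_measurable P" for P :: "'c measure" and W
  proof -
    interpret P: prob_space P by fact
    have i1: "integrable P (\<lambda>z. h (\<lambda>k. W k z))"
      by (rule P.integrable_const_bound[where B = B]) (auto simp: B)
    have i3: "integrable P (\<lambda>z. \<psi> R (\<lambda>k. W k z))"
    proof (rule P.integrable_const_bound[where B = 1])
      show "AE z in P. norm (\<psi> R (\<lambda>k. W k z)) \<le> 1" using \<psi>_range[of R] by (simp add: abs_of_nonneg)
    qed (unfold \<psi>_def, measurable)
    have i2: "integrable P (\<lambda>z. S (\<lambda>k. W k z))"
      unfolding S_def
    proof (intro Bochner_Integration.integrable_sum integrable_mult_right)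
      fix g
      show "integrable P (\<lambda>z. \<Prod>k\<in>K. f (g k) (W k z))"
      proof (rule P.integrable_const_bound[where B = 1])
        show "AE z in P. norm (\<Prod>k\<in>K. f (g k) (W k z)) \<le> 1"
          using f_bump unfolding prod_norm[symmetric] by (intro AE_I2 prod_le_1) (auto simp: bump_def)
      qed measurable
    qed
    have "(LINT z|P. h (\<lambda>k. W k z)) - (LINT z|P. S (\<lambda>k. W k z)) = (LINT z|P. h (\<lambda>k. W k z) - S (\<lambda>k. W k z))"
      using i1 i2 by simp
    also have "norm \<dots> \<le> (LINT z|P. norm (h (\<lambda>k. W k z) - S (\<lambda>k. W k z)))"
      by (rule integral_norm_bound)
    also have "\<dots> \<le> (LINT z|P. B * (1 - \<psi> R (\<lambda>k. W k z)) + e / 2)"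
      using i1 i2 i3 by (intro integral_mono) (auto intro: bound)
    also have "\<dots> = B * (1 - (LINT z|P. \<psi> R (\<lambda>k. W k z))) + e / 2"
      using i3 by (simp add: P.prob_space)
    finally show ?thesis .
  qed
  have "(\<lambda>n. LINT z|M. S (\<lambda>k. Y n k z)) \<longlonglongrightarrow> (LINT z|N. S (\<lambda>k. Y' k z))"
  proof -
    have i: "integrable P (\<lambda>z. \<Prod>k\<in>K. f (g k) (W k z))"
      if "prob_space P" and [measurable]: "\<And>k. k \<in> K \<Longrightarrow> W k \<in> borel_measurable P" for P :: "'c measure" and W g
    proof -
      interpret P: prob_space P by fact
      show ?thesis
      proof (rule P.integrable_const_bound[where B = 1])
        show "AE z in P. norm (\<Prod>k\<in>K. f (g k) (W k z)) \<le> 1"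
          using f_bump unfolding prod_norm[symmetric] by (intro AE_I2 prod_le_1) (auto simp: bump_def)
      qed measurable
    qed
    have "(\<lambda>n. \<Sum>g\<in>G. h (\<lambda>k. of_int (g k) / real m) * (LINT z|M. (\<Prod>k\<in>K. f (g k) (Y n k z))))
        \<longlonglongrightarrow> (\<Sum>g\<in>G. h (\<lambda>k. of_int (g k) / real m) * (LINT z|N. (\<Prod>k\<in>K. f (g k) (Y' k z))))"
      by (intro tendsto_sum tendsto_mult tendsto_const char_conv_imp_prod_conv[OF M N K meas conv])
        (auto intro: f_bump)
    then show ?thesis
      unfolding S_def using i[OF M meas(1)] i[OF N meas(2)]
      by (simp add: Bochner_Integration.integral_sum)
  qed
  moreover have "\<forall>\<^sub>F n in sequentially. norm ((LINT z|M. h (\<lambda>k. Y n k z)) - (LINT z|M. S (\<lambda>k. Y n k z))) \<le> e"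
    using Rn
  proof eventually_elim
    case (elim n)
    then show ?case using close[OF M meas(1)[of _ n] hm(1)[of n]] by simp
  qed
  moreover have "norm ((LINT z|N. h (\<lambda>k. Y' k z)) - (LINT z|N. S (\<lambda>k. Y' k z))) \<le> e"
    using close[OF N meas(2) hm(2)] R by simp
  ultimately show "\<exists>y l'. y \<longlonglongrightarrow> l' \<and>
      (\<forall>\<^sub>F n in sequentially. norm ((LINT z|M. h (\<lambda>k. Y n k z)) - y n) \<le> e) \<and>
      norm ((LINT z|N. h (\<lambda>k. Y' k z)) - l') \<le> e" by blast
qed

text \<open>Indicators of open boxes are limits of products of bumps.\<close>

lemma char_eq_imp_box_prob_eq:
  fixes Y :: "'k \<Rightarrow> 'a \<Rightarrow> real" and Y' :: "'k \<Rightarrow> 'b \<Rightarrow> real"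
  assumes M: "prob_space M" and N: "prob_space N" and K: "finite K"
    and meas[measurable]: "\<And>k. k \<in> K \<Longrightarrow> Y k \<in> borel_measurable M" "\<And>k. k \<in> K \<Longrightarrow> Y' k \<in> borel_measurable N"
    and eq: "\<And>a. (LINT z|M. iexp (\<Sum>k\<in>K. a k * Y k z)) = (LINT z|N. iexp (\<Sum>k\<in>K. a k * Y' k z))"
  shows "measure M {z \<in> space M. \<forall>k\<in>K. l k < Y k z \<and> Y k z < u k}
    = measure N {z \<in> space N. \<forall>k\<in>K. l k < Y' k z \<and> Y' k z < (u k :: real)}"
proof -
  define f where "f m k x = max 0 (min 1 (real m * min (x - l k) (u k - x)))" for m k x
  have f_bump: "bump (f m k)" for m k
    unfolding f_def
  proof (rule bump_clamp[where L = "real m" and R = "max \<bar>l k\<bar> \<bar>u k\<bar>"])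
    fix x y
    have "\<bar>min (x - l k) (u k - x) - min (y - l k) (u k - y)\<bar> \<le> \<bar>x - y\<bar>" by (auto simp: min_def)
    then have "real m * \<bar>min (x - l k) (u k - x) - min (y - l k) (u k - y)\<bar> \<le> real m * \<bar>x - y\<bar>"
      by (intro mult_left_mono) auto
    then show "\<bar>real m * min (x - l k) (u k - x) - real m * min (y - l k) (u k - y)\<bar> \<le> real m * \<bar>x - y\<bar>"
      by (metis abs_mult abs_of_nat right_diff_distrib)
  next
    fix x assume "max \<bar>l k\<bar> \<bar>u k\<bar> < \<bar>x\<bar>"
    then have "min (x - l k) (u k - x) \<le> 0" by (auto simp: min_def max_def split: if_splits)
    then show "real m * min (x - l k) (u k - x) \<le> 0" by (simp add: mult_nonneg_nonpos)
  qed
  have [measurable]: "f m k \<in> borel_measurable borel" for m k by (rule bump_measurable[OF f_bump])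
  have lim1: "(\<lambda>m. f m k x) \<longlonglongrightarrow> (if l k < x \<and> x < u k then 1 else 0)" for k x
  proof (cases "l k < x \<and> x < u k")
    case True
    define d where "d = min (x - l k) (u k - x)"
    have d: "0 < d" using True by (simp add: d_def)
    have "f m k x = 1" if "nat \<lceil>1 / d\<rceil> \<le> m" for m
    proof -
      have "1 / d \<le> real m" using that by linarith
      then have "1 \<le> real m * d" using d by (simp add: field_simps)
      then show ?thesis by (simp add: f_def d_def)
    qed
    then have "\<exists>N. \<forall>m\<ge>N. f m k x = 1" by blast
    then show ?thesis using True by (intro tendsto_eventually) (auto simp: eventually_sequentially)
  next
    case False
    then have le: "min (x - l k) (u k - x) \<le> 0" by auto
    have "real m * min (x - l k) (u k - x) \<le> 0" for m by (rule mult_nonneg_nonpos) (use le in auto)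
    moreover have "max 0 (min 1 r) = 0" if "r \<le> 0" for r :: real using that by simp
    ultimately have "f m k x = 0" for m unfolding f_def by blast
    then show ?thesis using False by auto
  qed
  have lim: "(\<lambda>m. LINT z|P. (\<Prod>k\<in>K. f m k (W k z))) \<longlonglongrightarrow> measure P {z \<in> space P. \<forall>k\<in>K. l k < W k z \<and> W k z < u k}"
    if "prob_space P" and [measurable]: "\<And>k. k \<in> K \<Longrightarrow> W k \<in> borel_measurable P" for P :: "'c measure" and W
  proof -
    interpret P: prob_space P by fact
    note [measurable] = K
    have set: "{z \<in> space P. \<forall>k\<in>K. l k < W k z \<and> W k z < u k} \<in> sets P"
      using K by measurable
    have "(\<lambda>m. LINT z|P. (\<Prod>k\<in>K. f m k (W k z)))
        \<longlonglongrightarrow> (LINT z|P. indicator {z \<in> space P. \<forall>k\<in>K. l k < W k z \<and> W k z < u k} z)"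
    proof (rule integral_dominated_convergence[where w = "\<lambda>_. 1"])
      show "AE z in P. (\<lambda>m. \<Prod>k\<in>K. f m k (W k z)) \<longlonglongrightarrow> indicator {z \<in> space P. \<forall>k\<in>K. l k < W k z \<and> W k z < u k} z"
      proof (rule AE_I2)
        fix z assume z: "z \<in> space P"
        have "(\<lambda>m. \<Prod>k\<in>K. f m k (W k z)) \<longlonglongrightarrow> (\<Prod>k\<in>K. if l k < W k z \<and> W k z < u k then 1 else 0)"
          by (intro tendsto_prod lim1)
        also have "(\<Prod>k\<in>K. if l k < W k z \<and> W k z < u k then 1 else 0)
            = (indicator {z \<in> space P. \<forall>k\<in>K. l k < W k z \<and> W k z < u k} z :: real)"
        proof (cases "\<forall>k\<in>K. l k < W k z \<and> W k z < u k")
          case False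
          then show ?thesis using K by (subst prod_zero) (auto simp: indicator_def)
        qed (use z in simp)
        finally show "(\<lambda>m. \<Prod>k\<in>K. f m k (W k z)) \<longlonglongrightarrow> indicator {z \<in> space P. \<forall>k\<in>K. l k < W k z \<and> W k z < u k} z" .
      qed
      show "AE z in P. norm (\<Prod>k\<in>K. f m k (W k z)) \<le> 1" for m
        using f_bump unfolding prod_norm[symmetric] by (intro AE_I2 prod_le_1) (auto simp: bump_def)
      show "(\<lambda>z. \<Prod>k\<in>K. f m k (W k z)) \<in> borel_measurable P" for m by measurable
    qed (use set in auto)
    then show ?thesis using set by simp
  qed
  \<comment> \<open>Equality of the characters makes the sequence that is constantly
    \<open>Y\<close> convergent in the sense required; its limit equals its terms.\<close>
  have "(LINT z|M. (\<Prod>k\<in>K. f m k (Y k z))) = (LINT z|N. (\<Prod>k\<in>K. f m k (Y' k z)))" for m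
  proof (rule LIMSEQ_unique)
    show "(\<lambda>n::nat. LINT z|M. (\<Prod>k\<in>K. f m k (Y k z))) \<longlonglongrightarrow> (LINT z|N. (\<Prod>k\<in>K. f m k (Y' k z)))"
      by (rule char_conv_imp_prod_conv[OF M N K, where Y = "\<lambda>_. Y"]) (simp_all only: eq f_bump meas tendsto_const)
  qed simp
  then show ?thesis using LIMSEQ_unique[OF lim[OF M meas(1)]] lim[OF N meas(2)] by simp
qed

text \<open>The joint law of \<open>D\<close> and the product of the marginal laws have the same
  characteristic functions, hence agree on boxes, which form an intersection-stable generator of the
  Borel sets.\<close>

lemma indep_vars_of_char:
  fixes D :: "'i \<Rightarrow> 'a \<Rightarrow> 'w::euclidean_space"
  assumes M: "prob_space M" and I: "finite I" and meas[measurable]: "\<And>i. i \<in> I \<Longrightarrow> D i \<in> borel_measurable M"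
    and eq: "\<And>a. (LINT z|M. iexp (\<Sum>i\<in>I. a i \<bullet> D i z)) = (\<Prod>i\<in>I. LINT z|M. iexp (a i \<bullet> D i z))"
  shows "prob_space.indep_vars M (\<lambda>_. borel) D I"
proof -
  interpret M: prob_space M by (rule M)
  define E where "E i = {D i -` A \<inter> space M | A. A \<in> range (\<lambda>(a, b). box a b)}" for i
  have gen: "sigma_sets (space M) (E i) = {D i -` A \<inter> space M | A. A \<in> sets borel}" if "i \<in> I" for i
  proof -
    have "sets (borel :: 'w measure) = sigma_sets UNIV (range (\<lambda>(a, b). box a b))"
      by (subst borel_eq_box) simp
    then show ?thesis unfolding E_def
      using sigma_sets_vimage_commute[of "D i" "space M" UNIV "range (\<lambda>(a, b). box a b)"] by simp
  qed
  have stable: "Int_stable (E i)" for i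
  proof (rule Int_stableI)
    fix a b assume "a \<in> E i" "b \<in> E i"
    then obtain l u l' u' where ab: "a = D i -` box l u \<inter> space M" "b = D i -` box l' u' \<inter> space M"
      by (auto simp: E_def)
    have "a \<inter> b = D i -` (box l u \<inter> box l' u') \<inter> space M" using ab by auto
    then show "a \<inter> b \<in> E i" unfolding Int_interval box_Int_box by (auto simp: E_def)
  qed
  have "M.indep_sets E I"
    unfolding M.indep_sets_def
  proof (intro conjI allI impI ballI)
    fix i assume "i \<in> I"
    then show "E i \<subseteq> M.events" by (auto simp: E_def)
  next
    fix J A assume J: "J \<subseteq> I" "J \<noteq> {}" "finite J" and A: "A \<in> Pi J E"
    have "\<forall>j\<in>J. \<exists>l u. A j = D j -` box l u \<inter> space M" using A by (force simp: E_def)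
    then obtain l u where lu: "\<And>j. j \<in> J \<Longrightarrow> A j = D j -` box (l j) (u j) \<inter> space M" by metis
    show "M.prob (\<Inter>j\<in>J. A j) = (\<Prod>j\<in>J. M.prob (A j))"
    proof (cases "\<forall>j\<in>J. box (l j) (u j) \<noteq> {}")
      case False
      then obtain j where "j \<in> J" "A j = {}" using lu by force
      then have "(\<Inter>j\<in>J. A j) = {}" "(\<Prod>j\<in>J. M.prob (A j)) = 0"
        using J by (auto intro!: prod_zero bexI[of _ j])
      then show ?thesis by simp
    next
      case True
      \<comment> \<open>Outside J the variable is replaced by zero, so that every \<open>Q j\<close>
        is a probability measure, as the product construction expects of all indices.\<close>
      define D' where "D' j = (if j \<in> J then D j else (\<lambda>_. 0))" for j
      have [measurable]: "D' j \<in> borel_measurable M" for j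
        using J by (auto simp: D'_def)
      define Q where "Q j = distr M borel (D' j)" for j
      have Q_prob: "prob_space (Q j)" for j unfolding Q_def by (rule M.prob_space_distr) simp
      interpret Q: finite_product_prob_space Q J
        using Q_prob J(3) by (simp add: finite_product_prob_space_def finite_product_sigma_finite_def
          product_prob_space_def product_sigma_finite_def product_prob_space_axioms_def
          finite_product_sigma_finite_axioms_def prob_space_imp_sigma_finite)
      let ?N = "PiM J Q"
      have [simp]: "sets (Q j) = sets borel" "space (Q j) = UNIV" for j by (simp_all add: Q_def)
      have Nm[measurable]: "(\<lambda>\<omega>. \<omega> j) \<in> borel_measurable ?N" if "j \<in> J" for j
        using measurable_component_singleton[OF that, of Q] by (simp cong: measurable_cong_sets)
      let ?K = "J \<times> (Basis :: 'w set)"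
      have chr: "(LINT z|M. iexp (\<Sum>k\<in>?K. a k * (D (fst k) z \<bullet> snd k)))
          = (LINT \<omega>|?N. iexp (\<Sum>k\<in>?K. a k * (\<omega> (fst k) \<bullet> snd k)))" for a
      proof -
        \<comment> \<open>Coefficients vanish outside J, so the factorisation over I restricts to J
          with all other factors equal to one.\<close>
        define \<alpha> where "\<alpha> i = (if i \<in> J then \<Sum>b\<in>Basis. a (i, b) *\<^sub>R b else 0)" for i
        have sum_eq: "(\<Sum>k\<in>?K. a k * (x (fst k) \<bullet> snd k)) = (\<Sum>j\<in>J. \<alpha> j \<bullet> x j)" for x
        proof -
          have "(\<Sum>k\<in>?K. a k * (x (fst k) \<bullet> snd k)) = (\<Sum>j\<in>J. \<Sum>b\<in>Basis. a (j, b) * (x j \<bullet> b))"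
            using J by (simp add: sum.cartesian_product case_prod_unfold)
          also have "\<dots> = (\<Sum>j\<in>J. \<alpha> j \<bullet> x j)"
            by (intro sum.cong) (simp_all add: \<alpha>_def inner_sum_left inner_commute[of "x _"])
          finally show ?thesis .
        qed
        have "(\<Sum>j\<in>J. \<alpha> j \<bullet> x j) = (\<Sum>i\<in>I. \<alpha> i \<bullet> x i)" for x
          using J I by (intro sum.mono_neutral_left) (auto simp: \<alpha>_def)
        then have "(LINT z|M. iexp (\<Sum>k\<in>?K. a k * (D (fst k) z \<bullet> snd k)))
            = (\<Prod>i\<in>I. LINT z|M. iexp (\<alpha> i \<bullet> D i z))"
          unfolding sum_eq[of "\<lambda>j. D j _"] using eq[of \<alpha>] by simp
        also have "\<dots> = (\<Prod>j\<in>J. LINT z|M. iexp (\<alpha> j \<bullet> D j z))"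
          using J I by (intro prod.mono_neutral_right) (auto simp: \<alpha>_def M.prob_space)
        also have "\<dots> = (\<Prod>j\<in>J. LINT x|Q j. iexp (\<alpha> j \<bullet> x))"
        proof (intro prod.cong refl)
          fix j assume "j \<in> J"
          then have "D' j = D j" by (simp add: D'_def)
          have "(LINT x|Q j. iexp (\<alpha> j \<bullet> x)) = (LINT z|M. iexp (\<alpha> j \<bullet> D' j z))"
            unfolding Q_def by (rule integral_distr) measurable
          then show "(LINT z|M. iexp (\<alpha> j \<bullet> D j z)) = (LINT x|Q j. iexp (\<alpha> j \<bullet> x))"
            unfolding \<open>D' j = D j\<close> by simp
        qed
        also have "\<dots> = (LINT \<omega>|?N. (\<Prod>j\<in>J. iexp (\<alpha> j \<bullet> \<omega> j)))"
        proof (rule Q.product_integral_prod[symmetric, OF J(3)])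
          fix j :: 'i
          have "(\<lambda>x. iexp (\<alpha> j \<bullet> x)) \<in> borel_measurable borel" by measurable
          then show "integrable (Q j) (\<lambda>x. iexp (\<alpha> j \<bullet> x))"
            by (intro finite_measure.integrable_const_bound[where B = 1] prob_space.finite_measure[OF Q_prob]) (auto simp: Q_def)
        qed
        also have "\<dots> = (LINT \<omega>|?N. iexp (\<Sum>k\<in>?K. a k * (\<omega> (fst k) \<bullet> snd k)))"
          unfolding sum_eq by (simp add: exp_sum[OF J(3)] sum_distrib_left)
        finally show ?thesis .
      qed
      have "M.prob {z \<in> space M. \<forall>k\<in>?K. l (fst k) \<bullet> snd k < D (fst k) z \<bullet> snd k \<and> D (fst k) z \<bullet> snd k < u (fst k) \<bullet> snd k}
         = measure ?N {\<omega> \<in> space ?N. \<forall>k\<in>?K. l (fst k) \<bullet> snd k < \<omega> (fst k) \<bullet> snd k \<and> \<omega> (fst k) \<bullet> snd k < u (fst k) \<bullet> snd k}"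
      proof (rule char_eq_imp_box_prob_eq[OF M, where Y = "\<lambda>k z. D (fst k) z \<bullet> snd k" and Y' = "\<lambda>k \<omega>. \<omega> (fst k) \<bullet> snd k"])
        show "prob_space ?N" by unfold_locales
        show "finite ?K" using J by simp
        show "(\<lambda>z. D (fst k) z \<bullet> snd k) \<in> borel_measurable M" if "k \<in> ?K" for k
          using that J by (intro borel_measurable_inner meas) auto
        show "(\<lambda>\<omega>. \<omega> (fst k) \<bullet> snd k) \<in> borel_measurable ?N" if "k \<in> ?K" for k
          using that by (intro borel_measurable_inner Nm) auto
      qed (rule chr)
      also have "{z \<in> space M. \<forall>k\<in>?K. l (fst k) \<bullet> snd k < D (fst k) z \<bullet> snd k \<and> D (fst k) z \<bullet> snd k < u (fst k) \<bullet> snd k} = (\<Inter>j\<in>J. A j)"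
        using J by (auto simp: lu mem_box)
      also have "{\<omega> \<in> space ?N. \<forall>k\<in>?K. l (fst k) \<bullet> snd k < \<omega> (fst k) \<bullet> snd k \<and> \<omega> (fst k) \<bullet> snd k < u (fst k) \<bullet> snd k}
          = PiE J (\<lambda>j. box (l j) (u j))"
        by (auto simp: space_PiM mem_box PiE_iff extensional_def)
      also have "measure ?N \<dots> = (\<Prod>j\<in>J. measure (Q j) (box (l j) (u j)))"
        by (rule Q.prob_times) simp
      also have "\<dots> = (\<Prod>j\<in>J. M.prob (A j))"
      proof (intro prod.cong refl)
        fix j assume "j \<in> J"
        then show "measure (Q j) (box (l j) (u j)) = M.prob (A j)"
          using J unfolding Q_def by (subst measure_distr) (auto simp: lu D'_def)
      qed
      finally show ?thesis .
    qed
  qed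
  then have "M.indep_sets (\<lambda>i. sigma_sets (space M) (E i)) I"
    by (rule M.indep_sets_sigma) (rule stable)
  then have "M.indep_sets (\<lambda>i. {D i -` A \<inter> space M | A. A \<in> sets borel}) I"
    by (simp add: gen cong: M.indep_sets_cong)
  then show ?thesis unfolding M.indep_vars_def2 by auto
qed

section \<open>Piecewise linear paths\<close>

definition pl :: "(nat \<Rightarrow> 'w::real_normed_vector) \<Rightarrow> real \<Rightarrow> 'w" where
  "pl \<xi> s = (let k = nat \<lfloor>s\<rfloor> in \<xi> k + (s - real k) *\<^sub>R (\<xi> (k + 1) - \<xi> k))"

lemma pl_of_nat [simp]: "pl \<xi> (real k) = \<xi> k"
  by (simp add: pl_def)

lemma pl_0 [simp]: "pl \<xi> 0 = \<xi> 0"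
  by (simp add: pl_def)

text \<open>Each increment enters with the time spent in its interval, clamped to [0, 1]. In this
  form the path is visibly continuous and Lipschitz in s, and linear in the increments.\<close>

lemma pl_eq_sum:
  assumes "0 \<le> s" "s \<le> real m"
  shows "pl \<xi> s = \<xi> 0 + (\<Sum>j<m. max 0 (min 1 (s - real j)) *\<^sub>R (\<xi> (Suc j) - \<xi> j))"
proof -
  define k where "k = nat \<lfloor>s\<rfloor>"
  have k: "real k \<le> s" "s < real k + 1" using assms by (simp_all add: k_def)
  have tele: "(\<Sum>j<k. max 0 (min 1 (s - real j)) *\<^sub>R (\<xi> (Suc j) - \<xi> j)) = \<xi> k - \<xi> 0"
  proof -
    have "max 0 (min 1 (s - real j)) = 1" if "j < k" for j
      using that k by (simp add: min_def)
    then have "(\<Sum>j<k. max 0 (min 1 (s - real j)) *\<^sub>R (\<xi> (Suc j) - \<xi> j)) = (\<Sum>j<k. \<xi> (Suc j) - \<xi> j)"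
      by (intro sum.cong) auto
    then show ?thesis by (simp add: sum_lessThan_telescope)
  qed
  show ?thesis
  proof (cases "k < m")
    case True
    have "(\<Sum>j<m. max 0 (min 1 (s - real j)) *\<^sub>R (\<xi> (Suc j) - \<xi> j))
        = (\<Sum>j<Suc k. max 0 (min 1 (s - real j)) *\<^sub>R (\<xi> (Suc j) - \<xi> j))"
    proof (rule sum.mono_neutral_right)
      show "\<forall>j\<in>{..<m} - {..<Suc k}. max 0 (min 1 (s - real j)) *\<^sub>R (\<xi> (Suc j) - \<xi> j) = 0"
      proof
        fix j assume "j \<in> {..<m} - {..<Suc k}"
        then have "s - real j \<le> 0" using k by auto
        then show "max 0 (min 1 (s - real j)) *\<^sub>R (\<xi> (Suc j) - \<xi> j) = 0" by simp
      qed
    qed (use True in auto)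
    also have "\<dots> = \<xi> k - \<xi> 0 + (s - real k) *\<^sub>R (\<xi> (Suc k) - \<xi> k)"
      unfolding sum.lessThan_Suc tele using k by simp
    finally show ?thesis by (simp add: pl_def Let_def flip: k_def)
  next
    case False
    then have "k = m" "s = real m" using assms k by linarith+
    then show ?thesis using tele by simp
  qed
qed

lemma continuous_on_pl: "continuous_on {0..} (pl \<xi>)"
  unfolding continuous_on_eq_continuous_within
proof
  fix s :: real assume s: "s \<in> {0..}"
  define m where "m = nat \<lceil>s\<rceil> + 1"
  have m: "s + 1 \<le> real m" using s by (simp add: m_def)
  have "continuous (at s within {0..}) (\<lambda>s. \<xi> 0 + (\<Sum>j<m. max 0 (min 1 (s - real j)) *\<^sub>R (\<xi> (Suc j) - \<xi> j)))"
    by (intro continuous_intros)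
  then show "continuous (at s within {0..}) (pl \<xi>)"
  proof (rule continuous_transform_within[where \<delta> = 1])
    fix s' assume "s' \<in> {0..}" "dist s' s < 1"
    then show "\<xi> 0 + (\<Sum>j<m. max 0 (min 1 (s' - real j)) *\<^sub>R (\<xi> (Suc j) - \<xi> j)) = pl \<xi> s'"
      using m by (subst pl_eq_sum[of s' m]) (auto simp: dist_real_def)
  qed (use s in auto)
qed

lemma pl_diff_le:
  assumes "0 \<le> s" "s \<le> real m" "\<xi> 0 = \<zeta> 0"
  shows "norm (pl \<xi> s - pl \<zeta> s) \<le> (\<Sum>j<m. norm ((\<xi> (Suc j) - \<xi> j) - (\<zeta> (Suc j) - \<zeta> j)))"
proof -
  have "pl \<xi> s - pl \<zeta> s = (\<Sum>j<m. max 0 (min 1 (s - real j)) *\<^sub>R ((\<xi> (Suc j) - \<xi> j) - (\<zeta> (Suc j) - \<zeta> j)))"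
    using assms by (simp add: pl_eq_sum[of s m] sum_subtractf[symmetric] scaleR_diff_right)
  also have "norm \<dots> \<le> (\<Sum>j<m. norm (max 0 (min 1 (s - real j)) *\<^sub>R ((\<xi> (Suc j) - \<xi> j) - (\<zeta> (Suc j) - \<zeta> j))))"
    by (rule norm_sum)
  also have "\<dots> \<le> (\<Sum>j<m. norm ((\<xi> (Suc j) - \<xi> j) - (\<zeta> (Suc j) - \<zeta> j)))"
    by (intro sum_mono) (simp add: mult_left_le_one_le)
  finally show ?thesis .
qed

text \<open>
  The refined and the coarse interpolation differ by tents of height equal to the midpoint
  displacements, and \<open>x \<le> c + x\<^sup>4 / c\<^sup>3\<close> turns the maximum of these into a sum.
\<close>

lemma pl_refine_le:
  assumes s: "0 \<le> s" "s \<le> real m" and c: "0 < c"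
  shows "norm (pl \<zeta> (2 * s) - pl (\<lambda>j. \<zeta> (2 * j)) s)
    \<le> c + (\<Sum>j<m. norm (\<zeta> (2 * j + 1) - (1 / 2) *\<^sub>R (\<zeta> (2 * j) + \<zeta> (2 * j + 2))) ^ 4) / c ^ 3"
proof -
  define j where "j = nat \<lfloor>s\<rfloor>"
  define u where "u = s - real j"
  define \<delta> where "\<delta> i = \<zeta> (2 * i + 1) - (1 / 2) *\<^sub>R (\<zeta> (2 * i) + \<zeta> (2 * i + 2))" for i
  have "real j = of_int \<lfloor>s\<rfloor>" using s by (simp add: j_def)
  then have u: "0 \<le> u" "u < 1" unfolding u_def by linarith+
  have p1: "pl (\<lambda>j. \<zeta> (2 * j)) s = \<zeta> (2 * j) + u *\<^sub>R (\<zeta> (2 * j + 2) - \<zeta> (2 * j))"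
    by (simp add: pl_def Let_def flip: j_def u_def)
  have p2: "pl \<zeta> (2 * s) = (if u < 1 / 2 then \<zeta> (2 * j) + (2 * u) *\<^sub>R (\<zeta> (2 * j + 1) - \<zeta> (2 * j))
      else \<zeta> (2 * j + 1) + (2 * u - 1) *\<^sub>R (\<zeta> (2 * j + 2) - \<zeta> (2 * j + 1)))"
  proof (cases "u < 1 / 2")
    case True
    have "\<lfloor>2 * s\<rfloor> = int (2 * j)"
      using u True by (intro floor_unique) (auto simp: u_def)
    then have "nat \<lfloor>2 * s\<rfloor> = 2 * j" by simp
    then show ?thesis using True by (simp add: pl_def u_def Let_def)
  next
    case False
    have "\<lfloor>2 * s\<rfloor> = int (2 * j + 1)"
      using u False by (intro floor_unique) (auto simp: u_def)
    then have "nat \<lfloor>2 * s\<rfloor> = 2 * j + 1" by simp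
    then show ?thesis using False by (simp add: pl_def u_def Let_def algebra_simps)
  qed
  have double: "(u * 2) *\<^sub>R v = u *\<^sub>R v + u *\<^sub>R v" for v :: 'a
    by (simp only: mult_2_right scaleR_add_left)
  have eq: "pl \<zeta> (2 * s) - pl (\<lambda>j. \<zeta> (2 * j)) s = (2 * min u (1 - u)) *\<^sub>R \<delta> j"
  proof (cases "u < 1 / 2")
    case True
    then have "min u (1 - u) = u" by simp
    then show ?thesis unfolding p1 p2 using True by (simp add: \<delta>_def algebra_simps double)
  next
    case False
    then have min: "min u (1 - u) = 1 - u" by simp
    define a b c where "a = \<zeta> (2 * j)" and "b = \<zeta> (2 * j + 1)" and "c = \<zeta> (2 * j + 2)"
    have "b + (2 * u - 1) *\<^sub>R (c - b) - (a + u *\<^sub>R (c - a)) = (2 * (1 - u)) *\<^sub>R (b - (1 / 2) *\<^sub>R (a + c))"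
      by (simp add: algebra_simps double scaleR_2)
    then show ?thesis unfolding p1 p2 min \<delta>_def a_def b_def c_def using False by simp
  qed
  show ?thesis
  proof (cases "j < m")
    case True
    have "norm (pl \<zeta> (2 * s) - pl (\<lambda>j. \<zeta> (2 * j)) s) \<le> 1 * norm (\<delta> j)"
      unfolding eq norm_scaleR using u by (intro mult_right_mono) (auto simp: min_def)
    also have "\<dots> \<le> c + norm (\<delta> j) ^ 4 / c ^ 3"
    proof (cases "norm (\<delta> j) \<le> c")
      case False
      then have "c ^ 3 \<le> norm (\<delta> j) ^ 3" using c by (intro power_mono) auto
      then have "norm (\<delta> j) * c ^ 3 \<le> norm (\<delta> j) * norm (\<delta> j) ^ 3" by (intro mult_left_mono) auto
      then have "norm (\<delta> j) \<le> norm (\<delta> j) ^ 4 / c ^ 3"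
        using c by (simp add: field_simps power3_eq_cube power4_eq_xxxx)
      then show ?thesis using c by simp
    qed (use c in \<open>simp add: add_increasing2\<close>)
    also have "norm (\<delta> j) ^ 4 \<le> (\<Sum>j<m. norm (\<delta> j) ^ 4)"
      using True by (intro member_le_sum) auto
    finally show ?thesis using c by (simp add: \<delta>_def divide_right_mono)
  next
    case False
    \<comment> \<open>The index j reaches m only at the right end s = m; the sum has no term for it,
      but the tent vanishes there.\<close>
    then have "u = 0" using s u by (simp add: u_def)
    then show ?thesis using eq c by (auto intro!: add_nonneg_nonneg sum_nonneg divide_nonneg_nonneg)
  qed
qed

lemma interpolated_path_eq:
  "interpolated_path \<xi> n = (\<lambda>t\<in>{0..}. (1 / sqrt (real n)) *\<^sub>R pl \<xi> (real n * t))"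
  by (simp add: interpolated_path_def pl_def Let_def)

lemma pl_path_space:
  assumes "\<xi> 0 = 0" "0 \<le> a"
  shows "(\<lambda>t\<in>{0..}. c *\<^sub>R pl \<xi> (a * t)) \<in> path_space"
proof -
  have "continuous_on {0..} (\<lambda>t. c *\<^sub>R pl \<xi> (a * t))"
    using assms by (intro continuous_intros continuous_on_compose2[OF continuous_on_pl]) auto
  then have "continuous_on {0..} (\<lambda>t\<in>{0..}. c *\<^sub>R pl \<xi> (a * t))"
    by (rule continuous_on_eq) simp
  then show ?thesis using assms by (simp add: path_space_def)
qed

section \<open>The path space\<close>

lemma path_space_continuous: "f \<in> path_space \<Longrightarrow> A \<subseteq> {0..} \<Longrightarrow> continuous_on A f"
  by (auto simp: path_space_def intro: continuous_on_subset)

lemma path_topology_mono: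
  assumes C: "0 < C" and le: "\<And>u. sqrt (g u u) \<le> C * sqrt (g' u u)" and U: "openin (path_topology g) U"
  shows "openin (path_topology g') U"
  unfolding openin_path_topology
proof (intro conjI ballI)
  show "U \<subseteq> path_space" using U by (simp add: openin_path_topology)
  fix f assume "f \<in> U"
  then obtain K \<epsilon> where K: "compact K" "K \<subseteq> {0..}" "0 < \<epsilon>" "path_nbhd g f K \<epsilon> \<subseteq> U"
    using U by (auto simp: openin_path_topology)
  have "path_nbhd g' f K (\<epsilon> / C) \<subseteq> path_nbhd g f K \<epsilon>"
  proof
    fix h assume h: "h \<in> path_nbhd g' f K (\<epsilon> / C)"
    have "sqrt (g (h t - f t) (h t - f t)) < \<epsilon>" if "t \<in> K" for t
    proof -
      have "C * sqrt (g' (h t - f t) (h t - f t)) < \<epsilon>"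
        using h that C by (auto simp: path_nbhd_def field_simps)
      then show ?thesis using le[of "h t - f t"] by linarith
    qed
    then show "h \<in> path_nbhd g f K \<epsilon>" using h by (simp add: path_nbhd_def)
  qed
  then show "\<exists>K \<epsilon>. compact K \<and> K \<subseteq> {0..} \<and> 0 < \<epsilon> \<and> path_nbhd g' f K \<epsilon> \<subseteq> U"
    using K C by (intro exI[of _ K] exI[of _ "\<epsilon> / C"]) auto
qed

text \<open>Equivalent norms define the same neighbourhoods up to a change of radius; this is what
  allows paths to be studied with the Euclidean inner product.\<close>

lemma path_topology_eq_inner:
  assumes "0 < c" "0 < C" "\<And>u. c * norm u \<le> sqrt (g u u)" "\<And>u. sqrt (g u u) \<le> C * norm u"
  shows "path_topology g = path_topology (\<bullet>)"
proof -
  have "openin (path_topology g) U \<longleftrightarrow> openin (path_topology (\<bullet>)) U" for U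
  proof
    show "openin (path_topology (\<bullet>)) U" if "openin (path_topology g) U"
      using path_topology_mono[OF assms(2) _ that] assms(4) by (simp flip: norm_eq_sqrt_inner)
    show "openin (path_topology g) U" if "openin (path_topology (\<bullet>)) U"
    proof (rule path_topology_mono[OF _ _ that])
      show "sqrt (u \<bullet> u) \<le> 1 / c * sqrt (g u u)" for u
        using assms(1) assms(3)[of u] by (simp add: field_simps flip: norm_eq_sqrt_inner)
    qed (use assms in auto)
  qed
  then show ?thesis by (simp add: topology_eq)
qed

text \<open>One of the seminorm distances that generate the topology; continuity of the paths makes
  the supremum finite.\<close>

definition path_dist :: "nat \<Rightarrow> (real \<Rightarrow> 'w::euclidean_space) \<Rightarrow> (real \<Rightarrow> 'w) \<Rightarrow> real" where
  "path_dist k f h = (SUP t\<in>{0..real k}. norm (f t - h t))"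

lemma path_dist_upper:
  assumes "f \<in> path_space" "h \<in> path_space" "0 \<le> t" "t \<le> real k"
  shows "norm (f t - h t) \<le> path_dist k f h"
  unfolding path_dist_def
proof (rule cSUP_upper)
  have "compact ((\<lambda>t. norm (f t - h t)) ` {0..real k})"
    using assms by (intro compact_continuous_image continuous_intros path_space_continuous) auto
  then show "bdd_above ((\<lambda>t. norm (f t - h t)) ` {0..real k})"
    by (intro bounded_imp_bdd_above compact_imp_bounded)
qed (use assms in auto)

lemma path_dist_le: "(\<And>t. 0 \<le> t \<Longrightarrow> t \<le> real k \<Longrightarrow> norm (f t - h t) \<le> e) \<Longrightarrow> path_dist k f h \<le> e"
  unfolding path_dist_def by (rule cSUP_least) auto

lemma path_dist_nonneg: "f \<in> path_space \<Longrightarrow> h \<in> path_space \<Longrightarrow> 0 \<le> path_dist k f h"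
  by (rule order_trans[OF norm_ge_zero path_dist_upper[of f h 0 k]]) auto

lemma path_dist_same: "f \<in> path_space \<Longrightarrow> path_dist k f f = 0"
  using path_dist_le[of k f f 0] path_dist_nonneg[of f f k] by simp

lemma path_dist_commute: "path_dist k f h = path_dist k h f"
  by (simp add: path_dist_def norm_minus_commute)

lemma path_dist_triangle:
  assumes "f \<in> path_space" "h \<in> path_space" "j \<in> path_space"
  shows "path_dist k f j \<le> path_dist k f h + path_dist k h j"
proof (rule path_dist_le)
  fix t assume t: "0 \<le> t" "t \<le> real k"
  have "norm (f t - j t) \<le> norm (f t - h t) + norm (h t - j t)"
    using norm_triangle_ineq[of "f t - h t" "h t - j t"] by simp
  then show "norm (f t - j t) \<le> path_dist k f h + path_dist k h j"
    using path_dist_upper[OF assms(1,2) t] path_dist_upper[OF assms(2,3) t] by linarith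
qed

lemma path_dist_mono:
  assumes "f \<in> path_space" "h \<in> path_space" "k \<le> l"
  shows "path_dist k f h \<le> path_dist l f h"
  by (rule path_dist_le, rule path_dist_upper) (use assms in auto)

text \<open>Every compact set of times lies in some [0, k]. Conversely, a strict pointwise bound
  passes to the supremum only as \<open>\<le>\<close>, so the radius is halved.\<close>

lemma openin_path_inner:
  "openin (path_topology (\<bullet>)) U \<longleftrightarrow> U \<subseteq> path_space \<and>
     (\<forall>f\<in>U. \<exists>k e. 0 < e \<and> (\<forall>h\<in>path_space. path_dist k f h < e \<longrightarrow> h \<in> U))"
proof -
  have key: "(\<exists>K \<epsilon>. compact K \<and> K \<subseteq> {0..} \<and> 0 < \<epsilon> \<and> path_nbhd (\<bullet>) f K \<epsilon> \<subseteq> U)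
      \<longleftrightarrow> (\<exists>k e. 0 < e \<and> (\<forall>h\<in>path_space. path_dist k f h < e \<longrightarrow> h \<in> U))"
    if f: "f \<in> path_space" for f
  proof safe
    fix K :: "real set" and \<epsilon> :: real
    assume K: "compact K" "K \<subseteq> {0..}" "0 < \<epsilon>" "path_nbhd (\<bullet>) f K \<epsilon> \<subseteq> U"
    obtain b where b: "\<And>t. t \<in> K \<Longrightarrow> norm t \<le> b" using compact_imp_bounded[OF K(1)] by (auto simp: bounded_iff)
    have "h \<in> U" if "h \<in> path_space" "path_dist (nat \<lceil>b\<rceil>) f h < \<epsilon>" for h
    proof -
      have "norm (h t - f t) < \<epsilon>" if "t \<in> K" for t
      proof -
        have "t \<le> real (nat \<lceil>b\<rceil>)" using b[OF that] K(2) that by (simp add: real_nat_ceiling_ge order_trans[of t b])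
        then show ?thesis
          using path_dist_upper[OF f \<open>h \<in> path_space\<close>, of t "nat \<lceil>b\<rceil>"] K(2) \<open>t \<in> K\<close> \<open>path_dist _ f h < \<epsilon>\<close>
          by (auto simp: norm_minus_commute)
      qed
      then show ?thesis using K(4) that by (auto simp: path_nbhd_def simp flip: norm_eq_sqrt_inner)
    qed
    then show "\<exists>k e. 0 < e \<and> (\<forall>h\<in>path_space. path_dist k f h < e \<longrightarrow> h \<in> U)" using K(3) by blast
  next
    fix k :: nat and e :: real
    assume e: "0 < e" "\<forall>h\<in>path_space. path_dist k f h < e \<longrightarrow> h \<in> U"
    have "path_nbhd (\<bullet>) f {0..real k} (e / 2) \<subseteq> U"
    proof
      fix h assume h: "h \<in> path_nbhd (\<bullet>) f {0..real k} (e / 2)"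
      have "path_dist k f h \<le> e / 2"
        using h by (intro path_dist_le) (auto simp: path_nbhd_def norm_minus_commute simp flip: norm_eq_sqrt_inner intro: less_imp_le)
      then show "h \<in> U" using e h by (auto simp: path_nbhd_def)
    qed
    then show "\<exists>K \<epsilon>. compact K \<and> K \<subseteq> {0..} \<and> 0 < \<epsilon> \<and> path_nbhd (\<bullet>) f K \<epsilon> \<subseteq> U"
      using e by (intro exI[of _ "{0..real k}"] exI[of _ "e / 2"]) auto
  qed
  show ?thesis unfolding openin_path_topology
    by (rule conj_cong[OF refl], rule ball_cong[OF refl], rule key) blast
qed

section \<open>Dyadic interpolation and semicontinuous functionals\<close>

definition dyadic :: "nat \<Rightarrow> (real \<Rightarrow> 'w::euclidean_space) \<Rightarrow> real \<Rightarrow> 'w" where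
  "dyadic N f = (\<lambda>t\<in>{0..}. pl (\<lambda>j. f (real j / 2 ^ N)) (2 ^ N * t))"

lemma dyadic_path_space: "f \<in> path_space \<Longrightarrow> dyadic N f \<in> path_space"
  using pl_path_space[of "\<lambda>j. f (real j / 2 ^ N)" "2 ^ N" 1]
  by (simp add: dyadic_def path_space_def)

lemma dyadic_tendsto:
  assumes f: "f \<in> path_space"
  shows "(\<lambda>N. path_dist k (dyadic N f) f) \<longlonglongrightarrow> 0"
proof (rule LIMSEQ_I)
  fix e :: real assume e: "0 < e"
  \<comment> \<open>The right dyadic node of a time t \<le> k may exceed k, by at most one.\<close>
  have "uniformly_continuous_on {0..real k + 1} f"
    using f by (intro compact_uniformly_continuous path_space_continuous) auto
  then obtain d where d: "0 < d" "\<And>s t. s \<in> {0..real k + 1} \<Longrightarrow> t \<in> {0..real k + 1} \<Longrightarrow> dist s t < d \<Longrightarrow> dist (f s) (f t) < e / 2"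
    unfolding uniformly_continuous_on_def using e by (metis half_gt_zero)
  have "(\<lambda>N. (1 / 2) ^ N :: real) \<longlonglongrightarrow> 0" by (rule LIMSEQ_realpow_zero) auto
  from LIMSEQ_D[OF this d(1)] obtain N0 where N0: "\<And>N. N0 \<le> N \<Longrightarrow> (1 / 2) ^ N < d" by auto
  have "path_dist k (dyadic N f) f \<le> e / 2" if "N0 \<le> N" for N
  proof (rule path_dist_le)
    fix t :: real assume t: "0 \<le> t" "t \<le> real k"
    define j where "j = nat \<lfloor>2 ^ N * t\<rfloor>"
    define u where "u = 2 ^ N * t - real j"
    have "real j = of_int \<lfloor>2 ^ N * t\<rfloor>" using t by (simp add: j_def)
    then have u: "0 \<le> u" "u < 1" unfolding u_def by linarith+
    have 1: "(1::real) \<le> 2 ^ N" by simp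
    have j: "real j / 2 ^ N \<le> t" "t \<le> (real j + 1) / 2 ^ N"
      using u by (simp_all add: u_def field_simps)
    have step: "(real j + 1) / 2 ^ N = real j / 2 ^ N + (1 / 2) ^ N"
      by (simp add: add_divide_distrib power_one_over)
    have "(1 / 2 :: real) ^ N \<le> 1" by (simp add: power_le_one)
    have close: "norm (f (real j / 2 ^ N) - f t) \<le> e / 2" "norm (f ((real j + 1) / 2 ^ N) - f t) \<le> e / 2"
    proof -
      have "dist (f (real j / 2 ^ N)) (f t) < e / 2"
        using t j step N0[OF that] \<open>(1 / 2 :: real) ^ N \<le> 1\<close>
        by (intro d(2)) (auto simp: dist_real_def intro: divide_nonneg_pos)
      then show "norm (f (real j / 2 ^ N) - f t) \<le> e / 2" by (simp add: dist_norm)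
      have "dist (f ((real j + 1) / 2 ^ N)) (f t) < e / 2"
        using t j step N0[OF that] \<open>(1 / 2 :: real) ^ N \<le> 1\<close>
        by (intro d(2)) (auto simp: dist_real_def)
      then show "norm (f ((real j + 1) / 2 ^ N) - f t) \<le> e / 2" by (simp add: dist_norm)
    qed
    have "dyadic N f t = pl (\<lambda>j. f (real j / 2 ^ N)) (2 ^ N * t)" using t by (simp add: dyadic_def)
    also have "\<dots> = f (real j / 2 ^ N) + u *\<^sub>R (f ((real j + 1) / 2 ^ N) - f (real j / 2 ^ N))"
      unfolding pl_def Let_def j_def[symmetric] u_def by (simp add: add.commute)
    finally have "dyadic N f t - f t = (1 - u) *\<^sub>R (f (real j / 2 ^ N) - f t) + u *\<^sub>R (f ((real j + 1) / 2 ^ N) - f t)"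
      by (simp add: algebra_simps)
    also have "norm \<dots> \<le> norm ((1 - u) *\<^sub>R (f (real j / 2 ^ N) - f t)) + norm (u *\<^sub>R (f ((real j + 1) / 2 ^ N) - f t))"
      by (rule norm_triangle_ineq)
    also have "\<dots> \<le> (1 - u) * (e / 2) + u * (e / 2)"
      using u close by (intro add_mono) (simp_all only: norm_scaleR abs_of_nonneg mult_left_mono diff_ge_0_iff_ge less_imp_le)
    also have "\<dots> = e / 2" by (simp add: field_simps)
    finally show "norm (dyadic N f t - f t) \<le> e / 2" .
  qed
  then show "\<exists>N0. \<forall>N\<ge>N0. norm (path_dist k (dyadic N f) f - 0) < e"
    using e path_dist_nonneg[OF dyadic_path_space[OF f] f]
    by (intro exI[of _ N0]) (fastforce simp: abs_of_nonneg)
qed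

definition path_lipschitz :: "nat \<Rightarrow> real \<Rightarrow> ((real \<Rightarrow> 'w::euclidean_space) \<Rightarrow> real) \<Rightarrow> bool" where
  "path_lipschitz k L F \<longleftrightarrow> (\<forall>f\<in>path_space. \<forall>h\<in>path_space. \<bar>F f - F h\<bar> \<le> L * path_dist k f h)"

text \<open>Lower semicontinuity in terms of the seminorms. It covers bounded continuous functionals
  together with their negatives, as weak convergence needs, and indicators of open sets, as
  measurability needs.\<close>

definition path_lsc :: "((real \<Rightarrow> 'w::euclidean_space) \<Rightarrow> real) \<Rightarrow> bool" where
  "path_lsc F \<longleftrightarrow> (\<forall>f\<in>path_space. \<forall>e>0. \<exists>k d. 0 < d \<and> (\<forall>h\<in>path_space. path_dist k f h < d \<longrightarrow> F f - e < F h))"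

lemma zero_path: "(\<lambda>t\<in>{0..}. 0) \<in> path_space"
  using pl_path_space[of "\<lambda>_. 0" 0 0] by simp

lemma path_lipschitz_nonneg:
  assumes "path_lipschitz k L F" shows "path_lipschitz k \<bar>L\<bar> F"
  unfolding path_lipschitz_def
proof (intro ballI)
  fix f h :: "real \<Rightarrow> 'a" assume "f \<in> path_space" "h \<in> path_space"
  then have "\<bar>F f - F h\<bar> \<le> L * path_dist k f h" using assms by (auto simp: path_lipschitz_def)
  also have "\<dots> \<le> \<bar>L\<bar> * path_dist k f h"
    using path_dist_nonneg[OF \<open>f \<in> path_space\<close> \<open>h \<in> path_space\<close>] by (intro mult_right_mono) auto
  finally show "\<bar>F f - F h\<bar> \<le> \<bar>L\<bar> * path_dist k f h" .
qed

text \<open>The approximation from below is \<open>f \<mapsto> inf\<^sub>h (F h + k d\<^sub>k(f, h))\<close>.\<close>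

lemma path_lsc_approx:
  assumes F: "path_lsc F" and B: "\<And>f. f \<in> path_space \<Longrightarrow> \<bar>F f\<bar> \<le> B"
  obtains G where "\<And>k. path_lipschitz k (real k) (G k)"
    "\<And>k f. f \<in> path_space \<Longrightarrow> \<bar>G k f\<bar> \<le> B" "\<And>k f. f \<in> path_space \<Longrightarrow> G k f \<le> F f"
    "\<And>f. f \<in> path_space \<Longrightarrow> (\<lambda>k. G k f) \<longlonglongrightarrow> F f"
proof -
  define G where "G k f = (INF h\<in>path_space. F h + real k * path_dist k f h)" for k f
  have bdd: "bdd_below ((\<lambda>h. F h + real k * path_dist k f h) ` path_space)" if "f \<in> path_space" for k f
  proof (rule bdd_belowI2[where m = "- B"])
    fix h assume "h \<in> (path_space :: (real \<Rightarrow> 'a) set)"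
    then show "- B \<le> F h + real k * path_dist k f h"
      using B[of h] path_dist_nonneg[OF that, of h k] mult_nonneg_nonneg[of "real k" "path_dist k f h"] by linarith
  qed
  have upper: "G k f \<le> F h + real k * path_dist k f h" if "f \<in> path_space" "h \<in> path_space" for k f h
    unfolding G_def by (rule cINF_lower[OF bdd]) (use that in auto)
  have lower: "c \<le> G k f" if "\<And>h. h \<in> path_space \<Longrightarrow> c \<le> F h + real k * path_dist k f h" for c k f
    unfolding G_def by (rule cINF_greatest) (use that zero_path in auto)
  have GF: "G k f \<le> F f" if "f \<in> path_space" for k f
    using upper[OF that that] path_dist_same[OF that] by simp
  have GB: "- B \<le> G k f" if "f \<in> path_space" for k f
  proof (rule lower)
    fix h assume "h \<in> (path_space :: (real \<Rightarrow> 'a) set)"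
    then show "- B \<le> F h + real k * path_dist k f h"
      using B[of h] path_dist_nonneg[OF that, of h k] mult_nonneg_nonneg[of "real k" "path_dist k f h"] by linarith
  qed
  have half: "G k f - G k h \<le> real k * path_dist k f h" if fh: "f \<in> path_space" "h \<in> path_space" for k f h
  proof -
    have "G k f - real k * path_dist k f h \<le> G k h"
    proof (rule lower)
      fix j assume j: "j \<in> (path_space :: (real \<Rightarrow> 'a) set)"
      have "G k f \<le> F j + real k * path_dist k f j" by (rule upper[OF fh(1) j])
      also have "real k * path_dist k f j \<le> real k * (path_dist k f h + path_dist k h j)"
        by (intro mult_left_mono path_dist_triangle fh j) simp
      finally show "G k f - real k * path_dist k f h \<le> F j + real k * path_dist k h j"
        by (simp add: algebra_simps)
    qed
    then show ?thesis by simp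
  qed
  show ?thesis
  proof
    show "path_lipschitz k (real k) (G k)" for k
      unfolding path_lipschitz_def
    proof (intro ballI)
      fix f h assume "f \<in> (path_space :: (real \<Rightarrow> 'a) set)" "h \<in> (path_space :: (real \<Rightarrow> 'a) set)"
      then show "\<bar>G k f - G k h\<bar> \<le> real k * path_dist k f h"
        using half[of f h k] half[of h f k] path_dist_commute[of k f h] by simp
    qed
    show "\<bar>G k f\<bar> \<le> B" if "f \<in> path_space" for k f
      using GF[OF that, of k] GB[OF that, of k] B[OF that] by simp
    show "(\<lambda>k. G k f) \<longlonglongrightarrow> F f" if f: "f \<in> path_space" for f
    proof (rule LIMSEQ_I)
      fix e :: real assume e: "0 < e"
      then obtain k0 d where d: "0 < d" "\<And>h. h \<in> path_space \<Longrightarrow> path_dist k0 f h < d \<Longrightarrow> F f - e / 2 < F h"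
        using F f unfolding path_lsc_def by (metis half_gt_zero)
      \<comment> \<open>Beyond distance d the penalty is at least 2 B and outweighs any variation of
        F; below it semicontinuity applies. The same k serves as index and as penalty factor, since
        the seminorms increase with k.\<close>
      define k1 where "k1 = max k0 (nat \<lceil>2 * B / d\<rceil>)"
      have "norm (G k f - F f) < e" if "k1 \<le> k" for k
      proof -
        have "2 * B / d \<le> real k" using that unfolding k1_def by linarith
        then have kd: "2 * B \<le> real k * d" using d by (simp add: field_simps)
        have "F f - e / 2 \<le> G k f"
        proof (rule lower)
          fix h assume h: "h \<in> (path_space :: (real \<Rightarrow> 'a) set)"
          show "F f - e / 2 \<le> F h + real k * path_dist k f h"
          proof (cases "path_dist k0 f h < d")
            case True
            have "0 \<le> real k * path_dist k f h" using path_dist_nonneg[OF f h, of k] by simp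
            then show ?thesis using d(2)[OF h True] e by linarith
          next
            case False
            have "d \<le> path_dist k f h"
              using False path_dist_mono[OF f h, of k0 k] that by (simp add: k1_def)
            then have "real k * d \<le> real k * path_dist k f h" by (intro mult_left_mono) auto
            then show ?thesis using kd B[OF f] B[OF h] e by linarith
          qed
        qed
        then show ?thesis using GF[OF f, of k] e by (simp add: abs_if)
      qed
      then show "\<exists>k1. \<forall>k\<ge>k1. norm (G k f - F f) < e" by blast
    qed
  qed (rule GF)
qed

lemma continuous_map_path_lsc:
  assumes "continuous_map (path_topology (\<bullet>)) euclideanreal F"
  shows "path_lsc F"
  unfolding path_lsc_def
proof (intro ballI allI impI)
  fix f :: "real \<Rightarrow> 'a" and e :: real assume f: "f \<in> path_space" and e: "0 < e"
  have "openin (path_topology (\<bullet>)) {h \<in> topspace (path_topology (\<bullet>)). F h \<in> {F f - e<..}}"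
    using assms by (rule openin_continuous_map_preimage) (simp flip: open_openin)
  then show "\<exists>k d. 0 < d \<and> (\<forall>h\<in>path_space. path_dist k f h < d \<longrightarrow> F f - e < F h)"
    unfolding openin_path_inner topspace_path_topology using f e by fastforce
qed

section \<open>Borel sets and path-valued maps\<close>

lemma space_path_borel: "space (path_borel g) = path_space"
  and sets_path_borel: "sets (path_borel g) = sigma_sets path_space {U. openin (path_topology g) U}"
proof -
  have "{U. openin (path_topology g) U} \<subseteq> Pow path_space"
    using openin_subset topspace_path_topology by blast
  then show "space (path_borel g) = path_space"
    "sets (path_borel g) = sigma_sets path_space {U. openin (path_topology g) U}"
    by (simp_all add: path_borel_def space_measure_of_conv)
qed

lemma continuous_map_path_borel_measurable:
  assumes "continuous_map (path_topology g) euclideanreal F"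
  shows "F \<in> borel_measurable (path_borel g)"
proof (rule borel_measurableI)
  fix U :: "real set" assume "open U"
  then have "openin (path_topology g) {f \<in> topspace (path_topology g). F f \<in> U}"
    using assms by (intro openin_continuous_map_preimage) (auto simp flip: open_openin)
  moreover have "F -` U \<inter> space (path_borel g) = {f \<in> topspace (path_topology g). F f \<in> U}"
    by (auto simp: space_path_borel topspace_path_topology)
  ultimately show "F -` U \<inter> space (path_borel g) \<in> sets (path_borel g)"
    by (auto simp: sets_path_borel)
qed

lemma path_eval_measurable:
  fixes g :: "'w::euclidean_space \<Rightarrow> 'w \<Rightarrow> real"
  assumes g: "path_topology g = path_topology (\<bullet>)" and t: "0 \<le> t"
  shows "(\<lambda>f. f t) \<in> borel_measurable (path_borel g)"
proof (rule borel_measurableI)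
  fix U :: "'w set" assume U: "open U"
  have "openin (path_topology (\<bullet>)) {f \<in> path_space. f t \<in> U}"
    unfolding openin_path_inner
  proof (intro conjI ballI)
    fix f :: "real \<Rightarrow> 'w" assume "f \<in> {f \<in> path_space. f t \<in> U}"
    then have f: "f \<in> path_space" "f t \<in> U" by auto
    then obtain e where e: "0 < e" "\<And>y. dist y (f t) < e \<Longrightarrow> y \<in> U" using U by (metis open_dist)
    have "h t \<in> U" if "h \<in> path_space" "path_dist (nat \<lceil>t\<rceil>) f h < e" for h
      using that path_dist_upper[OF f(1) that(1) t, of "nat \<lceil>t\<rceil>"]
      by (intro e(2)) (auto simp: dist_norm norm_minus_commute real_nat_ceiling_ge)
    then show "\<exists>k e. 0 < e \<and> (\<forall>h\<in>path_space. path_dist k f h < e \<longrightarrow> h \<in> {f \<in> path_space. f t \<in> U})"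
      using e(1) by (intro exI[of _ "nat \<lceil>t\<rceil>"] exI[of _ e]) auto
  qed auto
  moreover have "(\<lambda>f. f t) -` U \<inter> space (path_borel g) = {f \<in> path_space. f t \<in> U}"
    by (auto simp: space_path_borel)
  ultimately show "(\<lambda>f. f t) -` U \<inter> space (path_borel g) \<in> sets (path_borel g)"
    by (simp add: sets_path_borel g)
qed

text \<open>Subtracting the initial value yields a path for every sequence, so a functional of it is
  defined on the whole product space.\<close>

definition path_of_values :: "nat \<Rightarrow> (nat \<Rightarrow> 'w::euclidean_space) \<Rightarrow> real \<Rightarrow> 'w" where
  "path_of_values N \<xi> = (\<lambda>t\<in>{0..}. pl (\<lambda>j. \<xi> j - \<xi> 0) (2 ^ N * t))"

lemma path_of_values_path_space: "path_of_values N \<xi> \<in> path_space"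
  using pl_path_space[of "\<lambda>j. \<xi> j - \<xi> 0" "2 ^ N" 1] by (simp add: path_of_values_def)

lemma path_of_values_dist:
  "path_dist k (path_of_values N \<xi>) (path_of_values N \<zeta>)
    \<le> (\<Sum>j<k * 2 ^ N. norm ((\<xi> (Suc j) - \<xi> j) - (\<zeta> (Suc j) - \<zeta> j)))"
proof (rule path_dist_le)
  fix t :: real assume t: "0 \<le> t" "t \<le> real k"
  then have "2 ^ N * t \<le> real (k * 2 ^ N)" by (simp add: mult.commute)
  then have "norm (pl (\<lambda>j. \<xi> j - \<xi> 0) (2 ^ N * t) - pl (\<lambda>j. \<zeta> j - \<zeta> 0) (2 ^ N * t))
      \<le> (\<Sum>j<k * 2 ^ N. norm (((\<xi> (Suc j) - \<xi> 0) - (\<xi> j - \<xi> 0)) - ((\<zeta> (Suc j) - \<zeta> 0) - (\<zeta> j - \<zeta> 0))))"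
    using t by (intro pl_diff_le) auto
  then show "norm (path_of_values N \<xi> t - path_of_values N \<zeta> t)
      \<le> (\<Sum>j<k * 2 ^ N. norm ((\<xi> (Suc j) - \<xi> j) - (\<zeta> (Suc j) - \<zeta> j)))"
    using t by (simp add: path_of_values_def)
qed

lemma path_of_values_dyadic: "f \<in> path_space \<Longrightarrow> path_of_values N (\<lambda>j. f (real j / 2 ^ N)) = dyadic N f"
  by (simp add: path_of_values_def dyadic_def path_space_def)

lemma path_lipschitz_dyadic_tendsto:
  assumes F: "path_lipschitz k L F" and f: "f \<in> path_space"
  shows "(\<lambda>N. F (dyadic N f)) \<longlonglongrightarrow> F f"
proof (rule LIM_zero_cancel, rule Lim_null_comparison)
  show "\<forall>\<^sub>F N in sequentially. norm (F (dyadic N f) - F f) \<le> L * path_dist k (dyadic N f) f"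
    using F f by (intro always_eventually) (auto simp: path_lipschitz_def dyadic_path_space)
  show "(\<lambda>N. L * path_dist k (dyadic N f) f) \<longlonglongrightarrow> 0"
    using tendsto_mult_left[OF dyadic_tendsto[OF f]] by simp
qed

text \<open>After dyadic interpolation, a Lipschitz functional is a continuous function of the
  sequence of values at dyadic times, controlled by finitely many increments; letting the level tend
  to infinity gives the functional itself.\<close>

lemma path_lipschitz_measurable:
  fixes X :: "'a \<Rightarrow> real \<Rightarrow> 'w::euclidean_space"
  assumes X: "\<And>z. z \<in> space M \<Longrightarrow> X z \<in> path_space"
    and Xm: "\<And>t. 0 \<le> t \<Longrightarrow> (\<lambda>z. X z t) \<in> borel_measurable M"
    and G: "path_lipschitz k L G"
  shows "(\<lambda>z. G (X z)) \<in> borel_measurable M"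
proof (rule borel_measurable_LIMSEQ_metric)
  fix N
  define H where "H \<xi> = G (path_of_values N \<xi>)" for \<xi> :: "nat \<Rightarrow> 'w"
  have G': "path_lipschitz k \<bar>L\<bar> G" by (rule path_lipschitz_nonneg[OF G])
  have "continuous_on UNIV H"
    unfolding continuous_on_def
  proof
    fix \<xi> :: "nat \<Rightarrow> 'w"
    have coord: "((\<lambda>\<zeta>. \<zeta> j) \<longlongrightarrow> \<xi> j) (at \<xi>)" for j
      using continuous_on_product_coordinates[of j] unfolding continuous_on_def by auto
    have "((\<lambda>\<zeta>. \<bar>L\<bar> * (\<Sum>j<k * 2 ^ N. norm ((\<zeta> (Suc j) - \<zeta> j) - (\<xi> (Suc j) - \<xi> j)))) \<longlongrightarrow>
        \<bar>L\<bar> * (\<Sum>j<k * 2 ^ N. norm ((\<xi> (Suc j) - \<xi> j) - (\<xi> (Suc j) - \<xi> j)))) (at \<xi>)"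
      by (intro tendsto_intros coord)
    then have lim: "((\<lambda>\<zeta>. \<bar>L\<bar> * (\<Sum>j<k * 2 ^ N. norm ((\<zeta> (Suc j) - \<zeta> j) - (\<xi> (Suc j) - \<xi> j)))) \<longlongrightarrow> 0) (at \<xi>)"
      by simp
    have "((\<lambda>\<zeta>. H \<zeta> - H \<xi>) \<longlongrightarrow> 0) (at \<xi>)"
    proof (rule Lim_null_comparison[OF always_eventually lim], rule allI)
      fix \<zeta>
      have "norm (H \<zeta> - H \<xi>) \<le> \<bar>L\<bar> * path_dist k (path_of_values N \<zeta>) (path_of_values N \<xi>)"
        using G' unfolding path_lipschitz_def H_def by (simp add: path_of_values_path_space)
      also have "\<dots> \<le> \<bar>L\<bar> * (\<Sum>j<k * 2 ^ N. norm ((\<zeta> (Suc j) - \<zeta> j) - (\<xi> (Suc j) - \<xi> j)))"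
        by (intro mult_left_mono path_of_values_dist) auto
      finally show "norm (H \<zeta> - H \<xi>) \<le> \<bar>L\<bar> * (\<Sum>j<k * 2 ^ N. norm ((\<zeta> (Suc j) - \<zeta> j) - (\<xi> (Suc j) - \<xi> j)))" .
    qed
    then show "(H \<longlongrightarrow> H \<xi>) (at \<xi>)" by (rule LIM_zero_cancel)
  qed
  then have "H \<in> borel_measurable borel" by (rule borel_measurable_continuous_onI)
  \<comment> \<open>The product sigma-algebra on sequences is the Borel one, so measurability of the
    coordinates suffices.\<close>
  moreover have "(\<lambda>z j. X z (real j / 2 ^ N)) \<in> measurable M borel"
  proof -
    have "(\<lambda>z. \<lambda>j\<in>UNIV. X z (real j / 2 ^ N)) \<in> measurable M (PiM (UNIV :: nat set) (\<lambda>_. borel))"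
      by (intro measurable_restrict Xm) simp
    then show ?thesis
      unfolding restrict_UNIV measurable_cong_sets[OF refl sets_PiM_equal_borel] .
  qed
  ultimately have "(\<lambda>z. H (\<lambda>j. X z (real j / 2 ^ N))) \<in> borel_measurable M"
    by (rule measurable_compose[rotated])
  then show "(\<lambda>z. G (dyadic N (X z))) \<in> borel_measurable M"
  proof (rule measurable_cong[THEN iffD1, rotated])
    fix z assume z: "z \<in> space M"
    show "H (\<lambda>j. X z (real j / 2 ^ N)) = G (dyadic N (X z))"
      unfolding H_def path_of_values_dyadic[OF X[OF z]] ..
  qed
next
  show "(\<lambda>N. G (dyadic N (X z))) \<longlonglongrightarrow> G (X z)" if "z \<in> space M" for z
    by (rule path_lipschitz_dyadic_tendsto[OF G X[OF that]])
qed

text \<open>Measurability for the Borel sets has to come from that of the values at fixed times. The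
  indicator of an open set is lower semicontinuous, hence a limit of Lipschitz functionals, each of
  which is measurable by interpolation.\<close>

lemma measurable_path_borel:
  fixes X :: "'a \<Rightarrow> real \<Rightarrow> 'w::euclidean_space"
  assumes g: "path_topology g = path_topology (\<bullet>)"
    and X: "\<And>z. z \<in> space M \<Longrightarrow> X z \<in> path_space"
    and Xm: "\<And>t. 0 \<le> t \<Longrightarrow> (\<lambda>z. X z t) \<in> borel_measurable M"
  shows "X \<in> measurable M (path_borel g)"
proof -
  have "X \<in> measurable M (sigma path_space {U. openin (path_topology (\<bullet>)) U})"
  proof (rule measurable_measure_of)
    show "{U. openin (path_topology (\<bullet>)) U} \<subseteq> Pow (path_space :: (real \<Rightarrow> 'w) set)"
      using openin_subset topspace_path_topology by blast
    show "X \<in> space M \<rightarrow> path_space" using X by blast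
    fix U :: "(real \<Rightarrow> 'w) set" assume "U \<in> {U. openin (path_topology (\<bullet>)) U}"
    then have U: "openin (path_topology (\<bullet>)) U" by simp
    define F where "F f = (indicator U f :: real)" for f
    have "path_lsc F"
      unfolding path_lsc_def
    proof (intro ballI allI impI)
      fix f :: "real \<Rightarrow> 'w" and e :: real assume f: "f \<in> path_space" and e: "0 < e"
      show "\<exists>k d. 0 < d \<and> (\<forall>h\<in>path_space. path_dist k f h < d \<longrightarrow> F f - e < F h)"
      proof (cases "f \<in> U")
        case True
        then obtain k d where "0 < d" "\<forall>h\<in>path_space. path_dist k f h < d \<longrightarrow> h \<in> U"
          using U unfolding openin_path_inner by blast
        then show ?thesis using e by (intro exI[of _ k] exI[of _ d]) (auto simp: F_def indicator_def)
      next
        case False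
        then show ?thesis using e by (intro exI[of _ 0] exI[of _ 1]) (auto simp: F_def indicator_def)
      qed
    qed
    then obtain G where G: "\<And>k. path_lipschitz k (real k) (G k)"
      "\<And>f. f \<in> path_space \<Longrightarrow> (\<lambda>k. G k f) \<longlonglongrightarrow> F f"
      by (rule path_lsc_approx[of F 1]) (auto simp: F_def indicator_def)
    have "(\<lambda>z. F (X z)) \<in> borel_measurable M"
    proof (rule borel_measurable_LIMSEQ_metric)
      show "(\<lambda>z. G k (X z)) \<in> borel_measurable M" for k
        by (rule path_lipschitz_measurable[OF X Xm G(1)])
      show "(\<lambda>k. G k (X z)) \<longlonglongrightarrow> F (X z)" if "z \<in> space M" for z
        by (rule G(2)[OF X[OF that]])
    qed
    then have "(\<lambda>z. F (X z)) -` {1} \<inter> space M \<in> sets M"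
      by (rule measurable_sets) simp
    moreover have "(\<lambda>z. F (X z)) -` {1} \<inter> space M = X -` U \<inter> space M"
      by (auto simp: F_def indicator_def)
    ultimately show "X -` U \<inter> space M \<in> sets M" by simp
  qed
  then show ?thesis by (simp add: path_borel_def g)
qed

section \<open>Chaining over dyadic levels\<close>

text \<open>The fourth root of 1/2 balances the two terms c and 2^(-m) / c^3 of the refinement bound
  at c = \<open>dyadic_rate ^ m\<close>.\<close>

definition dyadic_rate :: real where "dyadic_rate = root 4 (1 / 2)"

lemma dyadic_rate: "0 < dyadic_rate" "dyadic_rate < 1" "(dyadic_rate ^ M) ^ 4 = (1 / 2) ^ M"
proof -
  have "dyadic_rate ^ 4 = 1 / 2" by (simp add: dyadic_rate_def)
  then show "(dyadic_rate ^ M) ^ 4 = (1 / 2) ^ M" by (metis power_mult mult.commute)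
qed (simp_all add: dyadic_rate_def)

lemma dyadic_rate_div: "(1 / 2) ^ M / (dyadic_rate ^ M) ^ 3 = dyadic_rate ^ M"
proof -
  have "(1 / 2) ^ M = (dyadic_rate ^ M) ^ 3 * dyadic_rate ^ M"
    using dyadic_rate(3)[of M] by (simp add: power_Suc2[symmetric] numeral_eq_Suc)
  then show ?thesis using dyadic_rate(1) by simp
qed

text \<open>The displacement of the midpoint is half the difference of the two increments, hence at
  most the larger of them in norm.\<close>

lemma midpoint_power4_le:
  fixes a b c :: "'w::real_normed_vector"
  shows "norm (b - (1 / 2) *\<^sub>R (a + c)) ^ 4 \<le> norm (b - a) ^ 4 + norm (c - b) ^ 4"
proof -
  have "b - (1 / 2) *\<^sub>R (a + c) = (1 / 2) *\<^sub>R ((b - a) - (c - b))"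
    by (simp add: algebra_simps scaleR_2[symmetric])
  then have "norm (b - (1 / 2) *\<^sub>R (a + c)) = (1 / 2) * norm ((b - a) - (c - b))" by simp
  also have "\<dots> \<le> (1 / 2) * (norm (b - a) + norm (c - b))"
    by (intro mult_left_mono norm_triangle_ineq4) simp
  also have "\<dots> \<le> max (norm (b - a)) (norm (c - b))" by simp
  finally have "norm (b - (1 / 2) *\<^sub>R (a + c)) ^ 4 \<le> max (norm (b - a)) (norm (c - b)) ^ 4"
    by (intro power_mono) auto
  also have "\<dots> \<le> norm (b - a) ^ 4 + norm (c - b) ^ 4" by (auto simp: max_def)
  finally show ?thesis .
qed

lemma path_dist_dyadic_Suc:
  assumes c: "0 < c"
  shows "path_dist k (dyadic (Suc M) f) (dyadic M f) \<le> c + (\<Sum>j<k * 2 ^ M.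
      norm (f (real (2 * j + 1) / 2 ^ Suc M) - f (real (2 * j) / 2 ^ Suc M)) ^ 4
    + norm (f (real (2 * j + 2) / 2 ^ Suc M) - f (real (2 * j + 1) / 2 ^ Suc M)) ^ 4) / c ^ 3"
proof (rule path_dist_le)
  fix t :: real assume t: "0 \<le> t" "t \<le> real k"
  define \<zeta> where "\<zeta> j = f (real j / 2 ^ Suc M)" for j
  define s where "s = 2 ^ M * t"
  have s: "0 \<le> s" "s \<le> real (k * 2 ^ M)" using t by (simp_all add: s_def mult.commute)
  have "(\<lambda>j. \<zeta> (2 * j)) = (\<lambda>j. f (real j / 2 ^ M))" by (simp add: \<zeta>_def)
  then have "dyadic M f t = pl (\<lambda>j. \<zeta> (2 * j)) s" using t by (simp add: dyadic_def s_def)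
  moreover have "dyadic (Suc M) f t = pl \<zeta> (2 * s)" using t by (simp add: dyadic_def \<zeta>_def[abs_def] s_def mult.assoc)
  ultimately have "norm (dyadic (Suc M) f t - dyadic M f t)
      \<le> c + (\<Sum>j<k * 2 ^ M. norm (\<zeta> (2 * j + 1) - (1 / 2) *\<^sub>R (\<zeta> (2 * j) + \<zeta> (2 * j + 2))) ^ 4) / c ^ 3"
    using pl_refine_le[OF s c, of \<zeta>] by simp
  also have "\<dots> \<le> c + (\<Sum>j<k * 2 ^ M. norm (\<zeta> (2 * j + 1) - \<zeta> (2 * j)) ^ 4 + norm (\<zeta> (2 * j + 2) - \<zeta> (2 * j + 1)) ^ 4) / c ^ 3"
    using c by (intro add_left_mono divide_right_mono sum_mono midpoint_power4_le) auto
  finally show "norm (dyadic (Suc M) f t - dyadic M f t) \<le> c + (\<Sum>j<k * 2 ^ M.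
      norm (f (real (2 * j + 1) / 2 ^ Suc M) - f (real (2 * j) / 2 ^ Suc M)) ^ 4
    + norm (f (real (2 * j + 2) / 2 ^ Suc M) - f (real (2 * j + 1) / 2 ^ Suc M)) ^ 4) / c ^ 3"
    by (simp only: \<zeta>_def)
qed

lemma dyadic_measurable:
  assumes "\<And>t. 0 \<le> t \<Longrightarrow> (\<lambda>z. X z t) \<in> borel_measurable M" "0 \<le> t"
  shows "(\<lambda>z. dyadic N (X z) t) \<in> borel_measurable M"
proof -
  have "(\<lambda>z. dyadic N (X z) t) = (\<lambda>z. X z (real (nat \<lfloor>2 ^ N * t\<rfloor>) / 2 ^ N) + (2 ^ N * t - real (nat \<lfloor>2 ^ N * t\<rfloor>)) *\<^sub>R
     (X z (real (nat \<lfloor>2 ^ N * t\<rfloor> + 1) / 2 ^ N) - X z (real (nat \<lfloor>2 ^ N * t\<rfloor>) / 2 ^ N)))"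
    using assms(2) by (simp add: dyadic_def pl_def Let_def)
  then show ?thesis by (simp only:) (intro borel_measurable_add borel_measurable_scaleR borel_measurable_diff assms(1) measurable_const; simp)
qed

text \<open>Telescoping over the levels m \<ge> N. At level m there are k 2^m coarse intervals, each
  with two halves of moment at most C 4^(-m-1); divided by the cube of the threshold, their sum is
  at most k C times \<open>dyadic_rate ^ m\<close>. The law of X enters only through C, so the bound
  is uniform over a family with a common C.\<close>

lemma path_lipschitz_dyadic_moment:
  fixes X :: "'a \<Rightarrow> real \<Rightarrow> 'w::euclidean_space"
  assumes M: "prob_space M"
    and X: "\<And>z. z \<in> space M \<Longrightarrow> X z \<in> path_space"
    and Xm: "\<And>t. 0 \<le> t \<Longrightarrow> (\<lambda>z. X z t) \<in> borel_measurable M"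
    and int: "\<And>s t. 0 \<le> s \<Longrightarrow> s \<le> t \<Longrightarrow> integrable M (\<lambda>z. norm (X z t - X z s) ^ 4)"
    and mom: "\<And>s t. 0 \<le> s \<Longrightarrow> s \<le> t \<Longrightarrow> (LINT z|M. norm (X z t - X z s) ^ 4) \<le> C * (t - s)\<^sup>2"
    and G: "path_lipschitz k L G" and L: "0 \<le> L" and C: "0 \<le> C"
    and K: "\<And>f. f \<in> path_space \<Longrightarrow> \<bar>G f\<bar> \<le> K"
  shows "\<bar>(LINT z|M. G (X z)) - (LINT z|M. G (dyadic N (X z)))\<bar>
    \<le> L * (1 + real k * C) * (dyadic_rate ^ N / (1 - dyadic_rate))"
proof -
  interpret M: prob_space M by (rule M)
  let ?r = dyadic_rate
  have Gm: "(\<lambda>z. G (dyadic m (X z))) \<in> borel_measurable M" for m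
    by (rule path_lipschitz_measurable[OF dyadic_path_space[OF X] dyadic_measurable[OF Xm] G])
  have Gi: "integrable M (\<lambda>z. G (dyadic m (X z)))" for m
    by (rule M.integrable_const_bound[where B = K]) (auto simp: Gm K X dyadic_path_space)
  have step: "\<bar>(LINT z|M. G (dyadic (Suc m) (X z))) - (LINT z|M. G (dyadic m (X z)))\<bar> \<le> L * (1 + real k * C) * ?r ^ m" for m
  proof -
    let ?c = "?r ^ m"
    have c: "0 < ?c" using dyadic_rate(1) by simp
    define S where "S z j = norm (X z (real (2 * j + 1) / 2 ^ Suc m) - X z (real (2 * j) / 2 ^ Suc m)) ^ 4
      + norm (X z (real (2 * j + 2) / 2 ^ Suc m) - X z (real (2 * j + 1) / 2 ^ Suc m)) ^ 4" for z j
    have le0: "0 \<le> real i / 2 ^ Suc m" for i by simp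
    have le1: "real i / 2 ^ Suc m \<le> real i' / 2 ^ Suc m" if "i \<le> i'" for i i'
      using that by (intro divide_right_mono) auto
    have i1: "integrable M (\<lambda>z. norm (X z (real (2 * j + 1) / 2 ^ Suc m) - X z (real (2 * j) / 2 ^ Suc m)) ^ 4)"
      "integrable M (\<lambda>z. norm (X z (real (2 * j + 2) / 2 ^ Suc m) - X z (real (2 * j + 1) / 2 ^ Suc m)) ^ 4)" for j
      by (rule int[OF le0 le1], linarith)+
    have Si: "integrable M (\<lambda>z. S z j)" for j
      unfolding S_def by (intro Bochner_Integration.integrable_add i1)
    have SC: "(LINT z|M. S z j) \<le> C * (1 / 4) ^ m" for j
    proof -
      have d: "real (2 * j + 1) / 2 ^ Suc m - real (2 * j) / 2 ^ Suc m = 1 / 2 ^ Suc m"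
        "real (2 * j + 2) / 2 ^ Suc m - real (2 * j + 1) / 2 ^ Suc m = 1 / 2 ^ Suc m"
        by (simp_all only: diff_divide_distrib[symmetric]) simp_all
      have "(LINT z|M. S z j) = (LINT z|M. norm (X z (real (2 * j + 1) / 2 ^ Suc m) - X z (real (2 * j) / 2 ^ Suc m)) ^ 4)
        + (LINT z|M. norm (X z (real (2 * j + 2) / 2 ^ Suc m) - X z (real (2 * j + 1) / 2 ^ Suc m)) ^ 4)"
        unfolding S_def by (intro Bochner_Integration.integral_add i1)
      also have "\<dots> \<le> C * (1 / 2 ^ Suc m)\<^sup>2 + C * (1 / 2 ^ Suc m)\<^sup>2"
        using mom[OF le0 le1, of "2 * j" "2 * j + 1"] mom[OF le0 le1, of "2 * j + 1" "2 * j + 2"]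
        unfolding d by (intro add_mono) linarith+
      also have "\<dots> = C * ((1 / 4) ^ m / 2)"
        by (simp add: power2_eq_square power_mult_distrib[symmetric] power_one_over field_simps)
      also have "\<dots> \<le> C * (1 / 4) ^ m" using C by (intro mult_left_mono) auto
      finally show ?thesis .
    qed
    have "(LINT z|M. G (dyadic (Suc m) (X z))) - (LINT z|M. G (dyadic m (X z)))
        = (LINT z|M. G (dyadic (Suc m) (X z)) - G (dyadic m (X z)))"
      using Gi by simp
    also have "\<bar>\<dots>\<bar> \<le> (LINT z|M. \<bar>G (dyadic (Suc m) (X z)) - G (dyadic m (X z))\<bar>)"
      by (rule integral_abs_bound)
    also have "\<dots> \<le> (LINT z|M. L * (?c + (\<Sum>j<k * 2 ^ m. S z j) / ?c ^ 3))"
    proof (rule integral_mono)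
      show "integrable M (\<lambda>z. \<bar>G (dyadic (Suc m) (X z)) - G (dyadic m (X z))\<bar>)" using Gi by simp
      show "integrable M (\<lambda>z. L * (?c + (\<Sum>j<k * 2 ^ m. S z j) / ?c ^ 3))" using Si by simp
      fix z assume z: "z \<in> space M"
      have "\<bar>G (dyadic (Suc m) (X z)) - G (dyadic m (X z))\<bar> \<le> L * path_dist k (dyadic (Suc m) (X z)) (dyadic m (X z))"
        using G X[OF z] unfolding path_lipschitz_def by (simp add: dyadic_path_space)
      also have "\<dots> \<le> L * (?c + (\<Sum>j<k * 2 ^ m. S z j) / ?c ^ 3)"
        using path_dist_dyadic_Suc[OF c, of k m "X z"] L unfolding S_def by (intro mult_left_mono)
      finally show "\<bar>G (dyadic (Suc m) (X z)) - G (dyadic m (X z))\<bar> \<le> L * (?c + (\<Sum>j<k * 2 ^ m. S z j) / ?c ^ 3)" .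
    qed
    also have "\<dots> = L * (?c + (\<Sum>j<k * 2 ^ m. LINT z|M. S z j) / ?c ^ 3)"
      using Si by (simp add: M.prob_space Bochner_Integration.integral_sum)
    also have "\<dots> \<le> L * (?c + (\<Sum>j<k * 2 ^ m. C * (1 / 4) ^ m) / ?c ^ 3)"
      using L c by (intro mult_left_mono add_left_mono divide_right_mono sum_mono SC) auto
    also have "(\<Sum>j<k * 2 ^ m. C * (1 / 4) ^ m) = real k * C * (1 / 2) ^ m"
    proof -
      have "(2::real) ^ m * (1 / 4) ^ m = (1 / 2) ^ m" by (simp flip: power_mult_distrib)
      then show ?thesis by (simp add: mult.assoc mult.left_commute)
    qed
    also have "real k * C * (1 / 2) ^ m / ?c ^ 3 = real k * C * ?c"
      using dyadic_rate_div[of m] by (metis times_divide_eq_right)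
    finally show ?thesis by (simp add: algebra_simps)
  qed
  have tele: "\<bar>(LINT z|M. G (dyadic (N + i) (X z))) - (LINT z|M. G (dyadic N (X z)))\<bar>
      \<le> L * (1 + real k * C) * (\<Sum>m<i. ?r ^ (N + m))" for i
  proof (induction i)
    case (Suc i)
    show ?case using Suc step[of "N + i"] by (simp add: distrib_left)
  qed simp
  have sum_le: "(\<Sum>m<i. ?r ^ (N + m)) \<le> ?r ^ N / (1 - ?r)" for i
  proof -
    have "(\<Sum>m<i. ?r ^ (N + m)) = ?r ^ N * (\<Sum>m<i. ?r ^ m)"
      by (simp add: power_add sum_distrib_left)
    also have "(\<Sum>m<i. ?r ^ m) \<le> 1 / (1 - ?r)"
      using dyadic_rate(1,2) by (simp add: sum_gp_strict field_simps)
    finally show ?thesis using dyadic_rate(1) by (simp add: mult_left_mono)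
  qed
  have "(\<lambda>i. LINT z|M. G (dyadic (N + i) (X z))) \<longlonglongrightarrow> (LINT z|M. G (X z))"
  proof (rule integral_dominated_convergence[where w = "\<lambda>_. K"])
    show "(\<lambda>z. G (X z)) \<in> borel_measurable M" by (rule path_lipschitz_measurable[OF X Xm G])
    show "AE z in M. (\<lambda>i. G (dyadic (N + i) (X z))) \<longlonglongrightarrow> G (X z)"
      using LIMSEQ_ignore_initial_segment[OF path_lipschitz_dyadic_tendsto[OF G X], of _ N]
      by (intro AE_I2) (simp add: add.commute)
    show "AE z in M. norm (G (dyadic (N + i) (X z))) \<le> K" for i
      by (intro AE_I2) (simp add: K X dyadic_path_space)
  qed (auto simp: Gm)
  then have "(\<lambda>i. \<bar>(LINT z|M. G (dyadic (N + i) (X z))) - (LINT z|M. G (dyadic N (X z)))\<bar>)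
      \<longlonglongrightarrow> \<bar>(LINT z|M. G (X z)) - (LINT z|M. G (dyadic N (X z)))\<bar>"
    by (intro tendsto_intros)
  then show ?thesis
  proof (rule LIMSEQ_le_const2, intro exI[of _ 0] allI impI)
    fix i
    have "L * (1 + real k * C) * (\<Sum>m<i. ?r ^ (N + m)) \<le> L * (1 + real k * C) * (?r ^ N / (1 - ?r))"
      using L C by (intro mult_left_mono sum_le) auto
    then show "\<bar>(LINT z|M. G (dyadic (N + i) (X z))) - (LINT z|M. G (dyadic N (X z)))\<bar>
        \<le> L * (1 + real k * C) * (?r ^ N / (1 - ?r))"
      using tele[of i] by linarith
  qed
qed

section \<open>From increments to weak convergence\<close>

text \<open>At a fixed level the functional depends on the path, in a Lipschitz way, only through
  its k 2^l increments on [0, k], so convergence of their joint characteristic functions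
  suffices.\<close>

lemma path_lipschitz_dyadic_conv:
  fixes X :: "nat \<Rightarrow> 'a \<Rightarrow> real \<Rightarrow> 'w::euclidean_space" and B :: "'b \<Rightarrow> real \<Rightarrow> 'w"
  assumes M: "prob_space M" and N: "prob_space N"
    and X: "\<And>n z. z \<in> space M \<Longrightarrow> X n z \<in> path_space"
    and Xm: "\<And>n t. 0 \<le> t \<Longrightarrow> (\<lambda>z. X n z t) \<in> borel_measurable M"
    and B: "\<And>z. z \<in> space N \<Longrightarrow> B z \<in> path_space"
    and Bm: "\<And>t. 0 \<le> t \<Longrightarrow> (\<lambda>z. B z t) \<in> borel_measurable N"
    and fdd: "\<And>m a. (\<lambda>n. LINT z|M. iexp (\<Sum>j<m. a j \<bullet> (X n z (real (Suc j) / 2 ^ l) - X n z (real j / 2 ^ l))))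
      \<longlonglongrightarrow> (LINT z|N. iexp (\<Sum>j<m. a j \<bullet> (B z (real (Suc j) / 2 ^ l) - B z (real j / 2 ^ l))))"
    and G: "path_lipschitz k L G" and K: "\<And>f. f \<in> path_space \<Longrightarrow> \<bar>G f\<bar> \<le> K"
  shows "(\<lambda>n. LINT z|M. G (dyadic l (X n z))) \<longlonglongrightarrow> (LINT z|N. G (dyadic l (B z)))"
proof -
  let ?K = "{..<k * 2 ^ l} \<times> (Basis :: 'w set)"
  define Y where "Y f = (\<lambda>(j, b). (f (real (Suc j) / 2 ^ l) - f (real j / 2 ^ l)) \<bullet> b)" for f :: "real \<Rightarrow> 'w"
  \<comment> \<open>The values at the dyadic nodes are rebuilt from the coordinates of the
    increments; this makes \<open>h\<close> a function of arbitrary real families, so that its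
    Lipschitz bound holds everywhere.\<close>
  define v where "v y i = (\<Sum>j<i. \<Sum>b\<in>Basis. y (j, b) *\<^sub>R b :: 'w)" for y and i :: nat
  define h where "h y = G (path_of_values l (v y))" for y
  have h_Y: "h (Y f) = G (dyadic l f)" if "f \<in> path_space" for f
  proof -
    have "v (Y f) i = f (real i / 2 ^ l) - f 0" for i
      unfolding v_def Y_def prod.case euclidean_representation
      using sum_lessThan_telescope[of "\<lambda>j. f (real j / 2 ^ l)" i] by simp
    then have "path_of_values l (v (Y f)) = path_of_values l (\<lambda>j. f (real j / 2 ^ l))"
      by (simp add: path_of_values_def)
    then show ?thesis using that by (simp add: h_def path_of_values_dyadic)
  qed
  have "(\<lambda>n. LINT z|M. h (\<lambda>k. Y (X n z) k)) \<longlonglongrightarrow> (LINT z|N. h (\<lambda>k. Y (B z) k))"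
  proof (rule char_conv_imp_lipschitz_conv[OF M N, where K = ?K and L = "\<bar>L\<bar>" and B = K
      and h = h and Y = "\<lambda>n k z. Y (X n z) k" and Y' = "\<lambda>k z. Y (B z) k"])
    show "(\<lambda>z. Y (X n z) k) \<in> borel_measurable M" if "k \<in> ?K" for n k
      using that by (auto simp: Y_def split: prod.split intro!: borel_measurable_inner borel_measurable_diff Xm)
    show "(\<lambda>z. Y (B z) k) \<in> borel_measurable N" if "k \<in> ?K" for k
      using that by (auto simp: Y_def split: prod.split intro!: borel_measurable_inner borel_measurable_diff Bm)
    show "(\<lambda>n. LINT z|M. iexp (\<Sum>k\<in>?K. a k * Y (X n z) k)) \<longlonglongrightarrow> (LINT z|N. iexp (\<Sum>k\<in>?K. a k * Y (B z) k))" for a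
    proof -
      have "(\<Sum>k\<in>?K. a k * Y f k) = (\<Sum>j<k * 2 ^ l. (\<Sum>b\<in>Basis. a (j, b) *\<^sub>R b) \<bullet> (f (real (Suc j) / 2 ^ l) - f (real j / 2 ^ l)))" for f
      proof -
        have "(\<Sum>k\<in>?K. a k * Y f k) = (\<Sum>j<k * 2 ^ l. \<Sum>b\<in>Basis. a (j, b) * ((f (real (Suc j) / 2 ^ l) - f (real j / 2 ^ l)) \<bullet> b))"
          by (simp add: sum.cartesian_product Y_def case_prod_unfold)
        also have "\<dots> = (\<Sum>j<k * 2 ^ l. (\<Sum>b\<in>Basis. a (j, b) *\<^sub>R b) \<bullet> (f (real (Suc j) / 2 ^ l) - f (real j / 2 ^ l)))"
          by (simp only: inner_sum_left inner_scaleR_left inner_commute)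
        finally show ?thesis .
      qed
      then show ?thesis using fdd by (simp only:)
    qed
    show "\<bar>h x - h y\<bar> \<le> \<bar>L\<bar> * (\<Sum>k\<in>?K. \<bar>x k - y k\<bar>)" for x y
    proof -
      have A: "\<bar>h x - h y\<bar> \<le> \<bar>L\<bar> * path_dist k (path_of_values l (v x)) (path_of_values l (v y))"
        using path_lipschitz_nonneg[OF G] unfolding h_def path_lipschitz_def by (simp add: path_of_values_path_space)
      have "path_dist k (path_of_values l (v x)) (path_of_values l (v y))
          \<le> (\<Sum>j<k * 2 ^ l. norm ((v x (Suc j) - v x j) - (v y (Suc j) - v y j)))"
        by (rule path_of_values_dist)
      also have "\<dots> \<le> (\<Sum>j<k * 2 ^ l. \<Sum>b\<in>Basis. \<bar>x (j, b) - y (j, b)\<bar>)"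
      proof (rule sum_mono)
        fix j
        have "(v x (Suc j) - v x j) - (v y (Suc j) - v y j) = (\<Sum>b\<in>Basis. (x (j, b) - y (j, b)) *\<^sub>R b)"
          by (simp add: v_def scaleR_diff_left sum_subtractf)
        also have "norm \<dots> \<le> (\<Sum>b\<in>Basis. norm ((x (j, b) - y (j, b)) *\<^sub>R b :: 'w))" by (rule norm_sum)
        finally show "norm ((v x (Suc j) - v x j) - (v y (Suc j) - v y j)) \<le> (\<Sum>b\<in>Basis. \<bar>x (j, b) - y (j, b)\<bar>)"
          by simp
      qed
      also have "\<dots> = (\<Sum>k\<in>?K. \<bar>x k - y k\<bar>)" by (simp add: sum.cartesian_product case_prod_unfold)
      finally show ?thesis by (intro order_trans[OF A] mult_left_mono) auto
    qed
    show "\<bar>h y\<bar> \<le> K" for y unfolding h_def by (rule K[OF path_of_values_path_space])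
    show "(\<lambda>z. h (\<lambda>k. Y (X n z) k)) \<in> borel_measurable M" for n
      by (rule measurable_cong[THEN iffD2, OF h_Y[OF X]])
        (auto intro!: path_lipschitz_measurable[OF dyadic_path_space[OF X] dyadic_measurable[OF Xm] G])
    show "(\<lambda>z. h (\<lambda>k. Y (B z) k)) \<in> borel_measurable N"
      by (rule measurable_cong[THEN iffD2, OF h_Y[OF B]])
        (auto intro!: path_lipschitz_measurable[OF dyadic_path_space[OF B] dyadic_measurable[OF Bm] G])
  qed simp
  moreover have "(LINT z|M. h (\<lambda>k. Y (X n z) k)) = (LINT z|M. G (dyadic l (X n z)))" for n
    by (rule Bochner_Integration.integral_cong) (simp_all add: h_Y X)
  moreover have "(LINT z|N. h (\<lambda>k. Y (B z) k)) = (LINT z|N. G (dyadic l (B z)))"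
    by (rule Bochner_Integration.integral_cong) (simp_all add: h_Y B)
  ultimately show ?thesis by simp
qed

text \<open>The level l is fixed before n tends to infinity: its error is controlled by the uniform
  moment bound for \<open>X\<close> and by dominated convergence for \<open>B\<close>. For
  continuous F a bound from below suffices, since it applies to the negative of F as well.\<close>

lemma path_weak_convergence:
  fixes X :: "nat \<Rightarrow> 'a \<Rightarrow> real \<Rightarrow> 'w::euclidean_space" and B :: "'b \<Rightarrow> real \<Rightarrow> 'w"
  assumes M: "prob_space M" and N: "prob_space N"
    and X: "\<And>n z. z \<in> space M \<Longrightarrow> X n z \<in> path_space"
    and Xm: "\<And>n t. 0 \<le> t \<Longrightarrow> (\<lambda>z. X n z t) \<in> borel_measurable M"
    and B: "\<And>z. z \<in> space N \<Longrightarrow> B z \<in> path_space"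
    and Bm: "\<And>t. 0 \<le> t \<Longrightarrow> (\<lambda>z. B z t) \<in> borel_measurable N"
    and fdd: "\<And>l m a. (\<lambda>n. LINT z|M. iexp (\<Sum>j<m. a j \<bullet> (X n z (real (Suc j) / 2 ^ l) - X n z (real j / 2 ^ l))))
      \<longlonglongrightarrow> (LINT z|N. iexp (\<Sum>j<m. a j \<bullet> (B z (real (Suc j) / 2 ^ l) - B z (real j / 2 ^ l))))"
    and int: "\<And>n s t. 0 \<le> s \<Longrightarrow> s \<le> t \<Longrightarrow> integrable M (\<lambda>z. norm (X n z t - X n z s) ^ 4)"
    and mom: "\<And>n s t. 0 \<le> s \<Longrightarrow> s \<le> t \<Longrightarrow> (LINT z|M. norm (X n z t - X n z s) ^ 4) \<le> C * (t - s)\<^sup>2"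
    and C: "0 \<le> C"
    and F: "continuous_map (path_topology (\<bullet>)) euclideanreal F" and K: "\<And>f. f \<in> path_space \<Longrightarrow> \<bar>F f\<bar> \<le> K"
  shows "(\<lambda>n. LINT z|M. F (X n z)) \<longlonglongrightarrow> (LINT z|N. F (B z))"
proof -
  interpret M: prob_space M by (rule M)
  interpret N: prob_space N by (rule N)
  have Fm: "(\<lambda>z. F (X n z)) \<in> borel_measurable M" "(\<lambda>z. F (B z)) \<in> borel_measurable N"
    if F: "continuous_map (path_topology (\<bullet>)) euclideanreal F" for F n
    using measurable_compose[OF measurable_path_borel[OF refl X Xm] continuous_map_path_borel_measurable[OF F]]
      measurable_compose[OF measurable_path_borel[OF refl B Bm] continuous_map_path_borel_measurable[OF F]]
    by auto
  have lip: "(\<lambda>n. LINT z|M. G (X n z)) \<longlonglongrightarrow> (LINT z|N. G (B z))"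
    if G: "path_lipschitz k (real k) G" and K: "\<And>f. f \<in> path_space \<Longrightarrow> \<bar>G f\<bar> \<le> K" for G k
  proof (rule tendsto_approx)
    fix e :: real assume e: "0 < e"
    have "(\<lambda>l. real k * (1 + real k * C) * (dyadic_rate ^ l / (1 - dyadic_rate)))
        \<longlonglongrightarrow> real k * (1 + real k * C) * (0 / (1 - dyadic_rate))"
      using dyadic_rate(1,2) by (intro tendsto_intros LIMSEQ_realpow_zero) auto
    then have ev1: "\<forall>\<^sub>F l in sequentially. real k * (1 + real k * C) * (dyadic_rate ^ l / (1 - dyadic_rate)) < e"
      by (rule order_tendstoD) (use e in simp)
    have "(\<lambda>l. LINT z|N. G (dyadic l (B z))) \<longlonglongrightarrow> (LINT z|N. G (B z))"
    proof (rule integral_dominated_convergence[where w = "\<lambda>_. K"])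
      show "(\<lambda>z. G (B z)) \<in> borel_measurable N" by (rule path_lipschitz_measurable[OF B Bm G])
      show "AE z in N. (\<lambda>l. G (dyadic l (B z))) \<longlonglongrightarrow> G (B z)"
        by (intro AE_I2 path_lipschitz_dyadic_tendsto[OF G] B)
      show "AE z in N. norm (G (dyadic l (B z))) \<le> K" for l
        by (intro AE_I2) (simp add: K B dyadic_path_space)
      show "(\<lambda>z. G (dyadic l (B z))) \<in> borel_measurable N" for l
        by (rule path_lipschitz_measurable[OF dyadic_path_space[OF B] dyadic_measurable[OF Bm] G])
    qed simp
    from tendstoD[OF this e] have ev2: "\<forall>\<^sub>F l in sequentially. dist (LINT z|N. G (dyadic l (B z))) (LINT z|N. G (B z)) < e" .
    from eventually_happens[OF eventually_conj[OF ev1 ev2]]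
    obtain l where l: "real k * (1 + real k * C) * (dyadic_rate ^ l / (1 - dyadic_rate)) < e"
      "dist (LINT z|N. G (dyadic l (B z))) (LINT z|N. G (B z)) < e" by auto
    show "\<exists>y l'. y \<longlonglongrightarrow> l' \<and> (\<forall>\<^sub>F n in sequentially. norm ((LINT z|M. G (X n z)) - y n) \<le> e)
        \<and> norm ((LINT z|N. G (B z)) - l') \<le> e"
    proof (intro exI conjI)
      show "(\<lambda>n. LINT z|M. G (dyadic l (X n z))) \<longlonglongrightarrow> (LINT z|N. G (dyadic l (B z)))"
        by (rule path_lipschitz_dyadic_conv[OF M N X Xm B Bm fdd G K])
      have "\<bar>(LINT z|M. G (X n z)) - (LINT z|M. G (dyadic l (X n z)))\<bar> \<le> e" for n
        using path_lipschitz_dyadic_moment[OF M X Xm int mom G _ C K, of n l] l(1) by simp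
      then show "\<forall>\<^sub>F n in sequentially. norm ((LINT z|M. G (X n z)) - (LINT z|M. G (dyadic l (X n z)))) \<le> e"
        by simp
      show "norm ((LINT z|N. G (B z)) - (LINT z|N. G (dyadic l (B z)))) \<le> e"
        using l(2) by (simp add: dist_norm norm_minus_commute)
    qed
  qed
  have lower: "\<forall>\<^sub>F n in sequentially. (LINT z|N. F (B z)) - e < (LINT z|M. F (X n z))"
    if e: "0 < e" and F: "continuous_map (path_topology (\<bullet>)) euclideanreal F"
      and K: "\<And>f. f \<in> path_space \<Longrightarrow> \<bar>F f\<bar> \<le> K" for F e
  proof -
    obtain G where G: "\<And>k. path_lipschitz k (real k) (G k)" "\<And>k f. f \<in> path_space \<Longrightarrow> \<bar>G k f\<bar> \<le> K"
      "\<And>k f. f \<in> path_space \<Longrightarrow> G k f \<le> F f" "\<And>f. f \<in> path_space \<Longrightarrow> (\<lambda>k. G k f) \<longlonglongrightarrow> F f"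
      using path_lsc_approx[OF continuous_map_path_lsc[OF F] K] by blast
    have "(\<lambda>k. LINT z|N. G k (B z)) \<longlonglongrightarrow> (LINT z|N. F (B z))"
      by (rule integral_dominated_convergence[where w = "\<lambda>_. K"])
        (auto intro!: AE_I2 Fm(2)[OF F] path_lipschitz_measurable[OF B Bm G(1)] simp: B G)
    then have "\<forall>\<^sub>F k in sequentially. (LINT z|N. F (B z)) - e < (LINT z|N. G k (B z))"
      by (rule order_tendstoD) (use e in simp)
    then obtain k where k: "(LINT z|N. F (B z)) - e < (LINT z|N. G k (B z))"
      by (auto dest: eventually_happens)
    have "\<forall>\<^sub>F n in sequentially. (LINT z|N. F (B z)) - e < (LINT z|M. G k (X n z))"
      by (rule order_tendstoD(1)[OF lip[OF G(1,2)] k])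
    then show ?thesis
    proof eventually_elim
      case (elim n)
      have "(LINT z|M. G k (X n z)) \<le> (LINT z|M. F (X n z))"
        by (intro integral_mono M.integrable_const_bound[where B = K])
          (auto simp: G X K Fm[OF F] intro!: path_lipschitz_measurable[OF X Xm G(1)])
      then show ?case using elim by simp
    qed
  qed
  have F': "continuous_map (path_topology (\<bullet>)) euclideanreal (\<lambda>f. - F f)"
    using F by (intro continuous_map_minus)
  show ?thesis
  proof (rule tendstoI)
    fix e :: real assume e: "0 < e"
    from lower[OF e F K] lower[OF e F'] K
    have "\<forall>\<^sub>F n in sequentially. (LINT z|N. F (B z)) - e < (LINT z|M. F (X n z))"
      "\<forall>\<^sub>F n in sequentially. (LINT z|N. - F (B z)) - e < (LINT z|M. - F (X n z))" by auto
    then show "\<forall>\<^sub>F n in sequentially. dist (LINT z|M. F (X n z)) (LINT z|N. F (B z)) < e"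
      by eventually_elim (simp add: dist_real_def abs_if)
  qed
qed

section \<open>Brownian motion\<close>

definition levy_scale :: "nat \<Rightarrow> real" where "levy_scale N = sqrt ((1 / 2) ^ N) / 2"

lemma levy_scale_squared: "(levy_scale N)\<^sup>2 = (1 / 2) ^ N / 4"
  by (simp add: levy_scale_def power_divide)

text \<open>
  Row \<open>N\<close> of \<open>levy z\<close> holds the values at the times \<open>k / 2\<^sup>N\<close>: the first row is a random walk, and
  each midpoint is displaced by the standard deviation of a Brownian bridge of length \<open>1 / 2\<^sup>N\<close>.
\<close>

fun levy :: "(nat \<times> nat \<Rightarrow> 'w::real_normed_vector) \<Rightarrow> nat \<Rightarrow> nat \<Rightarrow> 'w" where
  "levy z 0 k = (\<Sum>i<k. z (0, i))"
| "levy z (Suc N) k = (if even k then levy z N (k div 2)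
     else (1 / 2) *\<^sub>R (levy z N (k div 2) + levy z N (k div 2 + 1)) + levy_scale N *\<^sub>R z (Suc N, k div 2))"

lemma levy_0 [simp]: "levy z N 0 = 0"
  by (induction N) auto

definition levy_path :: "(nat \<times> nat \<Rightarrow> 'w::euclidean_space) \<Rightarrow> nat \<Rightarrow> real \<Rightarrow> 'w" where
  "levy_path z N = (\<lambda>t\<in>{0..}. pl (levy z N) (2 ^ N * t))"

text \<open>The sum in \<open>pl_refine_le\<close> at level N with threshold
  \<open>dyadic_rate ^ N\<close>: the midpoint displacements of the construction are exactly the new
  scaled vectors.\<close>

definition levy_error :: "(nat \<times> nat \<Rightarrow> 'w::euclidean_space) \<Rightarrow> nat \<Rightarrow> nat \<Rightarrow> real" where
  "levy_error z k N = (\<Sum>j<k * 2 ^ N. norm (levy_scale N *\<^sub>R z (Suc N, j)) ^ 4) / (dyadic_rate ^ N) ^ 3"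

lemma levy_path_space: "levy_path z N \<in> path_space"
  using pl_path_space[of "levy z N" "2 ^ N" 1] by (simp add: levy_path_def)

lemma levy_path_Suc:
  assumes t: "0 \<le> t" "t \<le> real k"
  shows "norm (levy_path z (Suc N) t - levy_path z N t) \<le> dyadic_rate ^ N + levy_error z k N"
proof -
  define s where "s = 2 ^ N * t"
  have s: "0 \<le> s" "s \<le> real (k * 2 ^ N)" using t by (simp_all add: s_def mult.commute)
  have mid: "levy z (Suc N) (2 * j + 1) - (1 / 2) *\<^sub>R (levy z (Suc N) (2 * j) + levy z (Suc N) (2 * j + 2))
      = levy_scale N *\<^sub>R z (Suc N, j)" for j
  proof -
    have "(2 * j + 1) div 2 = j" "(2 * j + 2) div 2 = j + 1" by simp_all
    then show ?thesis by simp
  qed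
  have coarse: "(\<lambda>j. levy z (Suc N) (2 * j)) = levy z N" by (rule ext) simp
  have "norm (pl (levy z (Suc N)) (2 * s) - pl (\<lambda>j. levy z (Suc N) (2 * j)) s)
      \<le> dyadic_rate ^ N + (\<Sum>j<k * 2 ^ N. norm (levy_scale N *\<^sub>R z (Suc N, j)) ^ 4) / (dyadic_rate ^ N) ^ 3"
    using pl_refine_le[OF s, of "dyadic_rate ^ N" "levy z (Suc N)"] dyadic_rate(1) unfolding mid by simp
  then show ?thesis using t unfolding coarse by (simp add: levy_path_def levy_error_def s_def mult.assoc)
qed

text \<open>Weierstrass test on each [0, k] with the bound of \<open>levy_path_Suc\<close> as
  majorant; the limits for different k agree because all are given by one pointwise series.\<close>

lemma levy_path_converges:
  assumes sum: "\<And>k. summable (levy_error z k)"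
  shows "\<exists>b\<in>path_space. \<forall>k. (\<lambda>N. path_dist k (levy_path z N) b) \<longlonglongrightarrow> 0"
proof -
  define f where "f i t = levy_path z (Suc i) t - levy_path z i t" for i t
  define b where "b = (\<lambda>t\<in>{0..}. levy_path z 0 t + (\<Sum>i. f i t))"
  have unif: "uniform_limit {0..real k} (levy_path z) b sequentially" for k
  proof -
    have "summable (\<lambda>N. dyadic_rate ^ N + levy_error z k N)"
      using dyadic_rate by (intro summable_add sum summable_geometric) auto
    then have "uniform_limit {0..real k} (\<lambda>n t. \<Sum>i<n. f i t) (\<lambda>t. \<Sum>i. f i t) sequentially"
      by (intro Weierstrass_m_test[where M = "\<lambda>N. dyadic_rate ^ N + levy_error z k N"])
        (auto simp: f_def levy_path_Suc)
    then have "uniform_limit {0..real k} (\<lambda>n t. levy_path z 0 t + (\<Sum>i<n. f i t)) (\<lambda>t. levy_path z 0 t + (\<Sum>i. f i t)) sequentially"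
      by (intro uniform_limit_add uniform_limit_const)
    moreover have "levy_path z 0 t + (\<Sum>i<n. f i t) = levy_path z n t" for n t
      by (simp add: f_def sum_lessThan_telescope[of "\<lambda>i. levy_path z i t"])
    ultimately have "uniform_limit {0..real k} (levy_path z) (\<lambda>t. levy_path z 0 t + (\<Sum>i. f i t)) sequentially"
      by simp
    then show ?thesis
      by (rule uniform_limit_cong'[THEN iffD1, rotated 2]) (auto simp: b_def)
  qed
  have "continuous_on {0..} b"
    unfolding continuous_on_eq_continuous_within
  proof
    fix s :: real assume s: "s \<in> {0..}"
    define k where "k = nat \<lceil>s\<rceil> + 1"
    have k: "s < real k" using s by (simp add: k_def) linarith
    have "continuous_on {0..real k} b"
      using unif[of k] by (rule uniform_limit_theorem[rotated])
        (auto intro!: always_eventually path_space_continuous levy_path_space)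
    then have "continuous (at s within {0..real k}) b"
      using s k by (simp add: continuous_on_eq_continuous_within)
    \<comment> \<open>The point s lies strictly below k, so continuity on [0, k] is continuity
      within the half-line.\<close>
    moreover have "at s within {0..real k} = at s within {0..}"
      using k by (intro at_within_nhd[of s "{..<real k}"]) auto
    ultimately show "continuous (at s within {0..}) b" by simp
  qed
  moreover have "f i 0 = 0" for i by (simp add: f_def levy_path_def)
  ultimately have b: "b \<in> path_space" by (simp add: path_space_def b_def levy_path_def)
  have "(\<lambda>N. path_dist k (levy_path z N) b) \<longlonglongrightarrow> 0" for k
  proof (rule LIMSEQ_I)
    fix e :: real assume e: "0 < e"
    have "\<forall>\<^sub>F N in sequentially. \<forall>t\<in>{0..real k}. dist (levy_path z N t) (b t) < e / 2"
      using uniform_limitD[OF unif, of "e / 2"] e by simp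
    then obtain N0 where "\<forall>N\<ge>N0. \<forall>t\<in>{0..real k}. dist (levy_path z N t) (b t) < e / 2"
      unfolding eventually_sequentially by (elim exE)
    then have N0: "dist (levy_path z N t) (b t) < e / 2" if "N0 \<le> N" "t \<in> {0..real k}" for N t
      using that by blast
    have "norm (path_dist k (levy_path z N) b - 0) < e" if "N0 \<le> N" for N
    proof -
      have "path_dist k (levy_path z N) b \<le> e / 2"
        using N0[OF that] by (intro path_dist_le) (auto simp: dist_norm intro: less_imp_le)
      then show ?thesis using e path_dist_nonneg[OF levy_path_space b, of k z N] by simp
    qed
    then show "\<exists>N0. \<forall>N\<ge>N0. norm (path_dist k (levy_path z N) b - 0) < e" by blast
  qed
  then show ?thesis using b by blast
qed

section \<open>Covariance of the midpoint construction\<close>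

locale quadratic_form =
  fixes Q :: "'w::real_inner \<Rightarrow> real"
  assumes Q_scale: "Q (c *\<^sub>R x) = c\<^sup>2 * Q x"
    and Q_parallelogram: "Q (x + y) + Q (x - y) = 2 * Q x + 2 * Q y"
begin

lemma Q_zero: "Q 0 = 0"
  using Q_scale[of 0 0] by simp

text \<open>Refinement turns the coefficients of two neighbouring fine increments into their mean on
  the coarse increment and their scaled difference on the new vector. With squared scale 2^(-N) / 4,
  the parallelogram law recombines the two contributions to 2^(-N-1) times the sum of Q over the
  original coefficients.\<close>

lemma levy_increments:
  "\<exists>I \<kappa>. finite I \<and> I \<subseteq> {..N} \<times> UNIV
    \<and> (\<forall>z. (\<Sum>j<R. a j \<bullet> (levy z N (Suc j) - levy z N j)) = (\<Sum>i\<in>I. \<kappa> i \<bullet> z i))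
    \<and> (\<Sum>i\<in>I. Q (\<kappa> i)) = (1 / 2) ^ N * (\<Sum>j<R. Q (a j))"
proof (induction N arbitrary: R a)
  case 0
  let ?I = "(\<lambda>j. (0 :: nat, j)) ` {..<R}"
  have inj: "inj_on (\<lambda>j. (0 :: nat, j)) {..<R}" by (auto simp: inj_on_def)
  show ?case
    by (rule exI[of _ ?I], rule exI[of _ "\<lambda>i. a (snd i)"]) (auto simp: sum.reindex[OF inj])
next
  case (Suc N)
  \<comment> \<open>The coefficients are continued by zero, so that the fine increments group in
    pairs even for odd R.\<close>
  define a' where "a' j = (if j < R then a j else 0)" for j
  define c where "c j = (1 / 2) *\<^sub>R (a' (2 * j) + a' (2 * j + 1))" for j
  define d where "d j = levy_scale N *\<^sub>R (a' (2 * j) - a' (2 * j + 1))" for j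
  have split: "(\<Sum>j<2 * n. g j) = (\<Sum>j<n. g (2 * j) + g (2 * j + 1))" for g :: "nat \<Rightarrow> real" and n
    by (induction n) auto
  have pad: "(\<Sum>j<R. g j) = (\<Sum>j<2 * R. if j < R then g j else 0)" for g :: "nat \<Rightarrow> real"
    by (rule sum.mono_neutral_cong_left) auto
  obtain I \<kappa> where I: "finite I" "I \<subseteq> {..N} \<times> UNIV"
    and rep: "\<And>z. (\<Sum>j<R. c j \<bullet> (levy z N (Suc j) - levy z N j)) = (\<Sum>i\<in>I. \<kappa> i \<bullet> z i)"
    and Q: "(\<Sum>i\<in>I. Q (\<kappa> i)) = (1 / 2) ^ N * (\<Sum>j<R. Q (c j))"
    using Suc[of c R] by blast
  define I' where "I' = (\<lambda>j. (Suc N, j)) ` {..<R}"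
  have inj: "inj_on (\<lambda>j. (Suc N, j)) {..<R}" by (auto simp: inj_on_def)
  define \<kappa>' where "\<kappa>' i = (if fst i = Suc N then d (snd i) else \<kappa> i)" for i
  have fin: "finite I'" "I \<inter> I' = {}" using I by (auto simp: I'_def)
  have sum': "(\<Sum>i\<in>I \<union> I'. g (\<kappa>' i) i) = (\<Sum>i\<in>I. g (\<kappa> i) i) + (\<Sum>j<R. g (d j) (Suc N, j))"
    for g :: "'w \<Rightarrow> nat \<times> nat \<Rightarrow> real"
  proof -
    have "(\<Sum>i\<in>I. g (\<kappa>' i) i) = (\<Sum>i\<in>I. g (\<kappa> i) i)"
      using I by (intro sum.cong) (auto simp: \<kappa>'_def)
    moreover have "(\<Sum>i\<in>I'. g (\<kappa>' i) i) = (\<Sum>j<R. g (d j) (Suc N, j))"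
      unfolding I'_def by (subst sum.reindex[OF inj]) (simp add: \<kappa>'_def)
    ultimately show ?thesis using I fin by (simp add: sum.union_disjoint)
  qed
  show ?case
  proof (rule exI[of _ "I \<union> I'"], rule exI[of _ \<kappa>'], intro conjI allI)
    show "finite (I \<union> I')" "I \<union> I' \<subseteq> {..Suc N} \<times> UNIV" using I fin by (auto simp: I'_def)
    fix z :: "nat \<times> nat \<Rightarrow> 'w"
    have "(\<Sum>j<R. a j \<bullet> (levy z (Suc N) (Suc j) - levy z (Suc N) j))
        = (\<Sum>j<2 * R. a' j \<bullet> (levy z (Suc N) (Suc j) - levy z (Suc N) j))"
      by (subst pad) (auto intro!: sum.cong simp: a'_def)
    also have "\<dots> = (\<Sum>j<R. c j \<bullet> (levy z N (Suc j) - levy z N j) + d j \<bullet> z (Suc N, j))"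
      unfolding split
    proof (rule sum.cong[OF refl])
      fix j
      have e: "levy z (Suc N) (2 * j) = levy z N j" "levy z (Suc N) (Suc (2 * j + 1)) = levy z N (Suc j)"
        "levy z (Suc N) (Suc (2 * j)) = (1 / 2) *\<^sub>R (levy z N j + levy z N (Suc j)) + levy_scale N *\<^sub>R z (Suc N, j)"
        "levy z (Suc N) (2 * j + 1) = (1 / 2) *\<^sub>R (levy z N j + levy z N (Suc j)) + levy_scale N *\<^sub>R z (Suc N, j)"
        by simp_all
      show "a' (2 * j) \<bullet> (levy z (Suc N) (Suc (2 * j)) - levy z (Suc N) (2 * j))
          + a' (2 * j + 1) \<bullet> (levy z (Suc N) (Suc (2 * j + 1)) - levy z (Suc N) (2 * j + 1))
          = c j \<bullet> (levy z N (Suc j) - levy z N j) + d j \<bullet> z (Suc N, j)"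
        unfolding e c_def d_def by (simp add: inner_simps algebra_simps)
    qed
    also have "\<dots> = (\<Sum>i\<in>I \<union> I'. \<kappa>' i \<bullet> z i)"
      using sum'[of "\<lambda>x i. x \<bullet> z i"] by (simp add: sum.distrib rep)
    finally show "(\<Sum>j<R. a j \<bullet> (levy z (Suc N) (Suc j) - levy z (Suc N) j)) = (\<Sum>i\<in>I \<union> I'. \<kappa>' i \<bullet> z i)" .
  next
    have "(\<Sum>i\<in>I \<union> I'. Q (\<kappa>' i)) = (\<Sum>j<R. (1 / 2) ^ N * Q (c j) + Q (d j))"
      using sum'[of "\<lambda>x i. Q x"] by (simp add: Q sum.distrib sum_distrib_left)
    also have "\<dots> = (\<Sum>j<R. (1 / 2) ^ Suc N * (Q (a' (2 * j)) + Q (a' (2 * j + 1))))"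
    proof (rule sum.cong[OF refl])
      fix j
      have A: "Q (c j) = (1 / 4) * Q (a' (2 * j) + a' (2 * j + 1))" unfolding c_def Q_scale by (simp add: power2_eq_square)
      have B: "Q (d j) = (1 / 2) ^ N / 4 * Q (a' (2 * j) - a' (2 * j + 1))"
        unfolding d_def Q_scale levy_scale_squared ..
      have "(1 / 2) ^ N * Q (c j) + Q (d j)
          = (1 / 2) ^ N / 4 * (Q (a' (2 * j) + a' (2 * j + 1)) + Q (a' (2 * j) - a' (2 * j + 1)))"
        unfolding A B by (simp add: algebra_simps)
      then show "(1 / 2) ^ N * Q (c j) + Q (d j) = (1 / 2) ^ Suc N * (Q (a' (2 * j)) + Q (a' (2 * j + 1)))"
        unfolding Q_parallelogram by (simp add: algebra_simps)
    qed
    also have "\<dots> = (1 / 2) ^ Suc N * (\<Sum>j<2 * R. Q (a' j))"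
      unfolding split by (rule sum_distrib_left[symmetric])
    also have "(\<Sum>j<2 * R. Q (a' j)) = (\<Sum>j<R. Q (a j))"
      by (subst pad) (auto intro!: sum.cong simp: a'_def Q_zero)
    finally show "(\<Sum>i\<in>I \<union> I'. Q (\<kappa>' i)) = (1 / 2) ^ Suc N * (\<Sum>j<R. Q (a j))" .
  qed
qed

text \<open>An increment over a block is the sum of the unit increments in it, so its coefficient is
  repeated along the block and Q is counted with the length of the block.\<close>

lemma coarse_increments:
  fixes k :: "nat \<Rightarrow> nat"
  assumes k: "mono k"
  shows "\<exists>\<alpha>. (\<forall>l :: nat \<Rightarrow> 'w. (\<Sum>j<m. a j \<bullet> (l (k (Suc j)) - l (k j))) = (\<Sum>i<k m. \<alpha> i \<bullet> (l (Suc i) - l i)))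
    \<and> (\<Sum>i<k m. Q (\<alpha> i)) = (\<Sum>j<m. Q (a j) * (real (k (Suc j)) - real (k j)))"
proof (induction m)
  case 0
  show ?case by (rule exI[of _ "\<lambda>_. 0"]) (simp add: Q_zero)
next
  case (Suc m)
  then obtain \<alpha> where \<alpha>: "\<And>l :: nat \<Rightarrow> 'w. (\<Sum>j<m. a j \<bullet> (l (k (Suc j)) - l (k j))) = (\<Sum>i<k m. \<alpha> i \<bullet> (l (Suc i) - l i))"
    "(\<Sum>i<k m. Q (\<alpha> i)) = (\<Sum>j<m. Q (a j) * (real (k (Suc j)) - real (k j)))" by blast
  define \<beta> where "\<beta> i = (if i < k m then \<alpha> i else a m)" for i
  have le: "k m \<le> k (Suc m)" using k by (simp add: mono_def)
  have sum: "(\<Sum>i<k (Suc m). g (\<beta> i) i) = (\<Sum>i<k m. g (\<alpha> i) i) + (\<Sum>i\<in>{k m..<k (Suc m)}. g (a m) i)"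
    for g :: "'w \<Rightarrow> nat \<Rightarrow> real"
  proof -
    have "{..<k (Suc m)} = {..<k m} \<union> {k m..<k (Suc m)}" using le by auto
    moreover have "(\<Sum>i\<in>{..<k m}. g (\<beta> i) i) = (\<Sum>i<k m. g (\<alpha> i) i)" by (intro sum.cong) (auto simp: \<beta>_def)
    moreover have "(\<Sum>i\<in>{k m..<k (Suc m)}. g (\<beta> i) i) = (\<Sum>i\<in>{k m..<k (Suc m)}. g (a m) i)"
      by (intro sum.cong) (auto simp: \<beta>_def)
    ultimately show ?thesis by (simp add: sum.union_disjoint ivl_disj_int)
  qed
  show ?case
  proof (intro exI[of _ \<beta>] conjI allI)
    fix l :: "nat \<Rightarrow> 'w"
    have "(\<Sum>i\<in>{k m..<k (Suc m)}. a m \<bullet> (l (Suc i) - l i)) = a m \<bullet> (l (k (Suc m)) - l (k m))"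
      using sum_Suc_diff'[OF le, of l] by (simp flip: inner_sum_right)
    then show "(\<Sum>j<Suc m. a j \<bullet> (l (k (Suc j)) - l (k j))) = (\<Sum>i<k (Suc m). \<beta> i \<bullet> (l (Suc i) - l i))"
      using sum[of "\<lambda>x i. x \<bullet> (l (Suc i) - l i)"] by (simp add: \<alpha>(1))
  next
    show "(\<Sum>i<k (Suc m). Q (\<beta> i)) = (\<Sum>j<Suc m. Q (a j) * (real (k (Suc j)) - real (k j)))"
      using sum[of "\<lambda>x i. Q x"] le by (simp add: \<alpha>(2) of_nat_diff)
  qed
qed

lemma levy_coarse_increments:
  assumes k: "mono k"
  shows "\<exists>I \<kappa>. finite I
    \<and> (\<forall>z. (\<Sum>j<m. a j \<bullet> (levy z N (k (Suc j)) - levy z N (k j))) = (\<Sum>i\<in>I. \<kappa> i \<bullet> z i))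
    \<and> (\<Sum>i\<in>I. Q (\<kappa> i)) = (1 / 2) ^ N * (\<Sum>j<m. Q (a j) * (real (k (Suc j)) - real (k j)))"
proof -
  obtain \<alpha> where \<alpha>: "\<And>l :: nat \<Rightarrow> 'w. (\<Sum>j<m. a j \<bullet> (l (k (Suc j)) - l (k j))) = (\<Sum>i<k m. \<alpha> i \<bullet> (l (Suc i) - l i))"
    "(\<Sum>i<k m. Q (\<alpha> i)) = (\<Sum>j<m. Q (a j) * (real (k (Suc j)) - real (k j)))"
    using coarse_increments[OF k, of a m] by blast
  show ?thesis using levy_increments[of N \<alpha> "k m"] unfolding \<alpha> by blast
qed

end

section \<open>Gaussian product space and limit process\<close>

lemma gaussian_product_char:
  fixes c :: "'i \<Rightarrow> real"
  assumes I: "finite I"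
  shows "(LINT \<omega>|PiM UNIV (\<lambda>_. std_normal_distribution). iexp (\<Sum>i\<in>I. c i * \<omega> i))
    = of_real (exp (- (\<Sum>i\<in>I. (c i)\<^sup>2) / 2))"
proof -
  let ?G = "\<lambda>_ :: 'i. std_normal_distribution"
  interpret G: prob_space std_normal_distribution by (rule prob_space_std_normal)
  interpret product_prob_space ?G UNIV
    by unfold_locales
  have "(LINT \<omega>|PiM UNIV ?G. iexp (\<Sum>i\<in>I. c i * \<omega> i)) = (LINT \<omega>|PiM UNIV ?G. iexp (\<Sum>i\<in>I. c i * restrict \<omega> I i))"
    by simp
  also have "\<dots> = (LINT \<omega>|distr (PiM UNIV ?G) (PiM I ?G) (\<lambda>\<omega>. restrict \<omega> I). iexp (\<Sum>i\<in>I. c i * \<omega> i))"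
    by (rule integral_distr[symmetric]) measurable
  also have "\<dots> = (LINT \<omega>|PiM I ?G. (\<Prod>i\<in>I. iexp (c i * \<omega> i)))"
    using I by (simp add: distr_PiM_restrict_finite exp_sum sum_distrib_left)
  also have "\<dots> = (\<Prod>i\<in>I. LINT x|std_normal_distribution. iexp (c i * x))"
    by (rule product_integral_prod[OF I]) (auto intro!: G.integrable_const_bound[where B = 1])
  also have "\<dots> = (\<Prod>i\<in>I. of_real (exp (- (c i)\<^sup>2 / 2)))"
    using fun_cong[OF char_std_normal_distribution] by (simp add: char_def)
  also have "\<dots> = of_real (exp (- (\<Sum>i\<in>I. (c i)\<^sup>2) / 2))"
    by (simp only: of_real_prod[symmetric] exp_sum[OF I, symmetric] sum_divide_distrib[symmetric] sum_negf)
  finally show ?thesis .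
qed

lemma gaussian_component_power4:
  "integrable (PiM UNIV (\<lambda>_. std_normal_distribution)) (\<lambda>\<omega>. \<omega> i ^ 4)"
  "(LINT \<omega>|PiM UNIV (\<lambda>_. std_normal_distribution). \<omega> i ^ 4) = 3"
proof -
  let ?G = "\<lambda>_ :: 'a. std_normal_distribution"
  interpret G: prob_space std_normal_distribution by (rule prob_space_std_normal)
  interpret product_prob_space ?G UNIV by unfold_locales
  have d: "distr (PiM UNIV ?G) std_normal_distribution (\<lambda>\<omega>. \<omega> i) = std_normal_distribution"
    by (rule PiM_component) simp
  have m: "(\<lambda>\<omega>. \<omega> i) \<in> measurable (PiM UNIV ?G) std_normal_distribution" by simp
  have "integrable std_normal_distribution (\<lambda>x. x ^ 4)" by (rule integrable_std_normal_distribution_moment)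
  then show "integrable (PiM UNIV ?G) (\<lambda>\<omega>. \<omega> i ^ 4)"
    using integrable_distr[OF m, of "\<lambda>x. x ^ 4"] by (simp add: d)
  have "(LINT \<omega>|PiM UNIV ?G. \<omega> i ^ 4) = (LINT x|std_normal_distribution. x ^ 4)"
    using integral_distr[OF m, of "\<lambda>x. x ^ 4"] by (simp add: d)
  then show "(LINT \<omega>|PiM UNIV ?G. \<omega> i ^ 4) = 3"
    using std_normal_distribution_even_moments(1)[of 2] by (simp add: fact_numeral)
qed

lemma sum_power4_le:
  assumes J: "finite J" and x: "\<And>e. e \<in> J \<Longrightarrow> 0 \<le> x e"
  shows "(\<Sum>e\<in>J. x e) ^ 4 \<le> real (card J) ^ 4 * (\<Sum>e\<in>J. x e ^ 4 :: real)"
proof (cases "J = {}")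
  case False
  define m where "m = Max (x ` J)"
  have m: "x e \<le> m" if "e \<in> J" for e using J that by (simp add: m_def)
  have "m \<in> x ` J" unfolding m_def using J False by (intro Max_in) auto
  then obtain e where e: "e \<in> J" "m = x e" by auto
  have "(\<Sum>e\<in>J. x e) \<le> real (card J) * m" using sum_bounded_above[of J x m] m by simp
  then have "(\<Sum>e\<in>J. x e) ^ 4 \<le> (real (card J) * m) ^ 4"
    by (intro power_mono sum_nonneg x) auto
  also have "\<dots> = real (card J) ^ 4 * x e ^ 4" by (simp add: power_mult_distrib e)
  also have "x e ^ 4 \<le> (\<Sum>e\<in>J. x e ^ 4)" using J e by (intro member_le_sum) (auto simp: x)
  finally show ?thesis by (simp add: mult_left_mono)
qed simp

text \<open>The vectors v factorise the covariance: attaching independent standard normals to the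
  elements of J and summing the multiples of v gives a Gaussian vector with covariance form
  \<open>Q\<close>, without a square root of an operator. The expectations of the level errors decay
  like \<open>dyadic_rate ^ N\<close>, so the errors are almost surely summable.\<close>

lemma brownian_motion_exists:
  fixes v :: "'e \<Rightarrow> 'w::euclidean_space"
  assumes J: "finite J"
  defines "\<Omega> \<equiv> PiM (UNIV :: ((nat \<times> nat) \<times> 'e) set) (\<lambda>_. std_normal_distribution)"
  defines "Q \<equiv> (\<lambda>x. \<Sum>e\<in>J. (v e \<bullet> x)\<^sup>2)"
  shows "\<exists>B. prob_space \<Omega> \<and> (\<forall>\<omega>\<in>space \<Omega>. B \<omega> \<in> path_space) \<and> (\<forall>t\<ge>0. (\<lambda>\<omega>. B \<omega> t) \<in> borel_measurable \<Omega>)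
    \<and> (\<forall>\<tau> m a. mono \<tau> \<and> 0 \<le> \<tau> 0 \<longrightarrow> (LINT \<omega>|\<Omega>. iexp (\<Sum>j<m. a j \<bullet> (B \<omega> (\<tau> (Suc j)) - B \<omega> (\<tau> j))))
      = of_real (exp (- (\<Sum>j<m. Q (a j) * (\<tau> (Suc j) - \<tau> j)) / 2)))"
proof -
  interpret G: prob_space std_normal_distribution by (rule prob_space_std_normal)
  interpret P: product_prob_space "\<lambda>_ :: (nat \<times> nat) \<times> 'e. std_normal_distribution" UNIV by unfold_locales
  have prob: "prob_space \<Omega>" unfolding \<Omega>_def by unfold_locales
  interpret O: prob_space \<Omega> by (rule prob)
  interpret quadratic_form Q
    by unfold_locales (auto simp: Q_def inner_simps power_mult_distrib sum_distrib_left sum.distrib[symmetric] power2_sum power2_diff algebra_simps intro!: sum.cong)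
  have comp[measurable]: "(\<lambda>\<omega>. \<omega> i) \<in> borel_measurable \<Omega>" for i
    using measurable_component_singleton[of i UNIV "\<lambda>_. std_normal_distribution"]
    by (simp add: \<Omega>_def cong: measurable_cong_sets)
  define Z where "Z \<omega> i = (\<Sum>e\<in>J. \<omega> (i, e) *\<^sub>R v e)" for \<omega> :: "(nat \<times> nat) \<times> 'e \<Rightarrow> real" and i
  have Zm[measurable]: "(\<lambda>\<omega>. Z \<omega> i) \<in> borel_measurable \<Omega>" for i
    unfolding Z_def by measurable
  have Zchar: "(LINT \<omega>|\<Omega>. iexp (\<Sum>i\<in>I. \<kappa> i \<bullet> Z \<omega> i)) = of_real (exp (- (\<Sum>i\<in>I. Q (\<kappa> i)) / 2))"
    if I: "finite I" for I \<kappa>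
  proof -
    have "(\<Sum>i\<in>I. \<kappa> i \<bullet> Z \<omega> i) = (\<Sum>k\<in>I \<times> J. (v (snd k) \<bullet> \<kappa> (fst k)) * \<omega> k)" for \<omega>
      by (simp add: Z_def inner_sum_right sum.cartesian_product case_prod_unfold inner_commute mult.commute)
    moreover have "(\<Sum>k\<in>I \<times> J. (v (snd k) \<bullet> \<kappa> (fst k))\<^sup>2) = (\<Sum>i\<in>I. Q (\<kappa> i))"
      by (simp add: Q_def sum.cartesian_product case_prod_unfold)
    ultimately show ?thesis
      using gaussian_product_char[of "I \<times> J" "\<lambda>k. v (snd k) \<bullet> \<kappa> (fst k)"] I J by (simp add: \<Omega>_def)
  qed
  define K4 where "K4 = real (card J) ^ 4 * (\<Sum>e\<in>J. 3 * norm (v e) ^ 4)"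
  have Zmom: "integrable \<Omega> (\<lambda>\<omega>. norm (Z \<omega> i) ^ 4)" "(LINT \<omega>|\<Omega>. norm (Z \<omega> i) ^ 4) \<le> K4" for i
  proof -
    have le: "norm (Z \<omega> i) ^ 4 \<le> real (card J) ^ 4 * (\<Sum>e\<in>J. \<omega> (i, e) ^ 4 * norm (v e) ^ 4)" for \<omega>
    proof -
      have "norm (Z \<omega> i) \<le> (\<Sum>e\<in>J. norm (\<omega> (i, e) *\<^sub>R v e))" unfolding Z_def by (rule norm_sum)
      then have "norm (Z \<omega> i) ^ 4 \<le> (\<Sum>e\<in>J. norm (\<omega> (i, e) *\<^sub>R v e)) ^ 4" by (intro power_mono) auto
      also have "\<dots> \<le> real (card J) ^ 4 * (\<Sum>e\<in>J. norm (\<omega> (i, e) *\<^sub>R v e) ^ 4)"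
        by (rule sum_power4_le[OF J]) simp
      finally show ?thesis by (simp add: power_mult_distrib power_even_abs)
    qed
    have int: "integrable \<Omega> (\<lambda>\<omega>. real (card J) ^ 4 * (\<Sum>e\<in>J. \<omega> (i, e) ^ 4 * norm (v e) ^ 4))"
      unfolding \<Omega>_def by (intro integrable_mult_right Bochner_Integration.integrable_sum integrable_mult_left gaussian_component_power4)
    show i: "integrable \<Omega> (\<lambda>\<omega>. norm (Z \<omega> i) ^ 4)"
    proof (rule Bochner_Integration.integrable_bound[OF int])
      show "AE \<omega> in \<Omega>. norm (norm (Z \<omega> i) ^ 4) \<le> norm (real (card J) ^ 4 * (\<Sum>e\<in>J. \<omega> (i, e) ^ 4 * norm (v e) ^ 4))"
        using order_trans[OF le abs_ge_self] by (intro AE_I2) simp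
    qed measurable
    have "(LINT \<omega>|\<Omega>. norm (Z \<omega> i) ^ 4) \<le> (LINT \<omega>|\<Omega>. real (card J) ^ 4 * (\<Sum>e\<in>J. \<omega> (i, e) ^ 4 * norm (v e) ^ 4))"
      by (rule integral_mono[OF i int le])
    also have "\<dots> = K4"
      unfolding K4_def \<Omega>_def
      by (simp add: Bochner_Integration.integral_sum gaussian_component_power4)
    finally show "(LINT \<omega>|\<Omega>. norm (Z \<omega> i) ^ 4) \<le> K4" .
  qed
  have scale4: "levy_scale N ^ 4 = (1 / 4) ^ N / 16" for N
  proof -
    have "levy_scale N ^ 4 = ((levy_scale N)\<^sup>2)\<^sup>2" by simp
    also have "\<dots> = (1 / 4) ^ N / 16"
      unfolding levy_scale_squared by (simp add: power_divide power_one_over power2_eq_square flip: power_mult_distrib)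
    finally show ?thesis .
  qed
  have err0: "0 \<le> levy_error (Z \<omega>) k N" for \<omega> k N
    unfolding levy_error_def using dyadic_rate(1) by (intro divide_nonneg_nonneg sum_nonneg) auto
  have err_int: "integrable \<Omega> (\<lambda>\<omega>. levy_error (Z \<omega>) k N)" for k N
    unfolding levy_error_def norm_scaleR power_mult_distrib
    by (intro integrable_divide Bochner_Integration.integrable_sum integrable_mult_right Zmom)
  have err_le: "(LINT \<omega>|\<Omega>. levy_error (Z \<omega>) k N) \<le> real k * K4 / 16 * dyadic_rate ^ N" for k N
  proof -
    have "(LINT \<omega>|\<Omega>. levy_error (Z \<omega>) k N)
        = (\<Sum>j<k * 2 ^ N. levy_scale N ^ 4 * (LINT \<omega>|\<Omega>. norm (Z \<omega> (Suc N, j)) ^ 4)) / (dyadic_rate ^ N) ^ 3"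
      unfolding levy_error_def norm_scaleR power_mult_distrib
      using Zmom by (simp add: Bochner_Integration.integral_sum power_even_abs)
    also have "\<dots> \<le> (\<Sum>j<k * 2 ^ N. levy_scale N ^ 4 * K4) / (dyadic_rate ^ N) ^ 3"
      using dyadic_rate(1) by (intro divide_right_mono sum_mono mult_left_mono Zmom) auto
    also have "(\<Sum>j<k * 2 ^ N. levy_scale N ^ 4 * K4) = real k * K4 / 16 * (2 ^ N * (1 / 4) ^ N)"
      by (simp add: scale4)
    also have "2 ^ N * (1 / 4) ^ N = (1 / 2 :: real) ^ N" by (simp flip: power_mult_distrib)
    also have "real k * K4 / 16 * (1 / 2) ^ N / (dyadic_rate ^ N) ^ 3 = real k * K4 / 16 * dyadic_rate ^ N"
      by (simp only: times_divide_eq_right[symmetric] dyadic_rate_div)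
    finally show ?thesis .
  qed
  have "AE \<omega> in \<Omega>. summable (levy_error (Z \<omega>) k)" for k
  proof -
    have sm: "summable (\<lambda>N. real k * K4 / 16 * dyadic_rate ^ N)"
      using dyadic_rate by (intro summable_mult summable_geometric) auto
    have "(\<integral>\<^sup>+\<omega>. (\<Sum>N. ennreal (levy_error (Z \<omega>) k N)) \<partial>\<Omega>) = (\<Sum>N. \<integral>\<^sup>+\<omega>. ennreal (levy_error (Z \<omega>) k N) \<partial>\<Omega>)"
      using err_int by (intro nn_integral_suminf) auto
    also have "\<dots> = (\<Sum>N. ennreal (LINT \<omega>|\<Omega>. levy_error (Z \<omega>) k N))"
      by (simp add: nn_integral_eq_integral[OF err_int] err0)
    also have "\<dots> \<le> (\<Sum>N. ennreal (real k * K4 / 16 * dyadic_rate ^ N))"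
      by (intro suminf_le ennreal_leI err_le) auto
    also have "\<dots> = ennreal (\<Sum>N. real k * K4 / 16 * dyadic_rate ^ N)"
      using dyadic_rate(1) by (intro suminf_ennreal2 sm) (auto simp: K4_def intro!: sum_nonneg mult_nonneg_nonneg)
    finally have "(\<integral>\<^sup>+\<omega>. (\<Sum>N. ennreal (levy_error (Z \<omega>) k N)) \<partial>\<Omega>) \<noteq> \<infinity>" by (auto simp: top_unique)
    then have "AE \<omega> in \<Omega>. (\<Sum>N. ennreal (levy_error (Z \<omega>) k N)) \<noteq> \<infinity>"
      using err_int by (intro nn_integral_PInf_AE) auto
    then show ?thesis
      by eventually_elim (auto intro: summable_suminf_not_top err0)
  qed
  then have "AE \<omega> in \<Omega>. \<forall>k. summable (levy_error (Z \<omega>) k)" by (simp add: AE_all_countable)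
  then obtain S where S: "{\<omega> \<in> space \<Omega>. \<not> (\<forall>k. summable (levy_error (Z \<omega>) k))} \<subseteq> S" "S \<in> null_sets \<Omega>"
    by (auto simp: eventually_ae_filter)
  \<comment> \<open>On the exceptional null set the zero path is taken, so that every sample path
    lies in the path space; that S is measurable keeps the evaluations measurable.\<close>
  define B where "B \<omega> = (if \<omega> \<in> S then (\<lambda>t\<in>{0..}. 0)
    else (SOME b. b \<in> path_space \<and> (\<forall>k. (\<lambda>N. path_dist k (levy_path (Z \<omega>) N) b) \<longlonglongrightarrow> 0)))" for \<omega>
  have B: "B \<omega> \<in> path_space \<and> (\<forall>k. (\<lambda>N. path_dist k (levy_path (Z \<omega>) N) (B \<omega>)) \<longlonglongrightarrow> 0)"
    if "\<omega> \<in> space \<Omega>" "\<omega> \<notin> S" for \<omega>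
  proof -
    have "\<exists>b. b \<in> path_space \<and> (\<forall>k. (\<lambda>N. path_dist k (levy_path (Z \<omega>) N) b) \<longlonglongrightarrow> 0)"
      using levy_path_converges[of "Z \<omega>"] S(1) that by blast
    from someI_ex[OF this] show ?thesis using that by (simp add: B_def)
  qed
  have B_path: "B \<omega> \<in> path_space" if "\<omega> \<in> space \<Omega>" for \<omega>
    using B[OF that] zero_path by (cases "\<omega> \<in> S") (auto simp: B_def)
  have levy_m[measurable]: "(\<lambda>\<omega>. levy (Z \<omega>) N k) \<in> borel_measurable \<Omega>" for N k
    by (induction N arbitrary: k) auto
  have B_m: "(\<lambda>\<omega>. B \<omega> t) \<in> borel_measurable \<Omega>" if t: "0 \<le> t" for t
  proof (rule borel_measurable_LIMSEQ_metric)
    have [measurable]: "S \<in> sets \<Omega>" using S(2) by blast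
    have eq: "levy_path z N t = pl (levy z N) (2 ^ N * t)" for z N
      using t by (simp add: levy_path_def)
    show "(\<lambda>\<omega>. if \<omega> \<in> S then 0 else levy_path (Z \<omega>) N t) \<in> borel_measurable \<Omega>" for N
      unfolding eq pl_def Let_def by measurable
    show "(\<lambda>N. if \<omega> \<in> S then 0 else levy_path (Z \<omega>) N t) \<longlonglongrightarrow> B \<omega> t" if \<omega>: "\<omega> \<in> space \<Omega>" for \<omega>
    proof (cases "\<omega> \<in> S")
      case True
      then show ?thesis using t by (simp add: B_def)
    next
      case False
      have "(\<lambda>N. levy_path (Z \<omega>) N t - B \<omega> t) \<longlonglongrightarrow> 0"
      proof (rule Lim_null_comparison[OF always_eventually])
        show "\<forall>N. norm (levy_path (Z \<omega>) N t - B \<omega> t) \<le> path_dist (nat \<lceil>t\<rceil>) (levy_path (Z \<omega>) N) (B \<omega>)"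
          using t by (intro allI path_dist_upper levy_path_space B_path \<omega>) (auto simp: real_nat_ceiling_ge)
      qed (use B[OF \<omega> False] in blast)
      then show ?thesis using False by (simp add: LIM_zero_iff)
    qed
  qed
  have B_char: "(LINT \<omega>|\<Omega>. iexp (\<Sum>j<m. a j \<bullet> (B \<omega> (\<tau> (Suc j)) - B \<omega> (\<tau> j))))
      = of_real (exp (- (\<Sum>j<m. Q (a j) * (\<tau> (Suc j) - \<tau> j)) / 2))"
    if \<tau>: "mono \<tau>" "0 \<le> \<tau> 0" for \<tau> :: "nat \<Rightarrow> real" and m a
  proof (rule LIMSEQ_unique)
    \<comment> \<open>Arbitrary times are approached from below by dyadic ones; rounding is
      monotone, so the increments stay consecutive and the exact formula at level N applies.\<close>
    define k where "k N j = nat \<lfloor>2 ^ N * \<tau> j\<rfloor>" for N j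
    have \<tau>0: "0 \<le> \<tau> j" for j using \<tau> by (meson mono_def order_trans zero_le)
    have k_mono: "mono (k N)" for N
      using \<tau>(1) by (auto simp: mono_def k_def intro!: nat_mono floor_mono)
    have k_lim: "(\<lambda>N. real (k N j) / 2 ^ N) \<longlonglongrightarrow> \<tau> j" for j
    proof -
      have "(\<lambda>N. real (k N j) / 2 ^ N - \<tau> j) \<longlonglongrightarrow> 0"
      proof (rule Lim_null_comparison[OF always_eventually])
        show "\<forall>N. norm (real (k N j) / 2 ^ N - \<tau> j) \<le> (1 / 2) ^ N"
        proof
          fix N
          have "real (k N j) = of_int \<lfloor>2 ^ N * \<tau> j\<rfloor>" using \<tau>0 by (simp add: k_def)
          then have "\<bar>real (k N j) - 2 ^ N * \<tau> j\<bar> \<le> 1" by linarith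
          then have "\<bar>real (k N j) - 2 ^ N * \<tau> j\<bar> / 2 ^ N \<le> 1 / 2 ^ N" by (intro divide_right_mono) auto
          moreover have "real (k N j) / 2 ^ N - \<tau> j = (real (k N j) - 2 ^ N * \<tau> j) / 2 ^ N" by (simp add: field_simps)
          ultimately show "norm (real (k N j) / 2 ^ N - \<tau> j) \<le> (1 / 2) ^ N" by (simp add: power_one_over)
        qed
        show "(\<lambda>N. (1 / 2 :: real) ^ N) \<longlonglongrightarrow> 0" by (rule LIMSEQ_realpow_zero) auto
      qed
      then show ?thesis by (simp add: LIM_zero_iff)
    qed
    have k_le: "real (k N j) / 2 ^ N \<le> \<tau> j" for N j
    proof -
      have "real (k N j) \<le> 2 ^ N * \<tau> j" using \<tau>0 by (simp add: k_def)
      then show ?thesis by (simp add: field_simps)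
    qed
    \<comment> \<open>Level and node vary together: uniform convergence on a bounded interval takes
      care of the level, continuity of the limit path of the node.\<close>
    have lv: "(\<lambda>N. levy (Z \<omega>) N (k N j)) \<longlonglongrightarrow> B \<omega> (\<tau> j)" if \<omega>: "\<omega> \<in> space \<Omega>" "\<omega> \<notin> S" for \<omega> j
    proof -
      have p: "levy (Z \<omega>) N (k N j) = levy_path (Z \<omega>) N (real (k N j) / 2 ^ N)" for N
        by (simp add: levy_path_def)
      have 1: "(\<lambda>N. levy (Z \<omega>) N (k N j) - B \<omega> (real (k N j) / 2 ^ N)) \<longlonglongrightarrow> 0"
      proof (rule Lim_null_comparison[OF always_eventually])
        show "\<forall>N. norm (levy (Z \<omega>) N (k N j) - B \<omega> (real (k N j) / 2 ^ N)) \<le> path_dist (nat \<lceil>\<tau> j\<rceil>) (levy_path (Z \<omega>) N) (B \<omega>)"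
          unfolding p using k_le[of _ j] real_nat_ceiling_ge[of "\<tau> j"]
          by (intro allI path_dist_upper levy_path_space B_path \<omega>) (auto intro: order_trans)
      qed (use B[OF \<omega>] in blast)
      have "continuous (at (\<tau> j) within {0..}) (B \<omega>)"
        using B_path[OF \<omega>(1)] \<tau>0 by (auto simp: path_space_def continuous_on_eq_continuous_within)
      then have 2: "(\<lambda>N. B \<omega> (real (k N j) / 2 ^ N)) \<longlonglongrightarrow> B \<omega> (\<tau> j)"
        by (rule continuous_within_tendsto_compose'[OF _ _ k_lim]) auto
      show ?thesis using tendsto_add[OF 1 2] by simp
    qed
    let ?L = "\<lambda>N \<omega>. \<Sum>j<m. a j \<bullet> (levy (Z \<omega>) N (k N (Suc j)) - levy (Z \<omega>) N (k N j))"
    show "(\<lambda>N. LINT \<omega>|\<Omega>. iexp (?L N \<omega>)) \<longlonglongrightarrow> (LINT \<omega>|\<Omega>. iexp (\<Sum>j<m. a j \<bullet> (B \<omega> (\<tau> (Suc j)) - B \<omega> (\<tau> j))))"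
    proof (rule integral_dominated_convergence[where w = "\<lambda>_. 1"])
      have [measurable]: "(\<lambda>\<omega>. B \<omega> (\<tau> j)) \<in> borel_measurable \<Omega>" for j by (rule B_m[OF \<tau>0])
      show "(\<lambda>\<omega>. iexp (\<Sum>j<m. a j \<bullet> (B \<omega> (\<tau> (Suc j)) - B \<omega> (\<tau> j)))) \<in> borel_measurable \<Omega>" by measurable
      show "(\<lambda>\<omega>. iexp (?L N \<omega>)) \<in> borel_measurable \<Omega>" for N by measurable
      have "AE \<omega> in \<Omega>. \<omega> \<notin> S" by (rule AE_not_in[OF S(2)])
      then show "AE \<omega> in \<Omega>. (\<lambda>N. iexp (?L N \<omega>)) \<longlonglongrightarrow> iexp (\<Sum>j<m. a j \<bullet> (B \<omega> (\<tau> (Suc j)) - B \<omega> (\<tau> j)))"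
        using AE_space by eventually_elim (intro tendsto_intros lv)
    qed auto
    have "(LINT \<omega>|\<Omega>. iexp (?L N \<omega>))
        = of_real (exp (- (\<Sum>j<m. Q (a j) * (real (k N (Suc j)) / 2 ^ N - real (k N j) / 2 ^ N)) / 2))" for N
    proof -
      obtain I \<kappa> where I: "finite I" and rep: "\<And>z. (\<Sum>j<m. a j \<bullet> (levy z N (k N (Suc j)) - levy z N (k N j))) = (\<Sum>i\<in>I. \<kappa> i \<bullet> z i)"
        and Q: "(\<Sum>i\<in>I. Q (\<kappa> i)) = (1 / 2) ^ N * (\<Sum>j<m. Q (a j) * (real (k N (Suc j)) - real (k N j)))"
        using levy_coarse_increments[OF k_mono[of N], of a N m] by blast
      have "(1 / 2) ^ N * (\<Sum>j<m. Q (a j) * (real (k N (Suc j)) - real (k N j)))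
          = (\<Sum>j<m. Q (a j) * (real (k N (Suc j)) / 2 ^ N - real (k N j) / 2 ^ N))"
        unfolding sum_distrib_left by (intro sum.cong refl) (simp add: power_one_over field_simps)
      then show ?thesis unfolding rep Zchar[OF I] Q by simp
    qed
    then show "(\<lambda>N. LINT \<omega>|\<Omega>. iexp (?L N \<omega>)) \<longlonglongrightarrow> of_real (exp (- (\<Sum>j<m. Q (a j) * (\<tau> (Suc j) - \<tau> j)) / 2))"
      by (simp only:) (intro tendsto_intros k_lim; simp)
  qed
  show ?thesis
    by (rule exI[of _ B]) (use prob B_path B_m B_char in blast)
qed

text \<open>Uniqueness of characteristic functions identifies the law with that of \<sigma> times a
  standard normal variable, whose density is known.\<close>

lemma distr_normal_of_char:
  assumes M: "prob_space M" and X[measurable]: "X \<in> borel_measurable M" and \<sigma>: "0 < \<sigma>"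
    and char: "\<And>\<theta>. (LINT z|M. iexp (\<theta> * X z)) = of_real (exp (- (\<sigma>\<^sup>2 * \<theta>\<^sup>2) / 2))"
  shows "distributed M lborel X (normal_density 0 \<sigma>)"
proof -
  let ?G = std_normal_distribution
  interpret G: prob_space ?G by (rule prob_space_std_normal)
  interpret M: prob_space M by (rule M)
  have "distributed ?G lborel (\<lambda>x. x) (normal_density 0 1)"
    by (auto simp: distributed_def distr_id2 intro: )
  from G.normal_density_affine[OF this, of \<sigma> 0] \<sigma>
  have s: "distributed ?G lborel (\<lambda>x. \<sigma> * x) (normal_density 0 \<sigma>)" by simp
  have "distr M borel X = distr ?G borel (\<lambda>x. \<sigma> * x)"
  proof (rule Levy_uniqueness)
    show "real_distribution (distr M borel X)" by (rule M.real_distribution_distr) simp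
    show "real_distribution (distr ?G borel (\<lambda>x. \<sigma> * x))" by (rule G.real_distribution_distr) simp
    show "char (distr M borel X) = char (distr ?G borel (\<lambda>x. \<sigma> * x))"
    proof
      fix \<theta>
      have "char (distr ?G borel (\<lambda>x. \<sigma> * x)) \<theta> = char ?G (\<theta> * \<sigma>)"
        by (simp add: char_def integral_distr mult.assoc)
      also have "\<dots> = of_real (exp (- (\<sigma>\<^sup>2 * \<theta>\<^sup>2) / 2))"
        by (simp add: char_std_normal_distribution power_mult_distrib mult.commute)
      also have "\<dots> = char (distr M borel X) \<theta>"
        unfolding char[symmetric] char_def by (rule integral_distr[symmetric]) measurable
      finally show "char (distr M borel X) \<theta> = char (distr ?G borel (\<lambda>x. \<sigma> * x)) \<theta>" ..
    qed
  qed
  moreover have "distr M lborel X = distr M borel X" "distr ?G lborel (\<lambda>x. \<sigma> * x) = distr ?G borel (\<lambda>x. \<sigma> * x)"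
    by (auto intro: distr_cong)
  ultimately show ?thesis using s by (simp add: distributed_def)
qed

section \<open>Centred additive functionals of a random walk\<close>

text \<open>With s and d for the squared norms of S and D and x for their product, the left side is
  (s + 2 x + d)^2. The term 4 s x is kept exact because it averages to zero for centred D; the rest
  is bounded by x^2 \<le> s d and 4 x d \<le> 2 x^2 + 2 d^2, whence the constants 8 and 3.\<close>

lemma norm_add_power4_le:
  fixes S D :: "'w::real_inner"
  assumes "norm D \<le> K"
  shows "norm (S + D) ^ 4 \<le> norm S ^ 4 + 4 * (norm S)\<^sup>2 * (S \<bullet> D) + (8 * K\<^sup>2 * (norm S)\<^sup>2 + 3 * K ^ 4)"
proof -
  define s d x where "s = (norm S)\<^sup>2" and "d = (norm D)\<^sup>2" and "x = S \<bullet> D"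
  have d: "0 \<le> d" "d \<le> K\<^sup>2" using assms by (auto simp: d_def intro: power_mono)
  have s: "0 \<le> s" by (simp add: s_def)
  have x2: "x\<^sup>2 \<le> s * d"
    using Cauchy_Schwarz_ineq[of S D] by (simp add: s_def d_def x_def power2_norm_eq_inner)
  have eq: "norm (S + D) ^ 4 = (s + 2 * x + d)\<^sup>2"
  proof -
    have "(norm (S + D))\<^sup>2 = s + 2 * x + d"
      by (simp add: s_def d_def x_def power2_norm_eq_inner inner_simps inner_commute)
    then show ?thesis by (simp flip: power_mult add: numeral_eq_Suc)
  qed
  have "(s + 2 * x + d)\<^sup>2 = s\<^sup>2 + 4 * x\<^sup>2 + d\<^sup>2 + 4 * s * x + 2 * s * d + 4 * x * d"
    by (simp add: power2_eq_square algebra_simps)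
  moreover have "4 * x * d \<le> 2 * x\<^sup>2 + 2 * d\<^sup>2"
    using sum_squares_bound[of x d] by simp
  moreover have "s * d \<le> s * K\<^sup>2" using d s by (intro mult_left_mono) auto
  moreover have "d\<^sup>2 \<le> (K\<^sup>2)\<^sup>2" using d by (intro power_mono) auto
  ultimately have "(s + 2 * x + d)\<^sup>2 \<le> s\<^sup>2 + 4 * s * x + (8 * K\<^sup>2 * s + 3 * (K\<^sup>2)\<^sup>2)"
    using x2 by (simp add: mult.commute mult.left_commute)
  then show ?thesis
    unfolding eq by (simp add: s_def x_def flip: power_mult)
qed

lemma pl_lipschitz:
  assumes inc: "\<And>j. norm (\<xi> (Suc j) - \<xi> j) \<le> K" and st: "0 \<le> s" "s \<le> t"
  shows "norm (pl \<xi> t - pl \<xi> s) \<le> K * (t - s)"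
proof -
  define m where "m = nat \<lceil>t\<rceil>"
  have m: "s \<le> real m" "t \<le> real m" using st by (auto simp: m_def real_nat_ceiling_ge intro: order_trans)
  define c where "c u j = max 0 (min 1 (u - real j))" for u j
  have mono: "c s j \<le> c t j" for j using st by (auto simp: c_def)
  \<comment> \<open>Interpolating the identity sequence gives the identity, so the clamped times add
    up to u.\<close>
  have tot: "(\<Sum>j<m. c u j) = u" if "0 \<le> u" "u \<le> real m" for u
    using pl_eq_sum[OF that, of real] that by (simp add: c_def pl_def Let_def)
  have "pl \<xi> t - pl \<xi> s = (\<Sum>j<m. (c t j - c s j) *\<^sub>R (\<xi> (Suc j) - \<xi> j))"
    using m st by (simp add: pl_eq_sum[of _ m] c_def sum_subtractf scaleR_diff_left)
  also have "norm \<dots> \<le> (\<Sum>j<m. norm ((c t j - c s j) *\<^sub>R (\<xi> (Suc j) - \<xi> j)))" by (rule norm_sum)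
  also have "\<dots> \<le> (\<Sum>j<m. (c t j - c s j) * K)"
    using mono inc by (intro sum_mono) (simp add: mult_left_mono)
  also have "\<dots> = K * (t - s)"
    unfolding sum_distrib_right[symmetric] sum_subtractf using tot[of t] tot[of s] m st by simp
  finally show ?thesis .
qed

locale walk_setup =
  fixes G :: "('v, 'e) pre_digraph" and q :: "'e \<Rightarrow> real" and x0 :: 'v
    and M :: "'a measure" and w :: "nat \<Rightarrow> 'a \<Rightarrow> 'v"
  assumes walk: "random_walk G q x0 M w"
    and wf: "wf_digraph G"
    and finite_out: "\<And>x. x \<in> verts G \<Longrightarrow> finite (out_arcs G x)"
    and q_nonneg: "\<And>e. e \<in> arcs G \<Longrightarrow> 0 \<le> q e"
    and q_sum: "\<And>x. x \<in> verts G \<Longrightarrow> (\<Sum>e\<in>out_arcs G x. q e) = 1"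
    and x0: "x0 \<in> verts G"
begin

sublocale prob_space M using walk by (simp add: random_walk_def)

lemma w_measurable [measurable]: "w n \<in> measurable M (count_space (verts G))"
  using walk by (simp add: random_walk_def)

lemma w_0: "z \<in> space M \<Longrightarrow> w 0 z = x0"
  using walk by (simp add: random_walk_def)

lemma head_verts: "e \<in> arcs G \<Longrightarrow> head G e \<in> verts G"
  using wf by (simp add: wf_digraph_def)

section \<open>Expectations as finite sums over paths\<close>

text \<open>Vertex sequences, as the walk is given by its vertices, so parallel edges are merged.
  Beyond time k a sequence is filled with x0, which makes it determined by its first k steps and the
  set finite.\<close>

fun walk_paths :: "nat \<Rightarrow> (nat \<Rightarrow> 'v) set" where
  "walk_paths 0 = {\<lambda>_. x0}"
| "walk_paths (Suc k) = (\<lambda>(y, v). y(Suc k := v)) ` (SIGMA y:walk_paths k. head G ` out_arcs G (y k))"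

lemma walk_paths_props:
  "y \<in> walk_paths k \<Longrightarrow> y 0 = x0 \<and> (\<forall>i. y i \<in> verts G) \<and> (\<forall>i>k. y i = x0)
    \<and> (\<forall>i<k. \<exists>e\<in>out_arcs G (y i). head G e = y (Suc i))"
proof (induction k arbitrary: y)
  case (Suc k)
  then obtain y' e where y: "y = y'(Suc k := head G e)" "y' \<in> walk_paths k" "e \<in> out_arcs G (y' k)" by auto
  from Suc.IH[OF y(2)] y(3) show ?case
    unfolding y(1) by (auto simp: head_verts less_Suc_eq)
qed (simp add: x0)

lemma walk_paths_verts: "y \<in> walk_paths k \<Longrightarrow> y i \<in> verts G"
  using walk_paths_props by blast

lemma finite_walk_paths: "finite (walk_paths k)"
  by (induction k) (auto intro!: finite_imageI finite_SigmaI finite_out walk_paths_verts)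

definition path_prob :: "nat \<Rightarrow> (nat \<Rightarrow> 'v) \<Rightarrow> real" where
  "path_prob k y = (\<Prod>i<k. step_probability G q (y i) (y (Suc i)))"

lemma path_prob_nonneg: "0 \<le> path_prob k y"
  unfolding path_prob_def step_probability_def by (intro prod_nonneg sum_nonneg ballI) (auto intro: q_nonneg)

text \<open>\<open>path_sum k F\<close> is the expectation of \<open>F\<close> if \<open>F\<close> depends on the first \<open>k\<close> steps only.\<close>

definition path_sum :: "nat \<Rightarrow> ((nat \<Rightarrow> 'v) \<Rightarrow> 'b::real_vector) \<Rightarrow> 'b" where
  "path_sum k F = (\<Sum>y\<in>walk_paths k. path_prob k y *\<^sub>R F y)"

text \<open>The Markov property in summed form: given the past, the last step averages over the
  outgoing edges, with edges of equal head collected in \<open>step_probability\<close>.\<close>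

lemma path_sum_Suc:
  "path_sum (Suc k) F = path_sum k (\<lambda>y. \<Sum>e\<in>out_arcs G (y k). q e *\<^sub>R F (y(Suc k := head G e)))"
proof -
  \<comment> \<open>Sequences in \<open>walk_paths k\<close> have the default x0 at
    \<open>Suc k\<close>, so overwriting that entry loses nothing.\<close>
  have inj: "inj_on (\<lambda>(y, v). y(Suc k := v)) (SIGMA y:walk_paths k. head G ` out_arcs G (y k))"
  proof (rule inj_onI, clarsimp)
    fix y e y' e' assume y: "y \<in> walk_paths k" "y' \<in> walk_paths k" and eq: "y(Suc k := head G e) = y'(Suc k := head G e')"
    have "y i = y' i" for i
    proof (cases "i = Suc k")
      case True
      then show ?thesis using walk_paths_props[OF y(1)] walk_paths_props[OF y(2)] by simp
    next
      case False
      then show ?thesis using fun_cong[OF eq, of i] by simp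
    qed
    then show "y = y' \<and> head G e = head G e'" using fun_cong[OF eq, of "Suc k"] by auto
  qed
  have "path_sum (Suc k) F = (\<Sum>(y, v)\<in>(SIGMA y:walk_paths k. head G ` out_arcs G (y k)).
      path_prob (Suc k) (y(Suc k := v)) *\<^sub>R F (y(Suc k := v)))"
    unfolding path_sum_def walk_paths.simps by (subst sum.reindex[OF inj]) (simp add: case_prod_unfold)
  also have "\<dots> = (\<Sum>y\<in>walk_paths k. \<Sum>v\<in>head G ` out_arcs G (y k). path_prob (Suc k) (y(Suc k := v)) *\<^sub>R F (y(Suc k := v)))"
    by (subst sum.Sigma) (auto simp: finite_walk_paths finite_out walk_paths_verts)
  also have "\<dots> = path_sum k (\<lambda>y. \<Sum>e\<in>out_arcs G (y k). q e *\<^sub>R F (y(Suc k := head G e)))"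
    unfolding path_sum_def
  proof (rule sum.cong[OF refl])
    fix y assume y: "y \<in> walk_paths k"
    have pp: "path_prob (Suc k) (y(Suc k := v)) = path_prob k y * step_probability G q (y k) v" for v
    proof -
      have "(\<Prod>i<k. step_probability G q ((y(Suc k := v)) i) ((y(Suc k := v)) (Suc i)))
          = (\<Prod>i<k. step_probability G q (y i) (y (Suc i)))" by (rule prod.cong) auto
      then show ?thesis by (simp add: path_prob_def)
    qed
    have fin: "finite (out_arcs G (y k))" by (rule finite_out[OF walk_paths_verts[OF y]])
    have "(\<Sum>v\<in>head G ` out_arcs G (y k). path_prob (Suc k) (y(Suc k := v)) *\<^sub>R F (y(Suc k := v)))
        = (\<Sum>v\<in>head G ` out_arcs G (y k). \<Sum>e\<in>{e \<in> out_arcs G (y k). head G e = v}.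
            path_prob k y *\<^sub>R q e *\<^sub>R F (y(Suc k := head G e)))"
      unfolding pp step_probability_def
      by (intro sum.cong refl) (auto simp: sum_distrib_left scaleR_sum_left intro!: sum.cong)
    also have "\<dots> = (\<Sum>e\<in>out_arcs G (y k). path_prob k y *\<^sub>R q e *\<^sub>R F (y(Suc k := head G e)))"
      by (rule sum.image_gen[OF fin, symmetric])
    finally show "(\<Sum>v\<in>head G ` out_arcs G (y k). path_prob (Suc k) (y(Suc k := v)) *\<^sub>R F (y(Suc k := v)))
        = path_prob k y *\<^sub>R (\<Sum>e\<in>out_arcs G (y k). q e *\<^sub>R F (y(Suc k := head G e)))"
      by (simp add: scaleR_sum_right)
  qed
  finally show ?thesis .
qed

lemma path_sum_cong: "(\<And>y. y \<in> walk_paths k \<Longrightarrow> F y = F' y) \<Longrightarrow> path_sum k F = path_sum k F'"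
  unfolding path_sum_def by (intro sum.cong) auto

lemma path_sum_add: "path_sum k (\<lambda>y. F y + F' y) = path_sum k F + path_sum k F'"
  by (simp add: path_sum_def scaleR_add_right sum.distrib)

lemma path_sum_diff: "path_sum k (\<lambda>y. F y - F' y) = path_sum k F - path_sum k F'"
  by (simp add: path_sum_def scaleR_diff_right sum_subtractf)

lemma path_sum_mult: "path_sum k (\<lambda>y. c * F y) = c * (path_sum k F :: 'b::real_algebra)"
  by (simp add: path_sum_def sum_distrib_left)

definition depends :: "nat \<Rightarrow> ((nat \<Rightarrow> 'v) \<Rightarrow> 'b) \<Rightarrow> bool" where
  "depends k F \<longleftrightarrow> (\<forall>y y'. (\<forall>i\<le>k. y i = y' i) \<longrightarrow> F y = F y')"

lemma depends_upd: "depends k F \<Longrightarrow> k < j \<Longrightarrow> F (y(j := v)) = F y"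
  by (auto simp: depends_def)

lemma depends_mono: "depends k F \<Longrightarrow> k \<le> l \<Longrightarrow> depends l F"
  by (auto simp: depends_def)

lemma path_sum_Suc_depends: "depends k F \<Longrightarrow> path_sum (Suc k) F = path_sum k F"
  unfolding path_sum_Suc
  by (intro path_sum_cong) (simp add: depends_upd q_sum walk_paths_verts flip: scaleR_sum_left)

lemma path_sum_depends: "depends k F \<Longrightarrow> path_sum (k + m) F = path_sum k F"
proof (induction m)
  case (Suc m)
  have "path_sum (Suc (k + m)) F = path_sum (k + m) F"
    by (rule path_sum_Suc_depends[OF depends_mono[OF Suc.prems]]) simp
  then show ?case using Suc by simp
qed simp

lemma path_prob_sum: "(\<Sum>y\<in>walk_paths k. path_prob k y) = 1"
proof -
  have "path_sum (0 + k) (\<lambda>_. 1 :: real) = path_sum 0 (\<lambda>_. 1)"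
    by (rule path_sum_depends) (simp add: depends_def)
  then show ?thesis by (simp add: path_sum_def path_prob_def)
qed

lemma path_sum_const: "path_sum k (\<lambda>_. c) = c"
  by (simp add: path_sum_def path_prob_sum flip: scaleR_sum_left)

lemma path_sum_mono:
  "(\<And>y. y \<in> walk_paths k \<Longrightarrow> F y \<le> F' y) \<Longrightarrow> path_sum k F \<le> (path_sum k F' :: real)"
  unfolding path_sum_def by (intro sum_mono) (simp add: mult_left_mono path_prob_nonneg)

lemma norm_path_sum_le:
  fixes F :: "(nat \<Rightarrow> 'v) \<Rightarrow> 'b::real_normed_vector"
  assumes "\<And>y. y \<in> walk_paths k \<Longrightarrow> norm (F y) \<le> c"
  shows "norm (path_sum k F) \<le> c"
proof -
  have "norm (path_sum k F) \<le> path_sum k (\<lambda>y. norm (F y))"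
    unfolding path_sum_def by (rule order_trans[OF norm_sum]) (simp add: path_prob_nonneg)
  also have "\<dots> \<le> path_sum k (\<lambda>_. c)" by (rule path_sum_mono[OF assms])
  finally show ?thesis by (simp add: path_sum_const)
qed

definition cylinder :: "nat \<Rightarrow> (nat \<Rightarrow> 'v) \<Rightarrow> 'a set" where
  "cylinder k y = {z \<in> space M. \<forall>i\<le>k. w i z = y i}"

lemma cylinder_sets [measurable]: "(\<And>i. y i \<in> verts G) \<Longrightarrow> cylinder k y \<in> sets M"
proof -
  assume y: "\<And>i. y i \<in> verts G"
  have "cylinder k y = space M \<inter> (\<Inter>i\<in>{..k}. w i -` {y i} \<inter> space M)" by (auto simp: cylinder_def)
  also have "\<dots> \<in> sets M"
    using y by (intro sets.Int sets.top sets.finite_INT measurable_sets[OF w_measurable]) auto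
  finally show ?thesis .
qed

lemma measure_cylinder: "y \<in> walk_paths k \<Longrightarrow> prob (cylinder k y) = path_prob k y"
  using walk walk_paths_props unfolding random_walk_def cylinder_def path_prob_def by blast

lemma cylinders_disjoint:
  "y \<in> walk_paths k \<Longrightarrow> y' \<in> walk_paths k \<Longrightarrow> z \<in> cylinder k y \<Longrightarrow> z \<in> cylinder k y' \<Longrightarrow> y = y'"
proof (rule ext)
  fix i assume "y \<in> walk_paths k" "y' \<in> walk_paths k" "z \<in> cylinder k y" "z \<in> cylinder k y'"
  then show "y i = y' i" using walk_paths_props[of y k] walk_paths_props[of y' k]
    by (cases "i \<le> k") (auto simp: cylinder_def)
qed

text \<open>The cylinders over the finitely many paths are disjoint and their probabilities sum to
  one; hence the process follows edges almost surely.\<close>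

lemma AE_cylinder: "AE z in M. \<exists>y\<in>walk_paths k. z \<in> cylinder k y"
proof -
  have S: "(\<Union>y\<in>walk_paths k. cylinder k y) \<in> sets M"
    by (intro sets.finite_UN finite_walk_paths cylinder_sets walk_paths_verts)
  have "prob (\<Union>y\<in>walk_paths k. cylinder k y) = (\<Sum>y\<in>walk_paths k. prob (cylinder k y))"
    by (rule finite_measure_finite_Union)
      (auto simp: finite_walk_paths disjoint_family_on_def intro!: cylinder_sets walk_paths_verts dest: cylinders_disjoint)
  also have "\<dots> = 1" by (simp add: measure_cylinder path_prob_sum)
  finally have "AE z in M. z \<in> (\<Union>y\<in>walk_paths k. cylinder k y)"
    using S by (simp add: prob_eq_1)
  then show ?thesis by simp
qed

text \<open>Almost surely, a functional of the first k steps equals a simple function that is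
  constant on the cylinders. This turns expectations into finite sums.\<close>

lemma
  fixes F :: "(nat \<Rightarrow> 'v) \<Rightarrow> 'b::{banach, second_countable_topology}"
  assumes F: "depends k F" and m[measurable]: "(\<lambda>z. F (\<lambda>i. w i z)) \<in> borel_measurable M"
  shows integrable_path: "integrable M (\<lambda>z. F (\<lambda>i. w i z))"
    and integral_path: "(LINT z|M. F (\<lambda>i. w i z)) = path_sum k F"
proof -
  let ?S = "\<lambda>z. \<Sum>y\<in>walk_paths k. indicator (cylinder k y) z *\<^sub>R F y"
  have AE: "AE z in M. F (\<lambda>i. w i z) = ?S z"
    using AE_cylinder[of k]
  proof eventually_elim
    case (elim z)
    then obtain y where y: "y \<in> walk_paths k" "z \<in> cylinder k y" by blast
    have "?S z = (\<Sum>y'\<in>{y}. indicator (cylinder k y') z *\<^sub>R F y')"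
      using y by (intro sum.mono_neutral_right finite_walk_paths) (auto simp: indicator_def dest: cylinders_disjoint)
    moreover have "F (\<lambda>i. w i z) = F y" using F y(2) by (auto simp: depends_def cylinder_def)
    ultimately show ?case using y by simp
  qed
  have cyl: "y \<in> walk_paths k \<Longrightarrow> cylinder k y \<in> sets M" for y
    by (intro cylinder_sets walk_paths_verts)
  have Sm: "?S \<in> borel_measurable M" using cyl by (intro borel_measurable_sum) auto
  have Si: "integrable M ?S" using cyl
    by (intro Bochner_Integration.integrable_sum integrable_scaleR_left) (auto simp: less_top[symmetric] emeasure_eq_measure)
  show "integrable M (\<lambda>z. F (\<lambda>i. w i z))"
    using integrable_cong_AE[OF m Sm AE] Si by simp
  have "(LINT z|M. F (\<lambda>i. w i z)) = (LINT z|M. ?S z)" by (rule integral_cong_AE[OF m Sm AE])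
  also have "\<dots> = (\<Sum>y\<in>walk_paths k. LINT z|M. indicator (cylinder k y) z *\<^sub>R F y)"
    using cyl by (intro Bochner_Integration.integral_sum integrable_scaleR_left) (auto simp: less_top[symmetric] emeasure_eq_measure)
  also have "\<dots> = path_sum k F"
    unfolding path_sum_def using cyl
    by (intro sum.cong refl) (simp add: less_top[symmetric] emeasure_eq_measure measure_cylinder)
  finally show "(LINT z|M. F (\<lambda>i. w i z)) = path_sum k F" .
qed

lemma AE_walk_step: "AE z in M. \<forall>k. \<exists>e\<in>out_arcs G (w k z). head G e = w (Suc k) z"
  unfolding AE_all_countable
proof
  fix k
  show "AE z in M. \<exists>e\<in>out_arcs G (w k z). head G e = w (Suc k) z"
    using AE_cylinder[of "Suc k"]
  proof eventually_elim
    case (elim z)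
    then obtain y where y: "y \<in> walk_paths (Suc k)" "z \<in> cylinder (Suc k) y" by blast
    then have "w k z = y k" "w (Suc k) z = y (Suc k)" by (auto simp: cylinder_def)
    then show ?case using walk_paths_props[OF y(1)] by auto
  qed
qed

end

lemma power_one_minus_tendsto:
  fixes d :: "nat \<Rightarrow> nat"
  assumes d: "(\<lambda>n. real (d n) / real n) \<longlonglongrightarrow> D"
  shows "(\<lambda>n. (1 - c / real n) ^ d n) \<longlonglongrightarrow> exp (- (c * D))"
proof -
  have "(\<lambda>n. real n * ln (1 - c / real n)) \<longlonglongrightarrow> - c" by real_asymp
  then have "(\<lambda>n. exp (real (d n) / real n * (real n * ln (1 - c / real n)))) \<longlonglongrightarrow> exp (D * - c)"
    by (intro tendsto_intros d)
  moreover have "\<forall>\<^sub>F n in sequentially. exp (real (d n) / real n * (real n * ln (1 - c / real n))) = (1 - c / real n) ^ d n"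
  proof -
    have "\<forall>\<^sub>F n in sequentially. 0 < 1 - c / real n" by real_asymp
    then show ?thesis using eventually_gt_at_top[of 0]
    proof eventually_elim
      case (elim n)
      have "exp (real (d n) * ln (1 - c / real n)) = (1 - c / real n) ^ d n"
        using elim by (simp add: exp_of_nat_mult)
      then show ?case using elim by simp
    qed
  qed
  ultimately show ?thesis by (simp add: tendsto_cong mult.commute)
qed

section \<open>Moments and characteristic functions under zero drift\<close>

locale additive_walk = walk_setup G q x0 M w
  for G :: "('v, 'e) pre_digraph" and q x0 and M :: "'a measure" and w +
  fixes \<phi> :: "'v \<Rightarrow> 'w::euclidean_space" and K :: real and Q :: "'w \<Rightarrow> real"
  assumes \<phi>_0: "\<phi> x0 = 0"
    and bounded: "\<And>e. e \<in> arcs G \<Longrightarrow> norm (\<phi> (head G e) - \<phi> (tail G e)) \<le> K"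
    and centred: "\<And>x. x \<in> verts G \<Longrightarrow> (\<Sum>e\<in>out_arcs G x. q e *\<^sub>R (\<phi> (head G e) - \<phi> x)) = 0"
    and K_nonneg: "0 \<le> K" and Q_nonneg: "\<And>a. 0 \<le> Q a"
    and corrector: "\<And>a. \<exists>g C. (\<forall>x\<in>verts G. \<bar>g x\<bar> \<le> C) \<and> (\<forall>x\<in>verts G.
       g x - (\<Sum>e\<in>out_arcs G x. q e * g (head G e)) = (\<Sum>e\<in>out_arcs G x. q e * (a \<bullet> (\<phi> (head G e) - \<phi> x))\<^sup>2) - Q a)"
begin

lemma bounded_out: "e \<in> out_arcs G x \<Longrightarrow> norm (\<phi> (head G e) - \<phi> x) \<le> K"
  using bounded[of e] by auto

lemma q_out: "e \<in> out_arcs G x \<Longrightarrow> 0 \<le> q e"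
  using q_nonneg by auto

lemma q_average_le:
  assumes "x \<in> verts G" "\<And>e. e \<in> out_arcs G x \<Longrightarrow> f e \<le> c"
  shows "(\<Sum>e\<in>out_arcs G x. q e * f e) \<le> (c :: real)"
proof -
  have "(\<Sum>e\<in>out_arcs G x. q e * f e) \<le> (\<Sum>e\<in>out_arcs G x. q e * c)"
    using assms by (intro sum_mono mult_left_mono q_out) auto
  then show ?thesis using q_sum[OF assms(1)] by (simp flip: sum_distrib_right)
qed

lemma centred_inner: "x \<in> verts G \<Longrightarrow> (\<Sum>e\<in>out_arcs G x. q e * (a \<bullet> (\<phi> (head G e) - \<phi> x))) = 0"
  using arg_cong[OF centred, of x "\<lambda>v. a \<bullet> v"] by (simp add: inner_sum_right)

text \<open>The cross term vanishes by zero drift, so the mean squares of the steps add up.\<close>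

lemma second_moment: "path_sum (k + m) (\<lambda>y. (norm (\<phi> (y (k + m)) - \<phi> (y k)))\<^sup>2) \<le> K\<^sup>2 * real m"
proof (induction m)
  case 0
  show ?case by (simp add: path_sum_const)
next
  case (Suc m)
  have "path_sum (Suc (k + m)) (\<lambda>y. (norm (\<phi> (y (k + Suc m)) - \<phi> (y k)))\<^sup>2)
      \<le> path_sum (k + m) (\<lambda>y. (norm (\<phi> (y (k + m)) - \<phi> (y k)))\<^sup>2 + K\<^sup>2)"
    unfolding path_sum_Suc
  proof (rule path_sum_mono)
    fix y assume y: "y \<in> walk_paths (k + m)"
    define x S where "x = y (k + m)" and "S = \<phi> (y (k + m)) - \<phi> (y k)"
    have x: "x \<in> verts G" using walk_paths_verts[OF y] by (simp add: x_def)
    have "(\<Sum>e\<in>out_arcs G x. q e * (norm (S + (\<phi> (head G e) - \<phi> x)))\<^sup>2)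
        = (\<Sum>e\<in>out_arcs G x. q e * ((norm S)\<^sup>2 + (norm (\<phi> (head G e) - \<phi> x))\<^sup>2) + 2 * (q e * (S \<bullet> (\<phi> (head G e) - \<phi> x))))"
    proof (intro sum.cong refl)
      fix e
      have "(norm (S + D))\<^sup>2 = (norm S)\<^sup>2 + (norm D)\<^sup>2 + 2 * (S \<bullet> D)" for D
        by (simp add: power2_norm_eq_inner inner_add_left inner_add_right inner_commute)
      then show "q e * (norm (S + (\<phi> (head G e) - \<phi> x)))\<^sup>2
          = q e * ((norm S)\<^sup>2 + (norm (\<phi> (head G e) - \<phi> x))\<^sup>2) + 2 * (q e * (S \<bullet> (\<phi> (head G e) - \<phi> x)))"
        by (simp only: distrib_left mult.left_commute)
    qed
    also have "\<dots> = (\<Sum>e\<in>out_arcs G x. q e * ((norm S)\<^sup>2 + (norm (\<phi> (head G e) - \<phi> x))\<^sup>2))"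
      using centred_inner[OF x, of S] by (subst sum.distrib) (subst sum_distrib_left[symmetric], simp only: mult_zero_right add_0_right)
    also have "\<dots> \<le> (norm S)\<^sup>2 + K\<^sup>2"
      by (intro q_average_le x add_left_mono power_mono bounded_out) auto
    finally show "(\<Sum>e\<in>out_arcs G (y (k + m)). q e *\<^sub>R (norm (\<phi> ((y(Suc (k + m) := head G e)) (k + Suc m)) - \<phi> ((y(Suc (k + m) := head G e)) k)))\<^sup>2)
        \<le> (norm (\<phi> (y (k + m)) - \<phi> (y k)))\<^sup>2 + K\<^sup>2"
      by (simp add: x_def S_def algebra_simps)
  qed
  also have "\<dots> \<le> K\<^sup>2 * real (Suc m)" using Suc by (simp add: path_sum_add path_sum_const algebra_simps)
  finally show ?case by simp
qed

text \<open>By \<open>norm_add_power4_le\<close> and zero drift, one more step adds at most 8 K^4 m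
  + 3 K^4 to the moment. This is at most 4 K^4 ((m + 1)^2 - m^2), which explains the constant
  4.\<close>

lemma fourth_moment: "path_sum (k + m) (\<lambda>y. norm (\<phi> (y (k + m)) - \<phi> (y k)) ^ 4) \<le> 4 * K ^ 4 * (real m)\<^sup>2"
proof (induction m)
  case 0
  show ?case by (simp add: path_sum_const)
next
  case (Suc m)
  have "path_sum (Suc (k + m)) (\<lambda>y. norm (\<phi> (y (k + Suc m)) - \<phi> (y k)) ^ 4)
      \<le> path_sum (k + m) (\<lambda>y. norm (\<phi> (y (k + m)) - \<phi> (y k)) ^ 4
          + (8 * K\<^sup>2 * (norm (\<phi> (y (k + m)) - \<phi> (y k)))\<^sup>2 + 3 * K ^ 4))"
    unfolding path_sum_Suc
  proof (rule path_sum_mono)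
    fix y assume y: "y \<in> walk_paths (k + m)"
    define x S where "x = y (k + m)" and "S = \<phi> (y (k + m)) - \<phi> (y k)"
    have x: "x \<in> verts G" using walk_paths_verts[OF y] by (simp add: x_def)
    define R where "R = norm S ^ 4 + (8 * K\<^sup>2 * (norm S)\<^sup>2 + 3 * K ^ 4)"
    have "(\<Sum>e\<in>out_arcs G x. q e * norm (S + (\<phi> (head G e) - \<phi> x)) ^ 4)
        \<le> (\<Sum>e\<in>out_arcs G x. q e * (4 * (norm S)\<^sup>2 * (S \<bullet> (\<phi> (head G e) - \<phi> x)) + R))"
      using norm_add_power4_le[OF bounded_out] by (intro sum_mono mult_left_mono q_out) (auto simp: R_def algebra_simps)
    also have "\<dots> = (\<Sum>e\<in>out_arcs G x. (4 * (norm S)\<^sup>2) * (q e * (S \<bullet> (\<phi> (head G e) - \<phi> x))) + q e * R)"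
      by (intro sum.cong refl) (simp add: algebra_simps)
    also have "\<dots> = (4 * (norm S)\<^sup>2) * (\<Sum>e\<in>out_arcs G x. q e * (S \<bullet> (\<phi> (head G e) - \<phi> x))) + (\<Sum>e\<in>out_arcs G x. q e) * R"
      unfolding sum.distrib sum_distrib_left[symmetric] sum_distrib_right[symmetric] ..
    also have "\<dots> = R" by (simp add: centred_inner[OF x] q_sum[OF x])
    finally show "(\<Sum>e\<in>out_arcs G (y (k + m)). q e *\<^sub>R norm (\<phi> ((y(Suc (k + m) := head G e)) (k + Suc m)) - \<phi> ((y(Suc (k + m) := head G e)) k)) ^ 4)
        \<le> norm (\<phi> (y (k + m)) - \<phi> (y k)) ^ 4 + (8 * K\<^sup>2 * (norm (\<phi> (y (k + m)) - \<phi> (y k)))\<^sup>2 + 3 * K ^ 4)"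
      by (simp add: x_def S_def R_def algebra_simps)
  qed
  also have "\<dots> = path_sum (k + m) (\<lambda>y. norm (\<phi> (y (k + m)) - \<phi> (y k)) ^ 4)
      + (8 * K\<^sup>2 * path_sum (k + m) (\<lambda>y. (norm (\<phi> (y (k + m)) - \<phi> (y k)))\<^sup>2) + 3 * K ^ 4)"
    by (simp add: path_sum_add path_sum_const path_sum_mult)
  also have "\<dots> \<le> 4 * K ^ 4 * (real m)\<^sup>2 + (8 * K\<^sup>2 * (K\<^sup>2 * real m) + 3 * K ^ 4)"
    using Suc second_moment[of k m] by (intro add_mono mult_left_mono) auto
  also have "\<dots> \<le> 4 * K ^ 4 * (real (Suc m))\<^sup>2"
  proof -
    have k4: "K ^ 4 = K\<^sup>2 * K\<^sup>2" by (simp flip: power_add)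
    have eq: "8 * K\<^sup>2 * (K\<^sup>2 * real m) = 8 * K ^ 4 * real m" unfolding k4 by (simp only: mult.assoc)
    have "4 * c * r\<^sup>2 + (8 * c * r + 3 * c) \<le> 4 * c * (r + 1)\<^sup>2" if "0 \<le> c" for c r :: real
      using that by (simp add: power2_eq_square algebra_simps)
    from this[of "K ^ 4" "real m"] show ?thesis unfolding eq by (simp add: add.commute)
  qed
  finally show ?case by simp
qed

text \<open>Taylor expansion to second order with a cubic remainder. The linear term vanishes by
  zero drift; the quadratic one and the weights at the heads of the edges combine by the Poisson
  equation into \<open>Q a\<close> and the weight at x, which removes the dependence of the
  conditional variance on x.\<close>

lemma one_step_char:
  "\<exists>g C. 0 \<le> C \<and> (\<forall>x\<in>verts G. \<bar>g x\<bar> \<le> C) \<and> (\<forall>x\<in>verts G. \<forall>\<epsilon>. 0 \<le> \<epsilon> \<and> \<epsilon> \<le> 1 \<longrightarrow>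
     norm ((\<Sum>e\<in>out_arcs G x. q e *\<^sub>R (iexp (\<epsilon> * (a \<bullet> (\<phi> (head G e) - \<phi> x))) * of_real (1 - \<epsilon>\<^sup>2 / 2 * g (head G e))))
       - of_real ((1 - \<epsilon>\<^sup>2 * Q a / 2) * (1 - \<epsilon>\<^sup>2 / 2 * g x))) \<le> C * \<epsilon> ^ 3)"
proof -
  obtain g C0 where g: "\<And>x. x \<in> verts G \<Longrightarrow> \<bar>g x\<bar> \<le> C0"
    and poisson: "\<And>x. x \<in> verts G \<Longrightarrow>
       g x - (\<Sum>e\<in>out_arcs G x. q e * g (head G e)) = (\<Sum>e\<in>out_arcs G x. q e * (a \<bullet> (\<phi> (head G e) - \<phi> x))\<^sup>2) - Q a"
    using corrector[of a] by blast
  have C0: "0 \<le> C0" using g[OF x0] by linarith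
  define A where "A = norm a * K"
  have A: "0 \<le> A" using K_nonneg by (simp add: A_def)
  \<comment> \<open>\<open>A ^ 3\<close> bounds the Taylor remainder, \<open>A * C0\<close> the
    product of the weight with the first-order term, and \<open>Q a * C0\<close> the fourth-order
    term left by the product of eigenvalue and weight; the last \<open>C0\<close> lets the same
    constant bound g.\<close>
  define C where "C = A ^ 3 + A * C0 + Q a * C0 + C0"
  have "norm ((\<Sum>e\<in>out_arcs G x. q e *\<^sub>R (iexp (\<epsilon> * (a \<bullet> (\<phi> (head G e) - \<phi> x))) * of_real (1 - \<epsilon>\<^sup>2 / 2 * g (head G e))))
       - of_real ((1 - \<epsilon>\<^sup>2 * Q a / 2) * (1 - \<epsilon>\<^sup>2 / 2 * g x))) \<le> C * \<epsilon> ^ 3"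
    if x: "x \<in> verts G" and \<epsilon>: "0 \<le> \<epsilon>" "\<epsilon> \<le> 1" for x \<epsilon>
  proof -
    define y where "y e = a \<bullet> (\<phi> (head G e) - \<phi> x)" for e
    have y: "\<bar>y e\<bar> \<le> A" if "e \<in> out_arcs G x" for e
      using order_trans[OF Cauchy_Schwarz_ineq2 mult_left_mono[OF bounded_out[OF that] norm_ge_zero]]
      by (simp add: y_def A_def)
    define R where "R e = iexp (\<epsilon> * y e) - (1 + \<i> * of_real (\<epsilon> * y e) - of_real ((\<epsilon> * y e)\<^sup>2 / 2))" for e
    define T where "T e = iexp (\<epsilon> * y e) - 1" for e
    have R: "norm (R e) \<le> \<epsilon> ^ 3 * A ^ 3" if "e \<in> out_arcs G x" for e
    proof -
      have "norm (R e) \<le> \<bar>\<epsilon> * y e\<bar> ^ 3 / 6"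
        using iexp_approx1[of "\<epsilon> * y e" 2]
        by (simp add: R_def numeral_eq_Suc power2_eq_square algebra_simps)
      also have "\<dots> \<le> \<bar>\<epsilon> * y e\<bar> ^ 3" by simp
      also have "\<dots> = \<epsilon> ^ 3 * \<bar>y e\<bar> ^ 3" using \<epsilon> by (simp add: abs_mult power_mult_distrib)
      also have "\<dots> \<le> \<epsilon> ^ 3 * A ^ 3" using y[OF that] \<epsilon> by (intro mult_left_mono power_mono) auto
      finally show ?thesis .
    qed
    have T: "norm (T e) \<le> \<epsilon> * A" if "e \<in> out_arcs G x" for e
    proof -
      have "norm (T e) \<le> \<bar>\<epsilon> * y e\<bar>" using iexp_approx1[of "\<epsilon> * y e" 0] by (simp add: T_def)
      also have "\<dots> \<le> \<epsilon> * A" using y[OF that] \<epsilon> by (simp add: abs_mult mult_left_mono)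
      finally show ?thesis .
    qed
    have avg: "norm (\<Sum>e\<in>out_arcs G x. q e *\<^sub>R F e) \<le> c" if "\<And>e. e \<in> out_arcs G x \<Longrightarrow> norm (F e) \<le> c" for F :: "'e \<Rightarrow> complex" and c
    proof -
      have "norm (\<Sum>e\<in>out_arcs G x. q e *\<^sub>R F e) \<le> (\<Sum>e\<in>out_arcs G x. norm (q e *\<^sub>R F e))" by (rule norm_sum)
      also have "\<dots> = (\<Sum>e\<in>out_arcs G x. q e * norm (F e))" by (intro sum.cong refl) (simp add: q_nonneg)
      also have "\<dots> \<le> c" by (rule q_average_le[OF x that])
      finally show ?thesis .
    qed
    have lin: "(\<Sum>e\<in>out_arcs G x. q e * y e) = 0" unfolding y_def by (rule centred_inner[OF x])
    have eq: "(\<Sum>e\<in>out_arcs G x. q e *\<^sub>R (iexp (\<epsilon> * y e) * of_real (1 - \<epsilon>\<^sup>2 / 2 * g (head G e))))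
        - of_real ((1 - \<epsilon>\<^sup>2 * Q a / 2) * (1 - \<epsilon>\<^sup>2 / 2 * g x))
      = (\<Sum>e\<in>out_arcs G x. q e *\<^sub>R R e) - (\<Sum>e\<in>out_arcs G x. q e *\<^sub>R (of_real (\<epsilon>\<^sup>2 / 2 * g (head G e)) * T e))
        - of_real (\<epsilon> ^ 4 * (Q a * g x) / 4)"
    proof -
      have expand: "iexp (\<epsilon> * y e) * of_real (1 - r) = R e - of_real r * T e + 1 + \<i> * of_real \<epsilon> * of_real (y e)
          - of_real (\<epsilon>\<^sup>2 / 2) * of_real ((y e)\<^sup>2) - of_real r" for r e
        by (simp add: R_def T_def power_mult_distrib algebra_simps)
      have scale: "q e *\<^sub>R (A - B + 1 + \<i> * of_real \<epsilon> * of_real u - of_real s * of_real v - of_real (s * r))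
          = q e *\<^sub>R A - q e *\<^sub>R B + of_real (q e) + \<i> * of_real \<epsilon> * of_real (q e * u) - of_real s * of_real (q e * v)
            - of_real s * of_real (q e * r)" for e A B u s v r
        by (simp add: scaleR_conv_of_real algebra_simps)
      have "(\<Sum>e\<in>out_arcs G x. q e *\<^sub>R (iexp (\<epsilon> * y e) * of_real (1 - \<epsilon>\<^sup>2 / 2 * g (head G e))))
          = (\<Sum>e\<in>out_arcs G x. q e *\<^sub>R R e - q e *\<^sub>R (of_real (\<epsilon>\<^sup>2 / 2 * g (head G e)) * T e)
             + of_real (q e) + \<i> * of_real \<epsilon> * of_real (q e * y e) - of_real (\<epsilon>\<^sup>2 / 2) * of_real (q e * (y e)\<^sup>2)
             - of_real (\<epsilon>\<^sup>2 / 2) * of_real (q e * g (head G e)))"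
        unfolding expand scale ..
      also have "\<dots> = (\<Sum>e\<in>out_arcs G x. q e *\<^sub>R R e) - (\<Sum>e\<in>out_arcs G x. q e *\<^sub>R (of_real (\<epsilon>\<^sup>2 / 2 * g (head G e)) * T e))
             + of_real (\<Sum>e\<in>out_arcs G x. q e) + \<i> * of_real \<epsilon> * of_real (\<Sum>e\<in>out_arcs G x. q e * y e)
             - of_real (\<epsilon>\<^sup>2 / 2) * of_real (\<Sum>e\<in>out_arcs G x. q e * (y e)\<^sup>2)
             - of_real (\<epsilon>\<^sup>2 / 2) * of_real (\<Sum>e\<in>out_arcs G x. q e * g (head G e))"
        unfolding sum.distrib sum_subtractf sum_distrib_left[symmetric] of_real_sum ..
      also have "(\<Sum>e\<in>out_arcs G x. q e * (y e)\<^sup>2) = g x - (\<Sum>e\<in>out_arcs G x. q e * g (head G e)) + Q a"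
        using poisson[OF x] by (simp add: y_def)
      finally have calc: "(\<Sum>e\<in>out_arcs G x. q e *\<^sub>R (iexp (\<epsilon> * y e) * of_real (1 - \<epsilon>\<^sup>2 / 2 * g (head G e))))
          = (\<Sum>e\<in>out_arcs G x. q e *\<^sub>R R e) - (\<Sum>e\<in>out_arcs G x. q e *\<^sub>R (of_real (\<epsilon>\<^sup>2 / 2 * g (head G e)) * T e))
             + of_real 1 + \<i> * of_real \<epsilon> * of_real 0
             - of_real (\<epsilon>\<^sup>2 / 2) * of_real (g x - (\<Sum>e\<in>out_arcs G x. q e * g (head G e)) + Q a)
             - of_real (\<epsilon>\<^sup>2 / 2) * of_real (\<Sum>e\<in>out_arcs G x. q e * g (head G e))"
        unfolding lin q_sum[OF x] .
      have "1 - \<epsilon>\<^sup>2 / 2 * (g x - s + Q a) - \<epsilon>\<^sup>2 / 2 * s - (1 - \<epsilon>\<^sup>2 * Q a / 2) * (1 - \<epsilon>\<^sup>2 / 2 * g x)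
          = - (\<epsilon> ^ 4 * (Q a * g x) / 4)" for s
        by (simp add: field_simps power2_eq_square numeral_eq_Suc)
      then have real: "complex_of_real (1 - \<epsilon>\<^sup>2 / 2 * (g x - s + Q a) - \<epsilon>\<^sup>2 / 2 * s - (1 - \<epsilon>\<^sup>2 * Q a / 2) * (1 - \<epsilon>\<^sup>2 / 2 * g x))
          = of_real (- (\<epsilon> ^ 4 * (Q a * g x) / 4))" for s
        by (simp only:)
      have regroup: "A - B + of_real 1 + \<i> * of_real \<epsilon> * of_real 0 - of_real c * of_real u - of_real c * of_real s - of_real d
          = A - B + of_real (1 - c * u - c * s - d)" for A B and c u s d :: real
        by simp
      show ?thesis unfolding calc regroup real by simp
    qed
    have "norm ((\<Sum>e\<in>out_arcs G x. q e *\<^sub>R (iexp (\<epsilon> * y e) * of_real (1 - \<epsilon>\<^sup>2 / 2 * g (head G e))))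
        - of_real ((1 - \<epsilon>\<^sup>2 * Q a / 2) * (1 - \<epsilon>\<^sup>2 / 2 * g x)))
      \<le> norm (\<Sum>e\<in>out_arcs G x. q e *\<^sub>R R e) + norm (\<Sum>e\<in>out_arcs G x. q e *\<^sub>R (of_real (\<epsilon>\<^sup>2 / 2 * g (head G e)) * T e))
        + norm (of_real (\<epsilon> ^ 4 * (Q a * g x) / 4) :: complex)"
      unfolding eq by (rule order_trans[OF norm_triangle_ineq4 add_right_mono[OF norm_triangle_ineq4]])
    also have "\<dots> \<le> \<epsilon> ^ 3 * A ^ 3 + \<epsilon>\<^sup>2 * C0 * (\<epsilon> * A) + \<epsilon> ^ 3 * (Q a * C0)"
    proof (intro add_mono)
      show "norm (\<Sum>e\<in>out_arcs G x. q e *\<^sub>R R e) \<le> \<epsilon> ^ 3 * A ^ 3" by (rule avg[OF R])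
      show "norm (\<Sum>e\<in>out_arcs G x. q e *\<^sub>R (of_real (\<epsilon>\<^sup>2 / 2 * g (head G e)) * T e)) \<le> \<epsilon>\<^sup>2 * C0 * (\<epsilon> * A)"
      proof (rule avg)
        fix e assume e: "e \<in> out_arcs G x"
        have "\<bar>\<epsilon>\<^sup>2 / 2 * g (head G e)\<bar> = \<epsilon>\<^sup>2 * (\<bar>g (head G e)\<bar> / 2)" by (simp add: abs_mult)
        also have "\<dots> \<le> \<epsilon>\<^sup>2 * C0" using g[of "head G e"] head_verts[of e] e by (intro mult_left_mono) auto
        finally have "\<bar>\<epsilon>\<^sup>2 / 2 * g (head G e)\<bar> \<le> \<epsilon>\<^sup>2 * C0" .
        then show "norm (of_real (\<epsilon>\<^sup>2 / 2 * g (head G e)) * T e) \<le> \<epsilon>\<^sup>2 * C0 * (\<epsilon> * A)"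
          unfolding norm_mult norm_of_real by (intro mult_mono T[OF e]) (use C0 in auto)
      qed
      have "\<bar>\<epsilon> ^ 4 * (Q a * g x) / 4\<bar> = \<epsilon> ^ 4 * (Q a * \<bar>g x\<bar> / 4)" using Q_nonneg[of a] by (simp add: abs_mult)
      also have "\<dots> \<le> \<epsilon> ^ 3 * (Q a * C0)"
      proof (intro mult_mono)
        show "\<epsilon> ^ 4 \<le> \<epsilon> ^ 3" using \<epsilon> by (intro power_decreasing) auto
        have "Q a * \<bar>g x\<bar> \<le> Q a * C0" using g[OF x] Q_nonneg[of a] by (intro mult_left_mono)
        moreover have "0 \<le> Q a * C0" using C0 Q_nonneg[of a] by simp
        ultimately show "Q a * \<bar>g x\<bar> / 4 \<le> Q a * C0" by linarith
      qed (use \<epsilon> Q_nonneg in auto)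
      finally show "norm (of_real (\<epsilon> ^ 4 * (Q a * g x) / 4) :: complex) \<le> \<epsilon> ^ 3 * (Q a * C0)"
        unfolding norm_of_real .
    qed
    also have "\<dots> = (A ^ 3 + A * C0 + Q a * C0) * \<epsilon> ^ 3" by (simp add: algebra_simps power2_eq_square numeral_eq_Suc)
    also have "\<dots> \<le> C * \<epsilon> ^ 3" using C0 \<epsilon> by (intro mult_right_mono) (auto simp: C_def)
    finally show ?thesis unfolding y_def .
  qed
  moreover have "0 \<le> C" "C0 \<le> C" using A C0 Q_nonneg[of a] by (auto simp: C_def)
  ultimately show ?thesis using g by (intro exI[of _ g] exI[of _ C]) force
qed

text \<open>
  The corrector makes \<open>1 - \<epsilon>\<^sup>2 g / 2\<close> an approximate eigenfunction of the transition operator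
  twisted by the character, so the time average of the conditional covariances never appears.
\<close>

lemma block_char:
  "\<exists>C\<ge>0. \<forall>\<epsilon> k m U. 0 \<le> \<epsilon> \<and> \<epsilon> \<le> 1 \<and> \<epsilon>\<^sup>2 * Q a \<le> 1 \<and> depends k U \<and> (\<forall>y. norm (U y) \<le> 1) \<longrightarrow>
     norm (path_sum (k + m) (\<lambda>y. U y * iexp (\<epsilon> * (a \<bullet> (\<phi> (y (k + m)) - \<phi> (y k)))))
       - of_real ((1 - \<epsilon>\<^sup>2 * Q a / 2) ^ m) * path_sum k U) \<le> C * (\<epsilon>\<^sup>2 + real m * \<epsilon> ^ 3)"
proof -
  obtain g C where C: "0 \<le> C" and g: "\<And>x. x \<in> verts G \<Longrightarrow> \<bar>g x\<bar> \<le> C"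
    and step: "\<And>x \<epsilon>. x \<in> verts G \<Longrightarrow> 0 \<le> \<epsilon> \<Longrightarrow> \<epsilon> \<le> 1 \<Longrightarrow>
     norm ((\<Sum>e\<in>out_arcs G x. q e *\<^sub>R (iexp (\<epsilon> * (a \<bullet> (\<phi> (head G e) - \<phi> x))) * of_real (1 - \<epsilon>\<^sup>2 / 2 * g (head G e))))
       - of_real ((1 - \<epsilon>\<^sup>2 * Q a / 2) * (1 - \<epsilon>\<^sup>2 / 2 * g x))) \<le> C * \<epsilon> ^ 3"
    using one_step_char[of a] by blast
  have "norm (path_sum (k + m) (\<lambda>y. U y * iexp (\<epsilon> * (a \<bullet> (\<phi> (y (k + m)) - \<phi> (y k)))))
       - of_real ((1 - \<epsilon>\<^sup>2 * Q a / 2) ^ m) * path_sum k U) \<le> C * (\<epsilon>\<^sup>2 + real m * \<epsilon> ^ 3)"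
    if \<epsilon>: "0 \<le> \<epsilon>" "\<epsilon> \<le> 1" "\<epsilon>\<^sup>2 * Q a \<le> 1" and U: "depends k U" "\<And>y. norm (U y) \<le> 1" for \<epsilon> k m U
  proof -
    define \<rho> where "\<rho> = 1 - \<epsilon>\<^sup>2 * Q a / 2"
    have \<rho>: "\<bar>\<rho>\<bar> \<le> 1" using \<epsilon>(3) Q_nonneg[of a] by (simp add: \<rho>_def abs_le_iff)
    define f where "f x = 1 - \<epsilon>\<^sup>2 / 2 * g x" for x
    define E where "E m y = U y * iexp (\<epsilon> * (a \<bullet> (\<phi> (y (k + m)) - \<phi> (y k))))" for m y
    have E1: "norm (E m y) \<le> 1" for m y using U(2)[of y] by (simp add: E_def norm_mult)
    \<comment> \<open>Each step adds an error of order \<epsilon>^3 and multiplies the previous one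
      by \<rho>; as \<bar>\<rho>\<bar> \<le> 1, the errors at most add up.\<close>
    have main: "norm (path_sum (k + m) (\<lambda>y. E m y * of_real (f (y (k + m)))) - of_real (\<rho> ^ m) * path_sum k (\<lambda>y. U y * of_real (f (y k))))
        \<le> real m * (C * \<epsilon> ^ 3)" for m
    proof (induction m)
      case 0
      show ?case by (simp add: E_def)
    next
      case (Suc m)
      define p where "p m = path_sum (k + m) (\<lambda>y. E m y * of_real (f (y (k + m))))" for m
      have "norm (p (Suc m) - of_real \<rho> * p m) \<le> C * \<epsilon> ^ 3"
      proof -
        have "p (Suc m) - of_real \<rho> * p m = path_sum (k + m) (\<lambda>y. (\<Sum>e\<in>out_arcs G (y (k + m)).
             q e *\<^sub>R (E (Suc m) (y(Suc (k + m) := head G e)) * of_real (f (head G e)))) - of_real \<rho> * (E m y * of_real (f (y (k + m)))))"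
          unfolding p_def path_sum_diff path_sum_mult by (simp add: path_sum_Suc)
        also have "norm \<dots> \<le> C * \<epsilon> ^ 3"
        proof (rule norm_path_sum_le)
          fix y assume y: "y \<in> walk_paths (k + m)"
          define x where "x = y (k + m)"
          have x: "x \<in> verts G" using walk_paths_verts[OF y] by (simp add: x_def)
          have "E (Suc m) (y(Suc (k + m) := v)) = E m y * iexp (\<epsilon> * (a \<bullet> (\<phi> v - \<phi> x)))" for v
          proof -
            have "U (y(Suc (k + m) := v)) = U y" by (rule depends_upd[OF U(1)]) simp
            moreover have "iexp (\<epsilon> * (a \<bullet> (\<phi> v - \<phi> (y k)))) = iexp (\<epsilon> * (a \<bullet> (\<phi> x - \<phi> (y k)))) * iexp (\<epsilon> * (a \<bullet> (\<phi> v - \<phi> x)))"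
              by (simp add: inner_diff_right algebra_simps flip: exp_add)
            ultimately show ?thesis by (simp add: E_def x_def mult.assoc)
          qed
          then have "(\<Sum>e\<in>out_arcs G x. q e *\<^sub>R (E (Suc m) (y(Suc (k + m) := head G e)) * of_real (f (head G e)))) - of_real \<rho> * (E m y * of_real (f x))
              = E m y * ((\<Sum>e\<in>out_arcs G x. q e *\<^sub>R (iexp (\<epsilon> * (a \<bullet> (\<phi> (head G e) - \<phi> x))) * of_real (f (head G e)))) - of_real (\<rho> * f x))"
            by (simp add: right_diff_distrib sum_distrib_left mult.assoc mult.left_commute)
          also have "norm \<dots> \<le> 1 * (C * \<epsilon> ^ 3)"
            unfolding norm_mult using step[OF x \<epsilon>(1,2)] E1 by (intro mult_mono) (auto simp: \<rho>_def f_def)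
          finally show "norm ((\<Sum>e\<in>out_arcs G (y (k + m)). q e *\<^sub>R (E (Suc m) (y(Suc (k + m) := head G e)) * of_real (f (head G e)))) - of_real \<rho> * (E m y * of_real (f (y (k + m))))) \<le> C * \<epsilon> ^ 3"
            by (simp add: x_def)
        qed
        finally show ?thesis .
      qed
      moreover have "norm (of_real \<rho> * (p m - of_real (\<rho> ^ m) * path_sum k (\<lambda>y. U y * of_real (f (y k))))) \<le> 1 * (real m * (C * \<epsilon> ^ 3))"
        unfolding norm_mult using \<rho> Suc by (intro mult_mono) (auto simp: p_def)
      ultimately have "norm ((p (Suc m) - of_real \<rho> * p m) + of_real \<rho> * (p m - of_real (\<rho> ^ m) * path_sum k (\<lambda>y. U y * of_real (f (y k)))))
          \<le> C * \<epsilon> ^ 3 + real m * (C * \<epsilon> ^ 3)" by (intro order_trans[OF norm_triangle_ineq]) simp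
      then show ?case by (simp add: p_def algebra_simps)
    qed
    \<comment> \<open>The weight differs from one by at most C \<epsilon>^2 / 2, so removing it at
      both ends of the block costs C \<epsilon>^2 in total.\<close>
    have f_close: "norm (path_sum l (\<lambda>y. V y * of_real (f (y i))) - path_sum l V) \<le> \<epsilon>\<^sup>2 * C / 2"
      if V: "\<And>y. norm (V y) \<le> 1" for l i and V :: "(nat \<Rightarrow> 'v) \<Rightarrow> complex"
    proof -
      have "path_sum l (\<lambda>y. V y * of_real (f (y i))) - path_sum l V = path_sum l (\<lambda>y. V y * of_real (f (y i) - 1))"
        by (simp add: right_diff_distrib flip: path_sum_diff)
      also have "norm \<dots> \<le> \<epsilon>\<^sup>2 * C / 2"
      proof (rule norm_path_sum_le)
        fix y assume y: "y \<in> walk_paths l"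
        have "\<bar>f (y i) - 1\<bar> = \<epsilon>\<^sup>2 / 2 * \<bar>g (y i)\<bar>" by (simp add: f_def abs_mult)
        also have "\<dots> \<le> \<epsilon>\<^sup>2 / 2 * C" using g[OF walk_paths_verts[OF y]] by (intro mult_left_mono) auto
        finally have "\<bar>f (y i) - 1\<bar> \<le> \<epsilon>\<^sup>2 * C / 2" by simp
        then have "norm (V y) * \<bar>f (y i) - 1\<bar> \<le> 1 * (\<epsilon>\<^sup>2 * C / 2)" using V by (intro mult_mono) auto
        then show "norm (V y * of_real (f (y i) - 1)) \<le> \<epsilon>\<^sup>2 * C / 2" by (simp only: norm_mult norm_of_real mult_1)
      qed
      finally show ?thesis .
    qed
    define p0 pf u0 uf where "p0 = path_sum (k + m) (E m)" and "pf = path_sum (k + m) (\<lambda>y. E m y * of_real (f (y (k + m))))"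
      and "u0 = path_sum k U" and "uf = path_sum k (\<lambda>y. U y * of_real (f (y k)))"
    have 1: "norm (pf - p0) \<le> \<epsilon>\<^sup>2 * C / 2" unfolding pf_def p0_def by (rule f_close[OF E1])
    have 2: "norm (uf - u0) \<le> \<epsilon>\<^sup>2 * C / 2" unfolding uf_def u0_def by (rule f_close[OF U(2)])
    have 3: "norm (pf - of_real (\<rho> ^ m) * uf) \<le> real m * (C * \<epsilon> ^ 3)" unfolding pf_def uf_def by (rule main)
    have "norm (of_real (\<rho> ^ m) * (uf - u0)) \<le> 1 * (\<epsilon>\<^sup>2 * C / 2)"
      unfolding norm_mult using 2 \<rho> by (intro mult_mono) (auto simp: norm_power power_le_one)
    then have 4: "norm (of_real (\<rho> ^ m) * (uf - u0)) \<le> \<epsilon>\<^sup>2 * C / 2" by simp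
    have "p0 - of_real (\<rho> ^ m) * u0 = (pf - of_real (\<rho> ^ m) * uf) - (pf - p0) + of_real (\<rho> ^ m) * (uf - u0)"
      by (simp add: algebra_simps)
    also have "norm \<dots> \<le> norm (pf - of_real (\<rho> ^ m) * uf) + norm (pf - p0) + norm (of_real (\<rho> ^ m) * (uf - u0))"
      by (rule order_trans[OF norm_triangle_ineq add_right_mono[OF norm_triangle_ineq4]])
    also have "\<dots> \<le> real m * (C * \<epsilon> ^ 3) + \<epsilon>\<^sup>2 * C / 2 + \<epsilon>\<^sup>2 * C / 2" using 1 3 4 by linarith
    also have "\<dots> = C * (\<epsilon>\<^sup>2 + real m * \<epsilon> ^ 3)" by (simp add: algebra_simps)
    finally show ?thesis by (simp add: p0_def u0_def E_def[abs_def] \<rho>_def)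
  qed
  then show ?thesis using C by blast
qed

end

context additive_walk
begin

text \<open>Induction on the number of blocks: the character of the earlier blocks is the factor U
  of \<open>block_char\<close>, bounded by one and determined by the past. A block has l of order n
  steps, so with \<epsilon> = 1 / \<surd>n the error \<epsilon>^2 + l \<epsilon>^3 is of order 1 /
  \<surd>n.\<close>

lemma joint_char:
  assumes k: "\<And>n. mono (k n)" and D: "\<And>j. (\<lambda>n. real (k n j) / real n) \<longlonglongrightarrow> \<tau> j"
  shows "(\<lambda>n. path_sum (k n m) (\<lambda>y. iexp (1 / sqrt (real n) * (\<Sum>j<m. a j \<bullet> (\<phi> (y (k n (Suc j))) - \<phi> (y (k n j)))))))
    \<longlonglongrightarrow> of_real (exp (- (\<Sum>j<m. Q (a j) * (\<tau> (Suc j) - \<tau> j)) / 2))"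
proof (induction m)
  case 0
  show ?case by (simp add: path_sum_const)
next
  case (Suc m)
  obtain C where C: "0 \<le> C" and block: "\<And>\<epsilon> k l U. 0 \<le> \<epsilon> \<Longrightarrow> \<epsilon> \<le> 1 \<Longrightarrow> \<epsilon>\<^sup>2 * Q (a m) \<le> 1 \<Longrightarrow> depends k U \<Longrightarrow> (\<forall>y. norm (U y) \<le> 1) \<Longrightarrow>
     norm (path_sum (k + l) (\<lambda>y. U y * iexp (\<epsilon> * (a m \<bullet> (\<phi> (y (k + l)) - \<phi> (y k)))))
       - of_real ((1 - \<epsilon>\<^sup>2 * Q (a m) / 2) ^ l) * path_sum k U) \<le> C * (\<epsilon>\<^sup>2 + real l * \<epsilon> ^ 3)"
    using block_char[of "a m"] by blast
  define \<epsilon> where "\<epsilon> n = 1 / sqrt (real n)" for n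
  define l where "l n = k n (Suc m) - k n m" for n
  have kl: "k n m + l n = k n (Suc m)" for n using k[of n] by (simp add: l_def mono_def)
  define U where "U n y = iexp (\<epsilon> n * (\<Sum>j<m. a j \<bullet> (\<phi> (y (k n (Suc j))) - \<phi> (y (k n j)))))" for n y
  have U1: "norm (U n y) \<le> 1" for n y by (simp add: U_def)
  have Ud: "depends (k n m) (U n)" for n
    unfolding depends_def
  proof (intro allI impI)
    fix y y' :: "nat \<Rightarrow> 'v" assume eq: "\<forall>i\<le>k n m. y i = y' i"
    have "y (k n j) = y' (k n j)" if "j \<le> m" for j using eq k[of n] that by (simp add: mono_def)
    then show "U n y = U n y'" unfolding U_def
      by (intro arg_cong[where f = "\<lambda>s. iexp (\<epsilon> n * s)"] sum.cong) auto
  qed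
  define p where "p n = path_sum (k n (Suc m)) (\<lambda>y. iexp (\<epsilon> n * (\<Sum>j<Suc m. a j \<bullet> (\<phi> (y (k n (Suc j))) - \<phi> (y (k n j))))))" for n
  have p: "p n = path_sum (k n m + l n) (\<lambda>y. U n y * iexp (\<epsilon> n * (a m \<bullet> (\<phi> (y (k n m + l n)) - \<phi> (y (k n m))))))" for n
    unfolding p_def kl U_def by (simp add: distrib_left flip: exp_add)
  have ratio: "(\<lambda>n. real (l n) / real n) \<longlonglongrightarrow> \<tau> (Suc m) - \<tau> m"
  proof -
    have "real (l n) / real n = real (k n (Suc m)) / real n - real (k n m) / real n" for n
      using kl[of n] by (simp add: diff_divide_distrib[symmetric] flip: of_nat_add)
    then show ?thesis by (simp only:) (intro tendsto_intros D)
  qed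
  have lim: "(\<lambda>n. of_real ((1 - (Q (a m) / 2) / real n) ^ l n) * path_sum (k n m) (U n))
      \<longlonglongrightarrow> of_real (exp (- (Q (a m) / 2 * (\<tau> (Suc m) - \<tau> m)))) * of_real (exp (- (\<Sum>j<m. Q (a j) * (\<tau> (Suc j) - \<tau> j)) / 2))"
    using Suc unfolding U_def \<epsilon>_def by (intro tendsto_intros power_one_minus_tendsto ratio)
  have "(\<lambda>n. p n - of_real ((1 - (Q (a m) / 2) / real n) ^ l n) * path_sum (k n m) (U n)) \<longlonglongrightarrow> 0"
  proof (rule Lim_null_comparison)
    have "(\<lambda>n. C * (1 / real n + real (l n) / real n * (1 / sqrt (real n)))) \<longlonglongrightarrow> C * (0 + (\<tau> (Suc m) - \<tau> m) * 0)"
      by (intro tendsto_intros ratio) real_asymp+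
    then show "(\<lambda>n. C * (1 / real n + real (l n) / real n * (1 / sqrt (real n)))) \<longlonglongrightarrow> 0" by simp
    have ev: "\<forall>\<^sub>F n in sequentially. Q (a m) / real n < 1" by real_asymp
    show "\<forall>\<^sub>F n in sequentially. norm (p n - of_real ((1 - (Q (a m) / 2) / real n) ^ l n) * path_sum (k n m) (U n))
        \<le> C * (1 / real n + real (l n) / real n * (1 / sqrt (real n)))"
      using ev eventually_gt_at_top[of 0]
    proof eventually_elim
      case (elim n)
      have e2: "(\<epsilon> n)\<^sup>2 = 1 / real n" using elim by (simp add: \<epsilon>_def power_divide)
      have e3: "\<epsilon> n ^ 3 = 1 / real n * (1 / sqrt (real n))"
      proof -
        have "\<epsilon> n ^ 3 = (\<epsilon> n)\<^sup>2 * \<epsilon> n" by (simp add: power2_eq_square power3_eq_cube)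
        then show ?thesis unfolding e2 by (simp add: \<epsilon>_def)
      qed
      have "norm (p n - of_real ((1 - (\<epsilon> n)\<^sup>2 * Q (a m) / 2) ^ l n) * path_sum (k n m) (U n))
          \<le> C * ((\<epsilon> n)\<^sup>2 + real (l n) * \<epsilon> n ^ 3)"
        unfolding p
      proof (rule block)
        show "\<epsilon> n \<le> 1" using elim by (simp add: \<epsilon>_def)
        show "(\<epsilon> n)\<^sup>2 * Q (a m) \<le> 1" using elim unfolding e2 by simp
      qed (use U1 Ud in \<open>auto simp: \<epsilon>_def\<close>)
      then show ?case unfolding e2 e3 by (simp add: ac_simps)
    qed
  qed
  from tendsto_add[OF this lim]
  have "p \<longlonglongrightarrow> of_real (exp (- (Q (a m) / 2 * (\<tau> (Suc m) - \<tau> m)))) * of_real (exp (- (\<Sum>j<m. Q (a j) * (\<tau> (Suc j) - \<tau> j)) / 2))"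
    by simp
  also have "of_real (exp (- (Q (a m) / 2 * (\<tau> (Suc m) - \<tau> m)))) * of_real (exp (- (\<Sum>j<m. Q (a j) * (\<tau> (Suc j) - \<tau> j)) / 2))
      = complex_of_real (exp (- (\<Sum>j<Suc m. Q (a j) * (\<tau> (Suc j) - \<tau> j)) / 2))"
    by (simp add: field_simps flip: of_real_mult exp_add)
  finally show ?case unfolding p_def \<epsilon>_def .
qed

section \<open>The rescaled interpolated paths\<close>

definition scaled :: "nat \<Rightarrow> 'a \<Rightarrow> real \<Rightarrow> 'w" where
  "scaled n z = interpolated_path (\<lambda>k. \<phi> (w k z)) n"

lemma scaled_path_space: "z \<in> space M \<Longrightarrow> scaled n z \<in> path_space"
  unfolding scaled_def interpolated_path_eq by (rule pl_path_space) (simp_all add: w_0 \<phi>_0)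

lemma \<phi>_measurable [measurable]: "(\<lambda>z. \<phi> (w k z)) \<in> borel_measurable M"
  by (rule measurable_compose[OF w_measurable]) simp

lemma scaled_measurable [measurable]: "0 \<le> t \<Longrightarrow> (\<lambda>z. scaled n z t) \<in> borel_measurable M"
  by (simp add: scaled_def interpolated_path_eq pl_def Let_def)

lemma AE_increment: "AE z in M. \<forall>k. norm (\<phi> (w (Suc k) z) - \<phi> (w k z)) \<le> K"
  using AE_walk_step
proof eventually_elim
  case (elim z)
  show ?case
  proof
    fix k
    obtain e where "e \<in> out_arcs G (w k z)" "head G e = w (Suc k) z" using elim by blast
    then show "norm (\<phi> (w (Suc k) z) - \<phi> (w k z)) \<le> K" using bounded_out[of e "w k z"] by simp
  qed
qed

text \<open>Steps are bounded by K, so almost surely the interpolated values differ from the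
  rescaled walk at the rounded times by at most K / \<surd>n. Characters are Lipschitz, so both have
  the same limit.\<close>

lemma scaled_fdd:
  assumes \<tau>: "\<And>j. 0 \<le> \<tau> j" "mono \<tau>"
  shows "(\<lambda>n. LINT z|M. iexp (\<Sum>j<m. a j \<bullet> (scaled n z (\<tau> (Suc j)) - scaled n z (\<tau> j))))
    \<longlonglongrightarrow> of_real (exp (- (\<Sum>j<m. Q (a j) * (\<tau> (Suc j) - \<tau> j)) / 2))"
proof -
  define k where "k n j = nat \<lfloor>real n * \<tau> j\<rfloor>" for n j
  have k_mono: "mono (k n)" for n
    using \<tau> by (auto simp: mono_def k_def intro!: nat_mono floor_mono mult_left_mono)
  have k_real: "real (k n j) = of_int \<lfloor>real n * \<tau> j\<rfloor>" for n j using \<tau> by (simp add: k_def)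
  have k_lim: "(\<lambda>n. real (k n j) / real n) \<longlonglongrightarrow> \<tau> j" for j
  proof -
    have "(\<lambda>n. real (k n j) / real n - \<tau> j) \<longlonglongrightarrow> 0"
    proof (rule Lim_null_comparison)
      show "\<forall>\<^sub>F n in sequentially. norm (real (k n j) / real n - \<tau> j) \<le> 1 / real n"
        using eventually_gt_at_top[of 0]
      proof eventually_elim
        case (elim n)
        have "\<bar>real (k n j) - real n * \<tau> j\<bar> \<le> 1" unfolding k_real by linarith
        then have "\<bar>real (k n j) - real n * \<tau> j\<bar> / real n \<le> 1 / real n" by (intro divide_right_mono) auto
        moreover have "real (k n j) / real n - \<tau> j = (real (k n j) - real n * \<tau> j) / real n"
          using elim by (simp add: field_simps)
        ultimately show ?case by simp
      qed
      show "(\<lambda>n. 1 / real n) \<longlonglongrightarrow> 0" by real_asymp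
    qed
    then show ?thesis by (simp add: LIM_zero_iff)
  qed
  define F where "F n y = iexp (1 / sqrt (real n) * (\<Sum>j<m. a j \<bullet> (\<phi> (y (k n (Suc j))) - \<phi> (y (k n j)))))" for n and y :: "nat \<Rightarrow> 'v"
  have Fd: "depends (k n m) (F n)" for n
    unfolding depends_def
  proof (intro allI impI)
    fix y y' :: "nat \<Rightarrow> 'v" assume eq: "\<forall>i\<le>k n m. y i = y' i"
    have "y (k n j) = y' (k n j)" if "j \<le> m" for j using eq k_mono[of n] that by (simp add: mono_def)
    then show "F n y = F n y'" unfolding F_def
      by (intro arg_cong[where f = "\<lambda>s. iexp (1 / sqrt (real n) * s)"] sum.cong) auto
  qed
  have Fm: "(\<lambda>z. F n (\<lambda>i. w i z)) \<in> borel_measurable M" for n unfolding F_def by measurable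
  have "(\<lambda>n. LINT z|M. F n (\<lambda>i. w i z)) \<longlonglongrightarrow> of_real (exp (- (\<Sum>j<m. Q (a j) * (\<tau> (Suc j) - \<tau> j)) / 2))"
    using joint_char[OF k_mono k_lim, of m a] unfolding integral_path[OF Fd Fm] by (simp only: F_def[abs_def])
  moreover have "(\<lambda>n. (LINT z|M. iexp (\<Sum>j<m. a j \<bullet> (scaled n z (\<tau> (Suc j)) - scaled n z (\<tau> j)))) - (LINT z|M. F n (\<lambda>i. w i z))) \<longlonglongrightarrow> 0"
  proof (rule Lim_null_comparison)
    define c where "c = (\<Sum>j<m. norm (a j) * (2 * K))"
    show "(\<lambda>n. c / sqrt (real n)) \<longlonglongrightarrow> 0" by real_asymp
    show "\<forall>\<^sub>F n in sequentially. norm ((LINT z|M. iexp (\<Sum>j<m. a j \<bullet> (scaled n z (\<tau> (Suc j)) - scaled n z (\<tau> j)))) - (LINT z|M. F n (\<lambda>i. w i z))) \<le> c / sqrt (real n)"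
      using eventually_gt_at_top[of 0]
    proof eventually_elim
      case (elim n)
      let ?I = "\<lambda>z. iexp (\<Sum>j<m. a j \<bullet> (scaled n z (\<tau> (Suc j)) - scaled n z (\<tau> j)))"
      have Im: "?I \<in> borel_measurable M" using \<tau> by measurable
      have i: "integrable M ?I" by (rule integrable_const_bound[OF _ Im, where B = 1]) simp
      have j: "integrable M (\<lambda>z. F n (\<lambda>i. w i z))" by (rule integrable_path[OF Fd Fm])
      have AE: "AE z in M. norm (?I z - F n (\<lambda>i. w i z)) \<le> c / sqrt (real n)"
        using AE_increment
      proof eventually_elim
        case (elim z)
        define \<xi> where "\<xi> i = \<phi> (w i z)" for i
        have near: "norm (scaled n z (\<tau> j) - (1 / sqrt (real n)) *\<^sub>R \<xi> (k n j)) \<le> K / sqrt (real n)" for j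
        proof -
          have le: "0 \<le> real n * \<tau> j - real (k n j)" "real n * \<tau> j - real (k n j) \<le> 1" unfolding k_real by linarith+
          have "norm (pl \<xi> (real n * \<tau> j) - pl \<xi> (real (k n j))) \<le> K * (real n * \<tau> j - real (k n j))"
            using elim le by (intro pl_lipschitz) (auto simp: \<xi>_def)
          also have "\<dots> \<le> K * 1" using le K_nonneg by (intro mult_left_mono) auto
          finally have "norm (pl \<xi> (real n * \<tau> j) - \<xi> (k n j)) \<le> K" by simp
          moreover have "scaled n z (\<tau> j) - (1 / sqrt (real n)) *\<^sub>R \<xi> (k n j) = (1 / sqrt (real n)) *\<^sub>R (pl \<xi> (real n * \<tau> j) - \<xi> (k n j))"
            using \<tau>(1)[of j] by (simp add: scaled_def interpolated_path_eq \<xi>_def[abs_def] scaleR_diff_right)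
          ultimately show ?thesis by (simp add: divide_right_mono)
        qed
        have "norm (?I z - F n (\<lambda>i. w i z))
            \<le> \<bar>(\<Sum>j<m. a j \<bullet> (scaled n z (\<tau> (Suc j)) - scaled n z (\<tau> j))) - 1 / sqrt (real n) * (\<Sum>j<m. a j \<bullet> (\<xi> (k n (Suc j)) - \<xi> (k n j)))\<bar>"
        proof -
          have "norm (iexp u - iexp v) \<le> \<bar>u - v\<bar>" for u v
          proof -
            have "iexp u - iexp v = iexp v * (iexp (u - v) - 1)"
              by (simp add: right_diff_distrib flip: exp_add)
            then show ?thesis using iexp_approx1[of "u - v" 0] by (simp add: norm_mult)
          qed
          then show ?thesis unfolding F_def \<xi>_def .
        qed
        also have "(\<Sum>j<m. a j \<bullet> (scaled n z (\<tau> (Suc j)) - scaled n z (\<tau> j))) - 1 / sqrt (real n) * (\<Sum>j<m. a j \<bullet> (\<xi> (k n (Suc j)) - \<xi> (k n j)))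
            = (\<Sum>j<m. a j \<bullet> ((scaled n z (\<tau> (Suc j)) - (1 / sqrt (real n)) *\<^sub>R \<xi> (k n (Suc j))) - (scaled n z (\<tau> j) - (1 / sqrt (real n)) *\<^sub>R \<xi> (k n j))))"
          unfolding sum_distrib_left sum_subtractf[symmetric] by (intro sum.cong refl) (simp add: inner_diff_right algebra_simps diff_divide_distrib)
        also have "\<bar>\<dots>\<bar> \<le> (\<Sum>j<m. norm (a j) * (2 * K / sqrt (real n)))"
        proof (rule order_trans[OF sum_abs], rule sum_mono)
          fix j
          have "norm ((scaled n z (\<tau> (Suc j)) - (1 / sqrt (real n)) *\<^sub>R \<xi> (k n (Suc j))) - (scaled n z (\<tau> j) - (1 / sqrt (real n)) *\<^sub>R \<xi> (k n j)))
              \<le> K / sqrt (real n) + K / sqrt (real n)"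
            by (rule order_trans[OF norm_triangle_ineq4 add_mono[OF near near]])
          then have le: "norm ((scaled n z (\<tau> (Suc j)) - (1 / sqrt (real n)) *\<^sub>R \<xi> (k n (Suc j))) - (scaled n z (\<tau> j) - (1 / sqrt (real n)) *\<^sub>R \<xi> (k n j)))
              \<le> 2 * K / sqrt (real n)" by simp
          show "\<bar>a j \<bullet> ((scaled n z (\<tau> (Suc j)) - (1 / sqrt (real n)) *\<^sub>R \<xi> (k n (Suc j))) - (scaled n z (\<tau> j) - (1 / sqrt (real n)) *\<^sub>R \<xi> (k n j)))\<bar>
              \<le> norm (a j) * (2 * K / sqrt (real n))"
            by (rule order_trans[OF Cauchy_Schwarz_ineq2 mult_left_mono[OF le norm_ge_zero]])
        qed
        also have "\<dots> = c / sqrt (real n)" by (simp add: c_def sum_divide_distrib)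
        finally show ?case .
      qed
      have "(LINT z|M. ?I z) - (LINT z|M. F n (\<lambda>i. w i z)) = (LINT z|M. ?I z - F n (\<lambda>i. w i z))"
        by (rule Bochner_Integration.integral_diff[OF i j, symmetric])
      also have "norm \<dots> \<le> (LINT z|M. norm (?I z - F n (\<lambda>i. w i z)))" by (rule integral_norm_bound)
      also have "\<dots> \<le> (LINT z|M. c / sqrt (real n))"
        by (rule integral_mono_AE[OF integrable_norm[OF Bochner_Integration.integrable_diff[OF i j]] _ AE]) simp
      also have "(LINT z|M. c / sqrt (real n)) = c / sqrt (real n)" by (simp add: prob_space)
      finally show ?case .
    qed
  qed
  from tendsto_add[OF this calculation] show ?thesis by simp
qed

lemma scaled_increment_le:
  assumes n: "0 < n" and st: "0 \<le> s" "s \<le> t"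
  shows "AE z in M. norm (scaled n z t - scaled n z s) \<le> K * (real n * (t - s)) / sqrt (real n)"
  using AE_increment
proof eventually_elim
  case (elim z)
  have "norm (pl (\<lambda>k. \<phi> (w k z)) (real n * t) - pl (\<lambda>k. \<phi> (w k z)) (real n * s)) \<le> K * (real n * t - real n * s)"
    using elim st by (intro pl_lipschitz) (auto intro: mult_left_mono)
  moreover have "scaled n z t - scaled n z s
      = (1 / sqrt (real n)) *\<^sub>R (pl (\<lambda>k. \<phi> (w k z)) (real n * t) - pl (\<lambda>k. \<phi> (w k z)) (real n * s))"
    using st by (simp add: scaled_def interpolated_path_eq scaleR_diff_right)
  ultimately show ?case by (simp add: divide_right_mono right_diff_distrib)
qed

text \<open>For n = 0 the factor 1 / sqrt 0 is 0, so the moment bounds can be stated for all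
  n.\<close>

lemma scaled_0: "0 \<le> t \<Longrightarrow> scaled 0 z t = 0"
  by (simp add: scaled_def interpolated_path_eq)

lemma scaled_increment_integrable:
  assumes st: "0 \<le> s" "s \<le> t"
  shows "integrable M (\<lambda>z. norm (scaled n z t - scaled n z s) ^ 4)"
proof (cases "n = 0")
  case True
  then show ?thesis using st by (simp add: scaled_0)
next
  case False
  have [measurable]: "(\<lambda>z. scaled n z t) \<in> borel_measurable M" "(\<lambda>z. scaled n z s) \<in> borel_measurable M"
    using st by simp_all
  show ?thesis
  proof (rule integrable_const_bound)
    have "AE z in M. norm (scaled n z t - scaled n z s) \<le> K * (real n * (t - s)) / sqrt (real n)"
      using scaled_increment_le[of n s t] False st by simp
    then show "AE z in M. norm (norm (scaled n z t - scaled n z s) ^ 4) \<le> (K * (real n * (t - s)) / sqrt (real n)) ^ 4"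
      by eventually_elim (simp add: power_mono)
  qed measurable
qed

lemma add_power4_le: "0 \<le> a \<Longrightarrow> 0 \<le> b \<Longrightarrow> (a + b) ^ 4 \<le> 8 * (a ^ 4 + b ^ 4)" for a b :: real
proof -
  assume "0 \<le> a" "0 \<le> b"
  have sq: "(x + y)\<^sup>2 \<le> 2 * (x\<^sup>2 + y\<^sup>2)" for x y :: real
    using sum_squares_bound[of x y] by (simp add: power2_sum)
  have "(a + b) ^ 4 = ((a + b)\<^sup>2)\<^sup>2" by simp
  also have "\<dots> \<le> (2 * (a\<^sup>2 + b\<^sup>2))\<^sup>2" by (intro power_mono sq) simp
  also have "\<dots> = 4 * (a\<^sup>2 + b\<^sup>2)\<^sup>2" unfolding power_mult_distrib by simp
  also have "\<dots> \<le> 4 * (2 * ((a\<^sup>2)\<^sup>2 + (b\<^sup>2)\<^sup>2))" by (intro mult_left_mono sq) simp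
  finally show ?thesis by simp
qed

text \<open>Two regimes in h = n (t - s). For h \<le> 1 the Lipschitz bound gives K^4 h^4 \<le> K^4
  h^2 before scaling. For h > 1 the rounded times are l \<le> 2 h steps apart, and the two rounding
  errors, at most K each, are absorbed because h^2 > 1. The constant is 8 (2^4 + 16) = 256, where 16
  comes from \<open>fourth_moment\<close> at l \<le> 2 h.\<close>

lemma scaled_fourth_moment:
  assumes st: "0 \<le> s" "s \<le> t"
  shows "(LINT z|M. norm (scaled n z t - scaled n z s) ^ 4) \<le> 256 * K ^ 4 * (t - s)\<^sup>2"
proof (cases "n = 0")
  case True
  then show ?thesis using st by (simp add: scaled_0)
next
  case False
  then have n: "0 < real n" by simp
  define h where "h = real n * (t - s)"
  have h: "0 \<le> h" using st by (simp add: h_def)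
  note int = scaled_increment_integrable[OF st, of n]
  have sq4: "sqrt (real n) ^ 4 = (real n)\<^sup>2"
  proof -
    have "x ^ 4 = (x\<^sup>2)\<^sup>2" for x :: real by simp
    then show ?thesis using real_sqrt_pow2[of "real n"] by (metis of_nat_0_le_iff)
  qed
  have final: "256 * K ^ 4 * h\<^sup>2 / (real n)\<^sup>2 = 256 * K ^ 4 * (t - s)\<^sup>2"
    using n by (simp add: h_def power_mult_distrib)
  show ?thesis
  proof (cases "h \<le> 1")
    case True
    have "AE z in M. norm (scaled n z t - scaled n z s) ^ 4 \<le> (K * h / sqrt (real n)) ^ 4"
      using scaled_increment_le[of n s t] False st unfolding h_def[symmetric] by (auto elim!: eventually_mono intro: power_mono)
    then have "(LINT z|M. norm (scaled n z t - scaled n z s) ^ 4) \<le> (LINT z|M. (K * h / sqrt (real n)) ^ 4)"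
      by (intro integral_mono_AE int) auto
    also have "\<dots> = K ^ 4 * h ^ 4 / (real n)\<^sup>2" by (simp add: prob_space power_divide power_mult_distrib sq4)
    also have "\<dots> \<le> 256 * K ^ 4 * h\<^sup>2 / (real n)\<^sup>2"
    proof (intro divide_right_mono mult_mono)
      show "h ^ 4 \<le> h\<^sup>2" using True h by (intro power_decreasing) auto
      show "K ^ 4 \<le> 256 * K ^ 4" by simp
    qed (use h in auto)
    finally show ?thesis unfolding final .
  next
    case False
    define k l where "k = nat \<lfloor>real n * s\<rfloor>" and "l = nat \<lfloor>real n * t\<rfloor> - nat \<lfloor>real n * s\<rfloor>"
    have kr: "real k = of_int \<lfloor>real n * s\<rfloor>" using st by (simp add: k_def)
    have "nat \<lfloor>real n * s\<rfloor> \<le> nat \<lfloor>real n * t\<rfloor>" using st by (intro nat_mono floor_mono mult_left_mono) auto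
    then have kl: "k + l = nat \<lfloor>real n * t\<rfloor>" by (simp add: k_def l_def)
    then have klr: "real (k + l) = of_int \<lfloor>real n * t\<rfloor>" using st by simp
    \<comment> \<open>Rounding adds at most one to h, and h exceeds one here.\<close>
    have l: "real l \<le> 2 * h"
    proof -
      have "real l = of_int \<lfloor>real n * t\<rfloor> - of_int \<lfloor>real n * s\<rfloor>" using klr kr by simp
      also have "\<dots> \<le> real n * t - real n * s + 1" by linarith
      finally show ?thesis using False by (simp add: h_def right_diff_distrib)
    qed
    let ?S = "\<lambda>z. norm (\<phi> (w (k + l) z) - \<phi> (w k z)) ^ 4"
    define H where "H y = norm (\<phi> (y (k + l)) - \<phi> (y k)) ^ 4" for y :: "nat \<Rightarrow> 'v"
    have Hd: "depends (k + l) H" by (simp add: depends_def H_def)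
    have Hm: "(\<lambda>z. H (\<lambda>i. w i z)) \<in> borel_measurable M" unfolding H_def by measurable
    have Si: "integrable M ?S" using integrable_path[OF Hd Hm] by (simp add: H_def)
    have Sm: "(LINT z|M. ?S z) \<le> 4 * K ^ 4 * (real l)\<^sup>2"
      using fourth_moment[of k l] integral_path[OF Hd Hm] by (simp add: H_def)
    have "AE z in M. norm (scaled n z t - scaled n z s) ^ 4 \<le> 8 * ((2 * K) ^ 4 + ?S z) / (real n)\<^sup>2"
      using AE_increment
    proof eventually_elim
      case (elim z)
      define \<xi> where "\<xi> i = \<phi> (w i z)" for i
      have near: "norm (pl \<xi> (real n * u) - \<xi> (nat \<lfloor>real n * u\<rfloor>)) \<le> K" if "0 \<le> u" for u
      proof -
        define i where "i = nat \<lfloor>real n * u\<rfloor>"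
        have ir: "real i = of_int \<lfloor>real n * u\<rfloor>" using that by (simp add: i_def)
        have "norm (pl \<xi> (real n * u) - pl \<xi> (real i)) \<le> K * (real n * u - real i)"
          using elim unfolding ir by (intro pl_lipschitz) (auto simp: \<xi>_def that)
        also have "\<dots> \<le> K * 1" using K_nonneg unfolding ir by (intro mult_left_mono) linarith+
        finally show ?thesis by (simp add: i_def)
      qed
      have nt: "norm (pl \<xi> (real n * t) - \<xi> (k + l)) \<le> K" unfolding kl using st by (intro near) simp
      have ns: "norm (pl \<xi> (real n * s) - \<xi> k) \<le> K" unfolding k_def using st by (intro near)
      have "pl \<xi> (real n * t) - pl \<xi> (real n * s)
          = ((pl \<xi> (real n * t) - \<xi> (k + l)) - (pl \<xi> (real n * s) - \<xi> k)) + (\<xi> (k + l) - \<xi> k)" by simp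
      also have "norm \<dots> \<le> (K + K) + norm (\<xi> (k + l) - \<xi> k)"
        by (intro order_trans[OF norm_triangle_ineq] add_mono order_refl order_trans[OF norm_triangle_ineq4] nt ns)
      finally have "norm (pl \<xi> (real n * t) - pl \<xi> (real n * s)) ^ 4 \<le> (2 * K + norm (\<xi> (k + l) - \<xi> k)) ^ 4"
        by (intro power_mono) auto
      also have "\<dots> \<le> 8 * ((2 * K) ^ 4 + norm (\<xi> (k + l) - \<xi> k) ^ 4)"
        using K_nonneg by (intro add_power4_le) auto
      finally have "norm (pl \<xi> (real n * t) - pl \<xi> (real n * s)) ^ 4 / (real n)\<^sup>2
          \<le> 8 * ((2 * K) ^ 4 + norm (\<xi> (k + l) - \<xi> k) ^ 4) / (real n)\<^sup>2" by (intro divide_right_mono) auto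
      moreover have "scaled n z t - scaled n z s = (1 / sqrt (real n)) *\<^sub>R (pl \<xi> (real n * t) - pl \<xi> (real n * s))"
        using st by (simp add: scaled_def interpolated_path_eq scaleR_diff_right \<xi>_def[abs_def])
      ultimately show ?case by (simp add: power_divide sq4 \<xi>_def)
    qed
    then have "(LINT z|M. norm (scaled n z t - scaled n z s) ^ 4) \<le> (LINT z|M. 8 * ((2 * K) ^ 4 + ?S z) / (real n)\<^sup>2)"
      using Si by (intro integral_mono_AE int) auto
    also have "\<dots> = 8 * ((2 * K) ^ 4 + (LINT z|M. ?S z)) / (real n)\<^sup>2"
      using Si by (simp add: prob_space)
    also have "\<dots> \<le> 256 * K ^ 4 * h\<^sup>2 / (real n)\<^sup>2"
    proof (intro divide_right_mono)
      have K4: "0 \<le> K ^ 4" by simp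
      have "(real l)\<^sup>2 \<le> (2 * h)\<^sup>2" using l by (intro power_mono) auto
      then have "4 * K ^ 4 * (real l)\<^sup>2 \<le> 4 * K ^ 4 * (2 * h)\<^sup>2" by (intro mult_left_mono) auto
      also have "\<dots> = 16 * (K ^ 4 * h\<^sup>2)" by (simp add: power_mult_distrib)
      finally have S: "(LINT z|M. ?S z) \<le> 16 * (K ^ 4 * h\<^sup>2)" using Sm by linarith
      have "1 * 1 \<le> h * h" using False by (intro mult_mono) auto
      then have "K ^ 4 * 1 \<le> K ^ 4 * h\<^sup>2" by (intro mult_left_mono) (auto simp: power2_eq_square)
      then show "8 * ((2 * K) ^ 4 + (LINT z|M. ?S z)) \<le> 256 * K ^ 4 * h\<^sup>2"
        using S unfolding power_mult_distrib by simp
    qed simp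
    finally show ?thesis unfolding final .
  qed
qed

end

section \<open>The invariance principle\<close>

text \<open>Testing an increment with u through the metric is the Euclidean product with R u, so the
  joint characteristic function yields a normal law of variance (t - s) Q (R u) = (t - s) g u u.
  Independence is its factorisation.\<close>

lemma wiener_measure_of_char:
  fixes g :: "'w::euclidean_space \<Rightarrow> 'w \<Rightarrow> real" and R :: "'w \<Rightarrow> 'w" and Q :: "'w \<Rightarrow> real"
  assumes N: "prob_space N" and B: "\<And>z. z \<in> space N \<Longrightarrow> B z \<in> path_space"
    and Bm: "\<And>t. 0 \<le> t \<Longrightarrow> (\<lambda>z. B z t) \<in> borel_measurable N"
    and char: "\<And>\<tau> m a. mono \<tau> \<Longrightarrow> 0 \<le> \<tau> 0 \<Longrightarrow> (LINT z|N. iexp (\<Sum>j<m. a j \<bullet> (B z (\<tau> (Suc j)) - B z (\<tau> j))))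
      = of_real (exp (- (\<Sum>j<m. Q (a j) * (\<tau> (Suc j) - \<tau> j)) / 2))"
    and top: "path_topology g = path_topology (\<bullet>)"
    and g: "\<And>u v. g v u = R u \<bullet> v" and gQ: "\<And>u. g u u = Q (R u)"
    and Q: "\<And>u. u \<noteq> 0 \<Longrightarrow> 0 < Q (R u)" "\<And>c a. Q (c *\<^sub>R a) = c\<^sup>2 * Q a"
  shows "wiener_measure g (distr N (path_borel g) B)"
proof -
  have meas: "B \<in> measurable N (path_borel g)" by (rule measurable_path_borel[OF top B Bm])
  define \<mu> where "\<mu> = distr N (path_borel g) B"
  have prob: "prob_space \<mu>" unfolding \<mu>_def by (rule prob_space.prob_space_distr[OF N meas])
  have eval: "(\<lambda>b. b t) \<in> borel_measurable \<mu>" if "0 \<le> t" for t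
    using path_eval_measurable[OF top that] by (simp add: \<mu>_def)
  have incr: "(\<lambda>b. b t - b s) \<in> borel_measurable \<mu>" if "0 \<le> s" "0 \<le> t" for s t
    by (intro borel_measurable_diff eval that)
  have Q0: "Q 0 = 0" using Q(2)[of 0 0] by simp
  have char': "(LINT b|\<mu>. iexp (\<Sum>j<m. a j \<bullet> (b (\<tau> (Suc j)) - b (\<tau> j))))
      = of_real (exp (- (\<Sum>j<m. Q (a j) * (\<tau> (Suc j) - \<tau> j)) / 2))" if \<tau>: "mono \<tau>" "0 \<le> \<tau> 0" for \<tau> m a
  proof -
    have pos: "0 \<le> \<tau> j" for j using \<tau>(2) monoD[OF \<tau>(1), of 0 j] by simp
    have "(\<lambda>b. iexp (\<Sum>j<m. a j \<bullet> (b (\<tau> (Suc j)) - b (\<tau> j)))) \<in> borel_measurable (path_borel g)"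
      using path_eval_measurable[OF top pos] by measurable
    from integral_distr[OF meas this] show ?thesis unfolding \<mu>_def char[OF \<tau>, symmetric] .
  qed
  have indep: "prob_space.indep_vars \<mu> (\<lambda>_. borel) (\<lambda>i b. b (\<tau> (Suc i)) - b (\<tau> i)) {..<n}"
    if \<tau>: "mono \<tau>" "0 \<le> \<tau> 0" for \<tau> :: "nat \<Rightarrow> real" and n
  proof (rule indep_vars_of_char[OF prob])
    have pos: "0 \<le> \<tau> j" for j using \<tau>(2) monoD[OF \<tau>(1), of 0 j] by simp
    show "(\<lambda>b. b (\<tau> (Suc i)) - b (\<tau> i)) \<in> borel_measurable \<mu>" for i by (intro incr pos)
    fix a :: "nat \<Rightarrow> 'w"
    \<comment> \<open>The marginal characteristic function is the joint one with zero coefficients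
      elsewhere.\<close>
    have single: "(LINT b|\<mu>. iexp (a i \<bullet> (b (\<tau> (Suc i)) - b (\<tau> i)))) = of_real (exp (- (Q (a i) * (\<tau> (Suc i) - \<tau> i)) / 2))"
      if i: "i < n" for i
    proof -
      have "(\<Sum>j<n. (if j = i then a j else 0) \<bullet> (b (\<tau> (Suc j)) - b (\<tau> j))) = a i \<bullet> (b (\<tau> (Suc i)) - b (\<tau> i))" for b
        using i by (simp add: if_distrib[of "\<lambda>x. x \<bullet> _"] cong: if_cong)
      moreover have "(\<Sum>j<n. Q (if j = i then a j else 0) * (\<tau> (Suc j) - \<tau> j)) = Q (a i) * (\<tau> (Suc i) - \<tau> i)"
        using i by (simp add: if_distrib[of Q] if_distrib[of "\<lambda>x. x * _"] Q0 cong: if_cong)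
      ultimately show ?thesis using char'[OF \<tau>, where m = n and a = "\<lambda>j. if j = i then a j else 0"] by simp
    qed
    have "(\<Prod>i<n. LINT b|\<mu>. iexp (a i \<bullet> (b (\<tau> (Suc i)) - b (\<tau> i))))
        = (\<Prod>i<n. of_real (exp (- (Q (a i) * (\<tau> (Suc i) - \<tau> i)) / 2)))"
      by (intro prod.cong refl single) simp
    also have "\<dots> = of_real (exp (- (\<Sum>j<n. Q (a j) * (\<tau> (Suc j) - \<tau> j)) / 2))"
      by (simp only: of_real_prod[symmetric] exp_sum[symmetric] finite_lessThan sum_divide_distrib[symmetric] sum_negf)
    finally show "(LINT b|\<mu>. iexp (\<Sum>i<n. a i \<bullet> (b (\<tau> (Suc i)) - b (\<tau> i))))
        = (\<Prod>i<n. LINT b|\<mu>. iexp (a i \<bullet> (b (\<tau> (Suc i)) - b (\<tau> i))))"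
      using char'[OF \<tau>] by simp
  qed simp
  have normal: "distributed \<mu> lborel (\<lambda>b. g (b t - b s) u) (normal_density 0 (sqrt ((t - s) * g u u)))"
    if st: "0 \<le> s" "s < t" and u: "u \<noteq> 0" for s t u
  proof (rule distr_normal_of_char[OF prob])
    show "(\<lambda>b. g (b t - b s) u) \<in> borel_measurable \<mu>"
      unfolding g using incr[of s t] st by (intro borel_measurable_inner) auto
    have pos: "0 < (t - s) * g u u" using Q(1)[OF u] st by (simp add: gQ)
    then show "0 < sqrt ((t - s) * g u u)" by simp
    fix \<theta> :: real
    \<comment> \<open>The increment over [s, t] is the first one of a time sequence that stays at t
      afterwards.\<close>
    have \<tau>: "mono (\<lambda>j::nat. if j = 0 then s else t)" using st by (auto simp: mono_def)
    have "(LINT b|\<mu>. iexp (\<theta> * g (b t - b s) u)) = of_real (exp (- (Q (\<theta> *\<^sub>R R u) * (t - s)) / 2))"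
      using char'[OF \<tau>, where m = 1 and a = "\<lambda>_. \<theta> *\<^sub>R R u"] st by (simp add: g)
    then show "(LINT b|\<mu>. iexp (\<theta> * g (b t - b s) u)) = of_real (exp (- ((sqrt ((t - s) * g u u))\<^sup>2 * \<theta>\<^sup>2) / 2))"
      using pos by (simp add: Q(2) gQ mult_ac)
  qed
  have "sets \<mu> = sets (path_borel g)" by (simp add: \<mu>_def)
  with prob indep normal show ?thesis unfolding \<mu>_def[symmetric] wiener_measure_def by blast
qed

context centred_crystal
begin

text \<open>The corrector solves the Poisson equation on the finite quotient and is lifted, hence
  bounded. Conditional variances lift as well, since the star of a vertex projects bijectively, and
  their stationary mean, the constant in the solvability condition, is \<open>Q a\<close>.\<close>

lemma additive_walk_lift:
  assumes walk: "random_walk G (\<lambda>e. q (proj e)) x0 M w" and x0: "x0 \<in> verts G" "\<Phi> x0 = 0"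
  shows "additive_walk G (\<lambda>e. q (proj e)) x0 M w \<Phi> (\<Sum>A\<in>arcs G0. norm (D A)) Q"
proof (intro additive_walk.intro walk_setup.intro additive_walk_axioms.intro)
  show "random_walk G (\<lambda>e. q (proj e)) x0 M w" "x0 \<in> verts G" "\<Phi> x0 = 0" by fact+
  show "wf_digraph G" by unfold_locales
  show "finite (out_arcs G x)" if "x \<in> verts G" for x using crystal that by (simp add: crystal_lattice_def)
  show "0 \<le> q (proj e)" if "e \<in> arcs G" for e using q_pos[of "proj e"] that by (simp add: arcs0 less_imp_le)
  show "(\<Sum>e\<in>out_arcs G x. q (proj e)) = 1" if "x \<in> verts G" for x
    using that by (simp add: sum_out_arcs_proj q_sum verts0)
  show "norm (\<Phi> (head G e) - \<Phi> (tail G e)) \<le> (\<Sum>A\<in>arcs G0. norm (D A))" if "e \<in> arcs G" for e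
    using member_le_sum[of "proj e" "arcs G0" "\<lambda>A. norm (D A)"] that G0.finite_arcs by (simp add: D_proj arcs0)
  have out: "(\<Sum>e\<in>out_arcs G x. F (q (proj e)) (\<Phi> (head G e) - \<Phi> x)) = (\<Sum>A\<in>out_arcs G0 (pv x). F (q A) (D A))"
    if "x \<in> verts G" for x and F :: "real \<Rightarrow> real ^ 'd \<Rightarrow> 'z::comm_monoid_add"
    unfolding sum_out_arcs_proj[OF that, symmetric] by (intro sum.cong) (auto simp: D_proj)
  show "(\<Sum>e\<in>out_arcs G x. q (proj e) *\<^sub>R (\<Phi> (head G e) - \<Phi> x)) = 0" if "x \<in> verts G" for x
    unfolding out[OF that, of scaleR] using that by (simp add: centred verts0)
  show "0 \<le> (\<Sum>A\<in>arcs G0. norm (D A))" by (simp add: sum_nonneg)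
  show "0 \<le> Q a" for a by (rule Q_nonneg)
  fix a
  define f where "f x = (\<Sum>A\<in>out_arcs G0 x. q A * (a \<bullet> D A)\<^sup>2)" for x
  obtain g where g: "\<forall>x\<in>verts G0. g x - (\<Sum>A\<in>out_arcs G0 x. q A * g (head G0 A)) = f x - (\<Sum>y\<in>verts G0. W.stat y * f y)"
    using W.graph_poisson by blast
  have Qa: "(\<Sum>y\<in>verts G0. W.stat y * f y) = Q a"
    unfolding f_def W.sum_edge_measure[symmetric] Q_def em_def ..
  show "\<exists>g C. (\<forall>x\<in>verts G. \<bar>g x\<bar> \<le> C) \<and> (\<forall>x\<in>verts G.
       g x - (\<Sum>e\<in>out_arcs G x. q (proj e) * g (head G e)) = (\<Sum>e\<in>out_arcs G x. q (proj e) * (a \<bullet> (\<Phi> (head G e) - \<Phi> x))\<^sup>2) - Q a)"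
  proof (intro exI conjI ballI)
    fix x assume x: "x \<in> verts G"
    then have px: "pv x \<in> verts G0" by (simp add: verts0)
    show "\<bar>g (pv x)\<bar> \<le> (\<Sum>x\<in>verts G0. \<bar>g x\<bar>)"
      using member_le_sum[OF px, of "\<lambda>x. \<bar>g x\<bar>"] G0.finite_verts by simp
    have "(\<Sum>e\<in>out_arcs G x. q (proj e) * g (pv (head G e))) = (\<Sum>A\<in>out_arcs G0 (pv x). q A * g (head G0 A))"
      unfolding sum_out_arcs_proj[OF x, symmetric] by (intro sum.cong) (auto simp: head0)
    then show "g (pv x) - (\<Sum>e\<in>out_arcs G x. q (proj e) * g (pv (head G e)))
        = (\<Sum>e\<in>out_arcs G x. q (proj e) * (a \<bullet> (\<Phi> (head G e) - \<Phi> x))\<^sup>2) - Q a"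
      unfolding out[OF x, of "\<lambda>r d. r * (a \<bullet> d)\<^sup>2"] Qa[symmetric] f_def[symmetric] using g px by simp
  qed
qed

lemma invariance_principle:
  assumes walk: "random_walk G (\<lambda>e. q (proj e)) x0 M w" and x0: "x0 \<in> verts G" "\<Phi> x0 = 0"
  defines "g \<equiv> albanese_metric X q"
  shows "\<exists>\<mu>. wiener_measure g \<mu> \<and> weakly_converges (path_topology g)
    (\<lambda>n. distr M (path_borel g) (\<lambda>z. interpolated_path (\<lambda>k. \<Phi> (w k z)) n)) \<mu>"
proof -
  define K where "K = (\<Sum>A\<in>arcs G0. norm (D A))"
  interpret A: additive_walk "graph X" "\<lambda>e. q (proj e)" x0 M w \<Phi> K Q
    unfolding K_def by (rule additive_walk_lift[OF walk x0])
  obtain c C where c: "0 < c" "0 < C"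
    and norms: "\<And>u. c * norm u \<le> sqrt (g u u) \<and> sqrt (g u u) \<le> C * norm u"
    using albanese_equivalent_norm unfolding g_def by blast
  \<comment> \<open>Open sets, Borel sets and continuous functionals are thereby the Euclidean ones;
    the metric itself matters for the law of the increments.\<close>
  have top: "path_topology g = path_topology (\<bullet>)"
    by (rule path_topology_eq_inner[of c C g, OF c]) (simp_all add: norms)
  define \<Omega> :: "((nat \<times> nat) \<times> 'e set \<Rightarrow> real) measure" where "\<Omega> = PiM UNIV (\<lambda>_. std_normal_distribution)"
  \<comment> \<open>The vectors sqrt (em A) D A, one for each edge of the quotient, factorise
    \<open>Q\<close> and drive the Brownian motion.\<close>
  have Qv: "(\<Sum>A\<in>arcs G0. ((sqrt (em A) *\<^sub>R D A) \<bullet> x)\<^sup>2) = Q x" for x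
    unfolding Q_def by (intro sum.cong) (auto simp: power_mult_distrib inner_commute less_imp_le em_pos)
  obtain B where BM: "prob_space \<Omega> \<and> (\<forall>\<omega>\<in>space \<Omega>. B \<omega> \<in> path_space) \<and> (\<forall>t\<ge>0. (\<lambda>\<omega>. B \<omega> t) \<in> borel_measurable \<Omega>)
      \<and> (\<forall>\<tau> m a. mono \<tau> \<and> 0 \<le> \<tau> 0 \<longrightarrow> (LINT \<omega>|\<Omega>. iexp (\<Sum>j<m. a j \<bullet> (B \<omega> (\<tau> (Suc j)) - B \<omega> (\<tau> j))))
        = of_real (exp (- (\<Sum>j<m. Q (a j) * (\<tau> (Suc j) - \<tau> j)) / 2)))"
    using brownian_motion_exists[OF G0.finite_arcs, of "\<lambda>A. sqrt (em A) *\<^sub>R D A"]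
    unfolding Qv \<Omega>_def[symmetric] by (elim exE)
  note \<Omega> = BM[THEN conjunct1]
    and B = BM[THEN conjunct2, THEN conjunct1, rule_format]
    and Bm = BM[THEN conjunct2, THEN conjunct2, THEN conjunct1, rule_format]
    and char = BM[THEN conjunct2, THEN conjunct2, THEN conjunct2, rule_format, OF conjI]
  define \<mu> where "\<mu> = distr \<Omega> (path_borel g) B"
  have Bmeas: "B \<in> measurable \<Omega> (path_borel g)" by (rule measurable_path_borel[OF top B Bm])
  have wiener: "wiener_measure g \<mu>"
    unfolding \<mu>_def
  proof (rule wiener_measure_of_char[where R = R and Q = Q, OF \<Omega> B Bm char top])
    show "g v u = R u \<bullet> v" for u v unfolding g_def by (rule albanese_eq)
    show "g u u = Q (R u)" for u unfolding g_def by (rule albanese_eq_Q)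
    show "0 < Q (R u)" if "u \<noteq> 0" for u by (intro Q_pos R_nonzero that)
    show "Q (c *\<^sub>R a) = c\<^sup>2 * Q a" for c a
      by (simp add: Q_def power_mult_distrib sum_distrib_left mult_ac)
  qed
  have conv: "weakly_converges (path_topology g) (\<lambda>n. distr M (path_borel g) (A.scaled n)) \<mu>"
    unfolding weakly_converges_def topspace_path_topology
  proof (intro allI impI, elim conjE)
    fix F assume F: "continuous_map (path_topology g) euclideanreal F" and bdd: "bounded (F ` path_space)"
    obtain C where C: "\<And>f. f \<in> path_space \<Longrightarrow> \<bar>F f\<bar> \<le> C" using bdd by (auto simp: bounded_iff)
    have Fm: "F \<in> borel_measurable (path_borel g)" by (rule continuous_map_path_borel_measurable[OF F])
    have Am: "A.scaled n \<in> measurable M (path_borel g)" for n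
      by (rule measurable_path_borel[OF top A.scaled_path_space A.scaled_measurable])
    have "(\<lambda>n. LINT z|M. F (A.scaled n z)) \<longlonglongrightarrow> (LINT z|\<Omega>. F (B z))"
    proof (rule path_weak_convergence[OF A.prob_space_axioms \<Omega> A.scaled_path_space A.scaled_measurable B Bm])
      fix l m :: nat and a :: "nat \<Rightarrow> real ^ 'd"
      have \<tau>: "mono (\<lambda>j. real j / 2 ^ l)" by (auto simp: mono_def divide_right_mono)
      have "(\<lambda>n. LINT z|M. iexp (\<Sum>j<m. a j \<bullet> (A.scaled n z (real (Suc j) / 2 ^ l) - A.scaled n z (real j / 2 ^ l))))
        \<longlonglongrightarrow> of_real (exp (- (\<Sum>j<m. Q (a j) * (real (Suc j) / 2 ^ l - real j / 2 ^ l)) / 2))"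
        by (rule A.scaled_fdd[OF _ \<tau>]) simp
      then show "(\<lambda>n. LINT z|M. iexp (\<Sum>j<m. a j \<bullet> (A.scaled n z (real (Suc j) / 2 ^ l) - A.scaled n z (real j / 2 ^ l))))
        \<longlonglongrightarrow> (LINT z|\<Omega>. iexp (\<Sum>j<m. a j \<bullet> (B z (real (Suc j) / 2 ^ l) - B z (real j / 2 ^ l))))"
        using char[OF \<tau>] by simp
      show "continuous_map (path_topology (\<bullet>)) euclideanreal F" using F by (simp only: top)
      show "0 \<le> 256 * K ^ 4" by simp
    qed (auto intro: A.scaled_increment_integrable A.scaled_fourth_moment C)
    then show "(\<lambda>n. integral\<^sup>L (distr M (path_borel g) (A.scaled n)) F) \<longlonglongrightarrow> integral\<^sup>L \<mu> F"
      unfolding \<mu>_def integral_distr[OF Am Fm] integral_distr[OF Bmeas Fm] .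
  qed
  show ?thesis
    using wiener conv[unfolded A.scaled_def] by (intro exI[of _ \<mu>] conjI)
qed

end

theorem theorem1p3:
  fixes X :: "('v, 'e, 'g, 'd::finite) crystal"
    and p :: "'e \<Rightarrow> real"
    and \<Phi> :: "'v \<Rightarrow> real ^ 'd"
    and x0 :: 'v
    and M :: "'a measure"
    and w :: "nat \<Rightarrow> 'a \<Rightarrow> 'v"
  assumes "crystal_lattice X"
    and "transition_probability (graph X) p"
    and "invariant_function X p"
    and "asymptotic_direction X p \<noteq> 0"
    and "modified_harmonic_realization X p \<Phi>"
    and "x0 \<in> verts (graph X)"
    and "\<Phi> x0 = 0"
    and "\<forall>x\<in>verts (quotient_graph X). \<exists>!l. is_arg_min (exp_moment X p \<Phi> x) (\<lambda>_. True) l"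
    and "random_walk (graph X) (\<lambda>e. changed_probability X p \<Phi> (edge_proj X e)) x0 M w"
  shows "let g = albanese_metric X (changed_probability X p \<Phi>) in
    \<exists>\<mu>. wiener_measure g \<mu>
      \<and> weakly_converges (path_topology g)
          (\<lambda>n. distr M (path_borel g) (\<lambda>z. interpolated_path (\<lambda>k. \<Phi> (w k z)) n)) \<mu>"
proof -
  interpret realized_crystal X \<Phi>
    using assms(1,5) by unfold_locales (simp_all add: modified_harmonic_realization_def)
  interpret centred_crystal X \<Phi> "changed_probability X p \<Phi>"
    by (rule centred_crystal_changed[OF assms(2,8)])
  show ?thesis unfolding Let_def by (rule invariance_principle[OF assms(9,6,7)])
qed

end
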